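(* Let $(\eta)=\{\eta_n\}_{n=0}^\infty$ be a sequence of complex numbers. (i) If $1\le p<\infty$, $\alpha>p-2$, and $F_{(\eta)}\in\Lambda^p_{1/p}$, then $\mathcal R_{(\eta)}\in\mathcal B(\mathcal D^p_\alpha)$. (ii) If $1\le p<\infty$, $\alpha>p-2$, and $F_{(\eta)}\in\lambda^p_{1/p}$, then $\mathcal R_{(\eta)}\in\mathcal K(\mathcal D^p_\alpha)$. (iii) If $1<p<\infty$, $-1<\alpha<2p-2$, and $\mathcal R_{(\eta)}\in\mathcal B(\mathcal D^p_\alpha)$, then $$M_p(r,F_{(\eta)}')=O\left(\frac{\log\frac{1}{1-r}}{(1-r)^{1-\frac1p}}\right),\quad\text{as } r\to 1.$$ (iv) If $1<p<\infty$, $-1<\alpha<2p-2$, and $\mathcal R_{(\eta)}\in\mathcal K(\mathcal D^p_\alpha)$, then $$M_p(r,F_{(\eta)}')=o\left(\frac{\log\frac{1}{1-r}}{(1-r)^{1-\frac1p}}\right),\quad\text{as } r\to 1.$$ (v) If $\alpha>0$, then $\mathcal R_{(\eta)}\in\mathcal B(\mathcal D^2_\alpha)$ if and only if $F_{(\eta)}\in\Lambda^2_{1/2}$. (vi) If $\alpha>0$, then $\mathcal R_{(\eta)}\in\mathcal K(\mathcal D^2_\alpha)$ if and only if $F_{(\eta)}\in\lambda^2_{1/2}$.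
   Context: $\mathbb D$ is the open unit disc in $\mathbb C$, and $\mathrm{Hol}(\mathbb D)$ is the space of analytic functions in $\mathbb D$. For $f\in \mathrm{Hol}(\mathbb D)$, $0<r<1$, $0<p<\infty$, $M_p(r,f)=\left(\frac1{2\pi}\int_0^{2\pi}|f(re^{it})|^p\,dt\right)^{1/p}$. The Hardy space $H^p$ consists of those $f\in\mathrm{Hol}(\mathbb D)$ with $\|f\|_{H^p}=\sup_{0<r<1}M_p(r,f)<\infty$. Dirichlet type spaces: $dA=\frac1\pi\,dx\,dy$ is normalized area measure on $\mathbb D$; for $0<p<\infty$, $\alpha>-1$, $dA_\alpha(z)=(\alpha+1)(1-|z|^2)^\alpha dA(z)$, and $\mathcal D^p_\alpha$ is the space of $f\in\mathrm{Hol}(\mathbb D)$ with $\|f\|_{\mathcal D^p_\alpha}^p=|f(0)|^p+\int_{\mathbb D}|f'|^p\,dA_\alpha<\infty$. Rhaly operator: for a complex sequence $(\eta)=\{\eta_n\}_{n=0}^\infty$ and $f(z)=\sum_{n=0}^\infty a_nz^n\in\mathrm{Hol}(\mathbb D)$, formally $\mathcal R_{(\eta)}(f)(z)=\sum_{n=0}^\infty\eta_n\left(\sum_{k=0}^na_k\right)z^n$, whenever the right-hand side defines an analytic function in $\mathbb D$. If the power series $\sum\eta_nz^n$ defines an analytic function in $\mathbb D$, set $F_{(\eta)}(z)=\sum_{n=0}^\infty\eta_nz^n$. (On a subspace of $\mathrm{Hol}(\mathbb D)$ containing the constants, $\mathcal R_{(\eta)}$ is well defined into $\mathrm{Hol}(\mathbb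 D)$ if and only if this power series defines an analytic function in $\mathbb D$; a hypothesis such as $F_{(\eta)}\in X$ includes that it does.) For a Banach space $X$, $\mathcal B(X)$ (resp. $\mathcal K(X)$) denotes the continuous (resp. compact) linear operators from $X$ into $X$; $\mathcal R_{(\eta)}\in\mathcal B(X)$ (resp. $\mathcal K(X)$) means that $\mathcal R_{(\eta)}$ is well defined on $X$, maps $X$ into $X$, and is bounded (resp. compact). Mean Lipschitz spaces: for $1\le p<\infty$ and $f$ with boundary values $f(e^{i\theta})$ a.e., $\omega_p(\delta,f)=\sup_{0<|t|\le\delta}\left(\frac1{2\pi}\int_{-\pi}^{\pi}|f(e^{i(\theta+t)})-f(e^{i\theta})|^p\,d\theta\right)^{1/p}$. For $0<\alpha\le1$, $\Lambda^p_\alpha$ (resp. $\lambda^p_\alpha$) is the space of $f\in H^p$ with $\omega_p(\delta,f)=O(\delta^\alpha)$ (resp. $o(\delta^\alpha)$) as $\delta\to0$; equivalently, $f\in\mathrm{Hol}(\mathbb D)$ with $M_p(r,f')=O((1-r)^{\alpha-1})$ (resp. $o((1-r)^{\alpha-1})$) as $r\to1$. *)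

theory Defs
  imports "HOL-Complex_Analysis.Complex_Analysis" "HOL-Library.Landau_Symbols"
begin

text \<open>
  A function on the unit disc is represented by a function on all of \<^typ>\<open>complex\<close>; its values
  outside \<^term>\<open>ball 0 1 :: complex set\<close> are irrelevant. Accordingly, identities between
  functions on the disc are stated pointwise on the ball.
\<close>

definition Hol :: "(complex \<Rightarrow> complex) set" where
  "Hol = {f. f holomorphic_on ball 0 1}"

definition Mp :: "real \<Rightarrow> real \<Rightarrow> (complex \<Rightarrow> complex) \<Rightarrow> real" where
  "Mp p r f = (1 / (2 * pi) *
     (LBINT t:{0..2 * pi}. norm (f (of_real r * cis t)) powr p)) powr (1 / p)"

definition Hardy :: "real \<Rightarrow> (complex \<Rightarrow> complex) set" where
  "Hardy p = {f \<in> Hol. bdd_above ((\<lambda>r. Mp p r f) ` {0<..<1})}"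

subsection \<open>Dirichlet type spaces\<close>

definition disc_measure :: "real \<Rightarrow> complex measure" where
  "disc_measure \<alpha> = density (restrict_space lborel (ball 0 1))
     (\<lambda>z. ennreal ((\<alpha> + 1) * (1 - (norm z)\<^sup>2) powr \<alpha> * (1 / pi)))"

definition Dirichlet :: "real \<Rightarrow> real \<Rightarrow> (complex \<Rightarrow> complex) set" where
  "Dirichlet p \<alpha> = {f \<in> Hol. integrable (disc_measure \<alpha>) (\<lambda>z. norm (deriv f z) powr p)}"

definition Dirichlet_norm :: "real \<Rightarrow> real \<Rightarrow> (complex \<Rightarrow> complex) \<Rightarrow> real" where
  "Dirichlet_norm p \<alpha> f =
     (norm (f 0) powr p + (LINT z|disc_measure \<alpha>. norm (deriv f z) powr p)) powr (1 / p)"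

subsection \<open>Mean Lipschitz spaces\<close>

text \<open>
  Boundary values are radial limits. By Fatou's theorem they exist almost everywhere for every
  function in a Hardy space, so the corresponding conjunct in the two definitions below is
  redundant; it records that the modulus of continuity is formed from genuine boundary values.
  (Where the limit does not exist, \<^const>\<open>Lim\<close> is a fixed unspecified value.)
\<close>

definition has_boundary_values :: "(complex \<Rightarrow> complex) \<Rightarrow> bool" where
  "has_boundary_values f \<longleftrightarrow>
     (AE \<theta> in lborel. \<exists>l. ((\<lambda>r::real. f (of_real r * cis \<theta>)) \<longlongrightarrow> l) (at_left 1))"

definition boundary_value :: "(complex \<Rightarrow> complex) \<Rightarrow> real \<Rightarrow> complex" where
  "boundary_value f \<theta> = Lim (at_left 1) (\<lambda>r::real. f (of_real r * cis \<theta>))"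

definition mean_modulus :: "real \<Rightarrow> real \<Rightarrow> (complex \<Rightarrow> complex) \<Rightarrow> real" where
  "mean_modulus p \<delta> f = (SUP t\<in>{t. 0 < \<bar>t\<bar> \<and> \<bar>t\<bar> \<le> \<delta>}.
     (1 / (2 * pi) * (LBINT \<theta>:{-pi..pi}.
        norm (boundary_value f (\<theta> + t) - boundary_value f \<theta>) powr p)) powr (1 / p))"

definition mean_Lipschitz :: "real \<Rightarrow> real \<Rightarrow> (complex \<Rightarrow> complex) set" where
  "mean_Lipschitz p \<alpha> = {f \<in> Hardy p. has_boundary_values f \<and>
     (\<lambda>\<delta>. mean_modulus p \<delta> f) \<in> O[at_right 0](\<lambda>\<delta>. \<delta> powr \<alpha>)}"

definition little_mean_Lipschitz :: "real \<Rightarrow> real \<Rightarrow> (complex \<Rightarrow> complex) set" where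
  "little_mean_Lipschitz p \<alpha> = {f \<in> Hardy p. has_boundary_values f \<and>
     (\<lambda>\<delta>. mean_modulus p \<delta> f) \<in> o[at_right 0](\<lambda>\<delta>. \<delta> powr \<alpha>)}"

subsection \<open>Power series in the disc and Rhaly operators\<close>

definition converges_in_disc :: "(nat \<Rightarrow> complex) \<Rightarrow> bool" where
  "converges_in_disc c \<longleftrightarrow> (\<forall>z\<in>ball 0 1. summable (\<lambda>n. c n * z ^ n))"

definition power_series :: "(nat \<Rightarrow> complex) \<Rightarrow> complex \<Rightarrow> complex" where
  "power_series c z = (\<Sum>n. c n * z ^ n)"

definition taylor_coeff :: "(complex \<Rightarrow> complex) \<Rightarrow> nat \<Rightarrow> complex" where
  "taylor_coeff f n = (deriv ^^ n) f 0 / fact n"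

definition Rhaly_coeff :: "(nat \<Rightarrow> complex) \<Rightarrow> (complex \<Rightarrow> complex) \<Rightarrow> nat \<Rightarrow> complex" where
  "Rhaly_coeff \<eta> f n = \<eta> n * (\<Sum>k\<le>n. taylor_coeff f k)"

definition Rhaly :: "(nat \<Rightarrow> complex) \<Rightarrow> (complex \<Rightarrow> complex) \<Rightarrow> complex \<Rightarrow> complex" where
  "Rhaly \<eta> f = power_series (Rhaly_coeff \<eta> f)"

definition Rhaly_well_defined_on ::
  "(nat \<Rightarrow> complex) \<Rightarrow> (complex \<Rightarrow> complex) set \<Rightarrow> bool" where
  "Rhaly_well_defined_on \<eta> X \<longleftrightarrow> (\<forall>f\<in>X. converges_in_disc (Rhaly_coeff \<eta> f))"

subsection \<open>Bounded and compact operators on a normed space of functions on the disc\<close>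

definition linear_operator_on ::
  "(complex \<Rightarrow> complex) set \<Rightarrow> ((complex \<Rightarrow> complex) \<Rightarrow> complex \<Rightarrow> complex) \<Rightarrow> bool" where
  "linear_operator_on X T \<longleftrightarrow> (\<forall>f\<in>X. T f \<in> X) \<and>
     (\<forall>f\<in>X. \<forall>g\<in>X. \<forall>z\<in>ball 0 1. T (\<lambda>w. f w + g w) z = T f z + T g z) \<and>
     (\<forall>c. \<forall>f\<in>X. \<forall>z\<in>ball 0 1. T (\<lambda>w. c * f w) z = c * T f z)"

definition bounded_operator_on ::
  "(complex \<Rightarrow> complex) set \<Rightarrow> ((complex \<Rightarrow> complex) \<Rightarrow> real) \<Rightarrow>
   ((complex \<Rightarrow> complex) \<Rightarrow> complex \<Rightarrow> complex) \<Rightarrow> bool" where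
  "bounded_operator_on X N T \<longleftrightarrow> linear_operator_on X T \<and>
     (\<exists>C. \<forall>f\<in>X. N (T f) \<le> C * N f)"

definition compact_operator_on ::
  "(complex \<Rightarrow> complex) set \<Rightarrow> ((complex \<Rightarrow> complex) \<Rightarrow> real) \<Rightarrow>
   ((complex \<Rightarrow> complex) \<Rightarrow> complex \<Rightarrow> complex) \<Rightarrow> bool" where
  "compact_operator_on X N T \<longleftrightarrow> linear_operator_on X T \<and>
     (\<forall>f :: nat \<Rightarrow> complex \<Rightarrow> complex. (\<forall>n. f n \<in> X) \<and> (\<exists>B. \<forall>n. N (f n) \<le> B) \<longrightarrow>
        (\<exists>g\<in>X. \<exists>s. strict_mono s \<and>
           (\<lambda>n. N (\<lambda>z. T (f (s n)) z - g z)) \<longlonglongrightarrow> 0))"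

definition Rhaly_bounded_Dirichlet :: "(nat \<Rightarrow> complex) \<Rightarrow> real \<Rightarrow> real \<Rightarrow> bool" where
  "Rhaly_bounded_Dirichlet \<eta> p \<alpha> \<longleftrightarrow> Rhaly_well_defined_on \<eta> (Dirichlet p \<alpha>) \<and>
     bounded_operator_on (Dirichlet p \<alpha>) (Dirichlet_norm p \<alpha>) (Rhaly \<eta>)"

definition Rhaly_compact_Dirichlet :: "(nat \<Rightarrow> complex) \<Rightarrow> real \<Rightarrow> real \<Rightarrow> bool" where
  "Rhaly_compact_Dirichlet \<eta> p \<alpha> \<longleftrightarrow> Rhaly_well_defined_on \<eta> (Dirichlet p \<alpha>) \<and>
     compact_operator_on (Dirichlet p \<alpha>) (Dirichlet_norm p \<alpha>) (Rhaly \<eta>)"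

end

theory Submission
  imports Defs "HOL-Computational_Algebra.Fundamental_Theorem_Algebra"
begin

text \<open>
  Since \<open>M\<^sub>p(r, f')\<close> increases with \<open>r\<close>, the Dirichlet integral of \<open>f\<close> is comparable to
  \<open>\<Sum>k. 2\<^bsup>-k(\<alpha>+1)\<^esup> M\<^sub>p(r\<^sub>k, f')\<^sup>p\<close> with \<open>r\<^sub>k = 1 - 2\<^bsup>-k\<^esup>\<close>.

  The derivative of the image of \<open>f\<close> is, up to a factor \<open>z\<close>, the Hadamard product of \<open>z F'\<close> and \<open>f / (1 - z)\<close>,
  so its \<open>p\<close>-mean is at most the \<open>p\<close>-mean of \<open>F'\<close> times the \<open>1\<close>-mean of \<open>f / (1 - z)\<close>. For \<open>\<alpha> > p - 2\<close>
  the latter has a weighted \<open>l\<^sup>p\<close> norm over the radii \<open>r\<^sub>k\<close> controlled by the norm of \<open>f\<close>. This reduces (i) and (ii) to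
  \<open>M\<^sub>p(r, F') = O((1 - r)\<^bsup>1/p-1\<^esup>)\<close>, resp. \<open>o\<close>, which follows from the mean Lipschitz condition
  because \<open>M\<^sub>p(r, H)\<close> is bounded by the \<open>L\<^sup>p\<close> norm of the boundary values for every \<open>H\<close> in \<open>H\<^sup>p\<close>,
  in particular for \<open>H(z) = F(e\<^bsup>it\<^esup> z) - F(z)\<close>. That bound in turn comes from the inequality between
  \<open>|H|\<^bsup>1/2\<^esup>\<close> and its Poisson integral, proved for polynomials by reflecting the zeros of the disc and taking a square root.

  Conversely, \<open>1 / (1 - \<rho>z)\<close> is mapped to \<open>(F(z) - \<rho> F(\<rho>z)) / (1 - \<rho>)\<close>. Telescoping over \<open>\<rho> = r\<^sub>k\<close> gives
  \<open>M\<^sub>p(r, F') = O((1 - r)\<^bsup>1/p-1\<^esup>)\<close> without the logarithm, so boundedness alone yields (iii) and also (iv).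
  For \<open>p = 2\<close>, testing on \<open>\<Sum>n\<in>{N..<2N}. z\<^sup>n\<close> bounds \<open>N\<^sup>-\<^sup>1 \<Sum> n\<^sup>2 |\<eta>\<^sub>n|\<^sup>2\<close> over dyadic blocks of \<open>n\<close>;
  by Parseval's identity this is the mean Lipschitz condition of order \<open>1/2\<close>.
\<close>

section \<open>Integrals over the circle\<close>

text \<open>The Lipschitz conditions speak of boundary values, while the operator sees F only
  through M_p(r, F'). For general p only the passage from the modulus of continuity to F' occurs,
  with constants tracked so that one estimate serves both O and o. At p = 1 the kernel integral
  diverges logarithmically, and difference quotients take its place. The reverse passage occurs for
  p = 2 only, where the existence of radial limits has to be established too: M_2(r, F')^2 = O((1 -
  r)^(-3/2)) makes F' integrable along almost every radius. Hoelder's inequality for f / (1 - z) is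
  applied with a large exponent q. The choice q = p would cost 2^(n/p) and reach only \<alpha> > p -
  1; a large q costs 2^(n/q), for which any \<alpha> > p - 2 leaves room. The functions 1 / (1 -
  \<rho> z) have the right norm only for \<alpha> < 2p - 2, but (v) and (vi) allow every \<alpha> >
  0. Polynomials with a block of equal coefficients take their place for p = 2: they vanish to order
  N at 0, so the inner radii are negligible for every \<alpha>.\<close>

text \<open>A probability measure on the line carried by one period, so that means over circles need
  no normalizing factor and constants integrate to themselves.\<close>

definition circ :: "real measure" where
  "circ = uniform_measure lborel {0..2*pi}"

lemma sets_circ [simp, measurable_cong]: "sets circ = sets borel"
  by (simp add: circ_def)

lemma space_circ [simp]: "space circ = UNIV"
  by (simp add: circ_def)

lemma emeasure_circ_UNIV: "emeasure circ UNIV = 1"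
  unfolding circ_def by (subst emeasure_uniform_measure) (auto simp: divide_ennreal)

lemma measure_circ_UNIV [simp]: "measure circ UNIV = 1"
  by (simp add: measure_def emeasure_circ_UNIV)

interpretation circ: finite_measure circ
  by standard (simp add: emeasure_circ_UNIV)

interpretation circ2: pair_sigma_finite circ circ ..

lemma AE_circ: "(\<And>t. t \<in> {0..2*pi} \<Longrightarrow> P t) \<Longrightarrow> AE t in circ. P t"
  unfolding circ_def by (rule AE_uniform_measureI) auto

lemma AE_circ_lborel: "AE t in lborel. P t \<Longrightarrow> AE t in circ. P t"
  unfolding circ_def by (rule AE_uniform_measureI) auto

lemma nn_integral_circ:
  assumes [measurable]: "f \<in> borel_measurable borel"
  shows "(\<integral>\<^sup>+t. f t \<partial>circ) = (\<integral>\<^sup>+t\<in>{0..2*pi}. f t \<partial>lborel) / ennreal (2*pi)"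
  unfolding circ_def by (subst nn_integral_uniform_measure) auto

lemma circ_density: "circ = density lborel (\<lambda>t. ennreal (indicator {0..2*pi} t / (2*pi)))"
  unfolding circ_def uniform_measure_def
  by (intro density_cong) (auto simp: divide_ennreal indicator_def simp flip: ennreal_1 intro!: AE_I2)

lemma integral_circ:
  fixes f :: "real \<Rightarrow> 'a::{banach, second_countable_topology}"
  assumes [measurable]: "f \<in> borel_measurable borel"
  shows "(\<integral>t. f t \<partial>circ) = (1/(2*pi)) *\<^sub>R (LBINT t:{0..2*pi}. f t)"
  unfolding circ_density
  by (subst integral_density) (auto simp: set_lebesgue_integral_def simp flip: integral_scaleR_right)

lemma integrable_circ_iff:
  fixes f :: "real \<Rightarrow> 'a::{banach, second_countable_topology}"
  assumes [measurable]: "f \<in> borel_measurable borel"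
  shows "integrable circ f \<longleftrightarrow> set_integrable lborel {0..2*pi} f"
proof -
  have "integrable circ f \<longleftrightarrow> integrable lborel (\<lambda>t. (1/(2*pi)) *\<^sub>R (indicator {0..2*pi} t *\<^sub>R f t))"
    unfolding circ_density by (subst integrable_density) (auto simp: divide_simps)
  also have "\<dots> \<longleftrightarrow> set_integrable lborel {0..2*pi} f"
    unfolding set_integrable_def using integrable_scaleR_right[of "2*pi" lborel "\<lambda>t. (1/(2*pi)) *\<^sub>R (indicator {0..2*pi} t *\<^sub>R f t)"]
      integrable_scaleR_right[of "1/(2*pi)" lborel "\<lambda>t. indicator {0..2*pi} t *\<^sub>R f t"]
    by (intro iffI) (simp_all del: integrable_scaleR_right)
  finally show ?thesis .
qed

lemma integrable_circ_cont:
  fixes f :: "real \<Rightarrow> 'a::{banach, second_countable_topology}"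
  assumes "continuous_on UNIV f"
  shows "integrable circ f"
proof -
  have [measurable]: "f \<in> borel_measurable borel"
    using assms by (rule borel_measurable_continuous_onI)
  show ?thesis
    by (subst integrable_circ_iff)
       (auto simp: set_integrable_def intro!: borel_integrable_compact continuous_on_subset[OF assms])
qed

text \<open>The product measure sits on the square of side 2 pi, so a function continuous on the
  plane is almost everywhere bounded by its maximum over that compact square.\<close>

lemma integrable_circ2_cont:
  fixes f :: "real \<Rightarrow> real \<Rightarrow> 'a::{banach, second_countable_topology}"
  assumes "continuous_on UNIV (\<lambda>(x, y). f x y)"
  shows "integrable (circ \<Otimes>\<^sub>M circ) (\<lambda>(x, y). f x y)"
proof -
  interpret c2: finite_measure "circ \<Otimes>\<^sub>M circ"
    by (intro finite_measure_pair_measure circ.finite_measure_axioms)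
  have "(\<lambda>(x, y). f x y) \<in> borel_measurable borel"
    using assms by (rule borel_measurable_continuous_onI)
  then have [measurable]: "(\<lambda>(x, y). f x y) \<in> borel_measurable (circ \<Otimes>\<^sub>M circ)"
    by (subst measurable_cong_sets[OF _ refl]) (auto simp: borel_prod[symmetric])
  have "compact ((\<lambda>(x, y). f x y) ` ({0..2*pi} \<times> {0..2*pi}))"
    by (intro compact_continuous_image continuous_on_subset[OF assms] compact_Times) auto
  then obtain B where B: "\<And>x y. x \<in> {0..2*pi} \<Longrightarrow> y \<in> {0..2*pi} \<Longrightarrow> norm (f x y) \<le> B"
    by (fastforce dest!: compact_imp_bounded simp: bounded_iff)
  have "AE z in circ \<Otimes>\<^sub>M circ. norm (case z of (x, y) \<Rightarrow> f x y) \<le> B"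
  proof (rule circ2.AE_pair_measure)
    show "{z \<in> space (circ \<Otimes>\<^sub>M circ). norm (case z of (x, y) \<Rightarrow> f x y) \<le> B} \<in> sets (circ \<Otimes>\<^sub>M circ)"
      by measurable
    show "AE x in circ. AE y in circ. norm (case (x, y) of (x, y) \<Rightarrow> f x y) \<le> B"
      using B by (intro AE_circ) auto
  qed
  then show ?thesis
    by (intro c2.integrable_const_bound[where B=B]) auto
qed

section \<open>Convexity of powers: the inequalities of Jensen and Minkowski\<close>

text \<open>Scaling x = y m reduces the tangent at m to the tangent at 1. The point x = 0 is
  separate because the derivative of \<open>powr\<close> is taken at positive arguments.\<close>

lemma powr_tangent:
  fixes x m p :: real
  assumes "0 \<le> x" "0 < m" "1 \<le> p"
  shows "m powr p + p * m powr (p - 1) * (x - m) \<le> x powr p"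
proof (cases "x = 0")
  case True
  have "m powr p = m * m powr (p - 1)" using assms by (simp add: powr_mult_base)
  then show ?thesis using assms True
    by (simp add: algebra_simps)
next
  case False
  then have x: "x > 0" using assms by auto
  define y where "y = x / m"
  have y: "y > 0" "x = y * m" using x assms by (auto simp: y_def)
  have "1 + p * (y - 1) \<le> y powr p"
  proof -
    have "((\<lambda>y. y powr p) has_real_derivative p * u powr (p - 1)) (at u)" if "u > 0" for u
      using that by (auto intro!: derivative_eq_intros)
    then have conv: "convex_on {0<..} (\<lambda>y::real. y powr p)"
      using assms by (intro convex_on_realI[where f' = "\<lambda>u. p * u powr (p - 1)"])
         (auto intro!: mult_left_mono powr_mono2)
    have "(y powr p) - 1 powr p \<ge> (p * 1 powr (p - 1)) * (y - 1)"
      by (rule convex_on_imp_above_tangent[OF conv, where c = 1])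
         (use y assms in \<open>auto intro!: derivative_eq_intros simp: interior_open\<close>)
    then show ?thesis by simp
  qed
  then have "(1 + p * (y - 1)) * m powr p \<le> y powr p * m powr p"
    by (intro mult_right_mono) auto
  moreover have "m powr p = m * m powr (p - 1)" using assms by (simp add: powr_mult_base)
  ultimately show ?thesis using y assms
    by (simp add: powr_mult algebra_simps)
qed

lemma powr_convex_comb:
  fixes a b l p :: real
  assumes "0 \<le> a" "0 \<le> b" "0 \<le> l" "l \<le> 1" "1 \<le> p"
  shows "(l * a + (1 - l) * b) powr p \<le> l * a powr p + (1 - l) * b powr p"
proof (cases "l * a + (1 - l) * b = 0")
  case False
  define m where "m = l * a + (1 - l) * b"
  have m: "m > 0" using False assms unfolding m_def
    by (metis add_nonneg_nonneg diff_ge_0_iff_ge mult_nonneg_nonneg order_less_le)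
  have "m powr p = l * (m powr p + p * m powr (p - 1) * (a - m)) + (1 - l) * (m powr p + p * m powr (p - 1) * (b - m))"
    by (simp add: m_def algebra_simps)
  also have "\<dots> \<le> l * a powr p + (1 - l) * b powr p"
    using assms m by (intro add_mono mult_left_mono powr_tangent) auto
  finally show ?thesis by (simp add: m_def)
qed (use assms in auto)

text \<open>Jensen's inequality for the measure with density w, without normalization; the total
  mass therefore appears to the power p - 1. The form covers Poisson kernels, Hoelder's inequality
  and finite geometric sums alike.\<close>

lemma weighted_jensen_powr:
  fixes \<phi> w :: "'a \<Rightarrow> real"
  assumes p: "1 \<le> p" and nn: "\<And>x. 0 \<le> \<phi> x" "\<And>x. 0 \<le> w x"
    and int: "integrable M w" "integrable M (\<lambda>x. \<phi> x * w x)" "integrable M (\<lambda>x. \<phi> x powr p * w x)"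
  shows "(\<integral>x. \<phi> x * w x \<partial>M) powr p \<le> (\<integral>x. w x \<partial>M) powr (p - 1) * (\<integral>x. \<phi> x powr p * w x \<partial>M)"
proof (cases "(\<integral>x. \<phi> x * w x \<partial>M) = 0")
  case True
  then show ?thesis using nn by (simp add: integral_nonneg)
next
  case False
  define I W where "I = (\<integral>x. \<phi> x * w x \<partial>M)" and "W = (\<integral>x. w x \<partial>M)"
  have I: "I > 0" using False nn unfolding I_def
    by (intro order.not_eq_order_implies_strict integral_nonneg) auto
  have "W \<noteq> 0"
  proof
    assume "W = 0"
    then have "AE x in M. w x = 0"
      using integral_nonneg_eq_0_iff_AE[OF int(1)] nn unfolding W_def by auto
    then have "AE x in M. \<phi> x * w x = 0" by eventually_elim auto
    then have "I = 0" unfolding I_def by (rule integral_eq_zero_AE)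
    with I show False by simp
  qed
  moreover have "W \<ge> 0" unfolding W_def using nn by (simp add: integral_nonneg)
  ultimately have W: "W > 0" by simp
  \<comment> \<open>The tangent is taken at the weighted mean of \<phi>, so its linear part
    integrates to zero.\<close>
  define m where "m = I / W"
  have m: "m > 0" using I W by (simp add: m_def)
  have "(m powr p) * W = (\<integral>x. m powr p * w x + p * m powr (p - 1) * (\<phi> x * w x - m * w x) \<partial>M)"
    using int by (simp add: I_def[symmetric] W_def[symmetric]) (use W in \<open>simp add: m_def\<close>)
  also have "\<dots> \<le> (\<integral>x. \<phi> x powr p * w x \<partial>M)"
  proof (rule integral_mono)
    show "integrable M (\<lambda>x. m powr p * w x + p * m powr (p - 1) * (\<phi> x * w x - m * w x))"
      using int by auto
    show "m powr p * w x + p * m powr (p - 1) * (\<phi> x * w x - m * w x) \<le> \<phi> x powr p * w x" for x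
      using mult_right_mono[OF powr_tangent[OF nn(1) m p] nn(2), of x x] by (simp add: algebra_simps)
  qed (use int in auto)
  finally have "m powr p * W \<le> (\<integral>x. \<phi> x powr p * w x \<partial>M)" .
  then have "W powr (p - 1) * (m powr p * W) \<le> W powr (p - 1) * (\<integral>x. \<phi> x powr p * w x \<partial>M)"
    by (intro mult_left_mono) auto
  moreover have "W powr (p - 1) * (m powr p * W) = I powr p"
  proof -
    have "W * W powr (p - 1) = W powr p" using W by (simp add: powr_mult_base)
    moreover have "W powr p > 0" using W by simp
    ultimately show ?thesis using W I by (simp add: m_def powr_divide field_simps)
  qed
  ultimately show ?thesis by (simp add: I_def W_def)
qed

text \<open>Minkowski's integral inequality: Jensen in s for each x, followed by Fubini. It is
  behind the estimates for Poisson integrals, Hadamard products, radial increments and derivatives;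
  joint continuity disposes of all integrability questions at once.\<close>

lemma minkowski_jensen:
  fixes A :: "real \<Rightarrow> real \<Rightarrow> real" and h :: "real \<Rightarrow> 'a::{banach, second_countable_topology}"
  assumes p: "1 \<le> p" and nn: "\<And>x s. 0 \<le> A x s" "\<And>s. 0 \<le> K s"
    and cA: "continuous_on UNIV (\<lambda>(x, s). A x s)" and cK: "continuous_on UNIV K"
    and ch: "continuous_on UNIV h" and h: "\<And>x. norm (h x) \<le> (\<integral>s. A x s * K s \<partial>circ)"
    and B: "\<And>s. (\<integral>x. A x s powr p \<partial>circ) \<le> B"
  shows "(\<integral>x. norm (h x) powr p \<partial>circ) \<le> (\<integral>s. K s \<partial>circ) powr p * B"
proof -
  define W where "W = (\<integral>s. K s \<partial>circ)"
  have W0: "W \<ge> 0" unfolding W_def using nn by (simp add: integral_nonneg)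
  have cA2: "continuous_on UNIV (\<lambda>z. A (fst z) (snd z))"
    using cA by (simp add: case_prod_unfold)
  have cAx: "continuous_on UNIV (A x)" for x
    by (rule continuous_on_compose2[OF cA2, of UNIV "\<lambda>s. (x, s)", simplified]) (auto intro!: continuous_intros)
  have cK2: "continuous_on UNIV (\<lambda>z::real\<times>real. K (snd z))"
    by (rule continuous_on_compose2[OF cK]) (auto intro!: continuous_intros)
  have cAK: "continuous_on UNIV (\<lambda>(x, s). A x s powr p * K s)"
    unfolding case_prod_unfold
    by (intro continuous_on_mult continuous_on_powr' cA2 cK2 continuous_on_const) (use nn p in auto)
  have i1: "integrable circ (\<lambda>s. A x s * K s)" for x
    by (intro integrable_circ_cont continuous_on_mult cAx cK)
  have i2: "integrable circ (\<lambda>s. A x s powr p * K s)" for x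
    by (intro integrable_circ_cont continuous_on_mult continuous_on_powr' cAx cK continuous_on_const) (use nn p in auto)
  have i3: "integrable (circ \<Otimes>\<^sub>M circ) (\<lambda>(x, s). A x s powr p * K s)"
    by (rule integrable_circ2_cont[OF cAK])
  have jen: "norm (h x) powr p \<le> W powr (p - 1) * (\<integral>s. A x s powr p * K s \<partial>circ)" for x
  proof -
    have "norm (h x) powr p \<le> (\<integral>s. A x s * K s \<partial>circ) powr p"
      using h p by (intro powr_mono2) auto
    also have "\<dots> \<le> W powr (p - 1) * (\<integral>s. A x s powr p * K s \<partial>circ)"
      unfolding W_def by (rule weighted_jensen_powr[OF p nn integrable_circ_cont[OF cK] i1 i2])
    finally show ?thesis .
  qed
  have i4: "integrable circ (\<lambda>x. \<integral>s. A x s powr p * K s \<partial>circ)"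
    using circ2.integrable_fst'[OF i3] by simp
  have "(\<integral>x. norm (h x) powr p \<partial>circ) \<le> (\<integral>x. W powr (p - 1) * (\<integral>s. A x s powr p * K s \<partial>circ) \<partial>circ)"
    using i4 p by (intro integral_mono jen integrable_circ_cont[of "\<lambda>x. norm (h x) powr p"] continuous_on_powr' continuous_on_norm ch) auto
  also have "\<dots> = W powr (p - 1) * (\<integral>s. (\<integral>x. A x s powr p * K s \<partial>circ) \<partial>circ)"
    using circ2.Fubini_integral[OF i3] by simp
  also have "(\<integral>s. (\<integral>x. A x s powr p * K s \<partial>circ) \<partial>circ) \<le> (\<integral>s. B * K s \<partial>circ)"
  proof (rule integral_mono)
    show "integrable circ (\<lambda>s. \<integral>x. A x s powr p * K s \<partial>circ)"
      using circ2.integrable_snd[OF i3] by simp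
    show "integrable circ (\<lambda>s. B * K s)" by (intro integrable_mult_right integrable_circ_cont cK)
    show "(\<integral>x. A x s powr p * K s \<partial>circ) \<le> B * K s" for s
      using mult_right_mono[OF B[of s] nn(2)[of s]] by simp
  qed
  also have "\<dots> = B * W" by (simp add: W_def)
  also have "W powr (p - 1) * (B * W) = W powr p * B"
    using W0 p by (cases "W = 0") (auto simp: powr_mult_base mult.commute mult.left_commute)
  finally show ?thesis by (simp add: W_def mult_left_mono)
qed

section \<open>Translation of periodic integrands\<close>

text \<open>The window is cut at the multiple \<open>c + 2*pi\<close> of the period that it
  contains, and the piece beyond the cut is moved back by one period. The half-open integrals
  \<open>I\<close> make the cutting exact.\<close>

lemma nn_integral_period_window:
  fixes g :: "real \<Rightarrow> ennreal"
  assumes [measurable]: "g \<in> borel_measurable borel" and per: "\<And>t. g (t + 2*pi) = g t"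
  shows "(\<integral>\<^sup>+t\<in>{a..a+2*pi}. g t \<partial>lborel) = (\<integral>\<^sup>+t\<in>{0..2*pi}. g t \<partial>lborel)"
proof -
  define I where "I x y = (\<integral>\<^sup>+t\<in>{x..<y}. g t \<partial>lborel)" for x y :: real
  have closed: "(\<integral>\<^sup>+t\<in>{x..y}. g t \<partial>lborel) = I x y" for x y
    unfolding I_def by (rule nn_integral_cong_AE, rule AE_mp[OF AE_lborel_singleton[of y]])
      (auto simp: indicator_def)
  have shift: "I (x + c) (y + c) = I x y" if "\<And>t. g (t + c) = g t" for x y c
    unfolding I_def
    by (subst nn_integral_real_affine[where c = 1 and t = c])
       (auto simp: that add.commute[of c] intro!: nn_integral_cong split: split_indicator)
  have split: "I x z = I x y + I y z" if "x \<le> y" "y \<le> z" for x y z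
    unfolding I_def using that
    by (subst nn_integral_add[symmetric]) (auto intro!: nn_integral_cong split: split_indicator)
  have perN: "g (t + of_nat n * (2*pi)) = g t" for t n
  proof (induction n)
    case (Suc n)
    have "g (t + of_nat (Suc n) * (2*pi)) = g ((t + of_nat n * (2*pi)) + 2*pi)"
      by (simp add: algebra_simps)
    also have "\<dots> = g (t + of_nat n * (2*pi))" by (rule per)
    finally show ?case using Suc by simp
  qed simp
  have perI: "g (t + of_int k * (2*pi)) = g t" for t k
  proof (cases "k \<ge> 0")
    case True
    then show ?thesis using perN[of t "nat k"] by simp
  next
    case False
    then show ?thesis using perN[of "t + of_int k * (2*pi)" "nat (-k)"] by (simp add: algebra_simps)
  qed
  define k where "k = \<lfloor>a / (2*pi)\<rfloor>"
  define c where "c = of_int k * (2*pi)"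
  have c: "c \<le> a" "a \<le> c + 2*pi"
  proof -
    have "of_int k \<le> a / (2*pi)" "a / (2*pi) \<le> of_int k + 1" unfolding k_def by linarith+
    then show "c \<le> a" "a \<le> c + 2*pi" by (auto simp: c_def field_simps)
  qed
  have "I a (a + 2*pi) = I a (c + 2*pi) + I (c + 2*pi) (a + 2*pi)"
    using c by (intro split) auto
  also have "I (c + 2*pi) (a + 2*pi) = I c a" by (rule shift[OF per])
  also have "I a (c + 2*pi) + I c a = I c (c + 2*pi)"
    using split[of c a "c+2*pi"] c by (simp add: add.commute)
  also have "\<dots> = I 0 (2*pi)"
    using shift[of c 0 "2*pi"] perI unfolding c_def by (simp add: add.commute)
  finally show ?thesis by (simp add: closed)
qed

lemma nn_integral_circ_shift:
  fixes g :: "real \<Rightarrow> ennreal"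
  assumes [measurable]: "g \<in> borel_measurable borel" and per: "\<And>t. g (t + 2*pi) = g t"
  shows "(\<integral>\<^sup>+t. g (t + s) \<partial>circ) = (\<integral>\<^sup>+t. g t \<partial>circ)"
proof -
  have "(\<integral>\<^sup>+t\<in>{s..s+2*pi}. g t \<partial>lborel) = (\<integral>\<^sup>+t\<in>{0..2*pi}. g (t + s) \<partial>lborel)"
    by (subst nn_integral_real_affine[where c = 1 and t = s])
       (auto simp: add.commute[of s] intro!: nn_integral_cong split: split_indicator)
  then show ?thesis
    using nn_integral_period_window[OF assms, of s] by (simp add: nn_integral_circ)
qed

lemma integral_circ_shift:
  fixes g :: "real \<Rightarrow> real"
  assumes [measurable]: "g \<in> borel_measurable borel" and per: "\<And>t. g (t + 2*pi) = g t" and "\<And>t. 0 \<le> g t"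
  shows "(\<integral>t. g (t + s) \<partial>circ) = (\<integral>t. g t \<partial>circ)"
  using nn_integral_circ_shift[of "\<lambda>t. ennreal (g t)" s] assms
  by (simp add: integral_eq_nn_integral)

section \<open>The L^p norm on the circle\<close>

definition Lc :: "real \<Rightarrow> (real \<Rightarrow> 'a::{banach, second_countable_topology}) \<Rightarrow> real" where
  "Lc p g = (\<integral>t. norm (g t) powr p \<partial>circ) powr (1/p)"

lemma Lc_nonneg [simp]: "0 \<le> Lc p g"
  by (simp add: Lc_def)

lemma Lc_powr: "p > 0 \<Longrightarrow> Lc p g powr p = (\<integral>t. norm (g t) powr p \<partial>circ)"
  by (simp add: Lc_def powr_powr integral_nonneg)

lemma cont_norm_powr:
  fixes g :: "real \<Rightarrow> 'a::{banach, second_countable_topology}"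
  assumes "continuous_on S g" "p > 0"
  shows "continuous_on S (\<lambda>t. norm (g t) powr p)"
  using assms by (intro continuous_on_powr' continuous_intros) auto

lemma integrable_norm_powr:
  fixes g :: "real \<Rightarrow> 'a::{banach, second_countable_topology}"
  assumes "continuous_on UNIV g" "p > 0"
  shows "integrable circ (\<lambda>t. norm (g t) powr p)"
  by (intro integrable_circ_cont cont_norm_powr assms)

lemma Lc_le_iff: "p > 0 \<Longrightarrow> 0 \<le> B \<Longrightarrow> Lc p g \<le> B \<longleftrightarrow> (\<integral>t. norm (g t) powr p \<partial>circ) \<le> B powr p"
  by (metis Lc_nonneg Lc_powr powr_mono2 powr_less_mono2 not_le less_imp_le)

lemma Lc_mono:
  assumes "p > 0" "continuous_on UNIV f" "continuous_on UNIV g" "\<And>t. norm (f t) \<le> norm (g t)"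
  shows "Lc p f \<le> Lc p g"
  using assms
  by (subst Lc_le_iff) (auto simp: Lc_powr intro!: integral_mono integrable_norm_powr powr_mono2)

lemma Lc_cong: "(\<And>t. norm (f t) = norm (g t)) \<Longrightarrow> Lc p f = Lc p g"
  by (simp add: Lc_def)

lemma Lc_const: "p > 0 \<Longrightarrow> Lc p (\<lambda>_. c) = norm c"
  by (simp add: Lc_def powr_powr)

lemma Lc_le_sup:
  assumes "p > 0" "continuous_on UNIV f" "\<And>t. norm (f t) \<le> B" "0 \<le> B"
  shows "Lc p f \<le> B"
  using Lc_mono[of p f "\<lambda>_. B"] assms by (simp add: Lc_const)

lemma Lc_cmult:
  fixes g :: "real \<Rightarrow> 'a::{banach, second_countable_topology, real_normed_div_algebra}"
  shows "p > 0 \<Longrightarrow> Lc p (\<lambda>t. c * g t) = norm c * Lc p g"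
  by (simp add: Lc_def norm_mult powr_mult powr_powr integral_nonneg)

text \<open>If a and b dominate the two norms, then f + g is (a + b) times a convex combination of f
  / a and g / b with weights a / (a + b) and b / (a + b), and convexity of the p-th power applies.
  Strictly positive a, b avoid division by zero; the excess tends to 0 at the end.\<close>

lemma Lc_triangle:
  assumes p: "1 \<le> p" and c: "continuous_on UNIV f" "continuous_on UNIV g"
  shows "Lc p (\<lambda>t. f t + g t) \<le> Lc p f + Lc p g"
proof -
  have bound: "Lc p (\<lambda>t. f t + g t) \<le> a + b" if ab: "a > 0" "b > 0" "Lc p f \<le> a" "Lc p g \<le> b" for a b
  proof -
    define l where "l = a / (a + b)"
    have l: "0 < l" "l < 1" "1 - l = b / (a + b)" using ab by (auto simp: l_def field_simps)
    have pt: "norm (f t + g t) powr p \<le> (a+b) powr p * (l * (norm (f t) powr p / a powr p) + (1 - l) * (norm (g t) powr p / b powr p))" for t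
    proof -
      have "norm (f t + g t) \<le> (a + b) * (l * (norm (f t) / a) + (1 - l) * (norm (g t) / b))"
        using ab norm_triangle_ineq[of "f t" "g t"] unfolding l(3)
        by (simp add: l_def distrib_left)
      then have "norm (f t + g t) powr p \<le> ((a + b) * (l * (norm (f t) / a) + (1 - l) * (norm (g t) / b))) powr p"
        using p by (intro powr_mono2) auto
      also have "\<dots> = (a + b) powr p * (l * (norm (f t) / a) + (1 - l) * (norm (g t) / b)) powr p"
        using ab l by (simp add: powr_mult)
      also have "\<dots> \<le> (a + b) powr p * (l * (norm (f t) / a) powr p + (1 - l) * (norm (g t) / b) powr p)"
        using l ab p by (intro mult_left_mono powr_convex_comb) auto
      finally show ?thesis using ab by (simp add: powr_divide)
    qed
    have "(\<integral>t. norm (f t + g t) powr p \<partial>circ) \<le> (\<integral>t. (a+b) powr p * (l * (norm (f t) powr p / a powr p) + (1 - l) * (norm (g t) powr p / b powr p)) \<partial>circ)"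
    proof (intro integral_mono pt)
      show "integrable circ (\<lambda>t. (a+b) powr p * (l * (norm (f t) powr p / a powr p) + (1 - l) * (norm (g t) powr p / b powr p)))"
        using c p by (intro integrable_mult_right Bochner_Integration.integrable_add integrable_divide integrable_norm_powr) auto
      show "integrable circ (\<lambda>t. norm (f t + g t) powr p)"
        using c p by (intro integrable_norm_powr continuous_on_add) auto
    qed
    also have "\<dots> = (a+b) powr p * (l * (Lc p f powr p / a powr p) + (1 - l) * (Lc p g powr p / b powr p))"
    proof -
      have i: "integrable circ (\<lambda>t. l * (norm (f t) powr p / a powr p))"
              "integrable circ (\<lambda>t. (1 - l) * (norm (g t) powr p / b powr p))"
        using c p by (intro integrable_mult_right integrable_divide integrable_norm_powr; auto)+
      show ?thesis
        using p by (simp only: integral_mult_right_zero integral_divide_zero Bochner_Integration.integral_add[OF i] Lc_powr[of p] order_less_le_trans[OF zero_less_one p])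
    qed
    also have "\<dots> \<le> (a+b) powr p * (l * 1 + (1 - l) * 1)"
      using ab l p by (intro mult_left_mono add_mono) (auto simp: divide_le_eq intro!: powr_mono2)
    finally show ?thesis using ab p by (subst Lc_le_iff) auto
  qed
  have "Lc p (\<lambda>t. f t + g t) \<le> Lc p f + Lc p g + e" if "e > 0" for e
    using bound[of "Lc p f + e/2" "Lc p g + e/2"] that by (simp add: add_nonneg_pos)
  then show ?thesis by (rule field_le_epsilon)
qed

lemma Lc_sum:
  assumes p: "1 \<le> p" and "\<And>i. i \<in> I \<Longrightarrow> continuous_on UNIV (f i)"
  shows "Lc p (\<lambda>t. \<Sum>i\<in>I. f i t) \<le> (\<Sum>i\<in>I. Lc p (f i))"
  using assms(2)
proof (induction I rule: infinite_finite_induct)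
  case (insert x F)
  have "Lc p (\<lambda>t. f x t + (\<Sum>i\<in>F. f i t)) \<le> Lc p (f x) + Lc p (\<lambda>t. \<Sum>i\<in>F. f i t)"
    using insert by (intro Lc_triangle p continuous_on_sum) auto
  also have "\<dots> \<le> Lc p (f x) + (\<Sum>i\<in>F. Lc p (f i))" using insert by auto
  finally show ?case using insert by simp
qed (use p in \<open>auto simp: Lc_const\<close>)

lemma Lc_minkowski:
  fixes A :: "real \<Rightarrow> real \<Rightarrow> real" and h :: "real \<Rightarrow> 'a::{banach, second_countable_topology}"
  assumes p: "1 \<le> p" and nn: "\<And>x s. 0 \<le> A x s" "\<And>s. 0 \<le> K s" "0 \<le> B"
    and cA: "continuous_on UNIV (\<lambda>(x, s). A x s)" and cK: "continuous_on UNIV K"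
    and ch: "continuous_on UNIV h" and h: "\<And>x. norm (h x) \<le> (\<integral>s. A x s * K s \<partial>circ)"
    and B: "\<And>s. Lc p (\<lambda>x. A x s) \<le> B"
  shows "Lc p h \<le> (\<integral>s. K s \<partial>circ) * B"
proof -
  have W: "0 \<le> (\<integral>s. K s \<partial>circ)" using nn by (simp add: integral_nonneg)
  have "(\<integral>x. norm (h x) powr p \<partial>circ) \<le> (\<integral>s. K s \<partial>circ) powr p * (B powr p)"
    using B nn p by (intro minkowski_jensen[OF _ _ _ cA cK ch h]) (auto simp: Lc_le_iff)
  also have "\<dots> = ((\<integral>s. K s \<partial>circ) * B) powr p" using W nn by (simp add: powr_mult)
  finally show ?thesis using W nn p by (subst Lc_le_iff) (auto simp: integral_nonneg)
qed

text \<open>Weighted Jensen with exponent q and weight g^r. Positivity of g gives meaning to its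
  negative powers.\<close>

lemma Lc_holder:
  fixes f g :: "real \<Rightarrow> real"
  assumes q: "1 < q" "1 / q + 1 / r = 1" and nn: "\<And>t. 0 \<le> f t" "\<And>t. 0 < g t"
    and c: "continuous_on UNIV f" "continuous_on UNIV g"
  shows "(\<integral>t. f t * g t \<partial>circ) \<le> Lc q f * Lc r g"
proof -
  have r: "1 / r = 1 - 1 / q" using q by simp
  have "1 / q < 1" using q(1) by simp
  with r have "1 / r > 0" by linarith
  then have r0: "r > 0" by simp
  have rq: "r * (q - 1) = q" using q r0 by (simp add: field_simps)
  \<comment> \<open>Chosen so that \<phi> times the weight is f g, while \<phi>^q times the weight
    is f^q, since (1 - r) q + r = 0 for conjugate exponents.\<close>
  define \<phi> where "\<phi> t = f t * g t powr (1 - r)" for t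
  define w where "w t = g t powr r" for t
  have cp: "continuous_on UNIV (\<lambda>t. g t powr a)" for a
    using c nn(2) by (intro continuous_on_powr') (auto simp: less_imp_le less_le)
  have cf: "continuous_on UNIV (\<lambda>t. f t powr q)"
    using c nn q by (intro continuous_on_powr') auto
  have g0: "g t \<noteq> 0" for t using nn(2)[of t] by simp
  have e1: "\<phi> t * w t = f t * g t" for t
    using nn(2)[of t] by (simp add: \<phi>_def w_def powr_diff)
  have e2: "\<phi> t powr q * w t = f t powr q" for t
  proof -
    have "\<phi> t powr q * w t = f t powr q * g t powr ((1 - r) * q + r)"
      using nn by (simp add: \<phi>_def w_def powr_mult powr_powr powr_add g0)
    also have "(1 - r) * q + r = 0" using rq by (simp add: algebra_simps)
    finally show ?thesis using g0 by simp
  qed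
  have cw: "continuous_on UNIV w" unfolding w_def by (rule cp)
  have "(\<integral>t. \<phi> t * w t \<partial>circ) powr q \<le> (\<integral>t. w t \<partial>circ) powr (q - 1) * (\<integral>t. \<phi> t powr q * w t \<partial>circ)"
  proof (rule weighted_jensen_powr)
    show "0 \<le> \<phi> t" "0 \<le> w t" for t using nn by (auto simp: \<phi>_def w_def)
    show "integrable circ w" "integrable circ (\<lambda>t. \<phi> t * w t)" "integrable circ (\<lambda>t. \<phi> t powr q * w t)"
      unfolding e1 e2 by (intro integrable_circ_cont cw cf continuous_on_mult c)+
  qed (use q in auto)
  then have *: "(\<integral>t. f t * g t \<partial>circ) powr q \<le> (\<integral>t. g t powr r \<partial>circ) powr (q - 1) * (\<integral>t. f t powr q \<partial>circ)"
    unfolding e1 e2 unfolding w_def .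
  have I0: "0 \<le> (\<integral>t. f t * g t \<partial>circ)" using nn by (intro Bochner_Integration.integral_nonneg) (auto simp: less_imp_le)
  have "(\<integral>t. f t * g t \<partial>circ) = ((\<integral>t. f t * g t \<partial>circ) powr q) powr (1/q)"
    using I0 q by (simp add: powr_powr)
  also have "\<dots> \<le> ((\<integral>t. g t powr r \<partial>circ) powr (q - 1) * (\<integral>t. f t powr q \<partial>circ)) powr (1/q)"
    using q by (intro powr_mono2 *) auto
  also have "\<dots> = Lc q f * (\<integral>t. g t powr r \<partial>circ) powr ((q - 1) / q)"
    using nn by (simp add: Lc_def powr_mult powr_powr integral_nonneg)
  also have "(q - 1) / q = 1 / r" using r q by (simp add: field_simps)
  also have "(\<integral>t. g t powr r \<partial>circ) powr (1/r) = Lc r g" using nn by (simp add: Lc_def less_imp_le)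
  finally show ?thesis .
qed

section \<open>Orthogonality of exponentials and pairings of absolutely convergent series\<close>

lemma integral_circ_FTC:
  fixes f :: "real \<Rightarrow> 'a::euclidean_space"
  assumes F: "\<And>x. 0 \<le> x \<Longrightarrow> x \<le> 2*pi \<Longrightarrow> (F has_vector_derivative f x) (at x within {0..2*pi})" and f: "continuous_on UNIV f"
  shows "(\<integral>t. f t \<partial>circ) = (1 / (2*pi)) *\<^sub>R (F (2*pi) - F 0)"
proof -
  have "(LBINT t:{0..2*pi}. f t) = F (2*pi) - F 0"
    unfolding set_lebesgue_integral_def
    by (rule integral_FTC_atLeastAtMost)
       (use F in \<open>auto intro: has_vector_derivative_at_within continuous_on_subset[OF f]\<close>)
  then show ?thesis
    by (simp add: integral_circ borel_measurable_continuous_onI[OF f])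
qed

lemma integral_circ_cis: "(\<integral>t. cis (of_int k * t) \<partial>circ) = (if k = 0 then 1 else 0)"
proof (cases "k = 0")
  case False
  have "(\<integral>t. cis (of_int k * t) \<partial>circ) =
      (1 / (2*pi)) *\<^sub>R (cis (of_int k * (2*pi)) / (\<i> * of_int k) - cis (of_int k * 0) / (\<i> * of_int k))"
  proof (rule integral_circ_FTC)
    show "((\<lambda>t. cis (of_int k * t) / (\<i> * of_int k)) has_vector_derivative cis (of_int k * t)) (at t within {0..2*pi})" for t
    proof -
      have "((\<lambda>t. cis (of_int k * t)) has_vector_derivative (of_int k *\<^sub>R (\<i> * cis (of_int k * t)))) (at t within {0..2*pi})"
        unfolding has_vector_derivative_def
        by (auto intro!: derivative_eq_intros has_derivative_cis simp: scaleR_conv_of_real mult_ac)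
      from has_vector_derivative_mult_right[OF this, of "1 / (\<i> * of_int k)"] show ?thesis
        using False by (simp add: scaleR_conv_of_real)
    qed
    show "continuous_on UNIV (\<lambda>t. cis (of_int k * t))"
      by (intro continuous_intros)
  qed
  also have "cis (of_int k * (2*pi)) = 1" by (metis cis_multiple_2pi mult.commute Ints_of_int)
  finally show ?thesis using False by simp
qed simp

lemma cont_trig_series:
  fixes a :: "nat \<Rightarrow> complex"
  assumes a: "summable (\<lambda>n. norm (a n))"
  shows "continuous_on UNIV (\<lambda>t. \<Sum>n. a n * cis (real_of_int (k n) * t))"
proof (rule uniform_limit_theorem)
  show "uniform_limit UNIV (\<lambda>N t. \<Sum>n<N. a n * cis (real_of_int (k n) * t))
     (\<lambda>t. \<Sum>n. a n * cis (real_of_int (k n) * t)) sequentially"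
    by (rule Weierstrass_m_test[OF _ a]) (simp add: norm_mult)
qed (auto intro!: always_eventually continuous_intros)

lemma integral_mult_trig_series:
  fixes a :: "nat \<Rightarrow> complex"
  assumes a: "summable (\<lambda>n. norm (a n))" and f: "continuous_on UNIV f" and B: "\<And>t. norm (f t) \<le> B"
  shows "(\<lambda>n. a n * (\<integral>t. f t * cis (real_of_int (k n) * t) \<partial>circ)) sums
    (\<integral>t. f t * (\<Sum>n. a n * cis (real_of_int (k n) * t)) \<partial>circ)"
proof -
  have s: "summable (\<lambda>n. a n * cis (real_of_int (k n) * t))" for t
    by (rule summable_norm_cancel) (simp add: norm_mult a)
  have i: "integrable circ (\<lambda>t. a n * (f t * cis (real_of_int (k n) * t)))" for n
    by (intro integrable_circ_cont continuous_intros f)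
  have "(\<lambda>n. \<integral>t. a n * (f t * cis (real_of_int (k n) * t)) \<partial>circ) sums
     (\<integral>t. (\<Sum>n. a n * (f t * cis (real_of_int (k n) * t))) \<partial>circ)"
  proof (rule sums_integral[OF i])
    have "summable (\<lambda>n. norm (a n) * norm (f t))" for t by (intro summable_mult2 a)
    then show "AE t in circ. summable (\<lambda>n. norm (a n * (f t * cis (real_of_int (k n) * t))))"
      by (simp add: norm_mult)
    show "summable (\<lambda>n. \<integral>t. norm (a n * (f t * cis (real_of_int (k n) * t))) \<partial>circ)"
    proof (rule summable_comparison_test[OF _ summable_mult2[OF a]], intro exI allI impI)
      fix n
      have "(\<integral>t. norm (a n * (f t * cis (real_of_int (k n) * t))) \<partial>circ) \<le> (\<integral>t. norm (a n) * B \<partial>circ)"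
        using B by (intro integral_mono integrable_norm i) (auto simp: norm_mult intro!: mult_left_mono)
      then show "norm (\<integral>t. norm (a n * (f t * cis (real_of_int (k n) * t))) \<partial>circ) \<le> norm (a n) * B"
        by (simp add: integral_nonneg)
    qed
  qed
  moreover have "(\<Sum>n. a n * (f t * cis (real_of_int (k n) * t))) = f t * (\<Sum>n. a n * cis (real_of_int (k n) * t))" for t
    using suminf_mult[OF s, of "f t" t] by (simp add: mult.left_commute)
  ultimately show ?thesis by simp
qed

lemma trig_series_coeff:
  fixes a :: "nat \<Rightarrow> complex"
  assumes a: "summable (\<lambda>n. norm (a n))"
  shows "(\<integral>t. (\<Sum>n. a n * cis (real n * t)) * cis (real_of_int k * t) \<partial>circ) = (if k \<le> 0 then a (nat (-k)) else 0)"
proof -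
  have "(\<lambda>n. a n * (\<integral>t. cis (real_of_int k * t) * cis (real_of_int (int n) * t) \<partial>circ)) sums
    (\<integral>t. cis (real_of_int k * t) * (\<Sum>n. a n * cis (real_of_int (int n) * t)) \<partial>circ)"
    by (rule integral_mult_trig_series[OF a, where B = 1]) (auto intro!: continuous_intros)
  moreover have "a n * (\<integral>t. cis (real_of_int k * t) * cis (real_of_int (int n) * t) \<partial>circ) = (if n = nat (-k) then (if k \<le> 0 then a (nat (-k)) else 0) else 0)" for n
  proof -
    have "cis (real_of_int k * t) * cis (real_of_int (int n) * t) = cis (of_int (k + int n) * t)" for t
      by (simp add: cis_mult algebra_simps)
    then show ?thesis using integral_circ_cis[of "k + int n"] by auto
  qed
  ultimately have "(\<lambda>n. if n = nat (-k) then (if k \<le> 0 then a (nat (-k)) else 0) else 0) sums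
    (\<integral>t. cis (real_of_int k * t) * (\<Sum>n. a n * cis (real n * t)) \<partial>circ)" by simp
  from sums_unique2[OF this sums_single] show ?thesis by (simp add: mult.commute)
qed

text \<open>The frequencies k n are left free because two cases are used: k n = -n pairs
  coefficients of equal index, which yields Hadamard products and Cauchy integrals; k n = n leaves
  only the constant term, which disposes of the conjugate half of the Poisson kernel.\<close>

lemma trig_series_pairing:
  fixes a b :: "nat \<Rightarrow> complex"
  assumes a: "summable (\<lambda>n. norm (a n))" and b: "summable (\<lambda>n. norm (b n))"
  shows "(\<lambda>n. b n * (if k n \<le> 0 then a (nat (- k n)) else 0)) sums
    (\<integral>t. (\<Sum>n. a n * cis (real n * t)) * (\<Sum>n. b n * cis (real_of_int (k n) * t)) \<partial>circ)"
proof -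
  have "norm (\<Sum>n. a n * cis (real n * t)) \<le> (\<Sum>n. norm (a n))" for t
    using a by (intro order_trans[OF summable_norm] suminf_le) (auto simp: norm_mult)
  moreover have "continuous_on UNIV (\<lambda>t. \<Sum>n. a n * cis (real n * t))"
    using cont_trig_series[OF a, of int] by simp
  ultimately have "(\<lambda>n. b n * (\<integral>t. (\<Sum>n. a n * cis (real n * t)) * cis (real_of_int (k n) * t) \<partial>circ)) sums
    (\<integral>t. (\<Sum>n. a n * cis (real n * t)) * (\<Sum>n. b n * cis (real_of_int (k n) * t)) \<partial>circ)"
    by (intro integral_mult_trig_series[OF b])
  then show ?thesis by (simp add: trig_series_coeff[OF a])
qed

section \<open>Holomorphic functions on circles\<close>

lemma Hol_sums:
  assumes "f \<in> Hol" "norm z < 1"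
  shows "(\<lambda>n. taylor_coeff f n * z ^ n) sums f z"
  using holomorphic_power_series[of f 0 1 z] assms by (simp add: Hol_def taylor_coeff_def)

lemma Hol_summable_norm:
  assumes "f \<in> Hol" "norm z < 1"
  shows "summable (\<lambda>n. norm (taylor_coeff f n * z ^ n))"
proof -
  obtain r where r: "norm z < r" "r < 1" using dense assms by blast
  have "norm (of_real r :: complex) < 1" using r norm_ge_zero[of z] by (simp del: norm_ge_zero)
  then have "summable (\<lambda>n. taylor_coeff f n * of_real r ^ n)"
    using Hol_sums[OF assms(1)] sums_summable by blast
  then show ?thesis
    by (rule powser_insidea) (use r norm_ge_zero[of z] in \<open>simp del: norm_ge_zero\<close>)
qed

lemma Hol_summable_norm':
  assumes "f \<in> Hol" "0 \<le> r" "r < 1"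
  shows "summable (\<lambda>n. norm (taylor_coeff f n) * r ^ n)"
  using Hol_summable_norm[OF assms(1), of "of_real r"] assms by (simp add: norm_mult norm_power)

lemma Hol_circle_sums:
  assumes "f \<in> Hol" "0 \<le> r" "r < 1"
  shows "f (of_real r * cis t) = (\<Sum>n. (taylor_coeff f n * of_real r ^ n) * cis (real n * t))"
  using sums_unique[OF Hol_sums[OF assms(1), of "of_real r * cis t"]] assms
  by (simp add: norm_mult power_mult_distrib Complex.DeMoivre mult.assoc)

lemma Hol_circle_summable:
  assumes "f \<in> Hol" "0 \<le> r" "r < 1"
  shows "summable (\<lambda>n. norm (taylor_coeff f n * of_real r ^ n))"
  using Hol_summable_norm'[OF assms] assms by (simp add: norm_mult norm_power)

lemma Hol_cont: "f \<in> Hol \<Longrightarrow> continuous_on (ball 0 1) f"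
  by (simp add: Hol_def holomorphic_on_imp_continuous_on)

lemma Hol_cont_compose:
  assumes "f \<in> Hol" "continuous_on S g" "\<And>x. x \<in> S \<Longrightarrow> norm (g x) < 1"
  shows "continuous_on S (\<lambda>x. f (g x))"
  by (rule continuous_on_compose2[OF Hol_cont[OF assms(1)] assms(2)]) (use assms(3) in auto)

lemma Hol_cont_circle:
  assumes "f \<in> Hol" "0 \<le> r" "r < 1"
  shows "continuous_on S (\<lambda>t. f (of_real r * cis t))"
  by (rule Hol_cont_compose[OF assms(1)]) (use assms in \<open>auto intro!: continuous_intros simp: norm_mult\<close>)

lemma Hol_deriv: "f \<in> Hol \<Longrightarrow> deriv f \<in> Hol"
  by (simp add: Hol_def holomorphic_deriv)

lemma Mp_eq_Lc:
  assumes "f \<in> Hol" "0 \<le> r" "r < 1" "p > 0"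
  shows "Mp p r f = Lc p (\<lambda>t. f (of_real r * cis t))"
  unfolding Mp_def Lc_def using assms
  by (subst integral_circ)
     (auto intro!: borel_measurable_continuous_onI cont_norm_powr Hol_cont_circle)

lemma Hol_coeff_integral:
  assumes "f \<in> Hol" "0 \<le> r" "r < 1"
  shows "(\<integral>t. f (of_real r * cis t) * cis (- (real n * t)) \<partial>circ) = taylor_coeff f n * of_real r ^ n"
  using trig_series_coeff[OF Hol_circle_summable[OF assms], of "- int n"]
  by (simp add: Hol_circle_sums[OF assms, symmetric])

text \<open>Both the coefficients c and the Taylor coefficients, defined by iterated derivatives,
  are Fourier coefficients of f on the circle of radius 1/2. This is how every function given by a
  series gets its \<open>taylor_coeff\<close>.\<close>

lemma Hol_coeff_unique:
  assumes s: "\<And>z. norm z < 1 \<Longrightarrow> (\<lambda>n. c n * z ^ n) sums f z"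
  shows "f \<in> Hol" "taylor_coeff f n = c n"
proof -
  show h: "f \<in> Hol" unfolding Hol_def
    using power_series_holomorphic[of 0 1 c f] s by simp
  have a: "summable (\<lambda>n. norm (c n * of_real (1/2) ^ n))"
    using powser_insidea[OF sums_summable[OF s[of "3/4"]], of "1/2"] by simp
  have eq: "f (of_real (1/2) * cis t) = (\<Sum>n. c n * of_real (1/2) ^ n * cis (real n * t))" for t
    using sums_unique[OF s[of "of_real (1/2) * cis t"]]
    by (simp add: norm_mult power_mult_distrib Complex.DeMoivre mult.assoc power_divide)
  have "taylor_coeff f n * of_real (1/2) ^ n = c n * of_real (1/2) ^ n"
    using trig_series_coeff[OF a, of "- int n"] Hol_coeff_integral[OF h, of "1/2" n]
    by (simp add: eq[symmetric] del: of_real_divide)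
  then show "taylor_coeff f n = c n" by simp
qed

lemma Hol_pairing:
  fixes b :: "nat \<Rightarrow> complex"
  assumes f: "f \<in> Hol" "0 \<le> r" "r < 1" and b: "summable (\<lambda>n. norm (b n))"
  shows "(\<lambda>n. b n * (taylor_coeff f n * of_real r ^ n)) sums
    (\<integral>t. f (of_real r * cis t) * (\<Sum>n. b n * cis (- (real n * t))) \<partial>circ)"
  using trig_series_pairing[OF Hol_circle_summable[OF f] b, of "\<lambda>n. - int n"]
  by (simp add: Hol_circle_sums[OF f, symmetric])

lemma Hol_pairing_conj:
  fixes b :: "nat \<Rightarrow> complex"
  assumes f: "f \<in> Hol" "0 \<le> r" "r < 1" and b: "summable (\<lambda>n. norm (b n))"
  shows "(\<integral>t. f (of_real r * cis t) * (\<Sum>n. b n * cis (real n * t)) \<partial>circ) = b 0 * f 0"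
proof -
  have "(\<lambda>n. b n * (if int n \<le> 0 then taylor_coeff f (nat (- int n)) * of_real r ^ nat (- int n) else 0)) sums
    (\<integral>t. f (of_real r * cis t) * (\<Sum>n. b n * cis (real n * t)) \<partial>circ)"
    using trig_series_pairing[OF Hol_circle_summable[OF f] b, of int]
    by (simp add: Hol_circle_sums[OF f, symmetric])
  moreover have "(\<lambda>n. b n * (if int n \<le> 0 then taylor_coeff f (nat (- int n)) * of_real r ^ nat (- int n) else 0)) =
      (\<lambda>n. if n = 0 then b 0 * f 0 else 0)"
    by (auto simp: taylor_coeff_def)
  ultimately have "(\<lambda>n. if n = 0 then b 0 * f 0 else 0) sums
    (\<integral>t. f (of_real r * cis t) * (\<Sum>n. b n * cis (real n * t)) \<partial>circ)" by simp
  from sums_unique2[OF this sums_single[of 0 "\<lambda>_. b 0 * f 0"]] show ?thesis .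
qed

text \<open>The pairing of f with the series of conjugated coefficients, whose sum on the circle is
  the conjugate of f.\<close>

lemma Parseval:
  assumes f: "f \<in> Hol" "0 \<le> r" "r < 1"
  shows "(\<lambda>n. (norm (taylor_coeff f n) * r ^ n)\<^sup>2) sums (\<integral>t. (norm (f (of_real r * cis t)))\<^sup>2 \<partial>circ)"
proof -
  define b where "b n = cnj (taylor_coeff f n * of_real r ^ n)" for n
  have b: "summable (\<lambda>n. norm (b n))" using Hol_circle_summable[OF f] by (simp add: b_def norm_mult norm_power)
  have eq: "(\<Sum>n. b n * cis (- (real n * t))) = cnj (f (of_real r * cis t))" for t
  proof -
    have "summable (\<lambda>n. taylor_coeff f n * of_real r ^ n * cis (real n * t))"
      by (rule summable_norm_cancel) (use Hol_circle_summable[OF f] in \<open>simp add: norm_mult\<close>)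
    then have "(\<lambda>n. cnj (taylor_coeff f n * of_real r ^ n * cis (real n * t))) sums cnj (f (of_real r * cis t))"
      unfolding sums_cnj Hol_circle_sums[OF f] by (rule summable_sums)
    then show ?thesis by (simp add: b_def cis_cnj sums_iff)
  qed
  have "(\<lambda>n. b n * (taylor_coeff f n * of_real r ^ n)) sums
    (\<integral>t. f (of_real r * cis t) * cnj (f (of_real r * cis t)) \<partial>circ)"
    using Hol_pairing[OF f b] by (simp add: eq)
  moreover have "b n * (taylor_coeff f n * of_real r ^ n) = of_real ((norm (taylor_coeff f n) * r ^ n)\<^sup>2)" for n
    using complex_norm_square[of "taylor_coeff f n * of_real r ^ n"] f
    by (simp add: b_def mult.commute norm_mult norm_power)
  moreover have "f z * cnj (f z) = of_real ((norm (f z))\<^sup>2)" for z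
    using complex_norm_square[of "f z"] by simp
  ultimately show ?thesis
    by (simp only: integral_complex_of_real sums_of_real_iff)
qed

lemma summable_norm_powers: "norm (w::complex) < 1 \<Longrightarrow> summable (\<lambda>n. norm (w ^ n))"
  by (simp add: norm_power)

lemma powers_cis: "w ^ n * cis (- (real n * t)) = (w * cis (-t)) ^ n"
  by (simp add: power_mult_distrib Complex.DeMoivre)

text \<open>The Cauchy kernel is the geometric series in w, so pairing it with f reproduces the
  Taylor series at R w.\<close>

lemma Hol_Cauchy:
  assumes f: "f \<in> Hol" "0 \<le> R" "R < 1" and w: "norm w < 1"
  shows "(\<integral>t. f (of_real R * cis t) * (1 / (1 - w * cis (-t))) \<partial>circ) = f (of_real R * w)"
proof -
  have "norm (of_real R * w) < 1" using f w by (simp add: norm_mult mult_strict_mono' [of R 1 "norm w" 1, simplified])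
  from Hol_sums[OF f(1) this] have "(\<lambda>n. w ^ n * (taylor_coeff f n * of_real R ^ n)) sums f (of_real R * w)"
    by (simp add: power_mult_distrib mult_ac)
  moreover have "(\<lambda>n. w ^ n * (taylor_coeff f n * of_real R ^ n)) sums
    (\<integral>t. f (of_real R * cis t) * (\<Sum>n. w ^ n * cis (- (real n * t))) \<partial>circ)"
    by (rule Hol_pairing[OF f summable_norm_powers[OF w]])
  moreover have "(\<Sum>n. w ^ n * cis (- (real n * t))) = 1 / (1 - w * cis (-t))" for t
    unfolding powers_cis using w by (intro suminf_geometric) (simp add: norm_mult)
  ultimately show ?thesis using sums_unique2 by fastforce
qed

lemma Hol_Cauchy_conj:
  assumes f: "f \<in> Hol" "0 \<le> R" "R < 1" and w: "norm w < 1"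
  shows "(\<integral>t. f (of_real R * cis t) * (cnj w * cis t / (1 - cnj w * cis t)) \<partial>circ) = 0"
proof -
  \<comment> \<open>The constant term is removed; it is the only one that the pairing with an
    analytic function could detect.\<close>
  define b where "b n = (if n = 0 then 0 else cnj w ^ n)" for n
  have "norm (b n) \<le> norm (w ^ n)" for n by (auto simp: b_def norm_power)
  then have b: "summable (\<lambda>n. norm (b n))"
    by (intro summable_comparison_test[OF _ summable_norm_powers[OF w]]) auto
  have "(\<Sum>n. b n * cis (real n * t)) = cnj w * cis t / (1 - cnj w * cis t)" for t
  proof -
    have n: "norm (cnj w * cis t) < 1" using w by (simp add: norm_mult)
    have "(\<lambda>n. (cnj w * cis t) ^ n) sums (1 / (1 - cnj w * cis t))" by (rule geometric_sums[OF n])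
    from sums_mult[OF this, of "cnj w * cis t"]
    have "(\<lambda>n. (cnj w * cis t) ^ Suc n) sums (cnj w * cis t / (1 - cnj w * cis t))" by simp
    then have "(\<lambda>n. b (Suc n) * cis (real (Suc n) * t)) sums (cnj w * cis t / (1 - cnj w * cis t))"
      unfolding b_def by (simp only: nat.distinct if_False power_mult_distrib Complex.DeMoivre)
    from sums_Suc[OF this] show ?thesis by (simp add: b_def sums_iff)
  qed
  then show ?thesis using Hol_pairing_conj[OF f b] by (simp add: b_def)
qed

section \<open>The Poisson kernel\<close>

text \<open>Indexed by the point w = \<rho> e^(i \<phi>) of the disc: this is (1 - \<rho>^2) / |1 -
  \<rho> e^(i (\<phi> - t))|^2, the usual kernel at angle \<phi> - t.\<close>

definition poisson :: "complex \<Rightarrow> real \<Rightarrow> real" where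
  "poisson w t = (1 - (norm w)\<^sup>2) / (norm (1 - w * cis (-t)))\<^sup>2"

lemma one_minus_cis_nonzero: "norm w < 1 \<Longrightarrow> 1 - w * cis t \<noteq> 0"
  by (metis eq_iff_diff_eq_0 mult.right_neutral norm_cis norm_mult norm_one order_less_irrefl)

lemma cont_poisson: "norm w < 1 \<Longrightarrow> continuous_on UNIV (poisson w)"
  unfolding poisson_def by (intro continuous_intros) (use one_minus_cis_nonzero in force)

lemma poisson_nonneg: "norm w < 1 \<Longrightarrow> 0 \<le> poisson w t"
  unfolding poisson_def by (intro divide_nonneg_nonneg) (auto simp: power_le_one)

lemma poisson_le:
  assumes "norm w < 1" shows "poisson w t \<le> 2 / (1 - norm w)"
proof -
  have "1 - norm w \<le> norm (1 - w * cis (-t))"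
    using norm_triangle_ineq2[of 1 "w * cis (-t)"] by (simp add: norm_mult)
  then have "(1 - norm w)\<^sup>2 \<le> (norm (1 - w * cis (-t)))\<^sup>2" using assms by (intro power_mono) auto
  then have "poisson w t \<le> (1 - (norm w)\<^sup>2) / (1 - norm w)\<^sup>2"
    unfolding poisson_def using assms by (intro divide_left_mono) (auto simp: power_le_one zero_less_mult_iff one_minus_cis_nonzero)
  also have "1 - (norm w)\<^sup>2 = (1 - norm w) * (1 + norm w)" by (simp add: power2_eq_square algebra_simps)
  also have "(1 - norm w) * (1 + norm w) / (1 - norm w)\<^sup>2 = (1 + norm w) / (1 - norm w)"
    using assms by (simp add: power2_eq_square)
  also have "\<dots> \<le> 2 / (1 - norm w)" using assms by (intro divide_right_mono) auto
  finally show ?thesis .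
qed

text \<open>The Poisson kernel is the Cauchy kernel plus the conjugate of the Cauchy kernel without
  its constant term. Analytic functions are reproduced by the first summand and annihilated by the
  second.\<close>

lemma poisson_split:
  assumes "norm w < 1"
  shows "of_real (poisson w t) = 1 / (1 - w * cis (-t)) + cnj w * cis t / (1 - cnj w * cis t)"
proof -
  define u where "u = w * cis (-t)"
  have c: "cnj w * cis t = cnj u" by (simp add: u_def cis_cnj)
  have n: "norm u = norm w" by (simp add: u_def norm_mult)
  have nz: "1 - u \<noteq> 0" unfolding u_def by (rule one_minus_cis_nonzero[OF assms])
  then have nz2: "1 - cnj u \<noteq> 0" by (metis complex_cnj_diff complex_cnj_one complex_cnj_zero_iff)
  have "1 / (1 - u) + cnj u / (1 - cnj u) = (1 - u * cnj u) / ((1 - u) * (1 - cnj u))"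
    using nz nz2 by (simp add: field_simps)
  also have "\<dots> = (1 - u * cnj u) / ((1 - u) * cnj (1 - u))" by simp
  also have "\<dots> = of_real ((1 - (norm u)\<^sup>2) / (norm (1 - u))\<^sup>2)"
    by (simp add: complex_norm_square del: of_real_power complex_cnj_diff)
  finally show ?thesis unfolding poisson_def c u_def[symmetric] by (simp add: n)
qed

lemma Hol_rotate: "f \<in> Hol \<Longrightarrow> (\<lambda>z. f (cis \<theta> * z)) \<in> Hol"
  unfolding Hol_def mem_Collect_eq
  by (rule holomorphic_on_compose_gen[of "\<lambda>z. cis \<theta> * z" _ f "ball 0 1", unfolded o_def])
     (auto intro!: holomorphic_intros simp: norm_mult)

lemma Hol_const [simp]: "(\<lambda>_. c) \<in> Hol"
  by (simp add: Hol_def)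

lemma Hol_Poisson0:
  assumes f: "f \<in> Hol" "0 \<le> R" "R < 1" and w: "norm w < 1"
  shows "(\<integral>t. f (of_real R * cis t) * of_real (poisson w t) \<partial>circ) = f (of_real R * w)"
proof -
  have w': "norm (cnj w) < 1" using w by simp
  have "(\<integral>t. f (of_real R * cis t) * of_real (poisson w t) \<partial>circ) =
    (\<integral>t. f (of_real R * cis t) * (1 / (1 - w * cis (-t))) + f (of_real R * cis t) * (cnj w * cis t / (1 - cnj w * cis t)) \<partial>circ)"
    by (simp add: poisson_split[OF w] distrib_left)
  also have "\<dots> = f (of_real R * w)"
    using one_minus_cis_nonzero[OF w] one_minus_cis_nonzero[OF w']
    by (subst Bochner_Integration.integral_add)
       (auto simp: Hol_Cauchy[OF f w, simplified] Hol_Cauchy_conj[OF f w, simplified]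
         intro!: integrable_circ_cont continuous_intros Hol_cont_circle[OF f])
  finally show ?thesis .
qed

lemma integral_poisson: "norm w < 1 \<Longrightarrow> (\<integral>t. poisson w t \<partial>circ) = 1"
  using Hol_Poisson0[of "\<lambda>_. 1" 0 w] by (simp add: of_real_eq_iff[where 'a=complex, of _ 1, simplified])

lemma Hol_Poisson:
  assumes f: "f \<in> Hol" "0 \<le> R" "R < 1" and w: "norm w < 1"
  shows "(\<integral>t. f (of_real R * cis (\<theta> + t)) * of_real (poisson w t) \<partial>circ) = f (of_real R * w * cis \<theta>)"
  using Hol_Poisson0[OF Hol_rotate[OF f(1), of \<theta>] f(2,3) w]
  by (simp add: cis_mult[symmetric] mult_ac)

lemma cont_circle_sum:
  assumes f: "f \<in> Hol" "0 \<le> R" "R < 1"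
  shows "continuous_on S (\<lambda>t. f (of_real R * cis (\<theta> + t)))" "continuous_on S' (\<lambda>(\<theta>, t). f (of_real R * cis (\<theta> + t)))"
  using f by (auto intro!: Hol_cont_compose[OF f(1)] continuous_intros simp: norm_mult case_prod_unfold)

lemma Hol_Poisson_norm:
  assumes f: "f \<in> Hol" "0 \<le> R" "R < 1" and w: "norm w < 1"
  shows "norm (f (of_real R * w * cis \<theta>)) \<le> (\<integral>t. norm (f (of_real R * cis (\<theta> + t))) * poisson w t \<partial>circ)"
  unfolding Hol_Poisson[OF f w, symmetric]
  using poisson_nonneg[OF w] by (intro order_trans[OF integral_norm_bound]) (simp add: norm_mult)

section \<open>Integral means of analytic functions\<close>

lemma Lc_shift:
  assumes g: "continuous_on UNIV g" and per: "\<And>t. g (t + 2*pi) = g t" and "p > 0"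
  shows "Lc p (\<lambda>t. g (t + s)) = Lc p g"
  unfolding Lc_def using assms
  by (subst integral_circ_shift[where g = "\<lambda>t. norm (g t) powr p"])
     (auto intro!: borel_measurable_continuous_onI cont_norm_powr)

lemma Lc_circle_shift:
  assumes f: "f \<in> Hol" "0 \<le> R" "R < 1" "p > 0"
  shows "Lc p (\<lambda>t. norm (f (of_real R * cis (t + s)))) = Mp p R f"
proof -
  have "Lc p (\<lambda>t. norm (f (of_real R * cis (t + s)))) = Lc p (\<lambda>t. f (of_real R * cis (t + s)))"
    by (rule Lc_cong) simp
  also have "\<dots> = Lc p (\<lambda>t. f (of_real R * cis t))"
    by (rule Lc_shift[OF Hol_cont_circle[OF f(1-3)]]) (use f in \<open>auto simp: cis_mult[symmetric]\<close>)
  finally show ?thesis using f by (simp add: Mp_eq_Lc)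
qed

lemma Mp_nonneg [simp]: "0 \<le> Mp p r f"
  by (simp add: Mp_def)

text \<open>The values on the inner circle are averages of rotated values on the outer circle
  against a Poisson kernel of mass one, and Minkowski's inequality bounds the norm of an average by
  the common norm of the rotated functions.\<close>

lemma Mp_mono:
  assumes f: "f \<in> Hol" and p: "1 \<le> p" and r: "0 \<le> r" "r \<le> R" "R < 1"
  shows "Mp p r f \<le> Mp p R f"
proof (cases "r = R")
  case False
  then have R: "R > 0" "0 \<le> R" using r by auto
  define w where "w = complex_of_real (r / R)"
  have w: "norm w < 1" using False r R by (simp add: w_def norm_divide)
  have rw: "of_real R * w = of_real r" using R by (simp add: w_def)
  have "Lc p (\<lambda>\<theta>. f (of_real r * cis \<theta>)) \<le> (\<integral>s. poisson w s \<partial>circ) * Mp p R f"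
  proof (rule Lc_minkowski)
    show "norm (f (of_real r * cis \<theta>)) \<le> (\<integral>t. norm (f (of_real R * cis (\<theta> + t))) * poisson w t \<partial>circ)" for \<theta>
      using Hol_Poisson_norm[OF f R(2) r(3) w, of \<theta>] by (simp add: rw)
    show "continuous_on UNIV (\<lambda>(x, s). norm (f (of_real R * cis (x + s))))"
      using cont_circle_sum(2)[OF f R(2) r(3)] by (auto simp: case_prod_unfold intro!: continuous_on_norm)
    show "Lc p (\<lambda>x. norm (f (of_real R * cis (x + s)))) \<le> Mp p R f" for s
      using p r R by (subst Lc_circle_shift[OF f]) auto
  qed (use p r f w in \<open>auto intro!: Hol_cont_circle cont_poisson poisson_nonneg\<close>)
  then show ?thesis using f p r by (simp add: Mp_eq_Lc integral_poisson[OF w])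
qed simp

text \<open>Jensen in the Poisson integral over the circle of radius R, after which the kernel is
  replaced by its maximum, at most 2 / (1 - |w|) with |w| at most r / R.\<close>

lemma Hol_sup_le_Mp:
  assumes f: "f \<in> Hol" and p: "1 \<le> p" and r: "0 \<le> r" "r < R" "R < 1" and z: "norm z \<le> r"
  shows "norm (f z) powr p \<le> 2 * R / (R - r) * Mp p R f powr p"
proof -
  have R: "R > 0" "0 \<le> R" using r by auto
  define w where "w = z / of_real R"
  have w: "norm w < 1" "norm w \<le> r / R" using r R z by (auto simp: w_def norm_divide divide_right_mono)
  have zw: "z = of_real R * w" using R by (simp add: w_def)
  have c: "continuous_on UNIV (\<lambda>t. norm (f (of_real R * cis t)))"
    by (intro continuous_on_norm Hol_cont_circle f R r)
  have cp: "continuous_on UNIV (\<lambda>t. norm (f (of_real R * cis t)) powr p)"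
    using p by (intro cont_norm_powr Hol_cont_circle f R r) auto
  have "norm (f z) powr p \<le> (\<integral>t. norm (f (of_real R * cis t)) * poisson w t \<partial>circ) powr p"
    using Hol_Poisson_norm[OF f R(2) r(3) w(1), of 0] p by (intro powr_mono2) (auto simp: zw)
  also have "\<dots> \<le> (\<integral>t. poisson w t \<partial>circ) powr (p - 1) * (\<integral>t. norm (f (of_real R * cis t)) powr p * poisson w t \<partial>circ)"
    using p poisson_nonneg[OF w(1)]
    by (intro weighted_jensen_powr integrable_circ_cont continuous_on_mult c cp cont_poisson w) auto
  also have "\<dots> = (\<integral>t. norm (f (of_real R * cis t)) powr p * poisson w t \<partial>circ)"
    by (simp add: integral_poisson[OF w(1)])
  also have "\<dots> \<le> (\<integral>t. norm (f (of_real R * cis t)) powr p * (2 / (1 - norm w)) \<partial>circ)"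
    by (intro integral_mono mult_left_mono poisson_le w integrable_circ_cont continuous_on_mult cp cont_poisson continuous_on_const) auto
  also have "\<dots> = 2 / (1 - norm w) * Mp p R f powr p"
    using f r R p by (simp add: Mp_eq_Lc Lc_powr mult.commute)
  also have "\<dots> \<le> 2 / (1 - r / R) * Mp p R f powr p"
    using w r R by (intro mult_right_mono divide_left_mono) (auto simp: zero_less_mult_iff)
  also have "2 / (1 - r / R) = 2 * R / (R - r)" using R r by (simp add: field_simps)
  finally show ?thesis .
qed

text \<open>Of the q factors |f|, the excess q - p is estimated by the maximum on the smaller circle
  and the remaining p are integrated. The loss is a power of 1 / (R - r), hence of 2^k for
  neighbouring dyadic radii.\<close>

lemma Mp_exponent_le:
  assumes f: "f \<in> Hol" and p: "1 \<le> p" "p \<le> q" and r: "0 \<le> r" "r < R" "R < 1"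
  shows "Mp q r f \<le> (2 * R / (R - r)) powr (1/p - 1/q) * Mp p R f"
proof -
  define m where "m = Mp p R f"
  define c where "c = 2 * R / (R - r)"
  have c0: "c > 0" using r by (auto simp: c_def)
  have m0: "m \<ge> 0" by (simp add: m_def)
  have pw: "norm (f (of_real r * cis t)) \<le> c powr (1/p) * m" for t
  proof -
    have "norm (f (of_real r * cis t)) powr p \<le> c * m powr p"
      unfolding c_def m_def using r by (intro Hol_sup_le_Mp f p) (auto simp: norm_mult)
    then have "(norm (f (of_real r * cis t)) powr p) powr (1/p) \<le> (c * m powr p) powr (1/p)"
      using p by (intro powr_mono2) auto
    then show ?thesis using p c0 m0 by (simp add: powr_powr powr_mult)
  qed
  have "(\<integral>t. norm (f (of_real r * cis t)) powr q \<partial>circ) \<le>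
      (\<integral>t. (c powr (1/p) * m) powr (q - p) * norm (f (of_real r * cis t)) powr p \<partial>circ)"
  proof (rule integral_mono)
    show "norm (f (of_real r * cis t)) powr q \<le> (c powr (1/p) * m) powr (q - p) * norm (f (of_real r * cis t)) powr p" for t
    proof -
      have "norm (f (of_real r * cis t)) powr q = norm (f (of_real r * cis t)) powr (q - p) * norm (f (of_real r * cis t)) powr p"
        by (simp add: powr_add[symmetric])
      also have "\<dots> \<le> (c powr (1/p) * m) powr (q - p) * norm (f (of_real r * cis t)) powr p"
        using p by (intro mult_right_mono powr_mono2 pw) auto
      finally show ?thesis .
    qed
  qed (use p r f in \<open>auto intro!: integrable_norm_powr Hol_cont_circle integrable_mult_right\<close>)
  also have "\<dots> = (c powr (1/p) * m) powr (q - p) * Mp p r f powr p"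
    using f r p by (simp add: Mp_eq_Lc Lc_powr)
  also have "\<dots> \<le> (c powr (1/p) * m) powr (q - p) * m powr p"
    unfolding m_def using f r p by (intro mult_left_mono powr_mono2 Mp_mono) auto
  also have "\<dots> = (c powr (1/p - 1/q) * m) powr q"
  proof -
    have "1 / p * (q - p) = (1/p - 1/q) * q" using p by (simp add: field_simps)
    then have "(c powr (1/p) * m) powr (q - p) * m powr p = c powr ((1/p - 1/q) * q) * (m powr (q - p) * m powr p)"
      using m0 by (simp add: powr_mult powr_powr)
    also have "m powr (q - p) * m powr p = m powr q" by (simp add: powr_add[symmetric])
    finally show ?thesis using m0 by (simp add: powr_mult powr_powr)
  qed
  finally show ?thesis
    using f r p m0 by (simp add: Mp_eq_Lc[OF f, of r] Lc_le_iff m_def c_def)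
qed

text \<open>The increment along a radius is the integral of f' over the segment; Minkowski's
  inequality then moves the norm inside, where monotonicity of the means gives the bound by the
  largest radius.\<close>

lemma Mp_diff_radii:
  assumes f: "f \<in> Hol" and p: "1 \<le> p" and r: "0 \<le> r" "r \<le> R" "R < 1"
  shows "Lc p (\<lambda>\<theta>. f (of_real R * cis \<theta>) - f (of_real r * cis \<theta>)) \<le> (R - r) * Mp p R (deriv f)"
proof -
  \<comment> \<open>The segment from r to R is parametrized by the circle variable so that the same
    form of Minkowski's inequality applies. Clamping keeps x s inside the segment for every real s,
    as required for continuity on the whole line.\<close>
  define x where "x s = r + (R - r) * max 0 (min 1 (s / (2*pi)))" for s
  have x: "0 \<le> x s" "x s \<le> R" "x s < 1" for s
  proof -
    have "(R - r) * max 0 (min 1 (s / (2*pi))) \<le> (R - r) * 1" using r by (intro mult_left_mono) auto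
    then show "x s \<le> R" by (simp add: x_def)
    then show "x s < 1" using r by simp
    show "0 \<le> x s" using r by (simp add: x_def)
  qed
  have cx: "continuous_on UNIV x" unfolding x_def by (intro continuous_intros) auto
  have cx2: "continuous_on UNIV (\<lambda>z::real \<times> real. x (snd z))"
    by (rule continuous_on_compose2[OF cx]) (auto intro!: continuous_intros)
  note f' = Hol_deriv[OF f]
  have cd: "continuous_on UNIV (\<lambda>s. deriv f (of_real (x s) * cis \<theta>))" for \<theta>
    by (rule Hol_cont_compose[OF f']) (use x in \<open>auto intro!: continuous_intros cx simp: norm_mult\<close>)
  have "Lc p (\<lambda>\<theta>. f (of_real R * cis \<theta>) - f (of_real r * cis \<theta>)) \<le> (\<integral>s. (R - r) \<partial>circ) * Mp p R (deriv f)"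
  proof (rule Lc_minkowski)
    show "norm (f (of_real R * cis \<theta>) - f (of_real r * cis \<theta>)) \<le> (\<integral>s. norm (deriv f (of_real (x s) * cis \<theta>)) * (R - r) \<partial>circ)" for \<theta>
    proof -
      have "(\<integral>s. (of_real ((R - r) / (2*pi)) * cis \<theta>) * deriv f (of_real (x s) * cis \<theta>) \<partial>circ) =
         (1 / (2*pi)) *\<^sub>R (f (of_real (r + (R - r) * (2*pi / (2*pi))) * cis \<theta>) - f (of_real (r + (R - r) * (0 / (2*pi))) * cis \<theta>))"
      proof (rule integral_circ_FTC)
        fix s :: real assume s: "0 \<le> s" "s \<le> 2*pi"
        have xs: "x s = r + (R - r) * (s / (2*pi))" using s by (simp add: x_def)
        have "of_real (x s) * cis \<theta> \<in> ball 0 1" using x[of s] by (simp add: norm_mult)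
        then have d: "(f has_field_derivative deriv f (of_real (r + (R - r) * (s / (2*pi))) * cis \<theta>)) (at (of_real (r + (R - r) * (s / (2*pi))) * cis \<theta>))"
          using f unfolding xs Hol_def by (auto intro: holomorphic_derivI)
        have "((\<lambda>s. of_real (r + (R - r) * (s / (2*pi))) * cis \<theta>) has_vector_derivative (of_real ((R - r) / (2*pi)) * cis \<theta>)) (at s within {0..2*pi})"
          by (auto intro!: derivative_eq_intros simp: has_vector_derivative_def scaleR_conv_of_real field_simps)
        from field_vector_diff_chain_within[OF this has_field_derivative_at_within[OF d]]
        show "((\<lambda>s. f (of_real (r + (R - r) * (s / (2*pi))) * cis \<theta>)) has_vector_derivative
           (of_real ((R - r) / (2*pi)) * cis \<theta>) * deriv f (of_real (x s) * cis \<theta>)) (at s within {0..2*pi})"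
          by (simp add: o_def xs)
      qed (intro continuous_intros cd)
      then have "of_real ((R - r) / (2*pi)) * cis \<theta> * (\<integral>s. deriv f (of_real (x s) * cis \<theta>) \<partial>circ)
          = (f (of_real R * cis \<theta>) - f (of_real r * cis \<theta>)) / of_real (2*pi)"
        unfolding integral_mult_right_zero by (simp add: scaleR_conv_of_real)
      then have "f (of_real R * cis \<theta>) - f (of_real r * cis \<theta>) = (of_real (R - r) * cis \<theta>) * (\<integral>s. deriv f (of_real (x s) * cis \<theta>) \<partial>circ)"
        by (simp add: field_simps)
      then have "norm (f (of_real R * cis \<theta>) - f (of_real r * cis \<theta>)) = (R - r) * norm (\<integral>s. deriv f (of_real (x s) * cis \<theta>) \<partial>circ)"
        using r by (simp add: norm_mult del: of_real_diff)
      also have "\<dots> \<le> (R - r) * (\<integral>s. norm (deriv f (of_real (x s) * cis \<theta>)) \<partial>circ)"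
        using r by (intro mult_left_mono integral_norm_bound) auto
      finally show ?thesis by (simp add: mult.commute)
    qed
    show "continuous_on UNIV (\<lambda>(\<theta>, s). norm (deriv f (of_real (x s) * cis \<theta>)))"
      unfolding case_prod_unfold
      by (intro continuous_on_norm Hol_cont_compose[OF f'])
         (use x in \<open>auto intro!: continuous_intros cx2 simp: norm_mult\<close>)
    show "Lc p (\<lambda>\<theta>. norm (deriv f (of_real (x s) * cis \<theta>))) \<le> Mp p R (deriv f)" for s
    proof -
      have "Lc p (\<lambda>\<theta>. norm (deriv f (of_real (x s) * cis \<theta>))) = Mp p (x s) (deriv f)"
        using x f' p by (subst Mp_eq_Lc) (auto intro: Lc_cong)
      also have "\<dots> \<le> Mp p R (deriv f)" using x r by (intro Mp_mono f' p) auto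
      finally show ?thesis .
    qed
  qed (use p r f in \<open>auto intro!: continuous_intros Hol_cont_circle\<close>)
  then show ?thesis by simp
qed

text \<open>On circles a Hadamard product is a convolution, and this is Young's inequality for L^p
  and L^1. The radius r * r is split evenly between the two factors.\<close>

lemma Hadamard_Young:
  assumes fg: "f \<in> Hol" "g \<in> Hol" "h \<in> Hol" and p: "1 \<le> p" and r: "0 \<le> r" "r < 1"
    and h: "\<And>n. taylor_coeff h n = taylor_coeff f n * taylor_coeff g n"
  shows "Mp p (r * r) h \<le> Mp p r f * Mp 1 r g"
proof -
  have rr: "0 \<le> r * r" "r * r < 1" using r by (auto simp: mult_strict_mono'[of r 1 r 1, simplified])
  have eq: "h (of_real (r * r) * cis \<theta>) = (\<integral>s. g (of_real r * cis s) * f (of_real r * cis (\<theta> + - s)) \<partial>circ)" for \<theta>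
  proof -
    define b where "b n = taylor_coeff f n * of_real r ^ n * cis (real n * \<theta>)" for n
    have b: "summable (\<lambda>n. norm (b n))"
      using Hol_circle_summable[OF fg(1) r] by (simp add: b_def norm_mult)
    have "f (of_real r * cis (\<theta> + - s)) = (\<Sum>n. b n * cis (- (real n * s)))" for s
      unfolding Hol_circle_sums[OF fg(1) r] b_def by (simp add: mult.assoc cis_mult algebra_simps)
    moreover have "h (of_real (r * r) * cis \<theta>) = (\<Sum>n. b n * (taylor_coeff g n * of_real r ^ n))"
      unfolding Hol_circle_sums[OF fg(3) rr] by (simp add: h b_def power_mult_distrib mult_ac)
    ultimately show ?thesis using Hol_pairing[OF fg(2) r b] by (simp add: sums_iff)
  qed
  have "Lc p (\<lambda>\<theta>. h (of_real (r * r) * cis \<theta>)) \<le> (\<integral>s. norm (g (of_real r * cis s)) \<partial>circ) * Mp p r f"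
  proof (rule Lc_minkowski)
    show "norm (h (of_real (r * r) * cis \<theta>)) \<le> (\<integral>s. norm (f (of_real r * cis (\<theta> + - s))) * norm (g (of_real r * cis s)) \<partial>circ)" for \<theta>
      unfolding eq by (intro order_trans[OF integral_norm_bound]) (simp add: norm_mult mult.commute)
    show "continuous_on UNIV (\<lambda>(\<theta>, s). norm (f (of_real r * cis (\<theta> + - s))))"
      unfolding case_prod_unfold using r
      by (intro continuous_on_norm Hol_cont_compose[OF fg(1)]) (auto intro!: continuous_intros simp: norm_mult)
    show "Lc p (\<lambda>\<theta>. norm (f (of_real r * cis (\<theta> + - s)))) \<le> Mp p r f" for s
      using p r by (subst Lc_circle_shift[OF fg(1)]) auto
  qed (use p fg r rr in \<open>auto intro!: continuous_on_norm Hol_cont_circle simp del: of_real_mult\<close>)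
  moreover have "(\<integral>s. norm (g (of_real r * cis s)) \<partial>circ) = Mp 1 r g"
    using fg r by (simp add: Mp_eq_Lc Lc_def integral_nonneg)
  ultimately show ?thesis
    using fg p rr by (simp add: Mp_eq_Lc mult.commute del: of_real_mult)
qed

section \<open>Means of negative powers of |1 - z|\<close>

text \<open>Jordan's inequality, from concavity of the sine; angles beyond pi are reflected.\<close>

lemma sin_half_lower:
  assumes "0 \<le> t" "t \<le> 2*pi"
  shows "min t (2*pi - t) / pi \<le> sin (t / 2)"
proof -
  have *: "x / (pi/2) \<le> sin x" if "0 \<le> x" "x \<le> pi/2" for x
  proof -
    have "concave_on {0..pi} sin"
      by (rule f''_le0_imp_concave[where f' = cos and f'' = "\<lambda>x. - sin x"])
         (auto intro!: derivative_eq_intros sin_ge_zero)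
    then have "convex_on {0..pi} (\<lambda>x. - sin x)" by (simp add: concave_on_def)
    from convex_onD[OF this, of "x / (pi/2)" 0 "pi/2"] that show ?thesis
      by (simp add: field_simps)
  qed
  show ?thesis
  proof (cases "t \<le> pi")
    case True
    then show ?thesis using *[of "t/2"] assms by (simp add: min_def)
  next
    case False
    have "sin (pi - t/2) = sin (t/2)" by (simp add: sin_diff)
    then show ?thesis using *[of "pi - t/2"] assms False by (simp add: min_def field_simps)
  qed
qed

text \<open>Away from the centre this comes from |1 - r e^(it)|^2 = (1 - r)^2 + 4 r sin^2(t/2). For
  r < 1/2 the triangle inequality is enough, and the constant 10 comes from there: 1 - r is at most
  1, the distance to the period lattice at most pi < 4, and (1 + 4) / 10 = 1/2.\<close>

lemma one_minus_cis_lower: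
  assumes r: "0 \<le> r" "r < 1" and t: "0 \<le> t" "t \<le> 2*pi"
  shows "((1 - r) + min t (2*pi - t)) / 10 \<le> norm (1 - of_real r * cis t)"
proof -
  define d where "d = min t (2*pi - t)"
  have d: "0 \<le> d" "d \<le> pi" using t by (auto simp: d_def min_def)
  show ?thesis
  proof (cases "r < 1/2")
    case True
    have "((1 - r) + d) / 10 \<le> (1 + 4) / 10" using d r pi_less_4 by (intro divide_right_mono add_mono) auto
    also have "\<dots> \<le> 1 - r" using True by simp
    also have "\<dots> \<le> norm (1 - of_real r * cis t)"
      using norm_triangle_ineq2[of 1 "of_real r * cis t"] r by (simp add: norm_mult)
    finally show ?thesis by (simp add: d_def)
  next
    case False
    have sq: "(norm (1 - of_real r * cis t))\<^sup>2 = (1 - r)\<^sup>2 + 4 * r * (sin (t/2))\<^sup>2"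
    proof -
      have "(norm (1 - of_real r * cis t))\<^sup>2 = (1 - r * cos t)\<^sup>2 + (r * sin t)\<^sup>2"
        by (simp add: cmod_power2)
      also have "\<dots> = 1 - 2 * r * cos t + ((r * cos t)\<^sup>2 + (r * sin t)\<^sup>2)"
        by (simp add: power2_eq_square algebra_simps)
      also have "(r * cos t)\<^sup>2 + (r * sin t)\<^sup>2 = r\<^sup>2"
        by (simp add: power_mult_distrib flip: distrib_left)
      also have "cos t = 1 - 2 * (sin (t/2))\<^sup>2"
        using cos_double_sin[of "t/2"] by simp
      finally show ?thesis by (simp add: power2_eq_square algebra_simps)
    qed
    have "(d / 4)\<^sup>2 \<le> (d / pi)\<^sup>2" using d pi_less_4 by (intro power_mono divide_left_mono) auto
    also have "\<dots> \<le> (sin (t/2))\<^sup>2"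
      using sin_half_lower[OF t] d by (intro power_mono) (auto simp: d_def)
    finally have s: "(d / 4)\<^sup>2 \<le> (sin (t/2))\<^sup>2" .
    have "(((1 - r) + d) / 10)\<^sup>2 \<le> (1 - r)\<^sup>2 + 2 * (d / 4)\<^sup>2"
    proof -
      have "2 * (1 - r) * d \<le> (1 - r)\<^sup>2 + d\<^sup>2" using sum_squares_bound[of "1 - r" d] by simp
      then have "(((1 - r) + d))\<^sup>2 \<le> 2 * ((1 - r)\<^sup>2 + d\<^sup>2)" by (simp add: power2_sum)
      then show ?thesis
        by (simp add: power_divide) (use zero_le_power2[of "1 - r"] zero_le_power2[of d] in linarith)
    qed
    also have "\<dots> \<le> (1 - r)\<^sup>2 + 4 * r * (sin (t/2))\<^sup>2"
    proof -
      have "2 * (d / 4)\<^sup>2 \<le> (4 * r) * (sin (t/2))\<^sup>2"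
        using False s by (intro mult_mono) auto
      then show ?thesis by simp
    qed
    finally have "(((1 - r) + d) / 10)\<^sup>2 \<le> (norm (1 - of_real r * cis t))\<^sup>2" unfolding sq .
    then show ?thesis unfolding d_def[symmetric] by (rule power2_le_imp_le) simp
  qed
qed

text \<open>The two integrands handle the two ends of [0, 2 pi], both of which are mapped to 1 by
  e^(it). The absolute values keep the base positive, hence the integrand continuous, on the whole
  line.\<close>

lemma integral_inverse_linear:
  assumes u: "u > 0" and b: "b > 1"
  shows "(\<integral>t. (u + \<bar>t\<bar>) powr (-b) \<partial>circ) \<le> u powr (1 - b) / (b - 1)"
    and "(\<integral>t. (u + \<bar>2*pi - t\<bar>) powr (-b) \<partial>circ) \<le> u powr (1 - b) / (b - 1)"
proof -
  have sg: "x / (1 - b) - y / (1 - b) = (y - x) / (b - 1)" for x y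
    by (metis diff_divide_distrib minus_diff_eq minus_divide_divide)
  have k: "(1 / (2*pi)) * (u powr (1 - b) - (u + 2*pi) powr (1 - b)) / (b - 1) \<le> u powr (1 - b) / (b - 1)"
  proof -
    have "1 / (2*pi) * (u powr (1 - b) - (u + 2*pi) powr (1 - b)) \<le> 1 * (u powr (1 - b) - 0)"
      using u b pi_gt3 by (intro mult_mono) (auto simp: intro!: powr_mono2')
    from divide_right_mono[OF this, of "b - 1"] show ?thesis using b by simp
  qed
  have "(\<integral>t. (u + \<bar>t\<bar>) powr (-b) \<partial>circ) = (1 / (2*pi)) *\<^sub>R ((u + 2*pi) powr (1 - b) / (1 - b) - (u + 0) powr (1 - b) / (1 - b))"
  proof (rule integral_circ_FTC)
    fix x :: real assume x: "0 \<le> x" "x \<le> 2*pi"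
    have "((\<lambda>x. (u + x) powr (1 - b) / (1 - b)) has_real_derivative (u + x) powr (-b)) (at x within {0..2*pi})"
    proof -
      have "((\<lambda>x. (u + x) powr (1 - b)) has_real_derivative (1 - b) * (u + x) powr (1 - b - of_nat 1) * 1) (at x)"
        by (rule DERIV_fun_powr) (use x u in \<open>auto intro!: derivative_eq_intros\<close>)
      from has_field_derivative_at_within[OF DERIV_cdivide[OF this, of "1 - b"]] show ?thesis using b by simp
    qed
    then show "((\<lambda>x. (u + x) powr (1 - b) / (1 - b)) has_vector_derivative (u + \<bar>x\<bar>) powr (-b)) (at x within {0..2*pi})"
      using x by (simp add: has_real_derivative_iff_has_vector_derivative)
  qed (use u in \<open>auto intro!: continuous_intros simp: add_pos_nonneg less_imp_neq[OF add_pos_nonneg, symmetric]\<close>)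
  also have "\<dots> = (1 / (2*pi)) * (u powr (1 - b) - (u + 2*pi) powr (1 - b)) / (b - 1)"
    using sg by simp
  finally show "(\<integral>t. (u + \<bar>t\<bar>) powr (-b) \<partial>circ) \<le> u powr (1 - b) / (b - 1)" using k by simp
  have "(\<integral>t. (u + \<bar>2*pi - t\<bar>) powr (-b) \<partial>circ) = (1 / (2*pi)) *\<^sub>R (- ((u + (2*pi - 2*pi)) powr (1 - b) / (1 - b)) - (- ((u + (2*pi - 0)) powr (1 - b) / (1 - b))))"
  proof (rule integral_circ_FTC)
    fix x :: real assume x: "0 \<le> x" "x \<le> 2*pi"
    have "((\<lambda>x. - ((u + (2*pi - x)) powr (1 - b) / (1 - b))) has_real_derivative (u + (2*pi - x)) powr (-b)) (at x within {0..2*pi})"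
    proof -
      have "((\<lambda>x. (u + (2*pi - x)) powr (1 - b)) has_real_derivative (1 - b) * (u + (2*pi - x)) powr (1 - b - of_nat 1) * (-1)) (at x)"
        by (rule DERIV_fun_powr) (use x u in \<open>auto intro!: derivative_eq_intros\<close>)
      from has_field_derivative_at_within[OF DERIV_minus[OF DERIV_cdivide[OF this, of "1 - b"]]] show ?thesis using b by simp
    qed
    then show "((\<lambda>x. - ((u + (2*pi - x)) powr (1 - b) / (1 - b))) has_vector_derivative (u + \<bar>2*pi - x\<bar>) powr (-b)) (at x within {0..2*pi})"
      using x by (simp add: has_real_derivative_iff_has_vector_derivative)
  qed (use u in \<open>auto intro!: continuous_intros simp: add_pos_nonneg less_imp_neq[OF add_pos_nonneg, symmetric]\<close>)
  also have "\<dots> = (1 / (2*pi)) * (u powr (1 - b) - (u + 2*pi) powr (1 - b)) / (b - 1)"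
    using sg by simp
  finally show "(\<integral>t. (u + \<bar>2*pi - t\<bar>) powr (-b) \<partial>circ) \<le> u powr (1 - b) / (b - 1)" using k by simp
qed

lemma one_minus_cis_pos: "0 \<le> r \<Longrightarrow> r < 1 \<Longrightarrow> 0 < norm (1 - of_real r * cis t)"
  using one_minus_cis_nonzero[of "of_real r" t] by simp

lemma cont_one_minus_cis_powr:
  assumes "0 \<le> r" "r < 1"
  shows "continuous_on UNIV (\<lambda>t. norm (1 - of_real r * cis t) powr b)"
  using one_minus_cis_pos[OF assms] by (intro continuous_on_powr continuous_intros) (metis less_irrefl)

text \<open>The modulus is at least a tenth of 1 - r plus the distance of t to the nearer end of the
  period; a negative power of that minimum is dominated by the sum of the powers for both
  ends.\<close>

lemma integral_one_minus_cis:
  assumes r: "0 \<le> r" "r < 1" and b: "b > 1"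
  shows "(\<integral>t. norm (1 - of_real r * cis t) powr (-b) \<partial>circ) \<le> 10 powr b * 2 / (b - 1) * (1 - r) powr (1 - b)"
proof -
  define u where "u = 1 - r"
  have u: "u > 0" using r by (simp add: u_def)
  have i: "integrable circ (\<lambda>t. (u + \<bar>t\<bar>) powr (-b))" "integrable circ (\<lambda>t. (u + \<bar>2*pi - t\<bar>) powr (-b))"
    using u by (auto intro!: integrable_circ_cont continuous_intros simp: less_imp_neq[OF add_pos_nonneg, symmetric])
  have "(\<integral>t. norm (1 - of_real r * cis t) powr (-b) \<partial>circ) \<le> (\<integral>t. 10 powr b * ((u + \<bar>t\<bar>) powr (-b) + (u + \<bar>2*pi - t\<bar>) powr (-b)) \<partial>circ)"
  proof (rule integral_mono_AE)
    show "AE t in circ. norm (1 - of_real r * cis t) powr (-b) \<le> 10 powr b * ((u + \<bar>t\<bar>) powr (-b) + (u + \<bar>2*pi - t\<bar>) powr (-b))"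
    proof (rule AE_circ)
      fix t assume t: "t \<in> {0..2*pi}"
      have "norm (1 - of_real r * cis t) powr (-b) \<le> ((u + min t (2*pi - t)) / 10) powr (-b)"
        using one_minus_cis_lower[OF r, of t] t u b
        by (intro powr_mono2') (auto simp: u_def[symmetric] intro: add_pos_nonneg)
      also have "\<dots> = 10 powr b * (u + min t (2*pi - t)) powr (-b)"
        using t u by (subst powr_divide) (auto simp: powr_minus field_simps)
      also have "(u + min t (2*pi - t)) powr (-b) \<le> (u + \<bar>t\<bar>) powr (-b) + (u + \<bar>2*pi - t\<bar>) powr (-b)"
        using t by (auto simp: min_def)
      finally show "norm (1 - of_real r * cis t) powr (-b) \<le> 10 powr b * ((u + \<bar>t\<bar>) powr (-b) + (u + \<bar>2*pi - t\<bar>) powr (-b))"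
        by simp
    qed
  qed (use i in \<open>auto intro!: integrable_circ_cont cont_one_minus_cis_powr r\<close>)
  also have "\<dots> \<le> 10 powr b * (u powr (1 - b) / (b - 1) + u powr (1 - b) / (b - 1))"
  proof -
    have "(\<integral>t. (u + \<bar>t\<bar>) powr (-b) + (u + \<bar>2*pi - t\<bar>) powr (-b) \<partial>circ) \<le> u powr (1 - b) / (b - 1) + u powr (1 - b) / (b - 1)"
      using integral_inverse_linear[OF u b] by (subst Bochner_Integration.integral_add[OF i]) (rule add_mono)
    from mult_left_mono[OF this, of "10 powr b"] show ?thesis by simp
  qed
  finally show ?thesis by (simp add: u_def)
qed

lemma taylor_coeff_deriv: "taylor_coeff (deriv f) n = of_nat (Suc n) * taylor_coeff f (Suc n)"
  by (simp add: taylor_coeff_def funpow_swap1 del: funpow.simps of_nat_Suc)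
     (simp add: funpow_Suc_right del: funpow.simps)

lemma Hol_deriv_sums:
  assumes "f \<in> Hol" "norm z < 1"
  shows "(\<lambda>n. of_nat n * taylor_coeff f n * z ^ n) sums (z * deriv f z)"
proof -
  have "(\<lambda>n. z * (of_nat (Suc n) * taylor_coeff f (Suc n) * z ^ n)) sums (z * deriv f z)"
    using Hol_sums[OF Hol_deriv[OF assms(1)] assms(2)] unfolding taylor_coeff_deriv by (rule sums_mult)
  then have "(\<lambda>n. of_nat (Suc n) * taylor_coeff f (Suc n) * z ^ Suc n) sums (z * deriv f z)"
    by (simp add: mult_ac)
  from sums_Suc[OF this] show ?thesis by simp
qed

section \<open>The Dirichlet integral over dyadic annuli\<close>

lemma lborel_complex: "lborel = distr (lborel \<Otimes>\<^sub>M lborel) borel (\<lambda>(x, y). Complex x y)"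
proof (rule lborel_eqI)
  have [measurable]: "(\<lambda>(x, y). Complex x y) \<in> borel_measurable (lborel \<Otimes>\<^sub>M lborel)"
    unfolding lborel_prod by (auto intro!: borel_measurable_continuous_onI continuous_intros simp: case_prod_unfold Complex_eq)
  fix l u :: complex assume lu: "\<And>b. b \<in> Basis \<Longrightarrow> l \<bullet> b \<le> u \<bullet> b"
  have 1: "Re l \<le> Re u" "Im l \<le> Im u" using lu[of 1] lu[of \<i>] by (auto simp: Basis_complex_def inner_complex_def)
  have "(\<lambda>(x, y). Complex x y) -` box l u \<inter> space (lborel \<Otimes>\<^sub>M lborel) = {Re l<..<Re u} \<times> {Im l<..<Im u}"
    by (auto simp: box_def Basis_complex_def inner_complex_def space_pair_measure)
  then have "emeasure (distr (lborel \<Otimes>\<^sub>M lborel) borel (\<lambda>(x, y). Complex x y)) (box l u)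
     = ennreal (Re u - Re l) * ennreal (Im u - Im l)"
    using 1 by (subst emeasure_distr) (auto simp: lborel.emeasure_pair_measure_Times)
  also have "\<dots> = ennreal (\<Prod>b\<in>Basis. (u - l) \<bullet> b)"
    using 1 by (simp add: Basis_complex_def inner_complex_def ennreal_mult)
  finally show "emeasure (distr (lborel \<Otimes>\<^sub>M lborel) borel (\<lambda>(x, y). Complex x y)) (box l u)
    = ennreal (\<Prod>b\<in>Basis. (u - l) \<bullet> b)" .
qed simp

lemma borel_measurable_Complex[measurable (raw)]:
  assumes [measurable]: "f \<in> borel_measurable M" "g \<in> borel_measurable M"
  shows "(\<lambda>x. Complex (f x) (g x)) \<in> borel_measurable M"
  unfolding Complex_eq by measurable

lemma nn_integral_complex:
  assumes [measurable]: "u \<in> borel_measurable borel"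
  shows "(\<integral>\<^sup>+z. u z \<partial>lborel) = (\<integral>\<^sup>+y. (\<integral>\<^sup>+x. u (Complex x y) \<partial>lborel) \<partial>lborel)"
proof -
  have "(\<integral>\<^sup>+z. u z \<partial>lborel) = (\<integral>\<^sup>+z. u (Complex (fst z) (snd z)) \<partial>(lborel \<Otimes>\<^sub>M lborel))"
    by (subst lborel_complex, subst nn_integral_distr) (auto simp: case_prod_unfold)
  also have "\<dots> = (\<integral>\<^sup>+y. (\<integral>\<^sup>+x. u (Complex x y) \<partial>lborel) \<partial>lborel)"
    by (subst lborel_pair.nn_integral_snd[symmetric]) auto
  finally show ?thesis .
qed

text \<open>A rotation through an angle with \<^term>\<open>cos \<theta> \<noteq> 0\<close> is a product of two affine substitutions,
  one in each variable.\<close>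

lemma nn_integral_rotate_cos_nonzero:
  assumes [measurable]: "u \<in> borel_measurable borel" and c: "cos \<theta> \<noteq> 0"
  shows "(\<integral>\<^sup>+z. u (cis \<theta> * z) \<partial>lborel) = (\<integral>\<^sup>+z. u z \<partial>(lborel :: complex measure))"
proof -
  define c s where "c = cos \<theta>" and "s = sin \<theta>"
  have c0: "c \<noteq> 0" using c by (simp add: c_def)
  have cs: "c * c + s * s = 1" using sin_cos_squared_add3[of \<theta>] by (simp add: c_def s_def)
  have "(\<integral>\<^sup>+z. u (cis \<theta> * z) \<partial>lborel) = (\<integral>\<^sup>+y. (\<integral>\<^sup>+x. u (Complex (c * x - s * y) (s * x + c * y)) \<partial>lborel) \<partial>lborel)"
    by (subst nn_integral_complex, measurable, (rule nn_integral_cong)+, rule arg_cong[where f = u])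
       (simp add: complex_eq_iff c_def s_def)
  also have "\<dots> = (\<integral>\<^sup>+y. ennreal \<bar>1/c\<bar> * (\<integral>\<^sup>+w. u (Complex w ((s * w + y) / c)) \<partial>lborel) \<partial>lborel)"
  proof (rule nn_integral_cong)
    fix y
    have e: "c * (s * y / c + 1 / c * w) - s * y = w" "s * (s * y / c + 1 / c * w) + c * y = (s * w + y) / c" for w
    proof -
      show "c * (s * y / c + 1 / c * w) - s * y = w" using c0 by (simp add: field_simps)
      have "s * (s * y / c + 1 / c * w) + c * y = (s * w + (c * c + s * s) * y) / c"
        using c0 by (simp add: field_simps)
      then show "s * (s * y / c + 1 / c * w) + c * y = (s * w + y) / c" by (simp add: cs)
    qed
    show "(\<integral>\<^sup>+x. u (Complex (c * x - s * y) (s * x + c * y)) \<partial>lborel) = ennreal \<bar>1/c\<bar> * (\<integral>\<^sup>+w. u (Complex w ((s * w + y) / c)) \<partial>lborel)"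
      by (subst nn_integral_real_affine[where c = "1/c" and t = "s * y / c"]) (use c0 in \<open>auto simp only: e, auto\<close>)
  qed
  also have "\<dots> = ennreal \<bar>1/c\<bar> * (\<integral>\<^sup>+y. (\<integral>\<^sup>+w. u (Complex w ((s * w + y) / c)) \<partial>lborel) \<partial>lborel)"
    by (rule nn_integral_cmult) measurable
  also have "(\<integral>\<^sup>+y. (\<integral>\<^sup>+w. u (Complex w ((s * w + y) / c)) \<partial>lborel) \<partial>lborel) = (\<integral>\<^sup>+w. (\<integral>\<^sup>+y. u (Complex w ((s * w + y) / c)) \<partial>lborel) \<partial>lborel)"
    by (rule lborel_pair.Fubini') measurable
  also have "ennreal \<bar>1/c\<bar> * \<dots> = (\<integral>\<^sup>+w. ennreal \<bar>1/c\<bar> * (\<integral>\<^sup>+y. u (Complex w ((s * w + y) / c)) \<partial>lborel) \<partial>lborel)"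
    by (rule nn_integral_cmult[symmetric]) measurable
  also have "\<dots> = (\<integral>\<^sup>+w. (\<integral>\<^sup>+v. u (Complex w v) \<partial>lborel) \<partial>lborel)"
    by (rule nn_integral_cong, subst (2) nn_integral_real_affine[where c = "1/c" and t = "s * _ / c"])
       (use c0 in \<open>auto simp: add_divide_distrib\<close>)
  also have "\<dots> = (\<integral>\<^sup>+v. (\<integral>\<^sup>+w. u (Complex w v) \<partial>lborel) \<partial>lborel)"
    by (rule lborel_pair.Fubini') measurable
  finally show ?thesis by (simp add: nn_integral_complex)
qed

text \<open>When \<open>cos \<theta> = 0\<close> the rotation is performed as two rotations through
  half the angle, whose cosine cannot vanish, since otherwise \<open>cos \<theta>\<close> would be
  -1.\<close>

lemma nn_integral_rotate:
  assumes [measurable]: "u \<in> borel_measurable borel"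
  shows "(\<integral>\<^sup>+z. u (cis \<theta> * z) \<partial>lborel) = (\<integral>\<^sup>+z. u z \<partial>(lborel :: complex measure))"
proof (cases "cos \<theta> = 0")
  case True
  have "cos (\<theta>/2) \<noteq> 0"
  proof
    assume "cos (\<theta>/2) = 0"
    then show False using True cos_double_cos[of "\<theta>/2"] by simp
  qed
  then have "(\<integral>\<^sup>+z. u (cis (\<theta>/2) * (cis (\<theta>/2) * z)) \<partial>lborel) = (\<integral>\<^sup>+z. u z \<partial>lborel)"
    by (subst nn_integral_rotate_cos_nonzero[of "\<lambda>z. u (cis (\<theta>/2) * z)"]) (auto simp: nn_integral_rotate_cos_nonzero)
  then show ?thesis by (simp add: mult.assoc[symmetric] cis_mult)
qed (simp add: nn_integral_rotate_cos_nonzero)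


section \<open>Dyadic radii and annuli\<close>

definition dyad :: "nat \<Rightarrow> real" where
  "dyad k = 1 - (1/2) ^ k"

lemma dyad_bounds [simp]: "0 \<le> dyad k" "dyad k < 1"
  by (auto simp: dyad_def power_le_one)

lemma dyad_mono: "i \<le> j \<Longrightarrow> dyad i \<le> dyad j"
  by (auto simp: dyad_def intro!: power_decreasing)

lemma dyad_less: "i < j \<Longrightarrow> dyad i < dyad j"
  by (auto simp: dyad_def intro!: power_strict_decreasing)

lemma dyad_0 [simp]: "dyad 0 = 0"
  by (simp add: dyad_def)

lemma dyad_diff: "dyad (Suc k) - dyad k = (1/2) ^ Suc k"
  by (simp add: dyad_def)

lemma dyad_tendsto: "dyad \<longlonglongrightarrow> 1"
proof -
  have "(\<lambda>k. 1 - (1/2::real) ^ k) \<longlonglongrightarrow> 1 - 0"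
    by (intro tendsto_intros) auto
  then show ?thesis by (simp add: dyad_def[abs_def])
qed

lemma dyad_interval:
  assumes "0 \<le> r" "r < 1"
  obtains k where "dyad k \<le> r" "r < dyad (Suc k)"
proof -
  have "eventually (\<lambda>k. r < dyad k) sequentially"
    using order_tendstoD(1)[OF dyad_tendsto] assms by auto
  then have ex: "\<exists>k. r < dyad k" by (auto dest: eventually_happens)
  define m where "m = (LEAST k. r < dyad k)"
  have m: "r < dyad m" using LeastI_ex[OF ex] by (simp add: m_def)
  have "m \<noteq> 0" using m assms by (intro notI) simp
  then obtain k where k: "m = Suc k" using not0_implies_Suc by blast
  have "\<not> r < dyad k" using not_less_Least[of k "\<lambda>k. r < dyad k"] k by (simp add: m_def)
  then show ?thesis using m k by (intro that[of k]) auto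
qed

definition annulus :: "nat \<Rightarrow> complex set" where
  "annulus k = {z. dyad k \<le> norm z \<and> norm z < dyad (Suc k)}"

lemma annulus_borel [measurable]: "annulus k \<in> sets borel"
  unfolding annulus_def by measurable

text \<open>The area is pi 2^(-k-1) times the sum of the two radii, a sum that lies between 1/2 and
  2 even for the innermost annulus, which is a disc.\<close>

lemma emeasure_annulus:
  "ennreal (pi / 4 * (1/2) ^ k) \<le> emeasure lborel (annulus k)"
  "emeasure lborel (annulus k) \<le> ennreal (pi * (1/2) ^ k)"
proof -
  have a: "annulus k = ball 0 (dyad (Suc k)) - ball 0 (dyad k)" by (auto simp: annulus_def)
  have "emeasure lborel (annulus k) = emeasure lborel (ball (0::complex) (dyad (Suc k))) - emeasure lborel (ball (0::complex) (dyad k))"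
    unfolding a by (rule emeasure_Diff) (auto simp: emeasure_ball intro!: subset_ball dyad_mono)
  also have "\<dots> = ennreal (pi * (dyad (Suc k))\<^sup>2) - ennreal (pi * (dyad k)\<^sup>2)"
    by (simp add: emeasure_ball unit_ball_vol_2)
  also have "\<dots> = ennreal (pi * (dyad (Suc k))\<^sup>2 - pi * (dyad k)\<^sup>2)"
    by (rule ennreal_minus) auto
  also have "pi * (dyad (Suc k))\<^sup>2 - pi * (dyad k)\<^sup>2 = (pi * (1/2) ^ Suc k) * (dyad (Suc k) + dyad k)"
    unfolding dyad_diff[symmetric] by (simp add: power2_eq_square algebra_simps)
  finally have e: "emeasure lborel (annulus k) = ennreal ((pi * (1/2) ^ Suc k) * (dyad (Suc k) + dyad k))" .
  have "1/2 \<le> dyad (Suc k)" using dyad_mono[of 1 "Suc k"] by (simp add: dyad_def)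
  then have b: "1/2 \<le> dyad (Suc k) + dyad k" by (simp add: add_increasing2)
  have c: "dyad (Suc k) + dyad k \<le> 2" using dyad_bounds[of "Suc k"] dyad_bounds[of k] by linarith
  have "(pi * (1/2) ^ Suc k) * (1/2) \<le> (pi * (1/2) ^ Suc k) * (dyad (Suc k) + dyad k)"
    by (intro mult_left_mono b) auto
  then show "ennreal (pi / 4 * (1/2) ^ k) \<le> emeasure lborel (annulus k)"
    unfolding e by (intro ennreal_leI) simp
  have "(pi * (1/2) ^ Suc k) * (dyad (Suc k) + dyad k) \<le> (pi * (1/2) ^ Suc k) * 2"
    by (intro mult_left_mono c) auto
  then show "emeasure lborel (annulus k) \<le> ennreal (pi * (1/2) ^ k)"
    unfolding e by (intro ennreal_leI) simp
qed

lemma ball_annuli: "(\<Sum>k. indicator (annulus k) z * (x::ennreal)) = indicator (ball 0 1) z * x"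
proof (cases "norm z < 1")
  case True
  then obtain k where k: "dyad k \<le> norm z" "norm z < dyad (Suc k)"
    using dyad_interval[of "norm z"] by auto
  have "z \<in> annulus j \<longleftrightarrow> j = k" for j
  proof
    assume "z \<in> annulus j"
    then have "dyad j \<le> norm z" "norm z < dyad (Suc j)" by (auto simp: annulus_def)
    then have "dyad j < dyad (Suc k)" "dyad k < dyad (Suc j)" using k by linarith+
    then have "\<not> Suc k \<le> j" "\<not> Suc j \<le> k" using dyad_mono[of "Suc k" j] dyad_mono[of "Suc j" k] by linarith+
    then show "j = k" by simp
  qed (use k in \<open>simp add: annulus_def\<close>)
  then have "(\<lambda>j. indicator (annulus j) z * x) = (\<lambda>j. if j = k then x else 0)"
    by (auto simp: indicator_def)
  moreover have "(\<lambda>j. if j = k then x else 0) sums x" by (rule sums_single)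
  ultimately show ?thesis using True by (simp add: sums_iff)
next
  case False
  have "z \<notin> annulus j" for j using False less_trans[OF _ dyad_bounds(2)[of "Suc j"]] by (auto simp: annulus_def)
  then show ?thesis using False by simp
qed

definition disc_weight :: "real \<Rightarrow> complex \<Rightarrow> real" where
  "disc_weight \<alpha> z = (\<alpha> + 1) * (1 - (norm z)\<^sup>2) powr \<alpha> * (1 / pi)"

text \<open>On the annulus, 1 - |z|^2 = (1 - |z|)(1 + |z|) lies between 2^(-k) / 2 and 2 times
  2^(-k). The exponent \<bar>\<alpha>\<bar> makes one constant fit both signs of \<alpha>.\<close>

lemma disc_weight_bounds:
  assumes \<alpha>: "-1 < \<alpha>" and z: "z \<in> annulus k"
  shows "(\<alpha> + 1) / pi * 2 powr (-\<bar>\<alpha>\<bar>) * ((1/2) ^ k) powr \<alpha> \<le> disc_weight \<alpha> z"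
    and "disc_weight \<alpha> z \<le> (\<alpha> + 1) / pi * 2 powr \<bar>\<alpha>\<bar> * ((1/2) ^ k) powr \<alpha>"
proof -
  define x where "x = (1 - (norm z)\<^sup>2) / (1/2) ^ k"
  have n: "1 - (1/2) ^ k \<le> norm z" "norm z < 1 - (1/2) ^ Suc k" using z by (auto simp: annulus_def dyad_def)
  have n1: "norm z < 1" using n(2) dyad_bounds(2)[of "Suc k"] unfolding dyad_def by linarith
  have e: "1 - (norm z)\<^sup>2 = (1 - norm z) * (1 + norm z)" by (simp add: power2_eq_square algebra_simps)
  have "(1/2) ^ Suc k * 1 \<le> (1 - norm z) * (1 + norm z)" using n by (intro mult_mono) (auto simp: less_imp_le)
  then have x1: "1/2 \<le> x" unfolding x_def e by (simp add: field_simps)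
  have "(1 - norm z) * (1 + norm z) \<le> (1/2) ^ k * 2" using n n1 by (intro mult_mono) auto
  then have x2: "x \<le> 2" unfolding x_def e by (simp add: field_simps)
  have xe: "(1 - (norm z)\<^sup>2) powr \<alpha> = x powr \<alpha> * ((1/2) ^ k) powr \<alpha>"
    using x1 by (subst powr_mult[symmetric]) (auto simp: x_def)
  have b: "2 powr (-\<bar>\<alpha>\<bar>) \<le> x powr \<alpha>" "x powr \<alpha> \<le> 2 powr \<bar>\<alpha>\<bar>"
  proof -
    have h: "(1/2::real) powr a = 2 powr (-a)" for a by (simp add: powr_minus powr_divide field_simps)
    show "2 powr (-\<bar>\<alpha>\<bar>) \<le> x powr \<alpha>"
      using powr_mono2[of \<alpha> "1/2" x] powr_mono2'[of \<alpha> x 2] x1 x2 by (cases "\<alpha> \<ge> 0") (auto simp: h)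
    show "x powr \<alpha> \<le> 2 powr \<bar>\<alpha>\<bar>"
      using powr_mono2[of \<alpha> x 2] powr_mono2'[of \<alpha> "1/2" x] x1 x2 by (cases "\<alpha> \<ge> 0") (auto simp: h)
  qed
  have w: "disc_weight \<alpha> z = (\<alpha> + 1) / pi * (x powr \<alpha> * ((1/2) ^ k) powr \<alpha>)"
    by (simp add: disc_weight_def xe)
  show "(\<alpha> + 1) / pi * 2 powr (-\<bar>\<alpha>\<bar>) * ((1/2) ^ k) powr \<alpha> \<le> disc_weight \<alpha> z"
    unfolding w mult.assoc using \<alpha> by (intro mult_left_mono mult_right_mono b) auto
  show "disc_weight \<alpha> z \<le> (\<alpha> + 1) / pi * 2 powr \<bar>\<alpha>\<bar> * ((1/2) ^ k) powr \<alpha>"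
    unfolding w mult.assoc using \<alpha> by (intro mult_left_mono mult_right_mono b) auto
qed

lemma nn_integral_disc:
  assumes [measurable]: "(\<lambda>z. indicator (ball 0 1) z * u z) \<in> borel_measurable (borel :: complex measure)"
  shows "(\<integral>\<^sup>+z. u z \<partial>disc_measure \<alpha>) = (\<integral>\<^sup>+z. indicator (ball 0 1) z * (ennreal (disc_weight \<alpha> z) * u z) \<partial>lborel)"
proof -
  have m: "u \<in> borel_measurable (restrict_space lborel (ball 0 1))"
    by (subst borel_measurable_restrict_space_iff_ennreal) (use assms in \<open>auto simp: mult.commute\<close>)
  have "(\<integral>\<^sup>+z. u z \<partial>disc_measure \<alpha>) = (\<integral>\<^sup>+z. ennreal (disc_weight \<alpha> z) * u z \<partial>restrict_space lborel (ball 0 1))"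
    unfolding disc_measure_def disc_weight_def[symmetric]
    by (rule nn_integral_density[OF _ m]) (auto simp: disc_weight_def intro!: measurable_restrict_space1)
  also have "\<dots> = (\<integral>\<^sup>+z. indicator (ball 0 1) z * (ennreal (disc_weight \<alpha> z) * u z) \<partial>lborel)"
    by (subst nn_integral_restrict_space) (auto simp: mult_ac)
  finally show ?thesis .
qed

lemma cont_indicator_measurable:
  fixes u :: "complex \<Rightarrow> real"
  assumes "continuous_on (ball 0 1) u"
  shows "(\<lambda>z. indicator (ball 0 1) z * ennreal (u z)) \<in> borel_measurable borel"
proof -
  have "(\<lambda>z. indicator (ball 0 1) z *\<^sub>R u z) \<in> borel_measurable borel"
    by (rule borel_measurable_continuous_on_indicator) (use assms in auto)
  then have "(\<lambda>z. ennreal (indicator (ball 0 1) z *\<^sub>R u z)) \<in> borel_measurable borel" by measurable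
  moreover have "(\<lambda>z. ennreal (indicator (ball 0 1) z *\<^sub>R u z)) = (\<lambda>z. indicator (ball 0 1) z * ennreal (u z))"
    by (auto simp: indicator_def)
  ultimately show ?thesis by simp
qed

text \<open>The area integral is invariant under rotation, so it equals its average over all
  rotations; after exchanging the integrals, the inner one is the p-mean over the circle through z.
  This takes the place of polar coordinates, and also shows that the radial integrand is
  measurable.\<close>

lemma disc_average:
  assumes g: "g \<in> Hol" and p: "p > 0"
  shows "(\<integral>\<^sup>+z. ennreal (norm (g z) powr p) \<partial>disc_measure \<alpha>) =
    (\<integral>\<^sup>+z. indicator (ball 0 1) z * (ennreal (disc_weight \<alpha> z) * ennreal (Mp p (norm z) g powr p)) \<partial>lborel)" (is ?eq)
    and "(\<lambda>z. indicator (ball 0 1) z * (ennreal (disc_weight \<alpha> z) * ennreal (Mp p (norm z) g powr p))) \<in> borel_measurable borel"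
proof -
  define u where "u z = indicator (ball 0 1) z * ennreal (norm (g z) powr p)" for z
  have [measurable]: "u \<in> borel_measurable borel"
    unfolding u_def[abs_def] using p
    by (intro cont_indicator_measurable continuous_on_powr' continuous_on_norm Hol_cont g continuous_on_const) auto
  have [measurable]: "(\<lambda>z. ennreal (disc_weight \<alpha> z)) \<in> borel_measurable borel"
    unfolding disc_weight_def by measurable
  define v where "v z = ennreal (disc_weight \<alpha> z) * u z" for z
  have [measurable]: "v \<in> borel_measurable borel" unfolding v_def[abs_def] by measurable
  have [measurable]: "(\<lambda>t. cis t) \<in> borel_measurable borel"
    by (intro borel_measurable_continuous_onI continuous_intros)
  have eq: "(\<integral>\<^sup>+t. v (cis t * z) \<partial>circ) = indicator (ball 0 1) z * (ennreal (disc_weight \<alpha> z) * ennreal (Mp p (norm z) g powr p))" for z :: complex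
    proof (cases "norm z < 1")
      case True
      define a where "a = Arg z"
      have z: "z = of_real (norm z) * cis a" using rcis_cmod_Arg[of z] by (simp add: a_def rcis_def)
      have cz: "cis t * z = of_real (norm z) * cis (t + a)" for t
        by (subst z) (simp add: cis_mult[symmetric] mult_ac)
      have c: "continuous_on UNIV (\<lambda>t. g (of_real (norm z) * cis t))" using True by (intro Hol_cont_circle g) auto
      have [measurable]: "(\<lambda>t. norm (g (of_real (norm z) * cis t)) powr p) \<in> borel_measurable borel"
        by (intro borel_measurable_continuous_onI cont_norm_powr c p)
      have "(\<integral>\<^sup>+t. v (cis t * z) \<partial>circ) = (\<integral>\<^sup>+t. ennreal (disc_weight \<alpha> z) * ennreal (norm (g (cis t * z)) powr p) \<partial>circ)"
        using True by (intro nn_integral_cong) (simp add: v_def u_def norm_mult disc_weight_def)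
      also have "\<dots> = (\<integral>\<^sup>+t. ennreal (disc_weight \<alpha> z) * ennreal (norm (g (of_real (norm z) * cis (t + a))) powr p) \<partial>circ)"
        unfolding cz ..
      also have "\<dots> = (\<integral>\<^sup>+t. ennreal (disc_weight \<alpha> z) * ennreal (norm (g (of_real (norm z) * cis t)) powr p) \<partial>circ)"
        by (rule nn_integral_circ_shift[of "\<lambda>t. ennreal (disc_weight \<alpha> z) * ennreal (norm (g (of_real (norm z) * cis t)) powr p)"])
           (auto simp: cis_mult[symmetric])
      also have "\<dots> = ennreal (disc_weight \<alpha> z) * (\<integral>\<^sup>+t. ennreal (norm (g (of_real (norm z) * cis t)) powr p) \<partial>circ)"
        by (rule nn_integral_cmult) measurable
      also have "(\<integral>\<^sup>+t. ennreal (norm (g (of_real (norm z) * cis t)) powr p) \<partial>circ) = ennreal (Mp p (norm z) g powr p)"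
        using True p g by (subst nn_integral_eq_integral) (auto simp: Mp_eq_Lc Lc_powr intro!: integrable_norm_powr c)
      finally show ?thesis using True by simp
    qed (simp add: v_def u_def norm_mult)
  have "(\<integral>\<^sup>+z. ennreal (norm (g z) powr p) \<partial>disc_measure \<alpha>) = (\<integral>\<^sup>+z. v z \<partial>lborel)"
  proof -
    have m: "(\<lambda>z. indicator (ball 0 1) z * ennreal (norm (g z) powr p)) \<in> borel_measurable borel"
      using \<open>u \<in> borel_measurable borel\<close> unfolding u_def[abs_def] .
    show ?thesis unfolding nn_integral_disc[OF m] v_def u_def by (simp only: mult_ac)
  qed
  also have "\<dots> = (\<integral>\<^sup>+t. (\<integral>\<^sup>+z. v (cis t * z) \<partial>lborel) \<partial>circ)"
    by (simp add: nn_integral_rotate emeasure_circ_UNIV)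
  also have "\<dots> = (\<integral>\<^sup>+z. (\<integral>\<^sup>+t. v (cis t * z) \<partial>circ) \<partial>lborel)"
  proof -
    interpret L: pair_sigma_finite circ "lborel :: complex measure" ..
    show ?thesis by (rule L.Fubini'[symmetric]) measurable
  qed
  also have "\<dots> = (\<integral>\<^sup>+z. indicator (ball 0 1) z * (ennreal (disc_weight \<alpha> z) * ennreal (Mp p (norm z) g powr p)) \<partial>lborel)"
    by (simp only: eq)
  finally show ?eq .
  show "(\<lambda>z. indicator (ball 0 1) z * (ennreal (disc_weight \<alpha> z) * ennreal (Mp p (norm z) g powr p))) \<in> borel_measurable borel"
    unfolding eq[symmetric] by measurable
qed

section \<open>The dyadic series of the Dirichlet integral\<close>

text \<open>The factor 2^(-k (\<alpha> + 1)) is the size 2^(-k \<alpha>) of the weight on the k-th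
  annulus times its area, of order 2^(-k).\<close>

definition dseq :: "real \<Rightarrow> real \<Rightarrow> (complex \<Rightarrow> complex) \<Rightarrow> nat \<Rightarrow> real" where
  "dseq p \<alpha> f k = 2 powr (-(real k * (\<alpha> + 1))) * Mp p (dyad k) (deriv f) powr p"

lemma dseq_nonneg [simp]: "0 \<le> dseq p \<alpha> f k"
  by (simp add: dseq_def)

lemma half_power_powr: "((1/2::real) ^ k) powr \<alpha> * (1/2) ^ k = 2 powr (-(real k * (\<alpha> + 1)))"
proof -
  have "(1/2::real) ^ k = 2 powr (- real k)"
    by (simp add: powr_minus_divide powr_realpow power_one_over)
  then show ?thesis by (simp add: powr_powr powr_add[symmetric] algebra_simps)
qed

text \<open>On the k-th annulus the mean lies between its values at the inner and the outer radius.
  The inner one gives the lower bound term by term; the outer one belongs to index k + 1, which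
  costs 2^(\<alpha> + 1). Extended values are kept so that finiteness of either side can be read off
  from the other.\<close>

lemma Dirichlet_nn_integral_bounds:
  assumes f: "f \<in> Hol" and p: "1 \<le> p" and \<alpha>: "-1 < \<alpha>"
  shows "ennreal ((\<alpha> + 1) * 2 powr (-\<bar>\<alpha>\<bar>) / 4) * (\<Sum>k. ennreal (dseq p \<alpha> f k))
      \<le> (\<integral>\<^sup>+z. ennreal (norm (deriv f z) powr p) \<partial>disc_measure \<alpha>)" (is ?lower)
    and "(\<integral>\<^sup>+z. ennreal (norm (deriv f z) powr p) \<partial>disc_measure \<alpha>)
      \<le> ennreal ((\<alpha> + 1) * 2 powr \<bar>\<alpha>\<bar> * 2 powr (\<alpha> + 1)) * (\<Sum>k. ennreal (dseq p \<alpha> f k))" (is ?upper)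
proof -
  define m where "m r = Mp p r (deriv f) powr p" for r
  have m_mono: "m r \<le> m s" if "0 \<le> r" "r \<le> s" "s < 1" for r s
    unfolding m_def using p that by (intro powr_mono2 Mp_mono Hol_deriv f) auto
  define F where "F z = ennreal (disc_weight \<alpha> z) * ennreal (m (norm z))" for z
  have F: "(\<integral>\<^sup>+z. ennreal (norm (deriv f z) powr p) \<partial>disc_measure \<alpha>) = (\<integral>\<^sup>+z. indicator (ball 0 1) z * F z \<partial>lborel)"
    using p unfolding F_def m_def by (intro disc_average Hol_deriv f) auto
  have [measurable]: "(\<lambda>z. indicator (ball 0 1) z * F z) \<in> borel_measurable borel"
    using p unfolding F_def m_def by (intro disc_average Hol_deriv f) auto
  have sub: "indicator (annulus k) z * F z = indicator (annulus k) z * (indicator (ball 0 1) z * F z)" for k z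
    using less_trans[OF _ dyad_bounds(2)[of "Suc k"]] by (auto simp: indicator_def annulus_def)
  have [measurable]: "(\<lambda>z. indicator (annulus k) z * F z) \<in> borel_measurable borel" for k
    unfolding sub by measurable
  have eq: "(\<integral>\<^sup>+z. indicator (ball 0 1) z * F z \<partial>lborel) = (\<Sum>k. \<integral>\<^sup>+z. indicator (annulus k) z * F z \<partial>lborel)"
    unfolding ball_annuli[symmetric] by (rule nn_integral_suminf) measurable
  have low: "ennreal ((\<alpha> + 1) * 2 powr (-\<bar>\<alpha>\<bar>) / 4) * ennreal (dseq p \<alpha> f k) \<le> (\<integral>\<^sup>+z. indicator (annulus k) z * F z \<partial>lborel)" for k
  proof -
    define c where "c = (\<alpha> + 1) / pi * 2 powr (-\<bar>\<alpha>\<bar>) * ((1/2) ^ k) powr \<alpha> * m (dyad k)"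
    have c0: "0 \<le> c" using \<alpha> by (simp add: c_def m_def)
    have "ennreal ((\<alpha> + 1) * 2 powr (-\<bar>\<alpha>\<bar>) / 4) * ennreal (dseq p \<alpha> f k) = ennreal c * ennreal (pi / 4 * (1/2) ^ k)"
      using \<alpha> c0 by (subst (1 2) ennreal_mult[symmetric])
        (auto simp: c_def dseq_def half_power_powr[symmetric] m_def)
    also have "\<dots> \<le> ennreal c * emeasure lborel (annulus k)"
      by (intro mult_left_mono emeasure_annulus) auto
    also have "\<dots> = (\<integral>\<^sup>+z. ennreal c * indicator (annulus k) z \<partial>lborel)"
      by (subst nn_integral_cmult_indicator) auto
    also have "\<dots> \<le> (\<integral>\<^sup>+z. indicator (annulus k) z * F z \<partial>lborel)"
    proof (rule nn_integral_mono)
      fix z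
      show "ennreal c * indicator (annulus k) z \<le> indicator (annulus k) z * F z"
      proof (cases "z \<in> annulus k")
        case True
        then have "c \<le> disc_weight \<alpha> z * m (norm z)"
          unfolding c_def using \<alpha> less_trans[OF _ dyad_bounds(2)[of "Suc k"]]
          by (intro mult_mono disc_weight_bounds m_mono) (auto simp: annulus_def m_def disc_weight_def)
        then have "ennreal c \<le> F z" unfolding F_def
          by (subst ennreal_mult''[symmetric]) (auto simp: m_def intro!: ennreal_leI)
        then show ?thesis using True by simp
      qed simp
    qed
    finally show ?thesis .
  qed
  have up: "(\<integral>\<^sup>+z. indicator (annulus k) z * F z \<partial>lborel) \<le> ennreal ((\<alpha> + 1) * 2 powr \<bar>\<alpha>\<bar> * 2 powr (\<alpha> + 1)) * ennreal (dseq p \<alpha> f (Suc k))" for k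
  proof -
    define c where "c = (\<alpha> + 1) / pi * 2 powr \<bar>\<alpha>\<bar> * ((1/2) ^ k) powr \<alpha> * m (dyad (Suc k))"
    have c0: "0 \<le> c" using \<alpha> by (simp add: c_def m_def)
    have "(\<integral>\<^sup>+z. indicator (annulus k) z * F z \<partial>lborel) \<le> (\<integral>\<^sup>+z. ennreal c * indicator (annulus k) z \<partial>lborel)"
    proof (rule nn_integral_mono)
      fix z
      show "indicator (annulus k) z * F z \<le> ennreal c * indicator (annulus k) z"
      proof (cases "z \<in> annulus k")
        case True
        then have "disc_weight \<alpha> z * m (norm z) \<le> c"
          unfolding c_def using \<alpha>
          by (intro mult_mono disc_weight_bounds m_mono) (auto simp: annulus_def m_def)
        then have "F z \<le> ennreal c" unfolding F_def
          by (subst ennreal_mult''[symmetric]) (auto simp: m_def intro!: ennreal_leI)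
        then show ?thesis using True by simp
      qed simp
    qed
    also have "\<dots> = ennreal c * emeasure lborel (annulus k)"
      by (subst nn_integral_cmult_indicator) auto
    also have "\<dots> \<le> ennreal c * ennreal (pi * (1/2) ^ k)"
      by (intro mult_left_mono emeasure_annulus) auto
    also have "\<dots> = ennreal ((\<alpha> + 1) * 2 powr \<bar>\<alpha>\<bar> * 2 powr (\<alpha> + 1)) * ennreal (dseq p \<alpha> f (Suc k))"
    proof -
      have "2 powr (\<alpha> + 1) * 2 powr (-(real (Suc k) * (\<alpha> + 1))) = 2 powr (-(real k * (\<alpha> + 1)))"
        by (simp add: powr_add[symmetric] algebra_simps)
      then have "2 powr (\<alpha> + 1) * dseq p \<alpha> f (Suc k) = ((1/2) ^ k) powr \<alpha> * (1/2) ^ k * m (dyad (Suc k))"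
        by (simp add: dseq_def m_def half_power_powr mult.assoc[symmetric])
      then have "c * (pi * (1/2) ^ k) = ((\<alpha> + 1) * 2 powr \<bar>\<alpha>\<bar>) * (2 powr (\<alpha> + 1) * dseq p \<alpha> f (Suc k))"
        by (simp add: c_def)
      then show ?thesis using \<alpha> c0 by (simp add: ennreal_mult[symmetric] mult.assoc)
    qed
    finally show ?thesis .
  qed
  show ?lower unfolding F eq ennreal_suminf_cmult[symmetric] by (intro suminf_le low summableI)
  have "(\<Sum>k. ennreal (dseq p \<alpha> f (Suc k))) \<le> (\<Sum>k. ennreal (dseq p \<alpha> f k))"
  proof (rule suminf_le_const[OF summableI])
    fix n
    have "(\<Sum>k<n. ennreal (dseq p \<alpha> f (Suc k))) = (\<Sum>k\<in>Suc ` {..<n}. ennreal (dseq p \<alpha> f k))"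
      by (simp add: sum.reindex)
    also have "\<dots> \<le> (\<Sum>k. ennreal (dseq p \<alpha> f k))" by (intro sum_le_suminf summableI) auto
    finally show "(\<Sum>k<n. ennreal (dseq p \<alpha> f (Suc k))) \<le> (\<Sum>k. ennreal (dseq p \<alpha> f k))" .
  qed
  then have "ennreal ((\<alpha> + 1) * 2 powr \<bar>\<alpha>\<bar> * 2 powr (\<alpha> + 1)) * (\<Sum>k. ennreal (dseq p \<alpha> f (Suc k)))
    \<le> ennreal ((\<alpha> + 1) * 2 powr \<bar>\<alpha>\<bar> * 2 powr (\<alpha> + 1)) * (\<Sum>k. ennreal (dseq p \<alpha> f k))"
    by (rule mult_left_mono) simp
  moreover have "(\<Sum>k. \<integral>\<^sup>+z. indicator (annulus k) z * F z \<partial>lborel) \<le> ennreal ((\<alpha> + 1) * 2 powr \<bar>\<alpha>\<bar> * 2 powr (\<alpha> + 1)) * (\<Sum>k. ennreal (dseq p \<alpha> f (Suc k)))"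
    unfolding ennreal_suminf_cmult[symmetric] by (intro suminf_le up summableI)
  ultimately show ?upper unfolding F eq by order
qed

lemma disc_measure_measurable:
  assumes "continuous_on (ball 0 1) u"
  shows "u \<in> borel_measurable (disc_measure \<alpha>)"
proof -
  have "u \<in> borel_measurable (restrict_space borel (ball 0 1))"
    using assms by (rule borel_measurable_continuous_on_restrict)
  then show ?thesis unfolding disc_measure_def
    by (subst measurable_cong_sets[OF _ refl, of _ "restrict_space borel (ball 0 1)"])
       (auto simp: sets_restrict_space)
qed

lemma deriv_powr_measurable:
  assumes "f \<in> Hol" "p > 0"
  shows "(\<lambda>z. norm (deriv f z) powr p) \<in> borel_measurable (disc_measure \<alpha>)"
  using assms by (intro disc_measure_measurable continuous_on_powr' continuous_on_norm Hol_cont Hol_deriv continuous_on_const) auto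

lemma Dirichlet_Hol: "f \<in> Dirichlet p \<alpha> \<Longrightarrow> f \<in> Hol"
  by (simp add: Dirichlet_def)

lemma suminf_ennreal_finite_iff:
  assumes "\<And>k. 0 \<le> s k"
  shows "(\<Sum>k. ennreal (s k)) < top \<longleftrightarrow> summable s"
  by (metis assms ennreal_less_top less_top suminf_ennreal2 summable_suminf_not_top)

lemma Dirichlet_iff:
  assumes f: "f \<in> Hol" and p: "1 \<le> p" and \<alpha>: "-1 < \<alpha>"
  shows "f \<in> Dirichlet p \<alpha> \<longleftrightarrow> summable (dseq p \<alpha> f)"
proof -
  define E where "E = (\<integral>\<^sup>+z. ennreal (norm (deriv f z) powr p) \<partial>disc_measure \<alpha>)"
  define S where "S = (\<Sum>k. ennreal (dseq p \<alpha> f k))"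
  have "f \<in> Dirichlet p \<alpha> \<longleftrightarrow> E < top"
    using f p deriv_powr_measurable[OF f, of p \<alpha>]
    by (simp add: Dirichlet_def integrable_iff_bounded E_def)
  also have "\<dots> \<longleftrightarrow> S < top"
  proof
    assume "E < top"
    show "S < top"
    proof (rule ccontr)
      assume "\<not> S < top"
      then have "S = top" using top.not_eq_extremum by blast
      then have "E = top" using Dirichlet_nn_integral_bounds(1)[OF f p \<alpha>] \<alpha>
        by (simp add: E_def S_def ennreal_mult_top top_unique)
      with \<open>E < top\<close> show False by simp
    qed
  next
    assume "S < top"
    then show "E < top" using Dirichlet_nn_integral_bounds(2)[OF f p \<alpha>]
      by (auto simp: E_def S_def ennreal_mult_less_top intro: le_less_trans)
  qed
  also have "\<dots> \<longleftrightarrow> summable (dseq p \<alpha> f)" unfolding S_def by (rule suminf_ennreal_finite_iff) simp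
  finally show ?thesis .
qed

definition dsum :: "real \<Rightarrow> real \<Rightarrow> (complex \<Rightarrow> complex) \<Rightarrow> real" where
  "dsum p \<alpha> f = norm (f 0) powr p + (\<Sum>k. dseq p \<alpha> f k)"

text \<open>The discrete substitute for \<open>Dirichlet_norm\<close> in which all estimates are
  carried out; the original norm enters only when boundedness and compactness are
  translated.\<close>

definition dnorm :: "real \<Rightarrow> real \<Rightarrow> (complex \<Rightarrow> complex) \<Rightarrow> real" where
  "dnorm p \<alpha> f = dsum p \<alpha> f powr (1/p)"

lemma dsum_nonneg:
  assumes "summable (dseq p \<alpha> f)" shows "0 \<le> dsum p \<alpha> f"
  using suminf_nonneg[OF assms] by (simp add: dsum_def)

text \<open>The two-sided bounds concern the derivative parts only; taking the minimum, resp.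
  maximum, with 1 lets the same constants cover the common term |f(0)|^p.\<close>

lemma Dirichlet_norm_equiv:
  assumes p: "1 \<le> p" and \<alpha>: "-1 < \<alpha>"
  obtains c C where "c > 0" "C > 0"
    "\<And>f. f \<in> Dirichlet p \<alpha> \<Longrightarrow> c * dnorm p \<alpha> f \<le> Dirichlet_norm p \<alpha> f"
    "\<And>f. f \<in> Dirichlet p \<alpha> \<Longrightarrow> Dirichlet_norm p \<alpha> f \<le> C * dnorm p \<alpha> f"
proof -
  define a where "a = min 1 ((\<alpha> + 1) * 2 powr (-\<bar>\<alpha>\<bar>) / 4)"
  define b where "b = max 1 ((\<alpha> + 1) * 2 powr \<bar>\<alpha>\<bar> * 2 powr (\<alpha> + 1))"
  have a: "a > 0" "a \<le> 1" using \<alpha> by (auto simp: a_def)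
  have b: "b \<ge> 1" by (auto simp: b_def)
  have main: "a * dsum p \<alpha> f \<le> norm (f 0) powr p + (LINT z|disc_measure \<alpha>. norm (deriv f z) powr p)"
    "norm (f 0) powr p + (LINT z|disc_measure \<alpha>. norm (deriv f z) powr p) \<le> b * dsum p \<alpha> f" "0 \<le> dsum p \<alpha> f"
    if f: "f \<in> Dirichlet p \<alpha>" for f
  proof -
    have fH: "f \<in> Hol" using f by (rule Dirichlet_Hol)
    have s: "summable (dseq p \<alpha> f)" using Dirichlet_iff[OF fH p \<alpha>] f by simp
    define S where "S = (\<Sum>k. dseq p \<alpha> f k)"
    define I where "I = (LINT z|disc_measure \<alpha>. norm (deriv f z) powr p)"
    have S0: "S \<ge> 0" unfolding S_def by (intro suminf_nonneg s) simp
    have I0: "I \<ge> 0" unfolding I_def by simp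
    have S: "(\<Sum>k. ennreal (dseq p \<alpha> f k)) = ennreal S"
      unfolding S_def by (intro suminf_ennreal2 s) simp
    have I: "(\<integral>\<^sup>+z. ennreal (norm (deriv f z) powr p) \<partial>disc_measure \<alpha>) = ennreal I"
      unfolding I_def using f by (intro nn_integral_eq_integral) (auto simp: Dirichlet_def)
    have 1: "(\<alpha> + 1) * 2 powr (-\<bar>\<alpha>\<bar>) / 4 * S \<le> I"
      using Dirichlet_nn_integral_bounds(1)[OF fH p \<alpha>] \<alpha> S0 I0 unfolding S I
      by (simp add: ennreal_mult[symmetric])
    have 2: "I \<le> (\<alpha> + 1) * 2 powr \<bar>\<alpha>\<bar> * 2 powr (\<alpha> + 1) * S"
      using Dirichlet_nn_integral_bounds(2)[OF fH p \<alpha>] \<alpha> S0 I0 unfolding S I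
      by (simp add: ennreal_mult[symmetric])
    have "a * S \<le> (\<alpha> + 1) * 2 powr (-\<bar>\<alpha>\<bar>) / 4 * S" using S0 by (intro mult_right_mono) (auto simp: a_def)
    moreover have "a * norm (f 0) powr p \<le> 1 * norm (f 0) powr p" using a by (intro mult_right_mono) auto
    ultimately show "a * dsum p \<alpha> f \<le> norm (f 0) powr p + (LINT z|disc_measure \<alpha>. norm (deriv f z) powr p)"
      using 1 by (simp add: dsum_def S_def[symmetric] I_def[symmetric] distrib_left)
    have "(\<alpha> + 1) * 2 powr \<bar>\<alpha>\<bar> * 2 powr (\<alpha> + 1) * S \<le> b * S" using S0 by (intro mult_right_mono) (auto simp: b_def)
    moreover have "1 * norm (f 0) powr p \<le> b * norm (f 0) powr p" using b by (intro mult_right_mono) auto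
    ultimately show "norm (f 0) powr p + (LINT z|disc_measure \<alpha>. norm (deriv f z) powr p) \<le> b * dsum p \<alpha> f"
      using 2 by (simp add: dsum_def S_def[symmetric] I_def[symmetric] distrib_left)
    show "0 \<le> dsum p \<alpha> f" by (rule dsum_nonneg[OF s])
  qed
  show ?thesis
  proof (rule that[of "a powr (1/p)" "b powr (1/p)"])
    fix f assume f: "f \<in> Dirichlet p \<alpha>"
    note m = main[OF f]
    show "a powr (1/p) * dnorm p \<alpha> f \<le> Dirichlet_norm p \<alpha> f"
      unfolding dnorm_def Dirichlet_norm_def using a m p
      by (subst powr_mult[symmetric]) (auto intro!: powr_mono2)
    show "Dirichlet_norm p \<alpha> f \<le> b powr (1/p) * dnorm p \<alpha> f"
      unfolding dnorm_def Dirichlet_norm_def using b m p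
      by (subst powr_mult[symmetric]) (auto intro!: powr_mono2)
  qed (use a b in auto)
qed

section \<open>Linear structure and point evaluations\<close>

lemma deriv_cong_disc:
  assumes "\<And>z. norm z < 1 \<Longrightarrow> f z = g z" "norm z < 1"
  shows "deriv f z = deriv g z"
proof (rule deriv_cong_ev[OF _ refl])
  have "eventually (\<lambda>w. w \<in> ball 0 1) (nhds z)" using assms(2) by (intro eventually_nhds_in_open) auto
  then show "eventually (\<lambda>w. f w = g w) (nhds z)" by eventually_elim (use assms(1) in auto)
qed

lemma Mp_cong:
  assumes "\<And>z. norm z < 1 \<Longrightarrow> f z = g z" "0 \<le> r" "r < 1"
  shows "Mp p r f = Mp p r g"
  unfolding Mp_def using assms by (simp add: norm_mult)

lemma dseq_cong:
  assumes "\<And>z. norm z < 1 \<Longrightarrow> f z = g z"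
  shows "dseq p \<alpha> f = dseq p \<alpha> g"
  unfolding dseq_def using assms by (intro ext) (simp add: Mp_cong[OF deriv_cong_disc[of f g]])

lemma dnorm_cong:
  assumes "\<And>z. norm z < 1 \<Longrightarrow> f z = g z"
  shows "dnorm p \<alpha> f = dnorm p \<alpha> g"
  unfolding dnorm_def dsum_def using dseq_cong[OF assms, where p = p and \<alpha> = \<alpha>] assms[of 0] by simp

lemma Hol_differentiable: "f \<in> Hol \<Longrightarrow> norm z < 1 \<Longrightarrow> f field_differentiable (at z)"
  unfolding Hol_def using holomorphic_on_imp_differentiable_at[of f "ball 0 1" z] by simp

lemma Hol_add: "f \<in> Hol \<Longrightarrow> g \<in> Hol \<Longrightarrow> (\<lambda>z. f z + g z) \<in> Hol"
  and Hol_diff: "f \<in> Hol \<Longrightarrow> g \<in> Hol \<Longrightarrow> (\<lambda>z. f z - g z) \<in> Hol"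
  and Hol_mult: "f \<in> Hol \<Longrightarrow> g \<in> Hol \<Longrightarrow> (\<lambda>z. f z * g z) \<in> Hol"
  by (auto simp: Hol_def intro: holomorphic_intros)

lemma Hol_cmult: "f \<in> Hol \<Longrightarrow> (\<lambda>z. c * f z) \<in> Hol"
  by (auto simp: Hol_def intro: holomorphic_intros)

lemma Mp_triangle:
  assumes "f \<in> Hol" "g \<in> Hol" "1 \<le> p" "0 \<le> r" "r < 1"
  shows "Mp p r (\<lambda>z. f z + g z) \<le> Mp p r f + Mp p r g"
  using assms by (simp add: Mp_eq_Lc Hol_add Lc_triangle Hol_cont_circle)

lemma Mp_cmult:
  assumes "f \<in> Hol" "p > 0" "0 \<le> r" "r < 1"
  shows "Mp p r (\<lambda>z. c * f z) = norm c * Mp p r f"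
  using assms by (simp add: Mp_eq_Lc Hol_cmult Lc_cmult)

lemma powr_add_le:
  fixes x y p :: real
  assumes "0 \<le> x" "0 \<le> y" "0 \<le> p"
  shows "(x + y) powr p \<le> 2 powr p * (x powr p + y powr p)"
proof -
  have "(x + y) powr p \<le> (2 * max x y) powr p" using assms by (intro powr_mono2) auto
  also have "\<dots> = 2 powr p * max x y powr p" using assms by (simp add: powr_mult)
  also have "\<dots> \<le> 2 powr p * (x powr p + y powr p)" by (intro mult_left_mono) (auto simp: max_def)
  finally show ?thesis .
qed

lemma dseq_cmult:
  assumes "f \<in> Hol" "1 \<le> p"
  shows "dseq p \<alpha> (\<lambda>z. c * f z) k = norm c powr p * dseq p \<alpha> f k"
proof -
  have "Mp p (dyad k) (deriv (\<lambda>z. c * f z)) = Mp p (dyad k) (\<lambda>z. c * deriv f z)"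
    by (rule Mp_cong) (auto intro!: deriv_cmult Hol_differentiable assms)
  also have "\<dots> = norm c * Mp p (dyad k) (deriv f)"
    using assms by (intro Mp_cmult Hol_deriv) auto
  finally show ?thesis by (simp add: dseq_def powr_mult)
qed

lemma dseq_add_le:
  assumes f: "f \<in> Hol" "g \<in> Hol" and p: "1 \<le> p"
  shows "dseq p \<alpha> (\<lambda>z. f z + g z) k \<le> 2 powr p * (dseq p \<alpha> f k + dseq p \<alpha> g k)"
proof -
  have "Mp p (dyad k) (deriv (\<lambda>z. f z + g z)) = Mp p (dyad k) (\<lambda>z. deriv f z + deriv g z)"
    by (rule Mp_cong) (auto intro!: deriv_add Hol_differentiable assms)
  also have "\<dots> \<le> Mp p (dyad k) (deriv f) + Mp p (dyad k) (deriv g)"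
    using assms by (intro Mp_triangle Hol_deriv) auto
  finally have "Mp p (dyad k) (deriv (\<lambda>z. f z + g z)) powr p \<le> (Mp p (dyad k) (deriv f) + Mp p (dyad k) (deriv g)) powr p"
    using p by (intro powr_mono2) auto
  also have "\<dots> \<le> 2 powr p * (Mp p (dyad k) (deriv f) powr p + Mp p (dyad k) (deriv g) powr p)"
    using p by (intro powr_add_le) auto
  finally have "2 powr (-(real k * (\<alpha> + 1))) * Mp p (dyad k) (deriv (\<lambda>z. f z + g z)) powr p
    \<le> 2 powr (-(real k * (\<alpha> + 1))) * (2 powr p * (Mp p (dyad k) (deriv f) powr p + Mp p (dyad k) (deriv g) powr p))"
    by (rule mult_left_mono) simp
  then show ?thesis by (simp add: dseq_def algebra_simps)
qed

lemma dnorm_nonneg [simp]: "0 \<le> dnorm p \<alpha> f"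
  by (simp add: dnorm_def)

context
  fixes p \<alpha> :: real
  assumes p: "1 \<le> p" and \<alpha>: "-1 < \<alpha>"
begin

lemma Dirichlet_iff': "f \<in> Dirichlet p \<alpha> \<longleftrightarrow> f \<in> Hol \<and> summable (dseq p \<alpha> f)"
  using Dirichlet_iff[OF _ p \<alpha>] Dirichlet_Hol by blast

lemma Dirichlet_summable: "f \<in> Dirichlet p \<alpha> \<Longrightarrow> summable (dseq p \<alpha> f)"
  using Dirichlet_iff[OF _ p \<alpha>] Dirichlet_Hol by blast

lemma Dirichlet_cmult: "f \<in> Dirichlet p \<alpha> \<Longrightarrow> (\<lambda>z. c * f z) \<in> Dirichlet p \<alpha>"
  and dnorm_cmult: "f \<in> Dirichlet p \<alpha> \<Longrightarrow> dnorm p \<alpha> (\<lambda>z. c * f z) = norm c * dnorm p \<alpha> f"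
proof -
  assume f: "f \<in> Dirichlet p \<alpha>"
  note fH = Dirichlet_Hol[OF f]
  have e: "dseq p \<alpha> (\<lambda>z. c * f z) = (\<lambda>k. norm c powr p * dseq p \<alpha> f k)"
    using dseq_cmult[OF fH p] by auto
  note s = Dirichlet_summable[OF f]
  show "(\<lambda>z. c * f z) \<in> Dirichlet p \<alpha>"
    using s by (subst Dirichlet_iff[OF Hol_cmult[OF fH] p \<alpha>]) (simp add: e summable_mult)
  have "dsum p \<alpha> (\<lambda>z. c * f z) = norm c powr p * dsum p \<alpha> f"
    unfolding dsum_def e by (simp add: suminf_mult[OF s] norm_mult powr_mult distrib_left)
  then show "dnorm p \<alpha> (\<lambda>z. c * f z) = norm c * dnorm p \<alpha> f"
    using p dsum_nonneg[OF s] by (simp add: dnorm_def powr_mult powr_powr)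
qed

text \<open>The factor 4 arises from (x + y)^p \<le> 2^p (x^p + y^p), used for each term and once
  more for the exponent 1/p. A triangle inequality up to a constant is enough for all boundedness
  and convergence arguments.\<close>

lemma Dirichlet_add: "f \<in> Dirichlet p \<alpha> \<Longrightarrow> g \<in> Dirichlet p \<alpha> \<Longrightarrow> (\<lambda>z. f z + g z) \<in> Dirichlet p \<alpha>"
  and dnorm_add: "f \<in> Dirichlet p \<alpha> \<Longrightarrow> g \<in> Dirichlet p \<alpha> \<Longrightarrow> dnorm p \<alpha> (\<lambda>z. f z + g z) \<le> 4 * (dnorm p \<alpha> f + dnorm p \<alpha> g)"
proof -
  assume f: "f \<in> Dirichlet p \<alpha>" and g: "g \<in> Dirichlet p \<alpha>"
  note H = Dirichlet_Hol[OF f] Dirichlet_Hol[OF g]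
  note s = Dirichlet_summable[OF f] Dirichlet_summable[OF g]
  have s2: "summable (\<lambda>k. 2 powr p * (dseq p \<alpha> f k + dseq p \<alpha> g k))"
    by (intro summable_mult summable_add s)
  have s3: "summable (dseq p \<alpha> (\<lambda>z. f z + g z))"
    by (rule summable_comparison_test[OF _ s2]) (use dseq_add_le[OF H p] in auto)
  then show "(\<lambda>z. f z + g z) \<in> Dirichlet p \<alpha>"
    by (subst Dirichlet_iff[OF Hol_add[OF H] p \<alpha>])
  have "(\<Sum>k. dseq p \<alpha> (\<lambda>z. f z + g z) k) \<le> 2 powr p * ((\<Sum>k. dseq p \<alpha> f k) + (\<Sum>k. dseq p \<alpha> g k))"
    using suminf_le[OF dseq_add_le[OF H p] s3 s2]
    by (simp add: suminf_mult suminf_add[symmetric] summable_add s)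
  moreover have "norm (f 0 + g 0) powr p \<le> 2 powr p * (norm (f 0) powr p + norm (g 0) powr p)"
    using p by (intro order_trans[OF powr_mono2[OF _ _ norm_triangle_ineq] powr_add_le]) auto
  ultimately have "dsum p \<alpha> (\<lambda>z. f z + g z) \<le> 2 powr p * (dsum p \<alpha> f + dsum p \<alpha> g)"
    by (simp add: dsum_def algebra_simps)
  then have "dnorm p \<alpha> (\<lambda>z. f z + g z) \<le> (2 powr p * (dsum p \<alpha> f + dsum p \<alpha> g)) powr (1/p)"
    unfolding dnorm_def using p dsum_nonneg[OF s3] by (intro powr_mono2) auto
  also have "\<dots> = 2 * (dsum p \<alpha> f + dsum p \<alpha> g) powr (1/p)"
    using p dsum_nonneg[OF s(1)] dsum_nonneg[OF s(2)] by (simp add: powr_mult powr_powr)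
  also have "\<dots> \<le> 2 * (2 powr (1/p) * (dnorm p \<alpha> f + dnorm p \<alpha> g))"
    unfolding dnorm_def using p dsum_nonneg[OF s(1)] dsum_nonneg[OF s(2)]
    by (intro mult_left_mono powr_add_le) auto
  also have "\<dots> \<le> 2 * (2 powr 1 * (dnorm p \<alpha> f + dnorm p \<alpha> g))"
    using p by (intro mult_left_mono mult_right_mono powr_mono) auto
  finally show "dnorm p \<alpha> (\<lambda>z. f z + g z) \<le> 4 * (dnorm p \<alpha> f + dnorm p \<alpha> g)" by simp
qed

lemma Dirichlet_diff: "f \<in> Dirichlet p \<alpha> \<Longrightarrow> g \<in> Dirichlet p \<alpha> \<Longrightarrow> (\<lambda>z. f z - g z) \<in> Dirichlet p \<alpha>"
  and dnorm_diff: "f \<in> Dirichlet p \<alpha> \<Longrightarrow> g \<in> Dirichlet p \<alpha> \<Longrightarrow> dnorm p \<alpha> (\<lambda>z. f z - g z) \<le> 4 * (dnorm p \<alpha> f + dnorm p \<alpha> g)"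
proof -
  assume f: "f \<in> Dirichlet p \<alpha>" and g: "g \<in> Dirichlet p \<alpha>"
  show "(\<lambda>z. f z - g z) \<in> Dirichlet p \<alpha>"
    using Dirichlet_add[OF f Dirichlet_cmult[OF g, of "-1"]] by simp
  show "dnorm p \<alpha> (\<lambda>z. f z - g z) \<le> 4 * (dnorm p \<alpha> f + dnorm p \<alpha> g)"
    using dnorm_add[OF f Dirichlet_cmult[OF g, of "-1"]] dnorm_cmult[OF g, of "-1"] by simp
qed

lemma Mp_dyad_le_dnorm:
  assumes f: "f \<in> Dirichlet p \<alpha>"
  shows "Mp p (dyad k) (deriv f) \<le> 2 powr (real k * (\<alpha> + 1) / p) * dnorm p \<alpha> f"
    and norm_0_le_dnorm: "norm (f 0) \<le> dnorm p \<alpha> f"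
proof -
  note s = Dirichlet_summable[OF f]
  have "dseq p \<alpha> f k \<le> dsum p \<alpha> f"
    using sum_le_suminf[OF s, of "{k}"] by (simp add: dsum_def add_increasing)
  then have "2 powr (real k * (\<alpha> + 1)) * dseq p \<alpha> f k \<le> 2 powr (real k * (\<alpha> + 1)) * dsum p \<alpha> f"
    by (rule mult_left_mono) simp
  moreover have "2 powr (real k * (\<alpha> + 1)) * dseq p \<alpha> f k = Mp p (dyad k) (deriv f) powr p"
    by (simp add: dseq_def powr_minus)
  ultimately have "(Mp p (dyad k) (deriv f) powr p) powr (1/p) \<le> (2 powr (real k * (\<alpha> + 1)) * dsum p \<alpha> f) powr (1/p)"
    using p by (intro powr_mono2) auto
  then show "Mp p (dyad k) (deriv f) \<le> 2 powr (real k * (\<alpha> + 1) / p) * dnorm p \<alpha> f"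
    using p dsum_nonneg[OF s] by (simp add: powr_powr powr_mult dnorm_def)
  have "(norm (f 0) powr p) powr (1/p) \<le> dsum p \<alpha> f powr (1/p)"
    using p suminf_nonneg[OF s] by (intro powr_mono2) (auto simp: dsum_def)
  then show "norm (f 0) \<le> dnorm p \<alpha> f" using p by (simp add: powr_powr dnorm_def)
qed

lemma Hol_sup_dyad:
  assumes "f \<in> Hol" "norm z \<le> dyad k"
  shows "norm (f z) \<le> 2 powr (real (k + 2) / p) * Mp p (dyad (Suc k)) f"
proof -
  have "norm (f z) powr p \<le> 2 * dyad (Suc k) / (dyad (Suc k) - dyad k) * Mp p (dyad (Suc k)) f powr p"
    using assms p by (intro Hol_sup_le_Mp) (auto simp: dyad_less)
  also have "\<dots> \<le> 2 powr (real (k + 2)) * Mp p (dyad (Suc k)) f powr p"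
  proof (rule mult_right_mono)
    have "2 * dyad (Suc k) / (dyad (Suc k) - dyad k) \<le> 2 * 1 / (1/2) ^ Suc k"
      unfolding dyad_diff by (intro divide_right_mono) (auto simp: less_imp_le)
    also have "\<dots> = 2 powr (real (k + 2))" by (simp add: powr_realpow power_divide powr_add)
    finally show "2 * dyad (Suc k) / (dyad (Suc k) - dyad k) \<le> 2 powr (real (k + 2))" .
  qed auto
  finally have "(norm (f z) powr p) powr (1/p) \<le> (2 powr (real (k + 2)) * Mp p (dyad (Suc k)) f powr p) powr (1/p)"
    using p by (intro powr_mono2) auto
  then show ?thesis using p by (simp add: powr_powr powr_mult)
qed

text \<open>The derivative is bounded on the disc of radius r_k by its p-mean at r_(k+1), a single
  term of the norm, and f is recovered from f(0) along segments. Thus bounded sets are locally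
  bounded, and norm convergence implies locally uniform convergence.\<close>

lemma Dirichlet_pointwise:
  obtains C where "C > 0" "\<And>f (z::complex). f \<in> Dirichlet p \<alpha> \<Longrightarrow> norm z \<le> dyad k \<Longrightarrow> norm (f z) \<le> C * dnorm p \<alpha> f"
proof -
  define C where "C = 2 powr (real (k + 2) / p) * 2 powr (real (Suc k) * (\<alpha> + 1) / p)"
  show ?thesis
  proof (rule that[of "1 + C"])
    show "1 + C > 0" by (simp add: C_def add_pos_nonneg)
    fix f and z :: complex assume f: "f \<in> Dirichlet p \<alpha>" and z: "norm z \<le> dyad k"
    note fH = Dirichlet_Hol[OF f]
    have b: "norm (deriv f w) \<le> C * dnorm p \<alpha> f" if "w \<in> cball 0 (dyad k)" for w
    proof -
      have "norm (deriv f w) \<le> 2 powr (real (k + 2) / p) * Mp p (dyad (Suc k)) (deriv f)"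
        using that by (intro Hol_sup_dyad Hol_deriv fH) simp
      also have "\<dots> \<le> 2 powr (real (k + 2) / p) * (2 powr (real (Suc k) * (\<alpha> + 1) / p) * dnorm p \<alpha> f)"
        by (intro mult_left_mono Mp_dyad_le_dnorm f) auto
      finally show ?thesis by (simp add: C_def)
    qed
    have "norm (f z - f 0) \<le> C * dnorm p \<alpha> f * norm (z - 0)"
    proof (rule field_differentiable_bound[of "cball 0 (dyad k)" f "deriv f"])
      show "(f has_field_derivative deriv f w) (at w within cball 0 (dyad k))" if "w \<in> cball 0 (dyad k)" for w
        using that le_less_trans[OF _ dyad_bounds(2)[of k]]
        by (intro has_field_derivative_at_within[OF holomorphic_derivI[of f "ball 0 1"]]) (use fH in \<open>auto simp: Hol_def\<close>)
    qed (use b z in auto)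
    also have "\<dots> \<le> C * dnorm p \<alpha> f * 1"
      using order_trans[OF z less_imp_le[OF dyad_bounds(2)]] by (intro mult_left_mono) (auto simp: C_def)
    finally have "norm (f z) \<le> norm (f 0) + C * dnorm p \<alpha> f"
      using norm_triangle_ineq2[of "f z" "f 0"] by simp
    then show "norm (f z) \<le> (1 + C) * dnorm p \<alpha> f"
      using norm_0_le_dnorm[OF f] by (simp add: distrib_right)
  qed
qed

end

section \<open>Rhaly operators as Hadamard products\<close>

text \<open>Young's inequality for a sequence in l^p and a geometric one in l^1: Jensen on each
  finite sum with the powers of \<rho> as weights, then the Cauchy product of two summable
  series.\<close>

lemma geometric_convolution:
  fixes b :: "nat \<Rightarrow> real"
  assumes p: "1 \<le> p" and b: "\<And>k. 0 \<le> b k" and s: "summable (\<lambda>k. b k powr p)" and \<rho>: "0 < \<rho>" "\<rho> < 1"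
  shows "summable (\<lambda>n. (\<Sum>k\<le>n. b k * \<rho> ^ (n - k)) powr p)"
    and "(\<Sum>n. (\<Sum>k\<le>n. b k * \<rho> ^ (n - k)) powr p) \<le> (1 / (1 - \<rho>)) powr p * (\<Sum>k. b k powr p)"
proof -
  define W where "W = 1 / (1 - \<rho>)"
  have W: "W > 0" using \<rho> by (simp add: W_def)
  have jen: "(\<Sum>k\<le>n. b k * \<rho> ^ (n - k)) powr p \<le> W powr (p - 1) * (\<Sum>k\<le>n. b k powr p * \<rho> ^ (n - k))" for n
  proof -
    have "(\<Sum>k\<le>n. b k * \<rho> ^ (n - k)) powr p \<le> (\<Sum>k\<le>n. \<rho> ^ (n - k)) powr (p - 1) * (\<Sum>k\<le>n. b k powr p * \<rho> ^ (n - k))"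
      using weighted_jensen_powr[OF p, of b "\<lambda>k. \<rho> ^ (n - k)" "count_space {..n}"] b \<rho>
      by (simp add: lebesgue_integral_count_space_finite integrable_count_space)
    also have "\<dots> \<le> W powr (p - 1) * (\<Sum>k\<le>n. b k powr p * \<rho> ^ (n - k))"
    proof (intro mult_right_mono powr_mono2 sum_nonneg)
      have "(\<Sum>k\<le>n. \<rho> ^ (n - k)) = (\<Sum>k\<le>n. \<rho> ^ k)"
        by (rule sum.reindex_bij_witness[of _ "\<lambda>k. n - k" "\<lambda>k. n - k"]) auto
      also have "\<dots> \<le> (\<Sum>k. \<rho> ^ k)" using \<rho> by (intro sum_le_suminf) auto
      also have "\<dots> = W" using \<rho> by (simp add: suminf_geometric W_def)
      finally show "(\<Sum>k\<le>n. \<rho> ^ (n - k)) \<le> W" .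
    qed (use p \<rho> in auto)
    finally show ?thesis .
  qed
  have ns: "summable (\<lambda>k. norm (b k powr p))" "summable (\<lambda>k. norm (\<rho> ^ k))" using s \<rho> by auto
  have sp: "summable (\<lambda>n. W powr (p - 1) * (\<Sum>k\<le>n. b k powr p * \<rho> ^ (n - k)))"
    by (intro summable_mult summable_Cauchy_product ns)
  show s1: "summable (\<lambda>n. (\<Sum>k\<le>n. b k * \<rho> ^ (n - k)) powr p)"
    by (rule summable_comparison_test[OF _ sp]) (use jen in auto)
  have "(\<Sum>n. (\<Sum>k\<le>n. b k * \<rho> ^ (n - k)) powr p) \<le> (\<Sum>n. W powr (p - 1) * (\<Sum>k\<le>n. b k powr p * \<rho> ^ (n - k)))"
    by (rule suminf_le[OF jen s1 sp])
  also have "\<dots> = W powr (p - 1) * ((\<Sum>k. b k powr p) * W)"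
    using Cauchy_product[OF ns] \<rho>
    by (simp add: suminf_mult[OF summable_Cauchy_product[OF ns]] suminf_geometric W_def)
  also have "\<dots> = W powr p * (\<Sum>k. b k powr p)"
    using W by (simp add: powr_diff)
  finally show "(\<Sum>n. (\<Sum>k\<le>n. b k * \<rho> ^ (n - k)) powr p) \<le> (1 / (1 - \<rho>)) powr p * (\<Sum>k. b k powr p)"
    by (simp add: W_def)
qed

text \<open>The Cauchy product with the geometric series. It identifies the partial sums in the
  definition of \<open>Rhaly_coeff\<close> as Taylor coefficients, which turns the operator into a
  Hadamard product.\<close>

lemma Hol_partial_sums:
  assumes "f \<in> Hol"
  shows "(\<lambda>z. f z / (1 - z)) \<in> Hol" "taylor_coeff (\<lambda>z. f z / (1 - z)) n = (\<Sum>k\<le>n. taylor_coeff f k)"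
proof -
  have s: "(\<lambda>n. (\<Sum>k\<le>n. taylor_coeff f k) * z ^ n) sums (f z / (1 - z))" if z: "norm z < 1" for z
  proof -
    have "(\<lambda>n. \<Sum>k\<le>n. (taylor_coeff f k * z ^ k) * z ^ (n - k)) sums ((\<Sum>k. taylor_coeff f k * z ^ k) * (\<Sum>k. z ^ k))"
      using z by (intro Cauchy_product_sums Hol_summable_norm assms) (auto simp: norm_power)
    moreover have "(\<Sum>k\<le>n. (taylor_coeff f k * z ^ k) * z ^ (n - k)) = (\<Sum>k\<le>n. taylor_coeff f k) * z ^ n" for n
      by (simp add: sum_distrib_right mult.assoc power_add[symmetric])
    ultimately show ?thesis
      using sums_unique[OF Hol_sums[OF assms z]] z by (simp add: suminf_geometric)
  qed
  show "(\<lambda>z. f z / (1 - z)) \<in> Hol" "taylor_coeff (\<lambda>z. f z / (1 - z)) n = (\<Sum>k\<le>n. taylor_coeff f k)"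
    using Hol_coeff_unique[OF s] by auto
qed

lemma power_series_Hol:
  assumes "converges_in_disc c"
  shows "power_series c \<in> Hol" "taylor_coeff (power_series c) n = c n"
    "norm z < 1 \<Longrightarrow> (\<lambda>n. c n * z ^ n) sums power_series c z"
proof -
  show s: "(\<lambda>n. c n * z ^ n) sums power_series c z" if "norm z < 1" for z
    using assms that unfolding converges_in_disc_def power_series_def by (auto intro: summable_sums)
  show "power_series c \<in> Hol" "taylor_coeff (power_series c) n = c n"
    using Hol_coeff_unique[OF s] by auto
qed

lemma taylor_coeff_add:
  assumes "f \<in> Hol" "g \<in> Hol"
  shows "taylor_coeff (\<lambda>z. f z + g z) n = taylor_coeff f n + taylor_coeff g n"
proof (rule Hol_coeff_unique(2))
  fix z :: complex assume "norm z < 1"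
  then show "(\<lambda>n. (taylor_coeff f n + taylor_coeff g n) * z ^ n) sums (f z + g z)"
    using sums_add[OF Hol_sums[OF assms(1)] Hol_sums[OF assms(2)]] by (simp add: distrib_right)
qed

lemma taylor_coeff_cmult:
  assumes "f \<in> Hol"
  shows "taylor_coeff (\<lambda>z. c * f z) n = c * taylor_coeff f n"
proof (rule Hol_coeff_unique(2))
  fix z :: complex assume "norm z < 1"
  then show "(\<lambda>n. (c * taylor_coeff f n) * z ^ n) sums (c * f z)"
    using sums_mult[OF Hol_sums[OF assms], of z c] by (simp add: mult.assoc)
qed

lemma Hol_id_mult: "f \<in> Hol \<Longrightarrow> (\<lambda>z. z * f z) \<in> Hol"
  by (auto simp: Hol_def intro: holomorphic_intros)

lemma taylor_coeff_z_deriv: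
  assumes "f \<in> Hol"
  shows "taylor_coeff (\<lambda>z. z * deriv f z) n = of_nat n * taylor_coeff f n"
  using Hol_coeff_unique(2)[OF Hol_deriv_sums[OF assms]] .

lemma Rhaly_converges:
  assumes \<eta>: "converges_in_disc \<eta>" and f: "f \<in> Hol"
  shows "converges_in_disc (Rhaly_coeff \<eta> f)"
  unfolding converges_in_disc_def
proof
  fix z :: complex assume "z \<in> ball 0 1"
  then have z: "norm z < 1" by simp
  \<comment> \<open>The power |z|^n is shared between the two factors: r^n makes the series of
    \<eta> absolutely convergent, and another r^n keeps the partial sums bounded.\<close>
  define r where "r = sqrt (norm z)"
  have r: "0 \<le> r" "r < 1" "r * r = norm z" using z by (auto simp: r_def)
  note G = Hol_partial_sums[OF f]
  have 1: "summable (\<lambda>n. norm (\<eta> n) * r ^ n)"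
    using Hol_summable_norm'[OF power_series_Hol(1)[OF \<eta>] r(1,2)] by (simp add: power_series_Hol(2)[OF \<eta>])
  have 2: "summable (\<lambda>n. norm (\<Sum>k\<le>n. taylor_coeff f k) * r ^ n)"
    using Hol_summable_norm'[OF G(1) r(1,2)] by (simp add: G(2))
  from summable_imp_bounded[OF 2] obtain B where B: "\<And>n. norm (norm (\<Sum>k\<le>n. taylor_coeff f k) * r ^ n) \<le> B"
    by (auto simp: bounded_iff)
  show "summable (\<lambda>n. Rhaly_coeff \<eta> f n * z ^ n)"
  proof (rule summable_comparison_test[OF _ summable_mult2[OF 1, of B]], intro exI allI impI)
    fix n
    have "norm (Rhaly_coeff \<eta> f n * z ^ n) = (norm (\<eta> n) * r ^ n) * (norm (\<Sum>k\<le>n. taylor_coeff f k) * r ^ n)"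
      by (simp add: Rhaly_coeff_def norm_mult norm_power r(3)[symmetric] power_mult_distrib mult_ac)
    also have "\<dots> \<le> (norm (\<eta> n) * r ^ n) * B"
      using B[of n] r by (intro mult_left_mono) (auto simp: abs_mult)
    finally show "norm (Rhaly_coeff \<eta> f n * z ^ n) \<le> norm (\<eta> n) * r ^ n * B" .
  qed
qed

lemma Rhaly_Hol:
  assumes \<eta>: "converges_in_disc \<eta>" and f: "f \<in> Hol"
  shows "Rhaly \<eta> f \<in> Hol" "taylor_coeff (Rhaly \<eta> f) n = \<eta> n * (\<Sum>k\<le>n. taylor_coeff f k)"
    "norm z < 1 \<Longrightarrow> (\<lambda>n. \<eta> n * (\<Sum>k\<le>n. taylor_coeff f k) * z ^ n) sums Rhaly \<eta> f z"
  using power_series_Hol[OF Rhaly_converges[OF assms]] by (auto simp: Rhaly_def Rhaly_coeff_def)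

lemma Hol_0: "f 0 = taylor_coeff f 0"
  by (simp add: taylor_coeff_def)

lemma Rhaly_0:
  assumes \<eta>: "converges_in_disc \<eta>" and f: "f \<in> Hol"
  shows "Rhaly \<eta> f 0 = \<eta> 0 * f 0"
  using Rhaly_Hol(2)[OF assms, of 0] by (simp add: Hol_0[of "Rhaly \<eta> f"] Hol_0[of f])

lemma Rhaly_add:
  assumes \<eta>: "converges_in_disc \<eta>" and f: "f \<in> Hol" "g \<in> Hol" and z: "norm z < 1"
  shows "Rhaly \<eta> (\<lambda>w. f w + g w) z = Rhaly \<eta> f z + Rhaly \<eta> g z"
proof -
  have "(\<lambda>n. \<eta> n * (\<Sum>k\<le>n. taylor_coeff f k) * z ^ n + \<eta> n * (\<Sum>k\<le>n. taylor_coeff g k) * z ^ n) sums (Rhaly \<eta> f z + Rhaly \<eta> g z)"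
    by (intro sums_add Rhaly_Hol(3) \<eta> f z)
  then have "(\<lambda>n. \<eta> n * (\<Sum>k\<le>n. taylor_coeff (\<lambda>w. f w + g w) k) * z ^ n) sums (Rhaly \<eta> f z + Rhaly \<eta> g z)"
    by (simp add: taylor_coeff_add[OF f] sum.distrib distrib_left distrib_right)
  then show ?thesis using sums_unique2 Rhaly_Hol(3)[OF \<eta> Hol_add[OF f] z] by blast
qed

lemma Rhaly_cmult:
  assumes \<eta>: "converges_in_disc \<eta>" and f: "f \<in> Hol" and z: "norm z < 1"
  shows "Rhaly \<eta> (\<lambda>w. c * f w) z = c * Rhaly \<eta> f z"
proof -
  have "(\<lambda>n. c * (\<eta> n * (\<Sum>k\<le>n. taylor_coeff f k) * z ^ n)) sums (c * Rhaly \<eta> f z)"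
    by (intro sums_mult Rhaly_Hol(3) \<eta> f z)
  then have "(\<lambda>n. \<eta> n * (\<Sum>k\<le>n. taylor_coeff (\<lambda>w. c * f w) k) * z ^ n) sums (c * Rhaly \<eta> f z)"
    by (simp add: taylor_coeff_cmult[OF f] sum_distrib_left[symmetric] mult_ac)
  then show ?thesis using sums_unique2 Rhaly_Hol(3)[OF \<eta> Hol_cmult[OF f] z] by blast
qed

lemma Rhaly_diff:
  assumes \<eta>: "converges_in_disc \<eta>" and f: "f \<in> Hol" "g \<in> Hol" and z: "norm z < 1"
  shows "Rhaly \<eta> (\<lambda>w. f w - g w) z = Rhaly \<eta> f z - Rhaly \<eta> g z"
  using Rhaly_add[OF \<eta> f(1) Hol_cmult[OF f(2), of "-1"] z] Rhaly_cmult[OF \<eta> f(2) z, of "-1"] by simp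

lemma Mp_id_mult:
  assumes "f \<in> Hol" "p > 0" "0 \<le> r" "r < 1"
  shows "Mp p r (\<lambda>z. z * f z) = r * Mp p r f"
proof -
  have "Mp p r (\<lambda>z. z * f z) = Lc p (\<lambda>t. of_real r * f (of_real r * cis t))"
    using assms by (subst Mp_eq_Lc) (auto simp: Hol_id_mult norm_mult intro: Lc_cong)
  then show ?thesis using assms by (simp add: Lc_cmult Mp_eq_Lc)
qed

text \<open>Young's inequality for z F' and f / (1 - z) at r = r_(n+1). The product radius still
  reaches r_n because (1 - x)^2 \<ge> 1 - 2x, and the factor 2 pays for the division by r \<ge>
  1/2.\<close>

lemma Mp_Rhaly_le:
  assumes \<eta>: "converges_in_disc \<eta>" and f: "f \<in> Hol" and p: "1 \<le> p"
  shows "Mp p (dyad n) (deriv (Rhaly \<eta> f)) \<le> 2 * (Mp p (dyad (Suc n)) (deriv (power_series \<eta>)) * Mp 1 (dyad (Suc n)) (\<lambda>z. f z / (1 - z)))"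
proof -
  define r where "r = dyad (Suc n)"
  have r: "1/2 \<le> r" "0 \<le> r" "r < 1" using dyad_mono[of 1 "Suc n"] by (auto simp: r_def dyad_def[of "Suc 0"])
  have rr: "0 \<le> r * r" "r * r < 1" using r by (auto simp: mult_strict_mono'[of r 1 r 1, simplified])
  have dn: "dyad n \<le> r * r"
  proof -
    have "r * r = 1 - 2 * (1/2) ^ Suc n + (1/2) ^ Suc n * (1/2) ^ Suc n"
      by (simp add: r_def dyad_def algebra_simps)
    also have "\<dots> \<ge> dyad n" by (simp add: dyad_def)
    finally show ?thesis .
  qed
  note F = power_series_Hol[OF \<eta>]
  note R = Rhaly_Hol[OF \<eta> f]
  note G = Hol_partial_sums[OF f]
  have "Mp p (r * r) (\<lambda>z. z * deriv (Rhaly \<eta> f) z) \<le> Mp p r (\<lambda>z. z * deriv (power_series \<eta>) z) * Mp 1 r (\<lambda>z. f z / (1 - z))"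
    by (intro Hadamard_Young Hol_id_mult Hol_deriv F R G p r)
       (simp add: taylor_coeff_z_deriv F R(1) R(2) G(2))
  then have "r * (r * Mp p (r * r) (deriv (Rhaly \<eta> f))) \<le> r * (Mp p r (deriv (power_series \<eta>)) * Mp 1 r (\<lambda>z. f z / (1 - z)))"
    using p r rr by (simp add: Mp_id_mult Hol_deriv F R(1) mult.assoc)
  then have "r * Mp p (r * r) (deriv (Rhaly \<eta> f)) \<le> Mp p r (deriv (power_series \<eta>)) * Mp 1 r (\<lambda>z. f z / (1 - z))"
    using r by simp
  moreover have "1/2 * Mp p (dyad n) (deriv (Rhaly \<eta> f)) \<le> r * Mp p (r * r) (deriv (Rhaly \<eta> f))"
    using r rr dn p by (intro mult_mono Mp_mono Hol_deriv R) auto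
  ultimately show ?thesis by (simp add: r_def)
qed

section \<open>The l^p estimate for f / (1 - z)\<close>

text \<open>Boundedness of this sequence is M_p(r, F') = O((1 - r)^(1/p - 1)) along the dyadic
  radii, and convergence to 0 is the corresponding o.\<close>

definition lip_seq :: "real \<Rightarrow> (complex \<Rightarrow> complex) \<Rightarrow> nat \<Rightarrow> real" where
  "lip_seq p F n = 2 powr (-(real n * (1 - 1/p))) * Mp p (dyad n) (deriv F)"

text \<open>The exponent is what remains of the weight of \<open>dseq\<close> after
  \<open>lip_seq\<close> has taken its share: (1 - 1/p) + ((\<alpha> + 2)/p - 1) = (\<alpha> + 1)/p.
  It is positive precisely when \<alpha> > p - 2.\<close>

definition cesaro_seq :: "real \<Rightarrow> real \<Rightarrow> (complex \<Rightarrow> complex) \<Rightarrow> nat \<Rightarrow> real" where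
  "cesaro_seq p \<alpha> f n = 2 powr (-(real n * ((\<alpha> + 2) / p - 1))) * Mp 1 (dyad (Suc n)) (\<lambda>z. f z / (1 - z))"

lemma lip_seq_nonneg [simp]: "0 \<le> lip_seq p F n"
  by (simp add: lip_seq_def)

lemma cesaro_seq_nonneg [simp]: "0 \<le> cesaro_seq p \<alpha> f n"
  by (simp add: cesaro_seq_def)

text \<open>One factor 2 comes from the bound for the means; the other covers 2^(1 - 1/p) \<le> 2,
  caused by reading \<open>lip_seq\<close> at index n + 1.\<close>

lemma dseq_Rhaly_le:
  assumes \<eta>: "converges_in_disc \<eta>" and f: "f \<in> Hol" and p: "1 \<le> p"
  shows "dseq p \<alpha> (Rhaly \<eta> f) n \<le> (4 * lip_seq p (power_series \<eta>) (Suc n) * cesaro_seq p \<alpha> f n) powr p"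
proof -
  define M where "M = Mp p (dyad (Suc n)) (deriv (power_series \<eta>))"
  define K where "K = Mp 1 (dyad (Suc n)) (\<lambda>z. f z / (1 - z))"
  have nn: "0 \<le> M" "0 \<le> K" by (auto simp: M_def K_def)
  have "dseq p \<alpha> (Rhaly \<eta> f) n \<le> 2 powr (-(real n * (\<alpha> + 1))) * (2 * (M * K)) powr p"
    unfolding dseq_def M_def K_def using p by (intro mult_left_mono powr_mono2 Mp_Rhaly_le \<eta> f) auto
  also have "\<dots> = (2 powr (-(real n * (\<alpha> + 1) / p)) * (2 * (M * K))) powr p"
    using p nn by (subst (2) powr_mult) (auto simp: powr_powr)
  also have "\<dots> \<le> (4 * lip_seq p (power_series \<eta>) (Suc n) * cesaro_seq p \<alpha> f n) powr p"
  proof (rule powr_mono2)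
    have "2 powr (-(real n * (\<alpha> + 1) / p)) * (2 * (M * K)) = 2 * (2 powr (-(real n * (\<alpha> + 1) / p)) * (M * K))" by simp
    also have "\<dots> \<le> 4 * (2 powr (-(real (Suc n) * (1 - 1/p)) + -(real n * ((\<alpha> + 2) / p - 1))) * (M * K))"
    proof -
      have e: "-(real (Suc n) * (1 - 1/p)) + -(real n * ((\<alpha> + 2) / p - 1)) = -(real n * (\<alpha> + 1) / p) + (1/p - 1)"
        using p by (simp add: field_simps)
      have "2 powr (1/p - 1) \<ge> 2 powr (- 1 :: real)" using p by (intro powr_mono) auto
      then have h: "1 \<le> 2 * 2 powr (1/p - 1)" by (simp add: powr_minus)
      have "2 * (2 powr (-(real n * (\<alpha> + 1) / p)) * (M * K)) * 1 \<le> 2 * (2 powr (-(real n * (\<alpha> + 1) / p)) * (M * K)) * (2 * 2 powr (1/p - 1))"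
        using nn by (intro mult_left_mono h) auto
      then show ?thesis unfolding e powr_add by (simp add: mult_ac)
    qed
    also have "\<dots> = 4 * lip_seq p (power_series \<eta>) (Suc n) * cesaro_seq p \<alpha> f n"
      by (simp only: powr_add lip_seq_def cesaro_seq_def M_def K_def mult_ac)
    finally show "2 powr (-(real n * (\<alpha> + 1) / p)) * (2 * (M * K)) \<le> 4 * lip_seq p (power_series \<eta>) (Suc n) * cesaro_seq p \<alpha> f n" .
  qed (use p nn in auto)
  finally show ?thesis .
qed

lemma Mp_le_telescope:
  assumes f: "f \<in> Hol" and q: "1 \<le> q"
  shows "Mp q (dyad n) f \<le> norm (f 0) + (\<Sum>k<n. (1/2) ^ Suc k * Mp q (dyad (Suc k)) (deriv f))"
proof -
  have c: "continuous_on UNIV (\<lambda>t. f (of_real (dyad k) * cis t))" for k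
    by (intro Hol_cont_circle f) auto
  have tel: "f (of_real (dyad n) * cis t) = f 0 + (\<Sum>k<n. f (of_real (dyad (Suc k)) * cis t) - f (of_real (dyad k) * cis t))" for t
    by (subst sum_lessThan_telescope) simp
  have "Mp q (dyad n) f = Lc q (\<lambda>t. f 0 + (\<Sum>k<n. f (of_real (dyad (Suc k)) * cis t) - f (of_real (dyad k) * cis t)))"
    using f q by (subst Mp_eq_Lc) (auto simp: tel[symmetric])
  also have "\<dots> \<le> Lc q (\<lambda>t. f 0) + Lc q (\<lambda>t. \<Sum>k<n. f (of_real (dyad (Suc k)) * cis t) - f (of_real (dyad k) * cis t))"
    using q by (intro Lc_triangle continuous_on_sum continuous_on_diff c) auto
  also have "Lc q (\<lambda>t. \<Sum>k<n. f (of_real (dyad (Suc k)) * cis t) - f (of_real (dyad k) * cis t)) \<le>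
     (\<Sum>k<n. Lc q (\<lambda>t. f (of_real (dyad (Suc k)) * cis t) - f (of_real (dyad k) * cis t)))"
    using q by (intro Lc_sum continuous_on_diff c) auto
  also have "\<dots> \<le> (\<Sum>k<n. (1/2) ^ Suc k * Mp q (dyad (Suc k)) (deriv f))"
    unfolding dyad_diff[symmetric] using q by (intro sum_mono Mp_diff_radii f) (auto intro: dyad_mono)
  finally show ?thesis using q by (simp add: Lc_const)
qed

text \<open>Hoelder's inequality for f and 1 / (1 - z): with r conjugate to q, the r-mean of 1 / (1
  - z) at radius 1 - 2^(-n) is of order 2^(n (r - 1) / r) = 2^(n / q).\<close>

lemma Mp1_geometric_le:
  assumes q: "1 < q"
  obtains C where "C > 0" "\<And>f n. f \<in> Hol \<Longrightarrow> Mp 1 (dyad n) (\<lambda>z. f z / (1 - z)) \<le> C * 2 powr (real n / q) * Mp q (dyad n) f"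
proof -
  define r where "r = q / (q - 1)"
  have r: "r > 1" "1 / q + 1 / r = 1" using q by (auto simp: r_def field_simps)
  define C where "C = 10 powr r * 2 / (r - 1)"
  have C: "C > 0" using r by (simp add: C_def)
  show ?thesis
  proof (rule that[of "C powr (1/r)"])
    show "C powr (1/r) > 0" using C by simp
    fix f n assume f: "f \<in> Hol"
    define g where "g t = norm (1 - of_real (dyad n) * cis t) powr (-1)" for t
    have g0: "g t > 0" for t unfolding g_def using one_minus_cis_pos[of "dyad n" t] by simp
    have gc: "continuous_on UNIV g" unfolding g_def by (intro cont_one_minus_cis_powr) auto
    have "Mp 1 (dyad n) (\<lambda>z. f z / (1 - z)) = (\<integral>t. norm (f (of_real (dyad n) * cis t)) * g t \<partial>circ)"
      using Hol_partial_sums(1)[OF f] one_minus_cis_pos[of "dyad n"]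
      by (simp add: Mp_eq_Lc Lc_def integral_nonneg g_def norm_mult norm_inverse powr_minus divide_inverse)
    also have "\<dots> \<le> Lc q (\<lambda>t. norm (f (of_real (dyad n) * cis t))) * Lc r g"
      using g0 q r gc by (intro Lc_holder) (auto intro!: continuous_on_norm Hol_cont_circle f)
    also have "Lc q (\<lambda>t. norm (f (of_real (dyad n) * cis t))) = Mp q (dyad n) f"
      using f q by (subst Mp_eq_Lc) (auto intro: Lc_cong)
    finally have H: "Mp 1 (dyad n) (\<lambda>z. f z / (1 - z)) \<le> Mp q (dyad n) f * Lc r g" .
    have "Lc r g \<le> C powr (1/r) * 2 powr (real n / q)"
    proof -
      have "(\<integral>t. norm (g t) powr r \<partial>circ) = (\<integral>t. norm (1 - of_real (dyad n) * cis t) powr (-r) \<partial>circ)"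
      proof -
        have "norm (g t) powr r = norm (1 - of_real (dyad n) * cis t) powr (-r)" for t
          unfolding real_norm_def abs_of_pos[OF g0] unfolding g_def powr_powr by simp
        then show ?thesis by simp
      qed
      also have "\<dots> \<le> C * (1 - dyad n) powr (1 - r)"
        unfolding C_def using r by (intro integral_one_minus_cis) auto
      finally have "Lc r g \<le> (C * (1 - dyad n) powr (1 - r)) powr (1/r)"
        unfolding Lc_def using r by (intro powr_mono2) (auto simp: integral_nonneg)
      also have "\<dots> = C powr (1/r) * (2 powr (- real n)) powr ((1 - r) / r)"
        using C by (simp add: powr_mult powr_powr dyad_def powr_minus_divide powr_realpow power_one_over)
      also have "(1 - r) / r = - 1 / q" using r q by (simp add: field_simps)
      finally show ?thesis by (simp add: powr_powr)
    qed
    from order_trans[OF H mult_left_mono[OF this]]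
    show "Mp 1 (dyad n) (\<lambda>z. f z / (1 - z)) \<le> C powr (1/r) * 2 powr (real n / q) * Mp q (dyad n) f"
      by (simp add: mult.commute)
  qed
qed

text \<open>Hoelder's inequality passes from f / (1 - z) to the q-mean of f, telescoping passes to
  q-means of f', and these are exchanged for p-means at the next radius. What results is the
  convolution of the weighted p-means of f' with the powers of 2^(-\<delta>), to which
  \<open>geometric_convolution\<close> applies.\<close>

lemma cesaro_seq_bound:
  assumes p: "1 \<le> p" and \<alpha>: "p - 2 < \<alpha>"
  obtains C where "C > 0"
    "\<And>f. f \<in> Dirichlet p \<alpha> \<Longrightarrow> summable (\<lambda>n. cesaro_seq p \<alpha> f n powr p)"
    "\<And>f. f \<in> Dirichlet p \<alpha> \<Longrightarrow> (\<Sum>n. cesaro_seq p \<alpha> f n powr p) \<le> C * dsum p \<alpha> f"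
proof -
  define \<gamma> where "\<gamma> = (\<alpha> + 2) / p - 1"
  have \<gamma>: "\<gamma> > 0" using p \<alpha> by (simp add: \<gamma>_def field_simps)
  \<comment> \<open>The reciprocal of the Hoelder exponent q. It must be below \<gamma> for the
    convolution to decay and below 1/p for q to exceed p; half of either bound will do.\<close>
  define \<epsilon> where "\<epsilon> = min (\<gamma>/2) (1 / (2*p))"
  define \<delta> where "\<delta> = \<gamma> - \<epsilon>"
  have \<epsilon>: "\<epsilon> > 0" "\<epsilon> < 1/p" and \<delta>: "\<delta> > 0" using \<gamma> p by (auto simp: \<epsilon>_def \<delta>_def min_def field_simps)
  define q where "q = 1 / \<epsilon>"
  have q: "1 < q" "p \<le> q" "1 / q = \<epsilon>"
  proof -
    have "\<epsilon> * p < 1" using \<epsilon> p by (simp add: field_simps)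
    then show "p \<le> q" using \<epsilon> by (simp add: q_def field_simps)
    have "\<epsilon> < 1" using \<epsilon>(2) p by (smt (verit) divide_le_eq_1_pos)
    then show "1 < q" using \<epsilon> by (simp add: q_def field_simps)
  qed (simp add: q_def)
  obtain C1 where C1: "C1 > 0" "\<And>f n. f \<in> Hol \<Longrightarrow> Mp 1 (dyad n) (\<lambda>z. f z / (1 - z)) \<le> C1 * 2 powr (real n / q) * Mp q (dyad n) f"
    using Mp1_geometric_le[OF q(1)] by blast
  define K where "K = 2 powr (-1 + 3 * (1/p - \<epsilon>) + 2 * (\<alpha> + 1) / p)"
  define C2 where "C2 = C1 * 2 powr \<epsilon> * max 1 K"
  have C2: "C2 > 0" using C1 by (simp add: C2_def)
  \<comment> \<open>The index k + 2 comes from the outer radius of the telescoping step and one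
    further radius for the change of exponent. The value f(0), the start of the telescoping sum, is
    stored in the term k = 0.\<close>
  define b where "b f k = 2 powr (-(real (k+2) * (\<alpha> + 1) / p)) * Mp p (dyad (k+2)) (deriv f) + (if k = 0 then norm (f 0) else 0)" for f :: "complex \<Rightarrow> complex" and k
  have b0: "0 \<le> b f k" for f k by (simp add: b_def)
  define \<rho> where "\<rho> = 2 powr (-\<delta>)"
  have \<rho>: "0 < \<rho>" "\<rho> < 1" using \<delta> using powr_less_mono[of "-\<delta>" 0 2] by (auto simp: \<rho>_def)
  have \<alpha>': "-1 < \<alpha>" using p \<alpha> by simp
  have key: "cesaro_seq p \<alpha> f n \<le> C2 * (\<Sum>k\<le>n. b f k * \<rho> ^ (n - k))" if f: "f \<in> Hol" for f n
  proof -
    define M where "M j = Mp p (dyad j) (deriv f)" for j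
    have trm: "(1/2) ^ Suc k * Mp q (dyad (Suc k)) (deriv f) \<le> K * 2 powr (real k * \<delta>) * (2 powr (-(real (k+2) * (\<alpha> + 1) / p)) * M (k+2))" for k
    proof -
      have "Mp q (dyad (Suc k)) (deriv f) \<le> (2 * dyad (k+2) / (dyad (k+2) - dyad (Suc k))) powr (1/p - 1/q) * M (k+2)"
        unfolding M_def using p q by (intro Mp_exponent_le Hol_deriv f) (auto intro: dyad_less)
      also have "\<dots> \<le> (2 powr real (k+3)) powr (1/p - 1/q) * M (k+2)"
      proof (intro mult_right_mono powr_mono2)
        have "dyad (k+2) - dyad (Suc k) = (1/2) ^ Suc (Suc k)" using dyad_diff[of "Suc k"] by simp
        then have "2 * dyad (k+2) / (dyad (k+2) - dyad (Suc k)) \<le> 2 * 1 / (1/2) ^ Suc (Suc k)"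
          by (simp only:, intro divide_right_mono mult_left_mono) (auto simp: less_imp_le)
        also have "\<dots> = 2 powr real (k+3)" by (simp add: powr_realpow power_divide powr_add numeral_3_eq_3)
        finally show "2 * dyad (k+2) / (dyad (k+2) - dyad (Suc k)) \<le> 2 powr real (k+3)" .
        show "0 \<le> 2 * dyad (k + 2) / (dyad (k + 2) - dyad (Suc k))"
          by (intro divide_nonneg_nonneg) (auto intro: dyad_mono)
      qed (use \<epsilon> q in \<open>auto simp: M_def\<close>)
      finally have "(1/2) ^ Suc k * Mp q (dyad (Suc k)) (deriv f) \<le> (1/2) ^ Suc k * ((2 powr real (k+3)) powr (1/p - \<epsilon>) * M (k+2))"
        using q by (intro mult_left_mono) auto
      also have h: "(1/2::real) ^ Suc k = 2 powr (- real (Suc k))"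
        by (simp only: powr_minus_divide powr_realpow power_one_over zero_less_numeral)
      also have "2 powr (- real (Suc k)) * ((2 powr real (k+3)) powr (1/p - \<epsilon>) * M (k+2)) = 2 powr (- real (Suc k) + real (k+3) * (1/p - \<epsilon>)) * M (k+2)"
        by (simp only: powr_add powr_powr mult.assoc)
      \<comment> \<open>The exponent is sorted into the constant \<open>K\<close>, the growth 2^(k
        \<delta>) and the weight under which the mean of f' is p-summable.\<close>
      also have "- real (Suc k) + real (k+3) * (1/p - \<epsilon>) = (-1 + 3 * (1/p - \<epsilon>) + 2 * (\<alpha> + 1) / p) + real k * \<delta> + (-(real (k+2) * (\<alpha> + 1) / p))"
        using p by (simp add: \<delta>_def \<gamma>_def field_simps)
      finally show ?thesis by (simp only: powr_add K_def mult.assoc h)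
    qed
    have "Mp q (dyad (Suc n)) f \<le> norm (f 0) + (\<Sum>k<Suc n. K * 2 powr (real k * \<delta>) * (2 powr (-(real (k+2) * (\<alpha> + 1) / p)) * M (k+2)))"
      using q by (intro order_trans[OF Mp_le_telescope[OF f]] add_left_mono sum_mono trm) auto
    also have "\<dots> \<le> max 1 K * norm (f 0) + (\<Sum>k<Suc n. max 1 K * 2 powr (real k * \<delta>) * (2 powr (-(real (k+2) * (\<alpha> + 1) / p)) * M (k+2)))"
      by (intro add_mono sum_mono mult_right_mono) (auto simp: M_def mult_le_cancel_right1)
    also have "\<dots> = max 1 K * (\<Sum>k\<le>n. 2 powr (real k * \<delta>) * b f k)"
      unfolding b_def M_def lessThan_Suc_atMost
      by (simp add: sum_distrib_left distrib_left sum.distrib if_distrib[of "\<lambda>x. _ * x"] mult.assoc cong: if_cong)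
    finally have Mq: "Mp q (dyad (Suc n)) f \<le> max 1 K * (\<Sum>k\<le>n. 2 powr (real k * \<delta>) * b f k)" .
    have "cesaro_seq p \<alpha> f n \<le> 2 powr (-(real n * \<gamma>)) * (C1 * 2 powr (real (Suc n) * \<epsilon>) * (max 1 K * (\<Sum>k\<le>n. 2 powr (real k * \<delta>) * b f k)))"
      unfolding cesaro_seq_def \<gamma>_def[symmetric]
    proof (rule mult_left_mono)
      have qd: "real (Suc n) / q = real (Suc n) * \<epsilon>" by (simp add: q_def)
      show "Mp 1 (dyad (Suc n)) (\<lambda>z. f z / (1 - z)) \<le> C1 * 2 powr (real (Suc n) * \<epsilon>) * (max 1 K * (\<Sum>k\<le>n. 2 powr (real k * \<delta>) * b f k))"
        using order_trans[OF C1(2)[OF f, of "Suc n"] mult_left_mono[OF Mq]] C1(1) unfolding qd by simp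
    qed simp
    also have "\<dots> = C2 * (2 powr (-(real n * \<gamma>) + real n * \<epsilon>) * (\<Sum>k\<le>n. 2 powr (real k * \<delta>) * b f k))"
    proof -
      have e: "2 powr (real (Suc n) * \<epsilon>) = 2 powr \<epsilon> * 2 powr (real n * \<epsilon>)"
        by (simp add: distrib_right powr_add)
      show ?thesis unfolding C2_def powr_add e by (simp only: mult_ac)
    qed
    also have "-(real n * \<gamma>) + real n * \<epsilon> = - (real n * \<delta>)" by (simp add: \<delta>_def algebra_simps)
    also have "2 powr (-(real n * \<delta>)) * (\<Sum>k\<le>n. 2 powr (real k * \<delta>) * b f k) = (\<Sum>k\<le>n. b f k * \<rho> ^ (n - k))"
      unfolding sum_distrib_left
    proof (rule sum.cong[OF refl])
      fix k assume "k \<in> {..n}"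
      then have "\<rho> ^ (n - k) = 2 powr (-(real n * \<delta>) + real k * \<delta>)"
        unfolding \<rho>_def by (simp add: powr_powr powr_realpow[symmetric] of_nat_diff algebra_simps)
      then show "2 powr (-(real n * \<delta>)) * (2 powr (real k * \<delta>) * b f k) = b f k * \<rho> ^ (n - k)"
        by (simp only: powr_add mult_ac)
    qed
    finally show ?thesis .
  qed
  have bp: "b f k powr p \<le> 2 powr p * (dseq p \<alpha> f (k+2) + (if k = 0 then norm (f 0) powr p else 0))" for f k
  proof -
    have "b f k powr p \<le> 2 powr p * ((2 powr (-(real (k+2) * (\<alpha> + 1) / p)) * Mp p (dyad (k+2)) (deriv f)) powr p + (if k = 0 then norm (f 0) else 0) powr p)"
      unfolding b_def using p by (intro powr_add_le) auto
    also have "(2 powr (-(real (k+2) * (\<alpha> + 1) / p)) * Mp p (dyad (k+2)) (deriv f)) powr p = dseq p \<alpha> f (k+2)"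
      using p by (simp add: powr_mult powr_powr dseq_def)
    also have "(if k = 0 then norm (f 0) else 0) powr p = (if k = 0 then norm (f 0) powr p else 0)" by auto
    finally show ?thesis .
  qed
  define C where "C = C2 powr p * ((1 / (1 - \<rho>)) powr p * 2 powr p)"
  have main: "summable (\<lambda>n. cesaro_seq p \<alpha> f n powr p)" "(\<Sum>n. cesaro_seq p \<alpha> f n powr p) \<le> C * dsum p \<alpha> f"
    if f: "f \<in> Dirichlet p \<alpha>" for f
  proof -
    note fH = Dirichlet_Hol[OF f]
    note s = Dirichlet_summable[OF p \<alpha>' f]
    have s1: "(\<lambda>k. if k = 0 then norm (f 0) powr p else 0) sums (norm (f 0) powr p)" by (rule sums_single)
    have s2: "summable (\<lambda>k. dseq p \<alpha> f (k+2))" using s by (simp only: summable_iff_shift)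
    have s3: "summable (\<lambda>k. 2 powr p * (dseq p \<alpha> f (k+2) + (if k = 0 then norm (f 0) powr p else 0)))"
      by (intro summable_mult summable_add s2 sums_summable[OF s1])
    have sb: "summable (\<lambda>k. b f k powr p)"
      by (rule summable_comparison_test[OF _ s3]) (use bp in auto)
    have "(\<Sum>k. b f k powr p) \<le> (\<Sum>k. 2 powr p * (dseq p \<alpha> f (k+2) + (if k = 0 then norm (f 0) powr p else 0)))"
      by (rule suminf_le[OF bp sb s3])
    also have "\<dots> = 2 powr p * ((\<Sum>k. dseq p \<alpha> f (k+2)) + norm (f 0) powr p)"
      using sums_mult[OF sums_add[OF summable_sums[OF s2] s1], of "2 powr p"] by (simp only: sums_iff)
    also have "\<dots> \<le> 2 powr p * dsum p \<alpha> f"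
      using suminf_split_initial_segment[OF s, of 2] sum_nonneg[of "{..<2}" "dseq p \<alpha> f"]
      by (intro mult_left_mono) (auto simp: dsum_def)
    finally have B: "(\<Sum>k. b f k powr p) \<le> 2 powr p * dsum p \<alpha> f" .
    note conv = geometric_convolution[OF p b0 sb \<rho>]
    have le: "cesaro_seq p \<alpha> f n powr p \<le> C2 powr p * (\<Sum>k\<le>n. b f k * \<rho> ^ (n - k)) powr p" for n
    proof -
      have "cesaro_seq p \<alpha> f n powr p \<le> (C2 * (\<Sum>k\<le>n. b f k * \<rho> ^ (n - k))) powr p"
        using p by (intro powr_mono2 key fH) auto
      then show ?thesis using C2 b0 \<rho> by (simp add: powr_mult sum_nonneg)
    qed
    note s4 = summable_mult[OF conv(1), of "C2 powr p"]
    show s5: "summable (\<lambda>n. cesaro_seq p \<alpha> f n powr p)"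
      by (rule summable_comparison_test[OF _ s4]) (use le in auto)
    have "(\<Sum>n. cesaro_seq p \<alpha> f n powr p) \<le> C2 powr p * (\<Sum>n. (\<Sum>k\<le>n. b f k * \<rho> ^ (n - k)) powr p)"
      using suminf_le[OF le s5 s4] by (simp add: suminf_mult[OF conv(1)])
    also have "\<dots> \<le> C2 powr p * ((1 / (1 - \<rho>)) powr p * (2 powr p * dsum p \<alpha> f))"
      by (intro mult_left_mono order_trans[OF conv(2)] B) auto
    finally show "(\<Sum>n. cesaro_seq p \<alpha> f n powr p) \<le> C * dsum p \<alpha> f" by (simp add: C_def mult_ac)
  qed
  have "C > 0" using C2 \<rho> by (simp add: C_def)
  with main show ?thesis using that by blast
qed

section \<open>Boundedness from the growth of F'\<close>

context
  fixes p \<alpha> :: real and \<eta> :: "nat \<Rightarrow> complex"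
  assumes p: "1 \<le> p" and \<alpha>: "p - 2 < \<alpha>" and \<eta>: "converges_in_disc \<eta>"
begin

private lemma \<alpha>': "-1 < \<alpha>" using p \<alpha> by simp

lemma Rhaly_dnorm_le:
  assumes A: "\<And>n. lip_seq p (power_series \<eta>) n \<le> A"
  obtains K where "K > 0" "\<And>f. f \<in> Dirichlet p \<alpha> \<Longrightarrow> Rhaly \<eta> f \<in> Dirichlet p \<alpha>"
    "\<And>f. f \<in> Dirichlet p \<alpha> \<Longrightarrow> dnorm p \<alpha> (Rhaly \<eta> f) \<le> K * dnorm p \<alpha> f"
proof -
  obtain C where C: "C > 0"
    "\<And>f. f \<in> Dirichlet p \<alpha> \<Longrightarrow> summable (\<lambda>n. cesaro_seq p \<alpha> f n powr p)"
    "\<And>f. f \<in> Dirichlet p \<alpha> \<Longrightarrow> (\<Sum>n. cesaro_seq p \<alpha> f n powr p) \<le> C * dsum p \<alpha> f"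
    by (rule cesaro_seq_bound[OF p \<alpha>]) (rule that)
  have A0: "0 \<le> A" using A[of 0] lip_seq_nonneg order_trans by blast
  \<comment> \<open>The summands account for the value \<open>\<eta> 0 * f 0\<close> at the origin,
    for the dyadic series, and for positivity of \<open>K\<close>.\<close>
  define K where "K = norm (\<eta> 0) powr p + (4 * A) powr p * C + 1"
  have K: "K > 0" using C by (simp add: K_def add_nonneg_pos)
  have main: "Rhaly \<eta> f \<in> Dirichlet p \<alpha>" "dsum p \<alpha> (Rhaly \<eta> f) \<le> K * dsum p \<alpha> f" "0 \<le> dsum p \<alpha> f"
    if f: "f \<in> Dirichlet p \<alpha>" for f
  proof -
    note fH = Dirichlet_Hol[OF f]
    have le: "dseq p \<alpha> (Rhaly \<eta> f) n \<le> (4 * A) powr p * cesaro_seq p \<alpha> f n powr p" for n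
    proof -
      have "dseq p \<alpha> (Rhaly \<eta> f) n \<le> (4 * lip_seq p (power_series \<eta>) (Suc n) * cesaro_seq p \<alpha> f n) powr p"
        by (rule dseq_Rhaly_le[OF \<eta> fH p])
      also have "\<dots> \<le> (4 * A * cesaro_seq p \<alpha> f n) powr p"
        using p A by (intro powr_mono2 mult_right_mono mult_left_mono) auto
      finally show ?thesis using A0 by (simp add: powr_mult)
    qed
    note s = summable_mult[OF C(2)[OF f], of "(4 * A) powr p"]
    have sR: "summable (dseq p \<alpha> (Rhaly \<eta> f))"
      by (rule summable_comparison_test[OF _ s]) (use le in auto)
    then show "Rhaly \<eta> f \<in> Dirichlet p \<alpha>"
      using Dirichlet_iff'[OF p \<alpha>'] Rhaly_Hol(1)[OF \<eta> fH] by blast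
    have "(\<Sum>n. dseq p \<alpha> (Rhaly \<eta> f) n) \<le> (4 * A) powr p * (C * dsum p \<alpha> f)"
      using suminf_le[OF le sR s] mult_left_mono[OF C(3)[OF f], of "(4 * A) powr p"]
      by (simp add: suminf_mult[OF C(2)[OF f]])
    moreover have sf: "summable (dseq p \<alpha> f)" by (rule Dirichlet_summable[OF p \<alpha>' f])
    have "norm (f 0) powr p \<le> dsum p \<alpha> f" using suminf_nonneg[OF sf] by (simp add: dsum_def)
    then have "norm (\<eta> 0) powr p * norm (f 0) powr p \<le> norm (\<eta> 0) powr p * dsum p \<alpha> f" by (rule mult_left_mono) simp
    moreover show "0 \<le> dsum p \<alpha> f" by (rule dsum_nonneg[OF sf])
    ultimately show "dsum p \<alpha> (Rhaly \<eta> f) \<le> K * dsum p \<alpha> f"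
      unfolding dsum_def[of p \<alpha> "Rhaly \<eta> f"] Rhaly_0[OF \<eta> fH] norm_mult
      by (simp add: powr_mult K_def algebra_simps)
  qed
  show ?thesis
  proof (rule that[of "K powr (1/p)"])
    fix f assume f: "f \<in> Dirichlet p \<alpha>"
    have "dsum p \<alpha> (Rhaly \<eta> f) powr (1/p) \<le> (K * dsum p \<alpha> f) powr (1/p)"
      using p main[OF f] dsum_nonneg[OF Dirichlet_summable[OF p \<alpha>' main(1)[OF f]]] by (intro powr_mono2) auto
    then show "dnorm p \<alpha> (Rhaly \<eta> f) \<le> K powr (1/p) * dnorm p \<alpha> f"
      using K main(3)[OF f] by (simp add: dnorm_def powr_mult)
  qed (use K main in auto)
qed

lemma Rhaly_linear_operator:
  assumes A: "\<And>n. lip_seq p (power_series \<eta>) n \<le> A"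
  shows "linear_operator_on (Dirichlet p \<alpha>) (Rhaly \<eta>)"
proof -
  obtain K where "K > 0" "\<And>f. f \<in> Dirichlet p \<alpha> \<Longrightarrow> Rhaly \<eta> f \<in> Dirichlet p \<alpha>"
    "\<And>f. f \<in> Dirichlet p \<alpha> \<Longrightarrow> dnorm p \<alpha> (Rhaly \<eta> f) \<le> K * dnorm p \<alpha> f"
    by (rule Rhaly_dnorm_le[OF A]) (rule that)
  then show ?thesis
    unfolding linear_operator_on_def by (auto intro!: Rhaly_add Rhaly_cmult \<eta> dest: Dirichlet_Hol)
qed

lemma Rhaly_well_defined: "Rhaly_well_defined_on \<eta> (Dirichlet p \<alpha>)"
  unfolding Rhaly_well_defined_on_def using Rhaly_converges[OF \<eta>] Dirichlet_Hol by blast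

theorem Rhaly_bounded_if_lip_seq_bounded:
  assumes A: "\<And>n. lip_seq p (power_series \<eta>) n \<le> A"
  shows "Rhaly_bounded_Dirichlet \<eta> p \<alpha>"
proof -
  obtain c C where cC: "c > 0" "C > 0"
    "\<And>f. f \<in> Dirichlet p \<alpha> \<Longrightarrow> c * dnorm p \<alpha> f \<le> Dirichlet_norm p \<alpha> f"
    "\<And>f. f \<in> Dirichlet p \<alpha> \<Longrightarrow> Dirichlet_norm p \<alpha> f \<le> C * dnorm p \<alpha> f"
    by (rule Dirichlet_norm_equiv[OF p \<alpha>']) (rule that)
  obtain K where K: "K > 0" "\<And>f. f \<in> Dirichlet p \<alpha> \<Longrightarrow> Rhaly \<eta> f \<in> Dirichlet p \<alpha>"
    "\<And>f. f \<in> Dirichlet p \<alpha> \<Longrightarrow> dnorm p \<alpha> (Rhaly \<eta> f) \<le> K * dnorm p \<alpha> f"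
    by (rule Rhaly_dnorm_le[OF A]) (rule that)
  have "Dirichlet_norm p \<alpha> (Rhaly \<eta> f) \<le> (C * K / c) * Dirichlet_norm p \<alpha> f" if f: "f \<in> Dirichlet p \<alpha>" for f
  proof -
    have "Dirichlet_norm p \<alpha> (Rhaly \<eta> f) \<le> C * dnorm p \<alpha> (Rhaly \<eta> f)" by (intro cC K f)
    also have "\<dots> \<le> C * (K * dnorm p \<alpha> f)" using cC by (intro mult_left_mono K f) auto
    also have "\<dots> = (C * K / c) * (c * dnorm p \<alpha> f)" using cC by simp
    also have "\<dots> \<le> (C * K / c) * Dirichlet_norm p \<alpha> f" using cC K by (intro mult_left_mono cC f) auto
    finally show ?thesis .
  qed
  then show ?thesis
    unfolding Rhaly_bounded_Dirichlet_def bounded_operator_on_def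
    using Rhaly_well_defined Rhaly_linear_operator[OF A] by blast
qed

end

section \<open>Normal families and compactness\<close>

lemma deriv_sup_bound:
  assumes h: "h \<in> Hol" and r: "0 \<le> r" "r < R" "R < 1" and B: "\<And>z. norm z \<le> R \<Longrightarrow> norm (h z) \<le> B" and z: "norm z \<le> r"
  shows "norm (deriv h z) \<le> B / (R - r)"
proof -
  have sub: "cball z (R - r) \<subseteq> cball 0 R"
    using z by (intro cball_subset_cball_iff[THEN iffD2]) auto
  have "norm ((deriv ^^ 1) h z) \<le> fact 1 * B / (R - r) ^ 1"
  proof (rule Cauchy_inequality)
    have "cball z (R - r) \<subseteq> ball 0 1" using sub r by (auto simp: subset_iff)
    then show "h holomorphic_on ball z (R - r)" "continuous_on (cball z (R - r)) h"
      using holomorphic_on_subset[of h "ball 0 1" "ball z (R - r)"] order_trans[OF ball_subset_cball] h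
        continuous_on_subset[OF Hol_cont[OF h]] unfolding Hol_def by blast+
    fix x assume "norm (z - x) = R - r"
    then have "x \<in> cball z (R - r)" by (simp add: dist_norm)
    then show "norm (h x) \<le> B" using sub by (intro B) auto
  qed (use r in auto)
  then show ?thesis by simp
qed

lemma Mp_le_sup:
  assumes f: "f \<in> Hol" and "p > 0" "0 \<le> r" "r < 1" "0 \<le> B" "\<And>z. norm z = r \<Longrightarrow> norm (f z) \<le> B"
  shows "Mp p r f \<le> B"
  using assms by (subst Mp_eq_Lc[OF f]) (auto intro!: Lc_le_sup Hol_cont_circle f simp: norm_mult)

text \<open>For fixed n the sequence is continuous under locally uniform convergence; no uniformity
  in n is claimed, and the compactness argument uses finitely many n.\<close>

lemma cesaro_seq_le_sup:
  assumes f: "f \<in> Hol" and B: "0 \<le> B" "\<And>z. norm z \<le> dyad (Suc n) \<Longrightarrow> norm (f z) \<le> B"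
  shows "cesaro_seq p \<alpha> f n \<le> 2 powr (-(real n * ((\<alpha> + 2) / p - 1))) * (B / (1 - dyad (Suc n)))"
  unfolding cesaro_seq_def
proof (intro mult_left_mono Mp_le_sup Hol_partial_sums f)
  fix z :: complex assume z: "norm z = dyad (Suc n)"
  have "1 - dyad (Suc n) \<le> norm (1 - z)" using norm_triangle_ineq2[of 1 z] z by simp
  then show "norm (f z / (1 - z)) \<le> B / (1 - dyad (Suc n))"
    unfolding norm_divide using B z by (intro frac_le) auto
qed (use B in \<open>auto simp: less_imp_le\<close>)

lemma dseq_le_sup:
  assumes f: "f \<in> Hol" and p: "1 \<le> p" and B: "0 \<le> B" "\<And>z. norm z \<le> dyad (Suc n) \<Longrightarrow> norm (f z) \<le> B"
  shows "dseq p \<alpha> f n \<le> 2 powr (-(real n * (\<alpha> + 1))) * (B / (1/2) ^ Suc n) powr p"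
  unfolding dseq_def
proof (intro mult_left_mono powr_mono2 Mp_le_sup Hol_deriv f)
  fix z :: complex assume z: "norm z = dyad n"
  show "norm (deriv f z) \<le> B / (1/2) ^ Suc n"
    using deriv_sup_bound[OF f _ _ _ B(2), of "dyad n" "dyad (Suc n)"] z unfolding dyad_diff by (simp add: dyad_less del: power_Suc)
qed (use p B in auto)

lemma tendsto_powr_zero_mult:
  fixes e :: "'a \<Rightarrow> real"
  assumes "(e \<longlongrightarrow> 0) F" "p > 0" "eventually (\<lambda>x. 0 \<le> e x * d) F"
  shows "((\<lambda>x. c * (e x * d) powr p) \<longlongrightarrow> 0) F"
proof -
  have "((\<lambda>x. (e x * d) powr p) \<longlongrightarrow> 0 powr p) F"
    using assms by (intro tendsto_powr' tendsto_const tendsto_mult_left_zero) auto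
  then show ?thesis using tendsto_mult_right_zero[of "\<lambda>x. (e x * d) powr p" F c] by simp
qed

text \<open>Point evaluations are bounded, so Montel's theorem applies. The limit lies in the space
  by a Fatou argument: each partial dyadic sum of g is compared with that of one member close to g
  on a large disc.\<close>

lemma Dirichlet_normal_family:
  fixes f :: "nat \<Rightarrow> complex \<Rightarrow> complex"
  assumes p: "1 \<le> p" and \<alpha>: "-1 < \<alpha>" and f: "\<And>n. f n \<in> Dirichlet p \<alpha>" and B: "\<And>n. dnorm p \<alpha> (f n) \<le> B"
  obtains g s where "g \<in> Dirichlet p \<alpha>" "strict_mono s"
    "\<And>r. r < 1 \<Longrightarrow> uniform_limit (cball 0 r) (\<lambda>n. f (s n)) g sequentially"
proof -
  have "\<exists>g s. g holomorphic_on ball 0 1 \<and> strict_mono (s :: nat \<Rightarrow> nat) \<and>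
     (\<forall>K. compact K \<longrightarrow> K \<subseteq> ball 0 1 \<longrightarrow> uniform_limit K (f \<circ> s) g sequentially)"
  proof (rule Montel[of "ball (0::complex) 1" "range f" f])
    fix K :: "complex set" assume K: "compact K" "K \<subseteq> ball 0 1"
    obtain k where k: "\<And>z. z \<in> K \<Longrightarrow> norm z \<le> dyad k"
    proof (cases "K = {}")
      case False
      then obtain x where x: "x \<in> K" "\<And>y. y \<in> K \<Longrightarrow> norm y \<le> norm x"
        using continuous_attains_sup[OF K(1), of norm] by (auto intro: continuous_intros)
      have "norm x < 1" using x K by auto
      then obtain k where "norm x < dyad (Suc k)" using dyad_interval[of "norm x"] by auto
      then show ?thesis using x by (intro that[of "Suc k"]) fastforce
    qed auto
    obtain C where C: "C > 0" "\<And>f (z::complex). f \<in> Dirichlet p \<alpha> \<Longrightarrow> norm z \<le> dyad k \<Longrightarrow> norm (f z) \<le> C * dnorm p \<alpha> f"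
      using Dirichlet_pointwise[OF p \<alpha>, of k] by blast
    have "norm (f n z) \<le> C * B" if "z \<in> K" for n z
      using order_trans[OF C(2)[OF f k[OF that], of n] mult_left_mono[OF B[of n], of C]] C(1) by simp
    then show "\<exists>B. \<forall>h\<in>range f. \<forall>z\<in>K. norm (h z) \<le> B" by auto
  next
    fix h assume "h \<in> range f"
    then show "h holomorphic_on ball 0 1" using Dirichlet_Hol[OF f] by (auto simp: Hol_def)
  qed (auto intro: exI)
  then obtain g s where g: "g holomorphic_on ball 0 1" and s: "strict_mono (s :: nat \<Rightarrow> nat)"
    and lim: "\<And>K. compact K \<Longrightarrow> K \<subseteq> ball 0 1 \<Longrightarrow> uniform_limit K (f \<circ> s) g sequentially"
    by blast
  have gH: "g \<in> Hol" using g by (simp add: Hol_def)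
  have ul: "uniform_limit (cball 0 r) (\<lambda>n. f (s n)) g sequentially" if "r < 1" for r
  proof -
    have "cball (0::complex) r \<subseteq> ball 0 1" using that by auto
    then show ?thesis using lim[of "cball 0 r"] by (simp add: o_def)
  qed
  have "summable (dseq p \<alpha> g)"
  proof (rule summableI_nonneg_bounded)
    fix N
    define c where "c k = 2 powr (-(real k * (\<alpha> + 1)))" for k :: nat
    \<comment> \<open>What a uniform error e on the disc of radius r_N can contribute to the first N
      dyadic terms, by Cauchy's estimate. It is continuous at 0, so some e > 0 keeps it below
      1.\<close>
    define t where "t e = (\<Sum>k<N. c k * (e / (1/2) ^ Suc k) powr p)" for e :: real
    have "(t \<longlongrightarrow> 0) (at_right 0)"
    proof -
      have "((\<lambda>e. \<Sum>k<N. c k * (e * (1 / (1/2) ^ Suc k)) powr p) \<longlongrightarrow> (\<Sum>k<N. 0)) (at_right 0)"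
        using p by (intro tendsto_sum tendsto_powr_zero_mult)
          (auto intro!: eventually_mono[OF eventually_at_right_less] simp: divide_simps)
      then show ?thesis by (simp add: t_def[abs_def])
    qed
    then have "eventually (\<lambda>e. t e < 1 \<and> e > 0) (at_right 0)"
      by (intro eventually_conj order_tendstoD(2)[of t 0] eventually_at_right_less) auto
    then obtain e where e: "t e < 1" "e > 0" using eventually_happens[of _ "at_right (0::real)"] by force
    have "eventually (\<lambda>n. \<forall>z\<in>cball 0 (dyad N). dist (f (s n) z) (g z) < e) sequentially"
      using ul[of "dyad N"] e unfolding uniform_limit_iff by auto
    then obtain n where n: "\<And>z. norm z \<le> dyad N \<Longrightarrow> dist (f (s n) z) (g z) < e"
      by (force simp: eventually_sequentially)
    note fn = f[of "s n"]
    have le: "dseq p \<alpha> g k \<le> 2 powr p * (dseq p \<alpha> (f (s n)) k + c k * (e / (1/2) ^ Suc k) powr p)" if k: "k < N" for k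
    proof -
      have d: "(\<lambda>z. g z - f (s n) z) \<in> Hol" by (intro Hol_diff gH Dirichlet_Hol[OF fn])
      have "dseq p \<alpha> g k = dseq p \<alpha> (\<lambda>z. f (s n) z + (g z - f (s n) z)) k" by simp
      also have "\<dots> \<le> 2 powr p * (dseq p \<alpha> (f (s n)) k + dseq p \<alpha> (\<lambda>z. g z - f (s n) z) k)"
        by (intro dseq_add_le Dirichlet_Hol[OF fn] d p)
      also have "\<dots> \<le> 2 powr p * (dseq p \<alpha> (f (s n)) k + c k * (e / (1/2) ^ Suc k) powr p)"
      proof (intro mult_left_mono add_left_mono)
        show "dseq p \<alpha> (\<lambda>z. g z - f (s n) z) k \<le> c k * (e / (1/2) ^ Suc k) powr p"
          unfolding c_def
        proof (rule dseq_le_sup[OF d p])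
          fix z :: complex assume "norm z \<le> dyad (Suc k)"
          then have "norm z \<le> dyad N" using dyad_mono[of "Suc k" N] k by simp
          from n[OF this] show "norm (g z - f (s n) z) \<le> e" by (simp add: dist_norm norm_minus_commute)
        qed (use e in auto)
      qed auto
      finally show ?thesis .
    qed
    have "(\<Sum>k<N. dseq p \<alpha> g k) \<le> (\<Sum>k<N. 2 powr p * (dseq p \<alpha> (f (s n)) k + c k * (e / (1/2) ^ Suc k) powr p))"
      using le by (intro sum_mono) auto
    also have "\<dots> = 2 powr p * ((\<Sum>k<N. dseq p \<alpha> (f (s n)) k) + t e)"
      by (simp add: t_def sum.distrib[symmetric] sum_distrib_left[symmetric])
    also have "\<dots> \<le> 2 powr p * (dsum p \<alpha> (f (s n)) + 1)"
      using e sum_le_suminf[OF Dirichlet_summable[OF p \<alpha> fn], of "{..<N}"]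
      by (intro mult_left_mono add_mono) (auto simp: dsum_def add_increasing)
    also have "dsum p \<alpha> (f (s n)) = dnorm p \<alpha> (f (s n)) powr p"
      using p dsum_nonneg[OF Dirichlet_summable[OF p \<alpha> fn]] by (simp add: dnorm_def powr_powr)
    also have "2 powr p * (dnorm p \<alpha> (f (s n)) powr p + 1) \<le> 2 powr p * (B powr p + 1)"
      using p B by (intro mult_left_mono add_mono powr_mono2) auto
    finally show "(\<Sum>k<N. dseq p \<alpha> g k) \<le> 2 powr p * (B powr p + 1)" .
  qed simp
  then have "g \<in> Dirichlet p \<alpha>" using gH by (simp add: Dirichlet_iff'[OF p \<alpha>])
  then show ?thesis using that s ul by blast
qed

text \<open>Along a locally uniformly convergent subsequence the differences from the limit are
  bounded in norm and tend to 0 locally uniformly. Finitely many dyadic terms of their images vanish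
  in the limit through \<open>cesaro_seq\<close>; all the others carry a uniformly small factor from
  \<open>lip_seq\<close>.\<close>

theorem Rhaly_compact_if_lip_seq_tendsto_0:
  assumes p: "1 \<le> p" and \<alpha>: "p - 2 < \<alpha>" and \<eta>: "converges_in_disc \<eta>"
    and l0: "lip_seq p (power_series \<eta>) \<longlonglongrightarrow> 0"
  shows "Rhaly_compact_Dirichlet \<eta> p \<alpha>"
proof -
  have \<alpha>': "-1 < \<alpha>" using p \<alpha> by simp
  obtain A where A: "\<And>n. lip_seq p (power_series \<eta>) n \<le> A"
    using convergent_imp_Bseq[of "lip_seq p (power_series \<eta>)"] l0
    by (auto simp: convergent_def Bseq_def)
  obtain c0 C0 where cC: "c0 > 0" "C0 > 0"
    "\<And>f. f \<in> Dirichlet p \<alpha> \<Longrightarrow> c0 * dnorm p \<alpha> f \<le> Dirichlet_norm p \<alpha> f"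
    "\<And>f. f \<in> Dirichlet p \<alpha> \<Longrightarrow> Dirichlet_norm p \<alpha> f \<le> C0 * dnorm p \<alpha> f"
    by (rule Dirichlet_norm_equiv[OF p \<alpha>']) (rule that)
  obtain K' where "K' > 0" and K: "\<And>f. f \<in> Dirichlet p \<alpha> \<Longrightarrow> Rhaly \<eta> f \<in> Dirichlet p \<alpha>"
    and "\<And>f. f \<in> Dirichlet p \<alpha> \<Longrightarrow> dnorm p \<alpha> (Rhaly \<eta> f) \<le> K' * dnorm p \<alpha> f"
    by (rule Rhaly_dnorm_le[OF p \<alpha> \<eta> A]) (rule that)
  obtain C where C: "C > 0"
    "\<And>f. f \<in> Dirichlet p \<alpha> \<Longrightarrow> summable (\<lambda>n. cesaro_seq p \<alpha> f n powr p)"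
    "\<And>f. f \<in> Dirichlet p \<alpha> \<Longrightarrow> (\<Sum>n. cesaro_seq p \<alpha> f n powr p) \<le> C * dsum p \<alpha> f"
    by (rule cesaro_seq_bound[OF p \<alpha>]) (rule that)
  have "\<exists>g\<in>Dirichlet p \<alpha>. \<exists>s. strict_mono s \<and> (\<lambda>n. Dirichlet_norm p \<alpha> (\<lambda>z. Rhaly \<eta> (f (s n)) z - g z)) \<longlonglongrightarrow> 0"
    if f: "\<And>n. f n \<in> Dirichlet p \<alpha>" and B: "\<And>n. Dirichlet_norm p \<alpha> (f n) \<le> B" for f :: "nat \<Rightarrow> complex \<Rightarrow> complex" and B
  proof -
    have B': "dnorm p \<alpha> (f n) \<le> B / c0" for n
      using order_trans[OF cC(3)[OF f] B, of n] cC(1) by (simp add: field_simps)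
    obtain g s where g: "g \<in> Dirichlet p \<alpha>" and s: "strict_mono s"
      and ul: "\<And>r. r < 1 \<Longrightarrow> uniform_limit (cball 0 r) (\<lambda>n. f (s n)) g sequentially"
      by (rule Dirichlet_normal_family[OF p \<alpha>' f B']) (rule that)
    define h where "h j = (\<lambda>z. f (s j) z - g z)" for j
    have h: "h j \<in> Dirichlet p \<alpha>" for j unfolding h_def by (intro Dirichlet_diff p \<alpha>' f g)
    note hH = Dirichlet_Hol[OF h]
    define D where "D = 4 * (B / c0 + dnorm p \<alpha> g)"
    have hD: "dnorm p \<alpha> (h j) \<le> D" for j
      unfolding h_def D_def using dnorm_diff[OF p \<alpha>' f g, of "s j"] B'[of "s j"] by simp
    have hs: "dsum p \<alpha> (h j) \<le> D powr p" for j
    proof -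
      have "dsum p \<alpha> (h j) = dnorm p \<alpha> (h j) powr p"
        using p dsum_nonneg[OF Dirichlet_summable[OF p \<alpha>' h]] by (simp add: dnorm_def powr_powr)
      also have "\<dots> \<le> D powr p" using p hD by (intro powr_mono2) auto
      finally show ?thesis .
    qed
    have small: "eventually (\<lambda>j. \<forall>z. norm z \<le> dyad n \<longrightarrow> norm (h j z) \<le> e) sequentially" if "e > 0" for e n
    proof -
      have "eventually (\<lambda>j. \<forall>z\<in>cball 0 (dyad n). dist (f (s j) z) (g z) < e) sequentially"
        using ul[of "dyad n"] that unfolding uniform_limit_iff by auto
      then show ?thesis by eventually_elim (auto simp: h_def dist_norm less_imp_le)
    qed
    have t1: "(\<lambda>j. cesaro_seq p \<alpha> (h j) n) \<longlonglongrightarrow> 0" for n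
    proof (rule LIMSEQ_I)
      fix e :: real assume e: "e > 0"
      define k where "k = 2 powr (-(real n * ((\<alpha> + 2) / p - 1))) / (1 - dyad (Suc n))"
      have k: "k > 0" by (simp add: k_def)
      have "e / (2 * k) > 0" using e k by simp
      from small[OF this, of "Suc n"] have "eventually (\<lambda>j. norm (cesaro_seq p \<alpha> (h j) n - 0) < e) sequentially"
      proof eventually_elim
        case (elim j)
        have "cesaro_seq p \<alpha> (h j) n \<le> 2 powr (-(real n * ((\<alpha> + 2) / p - 1))) * ((e / (2 * k)) / (1 - dyad (Suc n)))"
          using e k elim by (intro cesaro_seq_le_sup hH) auto
        also have "\<dots> = k * (e / (2 * k))" by (simp add: k_def)
        also have "\<dots> < e" using e k by simp
        finally show ?case by simp
      qed
      then show "\<exists>no. \<forall>j\<ge>no. norm (cesaro_seq p \<alpha> (h j) n - 0) < e" by (simp add: eventually_sequentially)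
    qed
    have t0: "(\<lambda>j. h j 0) \<longlonglongrightarrow> 0"
    proof (rule LIMSEQ_I)
      fix e :: real assume e: "e > 0"
      then have "eventually (\<lambda>j. norm (h j 0 - 0) < e) sequentially"
        using small[of "e/2" 0] by (auto elim!: eventually_mono)
      then show "\<exists>no. \<forall>j\<ge>no. norm (h j 0 - 0) < e" by (simp add: eventually_sequentially)
    qed
    define \<phi> where "\<phi> n = lip_seq p (power_series \<eta>) (Suc n)" for n
    have \<phi>0: "0 \<le> \<phi> n" for n by (simp add: \<phi>_def)
    have \<phi>l: "\<phi> \<longlonglongrightarrow> 0" unfolding \<phi>_def by (rule LIMSEQ_Suc[OF l0])
    have le: "dseq p \<alpha> (Rhaly \<eta> (h j)) n \<le> (4 * \<phi> n) powr p * cesaro_seq p \<alpha> (h j) n powr p" for j n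
      using dseq_Rhaly_le[OF \<eta> hH p, of \<alpha> j n] \<phi>0[of n] by (simp add: \<phi>_def powr_mult)
    have sR: "summable (dseq p \<alpha> (Rhaly \<eta> (h j)))" for j by (intro Dirichlet_summable p \<alpha>' K h)
    have lim: "(\<lambda>j. dsum p \<alpha> (Rhaly \<eta> (h j))) \<longlonglongrightarrow> 0"
    proof (rule LIMSEQ_I)
      fix e :: real assume e: "e > 0"
      \<comment> \<open>A bound, valid for all j, for the full sum of the p-th powers of
        \<open>cesaro_seq\<close> at \<open>h j\<close>. Beyond N the factor e / (2 (M + 1)) keeps
        the tail below e / 2.\<close>
      define M where "M = C * D powr p"
      have M: "M \<ge> 0" using C by (simp add: M_def)
      have "(\<lambda>n. 1 * (\<phi> n * 4) powr p) \<longlonglongrightarrow> 0" using p \<phi>0 by (intro tendsto_powr_zero_mult \<phi>l) auto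
      then have "eventually (\<lambda>n. 1 * (\<phi> n * 4) powr p < e / (2 * (M + 1))) sequentially"
        by (rule order_tendstoD(2)) (use e M in auto)
      then obtain N where N: "\<And>n. n \<ge> N \<Longrightarrow> (4 * \<phi> n) powr p < e / (2 * (M + 1))"
        by (auto simp: eventually_sequentially mult.commute)
      have "(\<lambda>j. norm (\<eta> 0 * h j 0) powr p + (\<Sum>n<N. (4 * \<phi> n) powr p * (cesaro_seq p \<alpha> (h j) n * 1) powr p)) \<longlonglongrightarrow> norm (\<eta> 0 * 0) powr p + (\<Sum>n<N. 0)"
        using p by (intro tendsto_add tendsto_sum tendsto_powr_zero_mult t1 tendsto_powr' tendsto_norm tendsto_mult tendsto_const t0) auto
      then have "(\<lambda>j. norm (\<eta> 0 * h j 0) powr p + (\<Sum>n<N. (4 * \<phi> n) powr p * cesaro_seq p \<alpha> (h j) n powr p)) \<longlonglongrightarrow> 0"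
        using p by simp
      then have "eventually (\<lambda>j. norm (\<eta> 0 * h j 0) powr p + (\<Sum>n<N. (4 * \<phi> n) powr p * cesaro_seq p \<alpha> (h j) n powr p) < e/2) sequentially"
        by (rule order_tendstoD(2)) (use e in auto)
      then have "eventually (\<lambda>j. norm (dsum p \<alpha> (Rhaly \<eta> (h j)) - 0) < e) sequentially"
      proof eventually_elim
        case (elim j)
        have "(\<Sum>n. dseq p \<alpha> (Rhaly \<eta> (h j)) (n + N)) \<le> (\<Sum>n. e / (2 * (M + 1)) * cesaro_seq p \<alpha> (h j) (n + N) powr p)"
        proof (rule suminf_le)
          fix n
          show "dseq p \<alpha> (Rhaly \<eta> (h j)) (n + N) \<le> e / (2 * (M + 1)) * cesaro_seq p \<alpha> (h j) (n + N) powr p"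
            using N[of "n + N"] by (intro order_trans[OF le] mult_right_mono) auto
        next
          show "summable (\<lambda>n. dseq p \<alpha> (Rhaly \<eta> (h j)) (n + N))" using sR by (simp only: summable_iff_shift)
          show "summable (\<lambda>n. e / (2 * (M + 1)) * cesaro_seq p \<alpha> (h j) (n + N) powr p)"
            by (intro summable_mult) (subst summable_iff_shift, rule C(2)[OF h])
        qed
        also have "\<dots> = e / (2 * (M + 1)) * (\<Sum>n. cesaro_seq p \<alpha> (h j) (n + N) powr p)"
          by (intro suminf_mult) (subst summable_iff_shift, rule C(2)[OF h])
        also have "\<dots> \<le> e / (2 * (M + 1)) * M"
        proof (rule mult_left_mono)
          have "(\<Sum>n. cesaro_seq p \<alpha> (h j) (n + N) powr p) \<le> (\<Sum>n. cesaro_seq p \<alpha> (h j) n powr p)"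
            using suminf_split_initial_segment[OF C(2)[OF h], of j N] sum_nonneg[of "{..<N}" "\<lambda>n. cesaro_seq p \<alpha> (h j) n powr p"] by simp
          also have "\<dots> \<le> C * dsum p \<alpha> (h j)" by (rule C(3)[OF h])
          also have "\<dots> \<le> M" unfolding M_def using C by (intro mult_left_mono hs) auto
          finally show "(\<Sum>n. cesaro_seq p \<alpha> (h j) (n + N) powr p) \<le> M" .
        qed (use e M in auto)
        also have "\<dots> \<le> e / 2" using e M by (simp add: field_simps)
        finally have tail: "(\<Sum>n. dseq p \<alpha> (Rhaly \<eta> (h j)) (n + N)) \<le> e / 2" .
        have "dsum p \<alpha> (Rhaly \<eta> (h j)) = norm (\<eta> 0 * h j 0) powr p + (\<Sum>n<N. dseq p \<alpha> (Rhaly \<eta> (h j)) n) + (\<Sum>n. dseq p \<alpha> (Rhaly \<eta> (h j)) (n + N))"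
          unfolding dsum_def Rhaly_0[OF \<eta> hH] using suminf_split_initial_segment[OF sR, of j N] by simp
        also have "\<dots> \<le> norm (\<eta> 0 * h j 0) powr p + (\<Sum>n<N. (4 * \<phi> n) powr p * cesaro_seq p \<alpha> (h j) n powr p) + e / 2"
          by (intro add_mono sum_mono le tail order_refl)
        also have "\<dots> < e" using elim by simp
        finally show ?case using dsum_nonneg[OF sR[of j]] by simp
      qed
      then show "\<exists>no. \<forall>j\<ge>no. norm (dsum p \<alpha> (Rhaly \<eta> (h j)) - 0) < e" by (simp add: eventually_sequentially)
    qed
    have lim2: "(\<lambda>j. dnorm p \<alpha> (Rhaly \<eta> (h j))) \<longlonglongrightarrow> 0"
      unfolding dnorm_def using tendsto_powr'[OF lim tendsto_const[of "1/p"]] p dsum_nonneg[OF sR] by simp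
    have Rg: "Rhaly \<eta> g \<in> Dirichlet p \<alpha>" by (rule K[OF g])
    have "Dirichlet_norm p \<alpha> (\<lambda>z. Rhaly \<eta> (f (s j)) z - Rhaly \<eta> g z) \<le> C0 * dnorm p \<alpha> (Rhaly \<eta> (h j))" for j
    proof -
      have "dnorm p \<alpha> (\<lambda>z. Rhaly \<eta> (f (s j)) z - Rhaly \<eta> g z) = dnorm p \<alpha> (Rhaly \<eta> (h j))"
        unfolding h_def by (rule dnorm_cong) (simp add: Rhaly_diff[OF \<eta> Dirichlet_Hol[OF f] Dirichlet_Hol[OF g]])
      then show ?thesis using cC(4)[OF Dirichlet_diff[OF p \<alpha>' K[OF f] Rg], of "s j"] by simp
    qed
    then have "norm (Dirichlet_norm p \<alpha> (\<lambda>z. Rhaly \<eta> (f (s j)) z - Rhaly \<eta> g z)) \<le> C0 * dnorm p \<alpha> (Rhaly \<eta> (h j))" for j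
      by (simp add: Dirichlet_norm_def)
    then have "(\<lambda>j. Dirichlet_norm p \<alpha> (\<lambda>z. Rhaly \<eta> (f (s j)) z - Rhaly \<eta> g z)) \<longlonglongrightarrow> 0"
      by (intro Lim_null_comparison[OF always_eventually tendsto_mult_right_zero[OF lim2]] allI)
    then show ?thesis using Rg s by blast
  qed
  then have "compact_operator_on (Dirichlet p \<alpha>) (Dirichlet_norm p \<alpha>) (Rhaly \<eta>)"
    unfolding compact_operator_on_def using Rhaly_linear_operator[OF p \<alpha> \<eta> A] by blast
  then show ?thesis unfolding Rhaly_compact_Dirichlet_def using Rhaly_well_defined[OF p \<alpha> \<eta>] by blast
qed

section \<open>Boundary values\<close>

lemma norm_one_minus_cnj_mult:
  "(norm (1 - cnj a * z))\<^sup>2 - (norm (z - a))\<^sup>2 = (1 - (norm z)\<^sup>2) * (1 - (norm a)\<^sup>2)"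
  unfolding cmod_power2 by (simp add: power2_eq_square algebra_simps)

text \<open>Replacing each root \<open>a\<close> in the open disc by its reflection \<open>1 / cnj a\<close>
  leaves the modulus on the unit circle unchanged, like the division by a Blaschke product.\<close>

lemma poly_reflect_roots:
  fixes q :: "complex poly"
  assumes "q \<noteq> 0"
  shows "\<exists>K. (\<forall>z. norm z < 1 \<longrightarrow> poly K z \<noteq> 0) \<and> (\<forall>z. norm z = 1 \<longrightarrow> norm (poly K z) = norm (poly q z)) \<and>
     (\<forall>z. norm z \<le> 1 \<longrightarrow> norm (poly q z) \<le> norm (poly K z))"
  using assms
proof (induction "degree q" arbitrary: q)
  case 0
  then obtain c where "q = [:c:]" by (metis degree_eq_zeroE)
  with 0 show ?case by (intro exI[of _ q]) auto
next
  case (Suc n)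
  then have "\<not> constant (poly q)" by (subst constant_degree) auto
  then obtain a where "poly q a = 0" using fundamental_theorem_of_algebra by blast
  then obtain q' where q': "q = [:- a, 1:] * q'" by (auto simp: poly_eq_0_iff_dvd elim: dvdE)
  with Suc.prems have nz: "q' \<noteq> 0" by auto
  have "degree q = 1 + degree q'" unfolding q' using nz by (subst degree_mult_eq) auto
  then have "n = degree q'" using Suc(2) by simp
  from Suc.hyps(1)[OF this nz] obtain K where K: "\<And>z. norm z < 1 \<Longrightarrow> poly K z \<noteq> 0"
    "\<And>z. norm z = 1 \<Longrightarrow> norm (poly K z) = norm (poly q' z)" "\<And>z. norm z \<le> 1 \<Longrightarrow> norm (poly q' z) \<le> norm (poly K z)"
    by blast
  have eq_q: "poly q z = (z - a) * poly q' z" for z by (simp add: q' algebra_simps)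
  show ?case
  proof (cases "norm a < 1")
    case True
    have ge: "norm (z - a) \<le> norm (1 - cnj a * z)" if "norm z \<le> 1" for z
    proof -
      have "0 \<le> (1 - (norm z)\<^sup>2) * (1 - (norm a)\<^sup>2)"
        using True that by (intro mult_nonneg_nonneg) (auto simp: power_le_one)
      then have "(norm (z - a))\<^sup>2 \<le> (norm (1 - cnj a * z))\<^sup>2" using norm_one_minus_cnj_mult[of a z] by linarith
      then show ?thesis by (rule power2_le_imp_le) simp
    qed
    have eq: "norm (1 - cnj a * z) = norm (z - a)" if "norm z = 1" for z
    proof -
      have "(norm (1 - cnj a * z))\<^sup>2 = (norm (z - a))\<^sup>2" using norm_one_minus_cnj_mult[of a z] that by simp
      then show ?thesis by (simp add: power2_eq_iff_nonneg)
    qed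
    have ne: "1 - cnj a * z \<noteq> 0" if "norm z < 1" for z
    proof
      assume "1 - cnj a * z = 0"
      then have "norm (cnj a * z) = 1" by (metis eq_iff_diff_eq_0 norm_one)
      moreover have "norm (cnj a * z) < 1 * 1" unfolding norm_mult using True that by (intro mult_strict_mono') auto
      ultimately show False by simp
    qed
    have e: "poly ([:1, - cnj a:] * K) z = (1 - cnj a * z) * poly K z" for z by (simp add: algebra_simps)
    show ?thesis
      by (rule exI[of _ "[:1, - cnj a:] * K"], unfold e eq_q)
         (use K ge eq ne in \<open>auto simp: norm_mult intro!: mult_mono simp del: right_minus_eq\<close>)
  next
    case False
    have ne: "z - a \<noteq> 0" if "norm z < 1" for z using False that by auto
    have e: "poly ([:- a, 1:] * K) z = (z - a) * poly K z" for z by (simp add: algebra_simps)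
    show ?thesis
      by (rule exI[of _ "[:- a, 1:] * K"], unfold e eq_q)
         (use K ne in \<open>auto simp: norm_mult intro!: mult_left_mono simp del: right_minus_eq\<close>)
  qed
qed

lemma norm_mult_mono_real:
  fixes a b :: real
  shows "0 \<le> a \<Longrightarrow> a \<le> A \<Longrightarrow> 0 \<le> b \<Longrightarrow> b \<le> B \<Longrightarrow> norm (a * b) \<le> A * B"
  by (simp add: abs_mult mult_mono)

lemma cont_poly_circle: "continuous_on S (\<lambda>t. poly q (c * cis t))"
  by (intro continuous_intros)

lemma dominated_convergence_bounded:
  fixes f :: "real \<Rightarrow> real"
  assumes "\<And>n. s n \<in> borel_measurable borel" "f \<in> borel_measurable borel"
    "AE t in circ. (\<lambda>n. s n t) \<longlonglongrightarrow> f t" "\<And>n t. norm (s n t) \<le> B"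
  shows "(\<lambda>n. \<integral>t. s n t \<partial>circ) \<longlonglongrightarrow> (\<integral>t. f t \<partial>circ)"
  using assms by (intro integral_dominated_convergence[where w = "\<lambda>_. B"]) auto

text \<open>The reflected polynomial K has no zeros in the disc, hence an analytic square root
  there, to which the Poisson formula on smaller circles applies; dominated convergence reaches the
  unit circle. Since K dominates q inside and has the same modulus on the boundary, the inequality
  passes to q.\<close>

lemma poly_sqrt_Poisson:
  fixes q :: "complex poly"
  assumes w: "norm w < 1"
  shows "sqrt (norm (poly q w)) \<le> (\<integral>t. sqrt (norm (poly q (cis t))) * poisson w t \<partial>circ)"
proof (cases "q = 0")
  case False
  obtain K where K: "\<And>z. norm z < 1 \<Longrightarrow> poly K z \<noteq> 0"
    "\<And>z. norm z = 1 \<Longrightarrow> norm (poly K z) = norm (poly q z)" "\<And>z. norm z \<le> 1 \<Longrightarrow> norm (poly q z) \<le> norm (poly K z)"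
    using poly_reflect_roots[OF False] by blast
  have "(\<lambda>z. poly K z) holomorphic_on ball 0 1" by (intro holomorphic_intros)
  moreover have "contractible (ball (0::complex) 1)" by (intro convex_imp_contractible) auto
  ultimately obtain k where k: "k holomorphic_on ball 0 1" "\<And>z. z \<in> ball 0 1 \<Longrightarrow> poly K z = (k z)\<^sup>2"
    using contractible_imp_holomorphic_sqrt[of "poly K" "ball 0 1"] K(1) by (metis mem_ball_0)
  have kH: "k \<in> Hol" using k by (simp add: Hol_def)
  have nk: "norm (k z) = sqrt (norm (poly K z))" if "norm z < 1" for z
    using k(2)[of z] that by (simp add: norm_power)
  have le: "sqrt (norm (poly K (of_real (dyad n) * w))) \<le> (\<integral>t. sqrt (norm (poly K (of_real (dyad n) * cis t))) * poisson w t \<partial>circ)" for n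
  proof -
    have "norm (of_real (dyad n) * w) < 1" using w by (simp add: norm_mult mult_strict_mono'[of "dyad n" 1 "norm w" 1, simplified])
    then show ?thesis
      using Hol_Poisson_norm[OF kH dyad_bounds w, of n 0] by (simp add: nk norm_mult)
  qed
  have "compact (poly K ` cball 0 1)" by (intro compact_continuous_image continuous_intros) auto
  then obtain B where B: "\<And>z. norm z \<le> 1 \<Longrightarrow> norm (poly K z) \<le> B"
    by (metis bounded_iff compact_imp_bounded imageI mem_cball_0)
  have [measurable]: "(\<lambda>t. poly K (c * cis t)) \<in> borel_measurable borel" for c
    by (intro borel_measurable_continuous_onI cont_poly_circle)
  have [measurable]: "(\<lambda>t. poly K (cis t)) \<in> borel_measurable borel"
    by (intro borel_measurable_continuous_onI continuous_intros)
  have [measurable]: "poisson w \<in> borel_measurable borel"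
    by (intro borel_measurable_continuous_onI cont_poisson w)
  have lim: "(\<lambda>n. \<integral>t. sqrt (norm (poly K (of_real (dyad n) * cis t))) * poisson w t \<partial>circ) \<longlonglongrightarrow> (\<integral>t. sqrt (norm (poly K (of_real 1 * cis t))) * poisson w t \<partial>circ)"
  proof (rule dominated_convergence_bounded[where B = "sqrt B * (2 / (1 - norm w))"])
    show "AE t in circ. (\<lambda>n. sqrt (norm (poly K (of_real (dyad n) * cis t))) * poisson w t) \<longlonglongrightarrow> sqrt (norm (poly K (of_real 1 * cis t))) * poisson w t"
      by (intro AE_I2 tendsto_intros dyad_tendsto)
    fix n t
    have "norm (of_real (dyad n) * cis t) \<le> 1" by (simp add: norm_mult less_imp_le)
    from B[OF this] show "norm (sqrt (norm (poly K (of_real (dyad n) * cis t))) * poisson w t) \<le> sqrt B * (2 / (1 - norm w))"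
      by (intro norm_mult_mono_real poisson_nonneg[OF w] poisson_le[OF w]) auto
  qed auto
  have "(\<lambda>n. sqrt (norm (poly K (of_real (dyad n) * w)))) \<longlonglongrightarrow> sqrt (norm (poly K (of_real 1 * w)))"
    by (intro tendsto_intros dyad_tendsto)
  from LIMSEQ_le[OF this lim] le have "sqrt (norm (poly K w)) \<le> (\<integral>t. sqrt (norm (poly K (cis t))) * poisson w t \<partial>circ)"
    by auto
  moreover have "sqrt (norm (poly q w)) \<le> sqrt (norm (poly K w))" using K(3)[of w] w by simp
  ultimately show ?thesis unfolding K(2)[OF norm_cis] by (rule order_trans[rotated])
qed simp

text \<open>On the closed unit disc the Taylor polynomials of z \<mapsto> f(R z) converge and are
  bounded by the sum of the moduli of their coefficients, so the polynomial inequality passes to the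
  limit by dominated convergence.\<close>

lemma Hol_sqrt_Poisson:
  assumes f: "f \<in> Hol" "0 \<le> R" "R < 1" and w: "norm w < 1"
  shows "sqrt (norm (f (of_real R * w))) \<le> (\<integral>t. sqrt (norm (f (of_real R * cis t))) * poisson w t \<partial>circ)"
proof -
  define a where "a n = taylor_coeff f n * of_real R ^ n" for n
  define q where "q N = (\<Sum>n<N. monom (a n) n)" for N
  have a: "summable (\<lambda>n. norm (a n))" unfolding a_def by (rule Hol_circle_summable[OF f])
  have pq: "poly (q N) z = (\<Sum>n<N. a n * z ^ n)" for N z by (simp add: q_def poly_sum poly_monom)
  have lim: "(\<lambda>N. poly (q N) z) \<longlonglongrightarrow> f (of_real R * z)" if "norm z \<le> 1" for z
  proof -
    have "norm (of_real R * z) < 1"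
      using f that mult_left_mono[OF that f(2)] by (simp add: norm_mult)
    from Hol_sums[OF f(1) this] show ?thesis unfolding pq by (simp add: sums_def a_def power_mult_distrib mult.assoc)
  qed
  have B: "norm (poly (q N) z) \<le> (\<Sum>n. norm (a n))" if "norm z \<le> 1" for N z
  proof -
    have "norm (poly (q N) z) \<le> (\<Sum>n<N. norm (a n) * 1)" unfolding pq
      using that by (intro order_trans[OF norm_sum] sum_mono) (auto simp: norm_mult norm_power intro!: mult_left_le power_le_one)
    also have "\<dots> \<le> (\<Sum>n. norm (a n))" using a by (simp add: sum_le_suminf)
    finally show ?thesis .
  qed
  have [measurable]: "(\<lambda>t. poly (q N) (cis t)) \<in> borel_measurable borel" for N
    by (intro borel_measurable_continuous_onI continuous_intros)
  have [measurable]: "(\<lambda>t. f (of_real R * cis t)) \<in> borel_measurable borel"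
    by (intro borel_measurable_continuous_onI Hol_cont_circle f)
  have [measurable]: "poisson w \<in> borel_measurable borel"
    by (intro borel_measurable_continuous_onI cont_poisson w)
  have "(\<lambda>N. \<integral>t. sqrt (norm (poly (q N) (cis t))) * poisson w t \<partial>circ) \<longlonglongrightarrow> (\<integral>t. sqrt (norm (f (of_real R * cis t))) * poisson w t \<partial>circ)"
  proof (rule dominated_convergence_bounded[where B = "sqrt (\<Sum>n. norm (a n)) * (2 / (1 - norm w))"])
    show "AE t in circ. (\<lambda>N. sqrt (norm (poly (q N) (cis t))) * poisson w t) \<longlonglongrightarrow> sqrt (norm (f (of_real R * cis t))) * poisson w t"
      by (intro AE_I2 tendsto_intros lim) simp
    show "norm (sqrt (norm (poly (q N) (cis t))) * poisson w t) \<le> sqrt (\<Sum>n. norm (a n)) * (2 / (1 - norm w))" for N t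
      using B[of "cis t" N] by (intro norm_mult_mono_real poisson_nonneg[OF w] poisson_le[OF w]) auto
  qed auto
  moreover have "(\<lambda>N. sqrt (norm (poly (q N) w))) \<longlonglongrightarrow> sqrt (norm (f (of_real R * w)))"
    using w by (intro tendsto_intros lim) auto
  ultimately show ?thesis using poly_sqrt_Poisson[OF w] by (intro LIMSEQ_le) auto
qed

lemma AE_lborel_shift:
  assumes "AE x in lborel. P x"
  shows "AE x in lborel. P (x + (c::real))"
proof -
  obtain N where N: "{x. \<not> P x} \<subseteq> N" "N \<in> null_sets lborel"
    using assms by (auto simp: eventually_ae_filter)
  have "AE x in lborel. x \<notin> N" using N(2) by (rule AE_not_in)
  then have "AE x in lborel. c + 1 * x \<notin> N"
    using N by (intro AE_borel_affine) auto
  then show ?thesis by eventually_elim (use N in \<open>auto simp: add.commute\<close>)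
qed

lemma Lc1_le:
  assumes p: "1 \<le> p" and g: "continuous_on UNIV g"
  shows "(\<integral>t. norm (g t) \<partial>circ) \<le> Lc p g"
proof -
  have "(\<integral>t. norm (g t) * 1 \<partial>circ) powr p \<le> (\<integral>t. 1 \<partial>circ) powr (p - 1) * (\<integral>t. norm (g t) powr p * 1 \<partial>circ)"
    using p by (intro weighted_jensen_powr)
      (auto intro!: integrable_circ_cont[of "\<lambda>t. norm (g t)"] integrable_circ_cont[of "\<lambda>_. 1::real"] integrable_norm_powr g continuous_on_norm)
  then have "((\<integral>t. norm (g t) \<partial>circ) powr p) powr (1/p) \<le> (\<integral>t. norm (g t) powr p \<partial>circ) powr (1/p)"
    using p by (intro powr_mono2) auto
  then show ?thesis using p by (simp add: powr_powr Lc_def integral_nonneg)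
qed

section \<open>Means inside the disc bounded by boundary values\<close>

text \<open>Limits and bounds are asked for along dyadic radii only, and g is any measurable
  periodic representative of the boundary function. This lets g be an increment of boundary values
  and f the corresponding difference of rotations.\<close>

locale radial_limit =
  fixes f :: "complex \<Rightarrow> complex" and g :: "real \<Rightarrow> complex" and p M :: real
  assumes f: "f \<in> Hol" and g_meas [measurable]: "g \<in> borel_measurable borel" and g_per: "\<And>t. g (t + 2*pi) = g t"
    and lim: "AE t in lborel. (\<lambda>n. f (of_real (dyad n) * cis t)) \<longlonglongrightarrow> g t"
    and p: "1 \<le> p" and M: "\<And>n. Mp p (dyad n) f \<le> M"
begin

lemma f_meas [measurable]: "(\<lambda>t. f (of_real (dyad n) * cis t)) \<in> borel_measurable borel"
  by (intro borel_measurable_continuous_onI Hol_cont_circle f) auto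

text \<open>Fatou's lemma along the dyadic circles.\<close>

lemma nn_integral_g_le: "(\<integral>\<^sup>+t. ennreal (norm (g t) powr p) \<partial>circ) \<le> ennreal (M powr p)"
proof -
  have "(\<integral>\<^sup>+t. ennreal (norm (g t) powr p) \<partial>circ) = (\<integral>\<^sup>+t. liminf (\<lambda>n. ennreal (norm (f (of_real (dyad n) * cis t)) powr p)) \<partial>circ)"
  proof (rule nn_integral_cong_AE)
    show "AE t in circ. ennreal (norm (g t) powr p) = liminf (\<lambda>n. ennreal (norm (f (of_real (dyad n) * cis t)) powr p))"
      using AE_circ_lborel[OF lim]
    proof eventually_elim
      case (elim t)
      have "(\<lambda>n. ennreal (norm (f (of_real (dyad n) * cis t)) powr p)) \<longlonglongrightarrow> ennreal (norm (g t) powr p)"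
        using p by (intro tendsto_ennrealI tendsto_powr' tendsto_norm elim tendsto_const) auto
      then show ?case by (intro lim_imp_Liminf[symmetric]) auto
    qed
  qed
  also have "\<dots> \<le> liminf (\<lambda>n. \<integral>\<^sup>+t. ennreal (norm (f (of_real (dyad n) * cis t)) powr p) \<partial>circ)"
    by (rule nn_integral_liminf) measurable
  also have "\<dots> \<le> liminf (\<lambda>n. ennreal (M powr p))"
  proof (intro Liminf_mono always_eventually allI)
    fix n
    have "(\<integral>\<^sup>+t. ennreal (norm (f (of_real (dyad n) * cis t)) powr p) \<partial>circ) = ennreal (Mp p (dyad n) f powr p)"
      using p f by (subst nn_integral_eq_integral) (auto simp: Mp_eq_Lc Lc_powr intro!: integrable_norm_powr Hol_cont_circle)
    also have "\<dots> \<le> ennreal (M powr p)" using p M by (intro ennreal_leI powr_mono2) auto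
    finally show "(\<integral>\<^sup>+t. ennreal (norm (f (of_real (dyad n) * cis t)) powr p) \<partial>circ) \<le> ennreal (M powr p)" .
  qed
  finally show ?thesis by (simp add: Liminf_const)
qed

lemma integrable_g: "integrable circ (\<lambda>t. norm (g t) powr p)"
  using nn_integral_g_le by (intro integrableI_bounded) (auto intro: le_less_trans)

lemma M_nonneg: "0 \<le> M"
  using M[of 0] Mp_nonneg order_trans by blast

lemma Lc_g_le: "Lc p g \<le> M"
proof -
  have "ennreal (\<integral>x. norm (g x) powr p \<partial>circ) \<le> ennreal (M powr p)"
    using nn_integral_g_le by (subst nn_integral_eq_integral[symmetric]) (auto intro: integrable_g)
  then have "(\<integral>x. norm (g x) powr p \<partial>circ) \<le> M powr p" by simp
  then show ?thesis using p M_nonneg by (subst Lc_le_iff) auto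
qed

text \<open>A bound in the mean of order one does not make the functions \<open>|f|\<close> on the circles uniformly integrable,
  but it does so for their square roots, whose Poisson integrals therefore converge to that of the boundary function.\<close>

lemma truncated_Poisson:
  assumes \<rho>: "0 \<le> \<rho>" "\<rho> < 1" and l: "l > 0"
  shows "sqrt (norm (f (of_real \<rho> * cis \<theta>))) \<le>
    (\<integral>t. min (sqrt (norm (g (\<theta> + t)))) l * poisson (of_real \<rho>) t \<partial>circ) + 2 / (1 - \<rho>) * M / l"
proof -
  define w where "w = complex_of_real \<rho>"
  have w: "norm w < 1" "norm w = \<rho>" using \<rho> by (auto simp: w_def)
  define u where "u n t = sqrt (norm (f (of_real (dyad n) * cis (\<theta> + t))))" for n t
  have cu: "continuous_on UNIV (u n)" for n
    unfolding u_def using f by (intro continuous_on_real_sqrt continuous_on_norm cont_circle_sum) auto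
  have [measurable]: "u n \<in> borel_measurable borel" for n using cu by (rule borel_measurable_continuous_onI)
  have [measurable]: "poisson w \<in> borel_measurable borel"
    by (intro borel_measurable_continuous_onI cont_poisson w)
  note P0 = poisson_nonneg[OF w(1)] and P1 = poisson_le[OF w(1), unfolded w(2)]
  have cP: "continuous_on UNIV (poisson w)" by (rule cont_poisson[OF w(1)])
  have u0: "0 \<le> u n t" for n t by (simp add: u_def)
  \<comment> \<open>Where u exceeds the level l it is at most u^2 / l, and u^2 = |f| has mean at
    most M. The error is therefore of order 1 / l, uniformly in n, while the truncated part is
    bounded and admits dominated convergence.\<close>
  have step: "sqrt (norm (f (of_real (dyad n) * w * cis \<theta>))) \<le> (\<integral>t. min (u n t) l * poisson w t \<partial>circ) + 2 / (1 - \<rho>) * M / l" for n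
  proof -
    have fr: "(\<lambda>z. f (cis \<theta> * z)) \<in> Hol" by (rule Hol_rotate[OF f])
    have "sqrt (norm (f (of_real (dyad n) * w * cis \<theta>))) \<le> (\<integral>t. u n t * poisson w t \<partial>circ)"
      using Hol_sqrt_Poisson[OF fr dyad_bounds w(1), of n] by (simp add: u_def cis_mult[symmetric] mult_ac)
    also have "\<dots> \<le> (\<integral>t. min (u n t) l * poisson w t + 2 / (1 - \<rho>) / l * (u n t)\<^sup>2 \<partial>circ)"
    proof (rule integral_mono)
      show "u n t * poisson w t \<le> min (u n t) l * poisson w t + 2 / (1 - \<rho>) / l * (u n t)\<^sup>2" for t
      proof (cases "u n t \<le> l")
        case True
        then show ?thesis using \<rho> l by (simp add: min_def)
      next
        case False
        have "u n t * poisson w t \<le> u n t * (2 / (1 - \<rho>))" by (intro mult_left_mono P1 u0)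
        also have "\<dots> = 2 / (1 - \<rho>) / l * (u n t * l)" using l by simp
        also have "\<dots> \<le> 2 / (1 - \<rho>) / l * (u n t * u n t)"
          using False \<rho> l u0 by (intro mult_left_mono) auto
        finally show ?thesis using P0[of t] l False by (simp add: power2_eq_square min_def add_increasing)
      qed
    qed (intro integrable_circ_cont continuous_intros cu cP continuous_on_min)+
    also have "\<dots> = (\<integral>t. min (u n t) l * poisson w t \<partial>circ) + 2 / (1 - \<rho>) / l * (\<integral>t. (u n t)\<^sup>2 \<partial>circ)"
      by (subst Bochner_Integration.integral_add)
        (use \<rho> l in \<open>auto intro!: integrable_circ_cont continuous_intros cu cP continuous_on_min\<close>)
    finally have H: "sqrt (norm (f (of_real (dyad n) * w * cis \<theta>))) \<le> (\<integral>t. min (u n t) l * poisson w t \<partial>circ) + 2 / (1 - \<rho>) / l * (\<integral>t. (u n t)\<^sup>2 \<partial>circ)" .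
    have "(\<integral>t. (u n t)\<^sup>2 \<partial>circ) \<le> M"
    proof -
      have "(\<integral>t. (u n t)\<^sup>2 \<partial>circ) = (\<integral>t. norm (f (of_real (dyad n) * cis (t + \<theta>))) \<partial>circ)" by (simp add: u_def add.commute)
      also have "\<dots> = (\<integral>t. norm (f (of_real (dyad n) * cis t)) \<partial>circ)"
        by (rule integral_circ_shift[of "\<lambda>t. norm (f (of_real (dyad n) * cis t))"]) (auto simp: cis_mult[symmetric])
      also have "\<dots> \<le> Lc p (\<lambda>t. f (of_real (dyad n) * cis t))" by (intro Lc1_le p Hol_cont_circle f) auto
      also have "\<dots> \<le> M" using M[of n] f p by (simp add: Mp_eq_Lc)
      finally show ?thesis .
    qed
    from mult_left_mono[OF this, of "2 / (1 - \<rho>) / l"] show ?thesis using H \<rho> l by simp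
  qed
  have "(\<lambda>n. \<integral>t. min (u n t) l * poisson w t \<partial>circ) \<longlonglongrightarrow> (\<integral>t. min (sqrt (norm (g (\<theta> + t)))) l * poisson w t \<partial>circ)"
  proof (rule dominated_convergence_bounded[where B = "l * (2 / (1 - \<rho>))"])
    show "AE t in circ. (\<lambda>n. min (u n t) l * poisson w t) \<longlonglongrightarrow> min (sqrt (norm (g (\<theta> + t)))) l * poisson w t"
      using AE_circ_lborel[OF AE_lborel_shift[OF lim, of \<theta>]]
    proof eventually_elim
      case (elim t)
      then show ?case unfolding u_def add.commute[of \<theta>] by (intro tendsto_intros)
    qed
    show "norm (min (u n t) l * poisson w t) \<le> l * (2 / (1 - \<rho>))" for n t
      using u0[of n t] l by (intro norm_mult_mono_real P0 P1) auto
  qed auto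
  then have rhs: "(\<lambda>n. (\<integral>t. min (u n t) l * poisson w t \<partial>circ) + 2 / (1 - \<rho>) * M / l) \<longlonglongrightarrow> (\<integral>t. min (sqrt (norm (g (\<theta> + t)))) l * poisson w t \<partial>circ) + 2 / (1 - \<rho>) * M / l"
    by (intro tendsto_intros)
  have lhs: "(\<lambda>n. sqrt (norm (f (of_real (dyad n) * w * cis \<theta>)))) \<longlonglongrightarrow> sqrt (norm (f (w * cis \<theta>)))"
  proof -
    have "isCont f (of_real 1 * w * cis \<theta>)"
      using Hol_cont[OF f] w by (intro continuous_on_interior[of "ball 0 1"]) (auto simp: norm_mult interior_open)
    moreover have "(\<lambda>n. of_real (dyad n) * w * cis \<theta>) \<longlonglongrightarrow> of_real 1 * w * cis \<theta>"
      by (intro tendsto_intros dyad_tendsto)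
    ultimately have "(\<lambda>n. f (of_real (dyad n) * w * cis \<theta>)) \<longlonglongrightarrow> f (of_real 1 * w * cis \<theta>)" by (rule isCont_tendsto_compose)
    then show ?thesis by (intro tendsto_intros) simp
  qed
  show ?thesis using LIMSEQ_le[OF lhs rhs] step by (auto simp: w_def)
qed

text \<open>The truncated inequality for the square root is raised to the power 2p by Jensen, which
  is possible for every p \<ge> 1 including p = 1, and the truncation level then tends to
  infinity.\<close>

lemma powr_Poisson:
  assumes \<rho>: "0 \<le> \<rho>" "\<rho> < 1"
  shows "norm (f (of_real \<rho> * cis \<theta>)) powr p \<le> (\<integral>t. norm (g (\<theta> + t)) powr p * poisson (of_real \<rho>) t \<partial>circ)"
    and "integrable circ (\<lambda>t. norm (g (\<theta> + t)) powr p * poisson (of_real \<rho>) t)"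
proof -
  define w where "w = complex_of_real \<rho>"
  have w: "norm w < 1" "norm w = \<rho>" using \<rho> by (auto simp: w_def)
  note P0 = poisson_nonneg[OF w(1)] and P1 = poisson_le[OF w(1), unfolded w(2)]
  have [measurable]: "poisson w \<in> borel_measurable borel"
    by (intro borel_measurable_continuous_onI cont_poisson w)
  have "(\<integral>\<^sup>+t. ennreal (norm (g (t + \<theta>)) powr p) \<partial>circ) = (\<integral>\<^sup>+t. ennreal (norm (g t) powr p) \<partial>circ)"
    by (rule nn_integral_circ_shift[of "\<lambda>t. ennreal (norm (g t) powr p)"]) (auto simp: g_per)
  then have "integrable circ (\<lambda>t. norm (g (t + \<theta>)) powr p)"
    using nn_integral_g_le by (intro integrableI_bounded) (auto intro: le_less_trans)
  then have ig: "integrable circ (\<lambda>t. norm (g (\<theta> + t)) powr p)" by (simp add: add.commute)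
  show J: "integrable circ (\<lambda>t. norm (g (\<theta> + t)) powr p * poisson (of_real \<rho>) t)"
    unfolding w_def[symmetric]
  proof (rule Bochner_Integration.integrable_bound[OF integrable_mult_right[OF ig, of "2 / (1 - \<rho>)"]])
    show "AE t in circ. norm (norm (g (\<theta> + t)) powr p * poisson w t) \<le> norm (2 / (1 - \<rho>) * norm (g (\<theta> + t)) powr p)"
    proof (rule AE_I2)
      fix t
      have "norm (g (\<theta> + t)) powr p * poisson w t \<le> norm (g (\<theta> + t)) powr p * (2 / (1 - \<rho>))"
        by (intro mult_left_mono P1) auto
      then show "norm (norm (g (\<theta> + t)) powr p * poisson w t) \<le> norm (2 / (1 - \<rho>) * norm (g (\<theta> + t)) powr p)"
        using P0[of t] \<rho> by (simp add: abs_mult mult.commute)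
    qed
  qed measurable
  define I where "I = (\<integral>t. norm (g (\<theta> + t)) powr p * poisson w t \<partial>circ)"
  have I0: "0 \<le> I" unfolding I_def using P0 by (intro Bochner_Integration.integral_nonneg) auto
  have b: "(\<integral>t. min (sqrt (norm (g (\<theta> + t)))) l * poisson w t \<partial>circ) \<le> I powr (1 / (2*p))" if l: "l > 0" for l
  proof -
    define m where "m t = min (sqrt (norm (g (\<theta> + t)))) l" for t
    have m0: "0 \<le> m t" for t using l by (simp add: m_def)
    have [measurable]: "m \<in> borel_measurable borel" unfolding m_def by measurable
    have mp: "m t powr (2*p) \<le> norm (g (\<theta> + t)) powr p" for t
    proof -
      have "m t powr (2*p) \<le> sqrt (norm (g (\<theta> + t))) powr (2*p)" using p m0 by (intro powr_mono2) (auto simp: m_def)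
      also have "\<dots> = norm (g (\<theta> + t)) powr p" by (simp add: powr_half_sqrt[symmetric] powr_powr)
      finally show ?thesis .
    qed
    have i: "integrable circ (\<lambda>t. m t powr (2*p) * poisson w t)"
      by (rule Bochner_Integration.integrable_bound[OF J[folded w_def]])
         (use P0 mp in \<open>auto simp: abs_mult intro!: mult_right_mono\<close>)
    have i1: "integrable circ (\<lambda>t. m t * poisson w t)"
      using m0 by (intro circ.integrable_const_bound[where B = "l * (2 / (1 - \<rho>))"] AE_I2 norm_mult_mono_real P0 P1)
        (auto simp: m_def)
    have "(\<integral>t. m t * poisson w t \<partial>circ) powr (2*p) \<le> (\<integral>t. poisson w t \<partial>circ) powr (2*p - 1) * (\<integral>t. m t powr (2*p) * poisson w t \<partial>circ)"
      using p m0 P0 by (intro weighted_jensen_powr i i1 integrable_circ_cont cont_poisson w) auto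
    also have "\<dots> \<le> I"
      unfolding I_def integral_poisson[OF w(1)] using P0 mp by (simp add: integral_mono[OF i J[folded w_def]] mult_right_mono)
    finally have "((\<integral>t. m t * poisson w t \<partial>circ) powr (2*p)) powr (1 / (2*p)) \<le> I powr (1 / (2*p))"
      using p by (intro powr_mono2) auto
    moreover have "0 \<le> (\<integral>t. m t * poisson w t \<partial>circ)" using m0 P0 by (intro Bochner_Integration.integral_nonneg) auto
    ultimately show ?thesis using p by (simp add: powr_powr m_def)
  qed
  have "sqrt (norm (f (of_real \<rho> * cis \<theta>))) \<le> I powr (1 / (2*p)) + e" if e: "e > 0" for e
  proof -
    define c where "c = 2 / (1 - \<rho>) * M"
    have c: "c \<ge> 0" using \<rho> M_nonneg by (simp add: c_def)
    \<comment> \<open>Makes the truncation error c / l at most e; the added 1 keeps the level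
      positive when c = 0.\<close>
    define l where "l = (c + 1) / e"
    have l: "l > 0" using e c by (auto simp: l_def)
    have "c / l \<le> e" using e c by (simp add: l_def field_simps)
    then have "2 / (1 - \<rho>) * M / l \<le> e" unfolding c_def .
    then show ?thesis using truncated_Poisson[OF \<rho> l, of \<theta>] b[OF l] by (simp add: w_def)
  qed
  then have "sqrt (norm (f (of_real \<rho> * cis \<theta>))) \<le> I powr (1 / (2*p))" by (rule field_le_epsilon)
  then have "sqrt (norm (f (of_real \<rho> * cis \<theta>))) powr (2*p) \<le> (I powr (1 / (2*p))) powr (2*p)"
    using p by (intro powr_mono2) auto
  then show "norm (f (of_real \<rho> * cis \<theta>)) powr p \<le> (\<integral>t. norm (g (\<theta> + t)) powr p * poisson (of_real \<rho>) t \<partial>circ)"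
    using p I0 by (simp add: powr_half_sqrt[symmetric] powr_powr I_def w_def)
qed

text \<open>The pointwise Poisson bound is integrated over \<theta>. After Fubini the inner integral
  of |g(\<theta> + t)|^p is independent of t, and the kernel has mass one.\<close>

lemma Mp_le_boundary:
  assumes \<rho>: "0 \<le> \<rho>" "\<rho> < 1"
  shows "Mp p \<rho> f \<le> Lc p g"
proof -
  define w where "w = complex_of_real \<rho>"
  have w: "norm w < 1" "norm w = \<rho>" using \<rho> by (auto simp: w_def)
  note P0 = poisson_nonneg[OF w(1)]
  have [measurable]: "poisson w \<in> borel_measurable borel"
    by (intro borel_measurable_continuous_onI cont_poisson w)
  have "ennreal (Mp p \<rho> f powr p) = (\<integral>\<^sup>+\<theta>. ennreal (norm (f (of_real \<rho> * cis \<theta>)) powr p) \<partial>circ)"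
    using p f \<rho> by (subst nn_integral_eq_integral) (auto simp: Mp_eq_Lc Lc_powr intro!: integrable_norm_powr Hol_cont_circle)
  also have "\<dots> \<le> (\<integral>\<^sup>+\<theta>. (\<integral>\<^sup>+t. ennreal (norm (g (\<theta> + t)) powr p * poisson w t) \<partial>circ) \<partial>circ)"
  proof (rule nn_integral_mono)
    fix \<theta>
    have "ennreal (norm (f (of_real \<rho> * cis \<theta>)) powr p) \<le> ennreal (\<integral>t. norm (g (\<theta> + t)) powr p * poisson w t \<partial>circ)"
      unfolding w_def by (intro ennreal_leI powr_Poisson \<rho>)
    also have "\<dots> = (\<integral>\<^sup>+t. ennreal (norm (g (\<theta> + t)) powr p * poisson w t) \<partial>circ)"
      using P0 unfolding w_def by (intro nn_integral_eq_integral[symmetric] powr_Poisson \<rho>) auto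
    finally show "ennreal (norm (f (of_real \<rho> * cis \<theta>)) powr p) \<le> (\<integral>\<^sup>+t. ennreal (norm (g (\<theta> + t)) powr p * poisson w t) \<partial>circ)" .
  qed
  also have "\<dots> = (\<integral>\<^sup>+t. (\<integral>\<^sup>+\<theta>. ennreal (norm (g (\<theta> + t)) powr p * poisson w t) \<partial>circ) \<partial>circ)"
    by (rule circ2.Fubini'[symmetric]) measurable
  also have "\<dots> = (\<integral>\<^sup>+t. ennreal (poisson w t) * (\<integral>\<^sup>+\<theta>. ennreal (norm (g \<theta>) powr p) \<partial>circ) \<partial>circ)"
  proof (rule nn_integral_cong)
    fix t
    have "(\<integral>\<^sup>+\<theta>. ennreal (norm (g (\<theta> + t)) powr p * poisson w t) \<partial>circ) = (\<integral>\<^sup>+\<theta>. ennreal (poisson w t) * ennreal (norm (g (\<theta> + t)) powr p) \<partial>circ)"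
      using P0 by (simp add: ennreal_mult' mult.commute)
    also have "\<dots> = ennreal (poisson w t) * (\<integral>\<^sup>+\<theta>. ennreal (norm (g (\<theta> + t)) powr p) \<partial>circ)"
      by (rule nn_integral_cmult) measurable
    also have "(\<integral>\<^sup>+\<theta>. ennreal (norm (g (\<theta> + t)) powr p) \<partial>circ) = (\<integral>\<^sup>+\<theta>. ennreal (norm (g \<theta>) powr p) \<partial>circ)"
      by (rule nn_integral_circ_shift[of "\<lambda>t. ennreal (norm (g t) powr p)"]) (auto simp: g_per)
    finally show "(\<integral>\<^sup>+\<theta>. ennreal (norm (g (\<theta> + t)) powr p * poisson w t) \<partial>circ) = ennreal (poisson w t) * (\<integral>\<^sup>+\<theta>. ennreal (norm (g \<theta>) powr p) \<partial>circ)" .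
  qed
  also have "\<dots> = (\<integral>\<^sup>+t. ennreal (poisson w t) \<partial>circ) * (\<integral>\<^sup>+\<theta>. ennreal (norm (g \<theta>) powr p) \<partial>circ)"
    by (rule nn_integral_multc) measurable
  also have "(\<integral>\<^sup>+t. ennreal (poisson w t) \<partial>circ) = 1"
    using P0 integral_poisson[OF w(1)] by (subst nn_integral_eq_integral) (auto intro!: integrable_circ_cont cont_poisson w)
  also have "1 * (\<integral>\<^sup>+\<theta>. ennreal (norm (g \<theta>) powr p) \<partial>circ) = ennreal (Lc p g powr p)"
    using p by (simp add: nn_integral_eq_integral integrable_g Lc_powr)
  finally have "Mp p \<rho> f powr p \<le> Lc p g powr p" by simp
  then show ?thesis using powr_less_mono2[of p "Lc p g" "Mp p \<rho> f"] p by (cases "Mp p \<rho> f \<le> Lc p g") auto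
qed

end

section \<open>Measurability of boundary values\<close>

text \<open>Existence of the radial limit is rewritten as a Cauchy condition that quantifies over
  countable types only, so that the set of angles where it holds is visibly Borel.\<close>

lemma radial_limit_iff:
  fixes \<phi> :: "real \<Rightarrow> complex"
  assumes c: "continuous_on {0..<1} \<phi>"
  shows "(\<exists>l. (\<phi> \<longlongrightarrow> l) (at_left 1)) \<longleftrightarrow>
    (\<forall>k::nat. \<exists>m::nat. \<forall>q::rat. dyad m < of_rat q \<and> of_rat q < (1::real) \<longrightarrow>
       norm (\<phi> (of_rat q) - \<phi> (dyad (Suc m))) \<le> 1 / (real k + 1))" (is "?L \<longleftrightarrow> ?R")
proof
  assume ?L
  then obtain l where l: "(\<phi> \<longlongrightarrow> l) (at_left 1)" by blast
  show ?R
  proof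
    fix k :: nat
    have "eventually (\<lambda>r. dist (\<phi> r) l < 1 / (2 * (real k + 1))) (at_left 1)"
      using l by (rule tendstoD) auto
    then obtain b where b: "b < 1" "\<And>r. b < r \<Longrightarrow> r < 1 \<Longrightarrow> dist (\<phi> r) l < 1 / (2 * (real k + 1))"
      by (auto simp: eventually_at_left[of 0 1])
    have "eventually (\<lambda>m. b < dyad m) sequentially" using order_tendstoD(1)[OF dyad_tendsto b(1)] .
    then obtain m where m: "b < dyad m" by (auto dest: eventually_happens)
    have "norm (\<phi> (of_rat q) - \<phi> (dyad (Suc m))) \<le> 1 / (real k + 1)" if q: "dyad m < of_rat q" "of_rat q < (1::real)" for q
    proof -
      have 1: "dist (\<phi> (of_rat q)) l < 1 / (2 * (real k + 1))" using q m by (intro b(2)) auto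
      have 2: "dist (\<phi> (dyad (Suc m))) l < 1 / (2 * (real k + 1))" using m dyad_less[of m "Suc m"] by (intro b(2)) auto
      have "dist (\<phi> (of_rat q)) (\<phi> (dyad (Suc m))) < 1 / (2 * (real k + 1)) + 1 / (2 * (real k + 1))"
        using dist_triangle2[of "\<phi> (of_rat q)" "\<phi> (dyad (Suc m))" l] 1 2 by linarith
      also have "1 / (2 * (real k + 1)) + 1 / (2 * (real k + 1)) = 1 / (real k + 1)"
        by (simp add: divide_simps del: of_nat_Suc)
      finally show ?thesis by (simp add: dist_norm)
    qed
    then show "\<exists>m. \<forall>q. dyad m < of_rat q \<and> of_rat q < (1::real) \<longrightarrow> norm (\<phi> (of_rat q) - \<phi> (dyad (Suc m))) \<le> 1 / (real k + 1)"
      by blast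
  qed
next
  assume R: ?R
  \<comment> \<open>By continuity, a violation at a real radius would persist at nearby radii to its
    right, among which there is a rational one.\<close>
  have real: "norm (\<phi> r - c) \<le> e"
    if q: "\<And>q::rat. dyad m < of_rat q \<Longrightarrow> of_rat q < (1::real) \<Longrightarrow> norm (\<phi> (of_rat q) - c) \<le> e" and r: "dyad m < r" "r < 1" for m c e r
  proof (rule ccontr)
    assume "\<not> norm (\<phi> r - c) \<le> e"
    then have gt: "e < norm (\<phi> r - c)" by simp
    have r0: "0 < r" using r dyad_bounds(1)[of m] by linarith
    have "isCont \<phi> r" using continuous_on_interior[OF c, of r] r r0 by simp
    then have "((\<lambda>x. norm (\<phi> x - c)) \<longlongrightarrow> norm (\<phi> r - c)) (at r)"
      by (intro tendsto_intros) (simp add: isCont_def)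
    then have "eventually (\<lambda>x. e < norm (\<phi> x - c)) (at r)" using gt by (rule order_tendstoD)
    then obtain d where d: "d > 0" "\<And>x. x \<noteq> r \<Longrightarrow> dist x r < d \<Longrightarrow> e < norm (\<phi> x - c)"
      by (auto simp: eventually_at)
    obtain x where x: "x \<in> \<rat>" "r < x" "x < min 1 (r + d)"
      using Rats_dense_in_real[of r "min 1 (r + d)"] r d by auto
    then obtain q where "x = of_rat q" by (auto elim: Rats_cases)
    then show False using q[of q] d(2)[of x] x r by (auto simp: dist_real_def)
  qed
  have Rk: "\<exists>m. \<forall>r. dyad m < r \<and> r < 1 \<longrightarrow> norm (\<phi> r - \<phi> (dyad (Suc m))) \<le> 1 / (real k + 1)" for k
  proof -
    obtain m where "\<And>q::rat. dyad m < of_rat q \<Longrightarrow> of_rat q < (1::real) \<Longrightarrow> norm (\<phi> (of_rat q) - \<phi> (dyad (Suc m))) \<le> 1 / (real k + 1)"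
      using R by blast
    from real[OF this] show ?thesis by blast
  qed
  have ex_k: "\<exists>k::nat. 2 / (real k + 1) < e" if "e > 0" for e
  proof -
    obtain k :: nat where "2 / e < real k" using reals_Archimedean2 by blast
    then have "2 / (real k + 1) < e" using that by (simp add: field_simps)
    then show ?thesis by blast
  qed
  have "Cauchy (\<lambda>n. \<phi> (dyad n))"
  proof (rule metric_CauchyI)
    fix e :: real assume "e > 0"
    then obtain k :: nat where k: "2 / (real k + 1) < e" using ex_k by blast
    obtain m where m: "\<And>r. dyad m < r \<Longrightarrow> r < 1 \<Longrightarrow> norm (\<phi> r - \<phi> (dyad (Suc m))) \<le> 1 / (real k + 1)"
      using Rk by blast
    show "\<exists>M. \<forall>i\<ge>M. \<forall>n\<ge>M. dist (\<phi> (dyad i)) (\<phi> (dyad n)) < e"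
    proof (intro exI allI impI)
      fix i n assume "Suc m \<le> i" "Suc m \<le> n"
      then have "dist (\<phi> (dyad i)) (\<phi> (dyad (Suc m))) \<le> 1 / (real k + 1)" "dist (\<phi> (dyad n)) (\<phi> (dyad (Suc m))) \<le> 1 / (real k + 1)"
        unfolding dist_norm using dyad_less[of m i] dyad_less[of m n] by (auto intro!: m)
      then have "dist (\<phi> (dyad i)) (\<phi> (dyad n)) \<le> 1 / (real k + 1) + 1 / (real k + 1)"
        using dist_triangle2[of "\<phi> (dyad i)" "\<phi> (dyad n)" "\<phi> (dyad (Suc m))"] by linarith
      then show "dist (\<phi> (dyad i)) (\<phi> (dyad n)) < e" using k by simp
    qed
  qed
  then obtain l where l: "(\<lambda>n. \<phi> (dyad n)) \<longlonglongrightarrow> l" using Cauchy_convergent convergent_def by blast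
  have "(\<phi> \<longlongrightarrow> l) (at_left 1)"
  proof (rule tendstoI)
    fix e :: real assume "e > 0"
    then obtain k :: nat where k: "2 / (real k + 1) < e" using ex_k by blast
    obtain m where m: "\<And>r. dyad m < r \<Longrightarrow> r < 1 \<Longrightarrow> norm (\<phi> r - \<phi> (dyad (Suc m))) \<le> 1 / (real k + 1)"
      using Rk by blast
    have "norm (l - \<phi> (dyad (Suc m))) \<le> 1 / (real k + 1)"
    proof (rule LIMSEQ_le_const2)
      show "(\<lambda>n. norm (\<phi> (dyad n) - \<phi> (dyad (Suc m)))) \<longlonglongrightarrow> norm (l - \<phi> (dyad (Suc m)))" by (intro tendsto_intros l)
      show "\<exists>N. \<forall>n\<ge>N. norm (\<phi> (dyad n) - \<phi> (dyad (Suc m))) \<le> 1 / (real k + 1)"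
        using dyad_less[of m] by (intro exI[of _ "Suc m"]) (auto intro!: m)
    qed
    then have "dist (\<phi> r) l < e" if "dyad m < r" "r < 1" for r
      using m[OF that] dist_triangle2[of "\<phi> r" l "\<phi> (dyad (Suc m))"] k by (simp add: dist_norm)
    then show "eventually (\<lambda>r. dist (\<phi> r) l < e) (at_left 1)"
      unfolding eventually_at_left[OF zero_less_one] by (intro exI[of _ "dyad m"]) auto
  qed
  then show ?L by blast
qed

lemma dyad_at_left: "filterlim dyad (at_left 1) sequentially"
  using dyad_tendsto by (auto simp: filterlim_at intro!: always_eventually less_imp_neq)

lemma boundary_value_eq:
  assumes "((\<lambda>r::real. f (of_real r * cis \<theta>)) \<longlongrightarrow> l) (at_left 1)"
  shows "boundary_value f \<theta> = l" "(\<lambda>n. f (of_real (dyad n) * cis \<theta>)) \<longlonglongrightarrow> boundary_value f \<theta>"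
proof -
  show "boundary_value f \<theta> = l" unfolding boundary_value_def using assms by (intro tendsto_Lim) auto
  then show "(\<lambda>n. f (of_real (dyad n) * cis \<theta>)) \<longlonglongrightarrow> boundary_value f \<theta>"
    using filterlim_compose[OF assms dyad_at_left] by simp
qed

lemma boundary_value_measurable:
  assumes f: "f \<in> Hol"
  shows "boundary_value f \<in> borel_measurable borel"
proof -
  define E where "E \<theta> \<longleftrightarrow> (\<exists>l. ((\<lambda>r::real. f (of_real r * cis \<theta>)) \<longlongrightarrow> l) (at_left 1))" for \<theta>
  define \<psi> where "\<psi> q \<theta> = (if 0 \<le> q \<and> q < 1 then f (of_real q * cis \<theta>) else 0)" for q \<theta> :: real
  have [measurable]: "(\<lambda>\<theta>. \<psi> q \<theta>) \<in> borel_measurable borel" for q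
  proof (cases "0 \<le> q \<and> q < 1")
    case True
    then show ?thesis
      unfolding \<psi>_def by simp (intro borel_measurable_continuous_onI Hol_cont_circle f, auto)
  next
    case False
    then have "\<psi> q = (\<lambda>_. 0)" by (auto simp: \<psi>_def)
    then show ?thesis by simp
  qed
  have [measurable]: "(\<lambda>\<theta>. f (of_real (dyad n) * cis \<theta>)) \<in> borel_measurable borel" for n
    by (intro borel_measurable_continuous_onI Hol_cont_circle f) auto
  have Eeq: "E \<theta> \<longleftrightarrow> (\<forall>k::nat. \<exists>m::nat. \<forall>q::rat. dyad m < of_rat q \<and> of_rat q < (1::real) \<longrightarrow>
       norm (\<psi> (of_rat q) \<theta> - \<psi> (dyad (Suc m)) \<theta>) \<le> 1 / (real k + 1))" for \<theta>
  proof -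
    have c: "continuous_on {0..<1} (\<lambda>r::real. f (of_real r * cis \<theta>))"
      by (rule Hol_cont_compose[OF f]) (auto intro!: continuous_intros simp: norm_mult)
    have e: "\<psi> (of_rat q) \<theta> = f (of_real (of_rat q) * cis \<theta>)" if "dyad m < of_rat q" "of_rat q < (1::real)" for q m
      using that order_trans[OF dyad_bounds(1) less_imp_le[OF that(1)]] by (simp add: \<psi>_def)
    have e2: "\<psi> (dyad n) \<theta> = f (of_real (dyad n) * cis \<theta>)" for n by (simp add: \<psi>_def)
    show ?thesis unfolding E_def radial_limit_iff[OF c] e2 using e by (metis (no_types, lifting))
  qed
  have [measurable]: "Measurable.pred borel E" unfolding Eeq[abs_def] by measurable
  \<comment> \<open>Off the set \<open>E\<close> the description behind \<open>Lim\<close> has an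
    unsatisfiable predicate, so its value is one and the same constant for all such angles.\<close>
  have eq: "boundary_value f \<theta> = (if E \<theta> then lim (\<lambda>n. f (of_real (dyad n) * cis \<theta>)) else The (\<lambda>_. False))" for \<theta>
  proof (cases "E \<theta>")
    case True
    then show ?thesis using boundary_value_eq(2) unfolding E_def by (auto intro!: limI[symmetric])
  next
    case False
    then have "(\<lambda>l. ((\<lambda>r::real. f (of_real r * cis \<theta>)) \<longlongrightarrow> l) (at_left 1)) = (\<lambda>_. False)" by (auto simp: E_def)
    then show ?thesis using False by (simp add: boundary_value_def t2_space_class.Lim_def)
  qed
  show ?thesis unfolding eq[abs_def] by measurable
qed

lemma boundary_value_periodic: "boundary_value f (\<theta> + 2*pi) = boundary_value f \<theta>"
  by (simp add: boundary_value_def cis_mult[symmetric])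

text \<open>Reconciles the window [-pi, pi] in \<open>mean_modulus\<close> with the window [0, 2 pi]
  of \<open>circ\<close>.\<close>

lemma set_integral_window:
  fixes h :: "real \<Rightarrow> real"
  assumes [measurable]: "h \<in> borel_measurable borel" and per: "\<And>t. h (t + 2*pi) = h t" and nn: "\<And>t. 0 \<le> h t"
  shows "1 / (2*pi) * (LBINT t:{-pi..pi}. h t) = (\<integral>t. h t \<partial>circ)"
proof -
  have e: "(LBINT t:{a..b}. h t) = enn2real (\<integral>\<^sup>+t\<in>{a..b}. ennreal (h t) \<partial>lborel)" for a b
    unfolding set_lebesgue_integral_def using nn
    by (subst integral_eq_nn_integral)
       (auto intro!: arg_cong[where f = enn2real] nn_integral_cong simp: indicator_def)
  have "(LBINT t:{-pi..pi}. h t) = (LBINT t:{0..2*pi}. h t)"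
    unfolding e using nn_integral_period_window[of "\<lambda>t. ennreal (h t)" "-pi"] by (simp add: per)
  then show ?thesis by (simp add: integral_circ)
qed

section \<open>Mean Lipschitz spaces\<close>

text \<open>Its boundary values are the increments measured by \<open>mean_modulus\<close>; being
  analytic, it has interior means controlled by them.\<close>

definition rot_diff :: "(complex \<Rightarrow> complex) \<Rightarrow> real \<Rightarrow> complex \<Rightarrow> complex" where
  "rot_diff f s z = f (cis s * z) - f z"

lemma rot_diff_Hol: "f \<in> Hol \<Longrightarrow> rot_diff f s \<in> Hol"
  unfolding rot_diff_def by (intro Hol_diff Hol_rotate)

lemma Mp_rotate:
  assumes "f \<in> Hol" "p > 0" "0 \<le> r" "r < 1"
  shows "Mp p r (\<lambda>z. f (cis s * z)) = Mp p r f"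
proof -
  have "Mp p r (\<lambda>z. f (cis s * z)) = Lc p (\<lambda>t. norm (f (of_real r * cis (t + s))))"
  proof -
    have e: "cis s * (of_real r * cis t) = of_real r * cis (t + s)" for t by (simp add: cis_mult[symmetric] mult_ac)
    show ?thesis using assms by (subst Mp_eq_Lc; (unfold e)?) (auto simp: Hol_rotate simp del: mult_cancel_left intro: Lc_cong)
  qed
  then show ?thesis using assms by (simp add: Lc_circle_shift)
qed

lemma Mp_rot_diff_le:
  assumes "f \<in> Hol" "1 \<le> p" "0 \<le> r" "r < 1"
  shows "Mp p r (rot_diff f s) \<le> 2 * Mp p r f"
  using Mp_triangle[OF Hol_rotate[OF assms(1), of s] Hol_cmult[OF assms(1), of "-1"] assms(2-4)]
    Mp_rotate[OF assms(1), of p r s] Mp_cmult[OF assms(1), of p r "-1"] assms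
  by (simp add: rot_diff_def[abs_def])

lemma Hardy_bound:
  assumes "f \<in> Hardy p" "1 \<le> p"
  obtains M where "\<And>r. 0 \<le> r \<Longrightarrow> r < 1 \<Longrightarrow> Mp p r f \<le> M"
proof -
  have f: "f \<in> Hol" using assms by (simp add: Hardy_def)
  from assms obtain M where "\<forall>x\<in>(\<lambda>r. Mp p r f) ` {0<..<1}. x \<le> M"
    unfolding Hardy_def bdd_above_def by blast
  then have M: "Mp p r f \<le> M" if "0 < r" "r < 1" for r using that by simp
  have "Mp p r f \<le> M" if "0 \<le> r" "r < 1" for r
  proof -
    have "Mp p r f \<le> Mp p ((1 + r) / 2) f" using that by (intro Mp_mono f assms) auto
    also have "\<dots> \<le> M" using that by (intro M) auto
    finally show ?thesis .
  qed
  then show ?thesis using that by blast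
qed

lemma radial_limit_rot_diff:
  assumes f: "f \<in> Hol" and bv: "has_boundary_values f" and p: "1 \<le> p"
    and M: "\<And>n. Mp p (dyad n) (rot_diff f s) \<le> M"
  shows "radial_limit (rot_diff f s) (\<lambda>x. boundary_value f (x + s) - boundary_value f x) p M"
proof
  note [measurable] = boundary_value_measurable[OF f]
  have lim: "AE x in lborel. (\<lambda>n. f (of_real (dyad n) * cis x)) \<longlonglongrightarrow> boundary_value f x"
    using bv unfolding has_boundary_values_def by (auto elim!: eventually_mono intro: boundary_value_eq(2))
  show "AE x in lborel. (\<lambda>n. rot_diff f s (of_real (dyad n) * cis x)) \<longlonglongrightarrow> boundary_value f (x + s) - boundary_value f x"
    using AE_lborel_shift[OF lim, of s] lim
  proof eventually_elim
    case (elim x)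
    have e: "cis s * (of_real (dyad n) * cis x) = of_real (dyad n) * cis (x + s)" for n
      by (simp add: cis_mult[symmetric] mult_ac)
    show ?case unfolding rot_diff_def e by (intro tendsto_diff elim)
  qed
  show "(\<lambda>x. boundary_value f (x + s) - boundary_value f x) \<in> borel_measurable borel" by measurable
  show "boundary_value f (t + 2*pi + s) - boundary_value f (t + 2*pi) = boundary_value f (t + s) - boundary_value f t" for t
    using boundary_value_periodic[of f "t + s"] boundary_value_periodic[of f t] by (simp add: add_ac)
qed (use rot_diff_Hol[OF f] p M in auto)

lemma mean_modulus_eq_Lc:
  assumes f: "f \<in> Hol"
  shows "mean_modulus p \<delta> f = (SUP t\<in>{t. 0 < \<bar>t\<bar> \<and> \<bar>t\<bar> \<le> \<delta>}. Lc p (\<lambda>x. boundary_value f (x + t) - boundary_value f x))"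
proof -
  note [measurable] = boundary_value_measurable[OF f]
  have per: "boundary_value f (x + 2*pi + t) = boundary_value f (x + t)" for x t
    using boundary_value_periodic[of f "x + t"] by (simp add: add_ac)
  show ?thesis unfolding mean_modulus_def Lc_def
    by (subst set_integral_window) (auto simp: boundary_value_periodic per)
qed

text \<open>The norms of the increments are bounded by twice the Hardy norm bound, which makes the
  real supremum in \<open>mean_modulus\<close> a genuine upper bound.\<close>

lemma mean_modulus_controls:
  assumes f: "f \<in> Hardy p" and bv: "has_boundary_values f" and p: "1 \<le> p"
    and t: "t \<noteq> 0" "\<bar>t\<bar> \<le> \<delta>" and R: "0 \<le> R" "R < 1"
  shows "Mp p R (rot_diff f t) \<le> mean_modulus p \<delta> f"
proof -
  have fH: "f \<in> Hol" using f by (simp add: Hardy_def)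
  obtain M where M: "\<And>r. 0 \<le> r \<Longrightarrow> r < 1 \<Longrightarrow> Mp p r f \<le> M" using Hardy_bound[OF f p] by blast
  have D: "radial_limit (rot_diff f s) (\<lambda>x. boundary_value f (x + s) - boundary_value f x) p (2 * M)" for s
    by (intro radial_limit_rot_diff fH bv p order_trans[OF Mp_rot_diff_le[OF fH p] mult_left_mono[OF M]]) auto
  have "Lc p (\<lambda>x. boundary_value f (x + t) - boundary_value f x) \<le> mean_modulus p \<delta> f"
    unfolding mean_modulus_eq_Lc[OF fH] using t radial_limit.Lc_g_le[OF D] by (intro cSUP_upper) (auto intro!: bdd_aboveI)
  then show ?thesis using radial_limit.Mp_le_boundary[OF D R] order_trans by blast
qed

section \<open>From the modulus of continuity to the growth of the derivative\<close>

lemma geometric_deriv_sum: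
  assumes "norm (u::complex) < 1"
  shows "(\<lambda>n. of_nat n * u ^ n) sums (u / (1 - u)\<^sup>2)"
proof -
  have "(\<lambda>n. u * (of_nat (Suc n) * u ^ n)) sums (u * (1 / (1 - u)\<^sup>2))"
    by (intro sums_mult geometric_deriv_sums assms)
  then have "(\<lambda>n. of_nat (Suc n) * u ^ Suc n) sums (u / (1 - u)\<^sup>2)" by (simp add: mult_ac)
  from sums_Suc[OF this] show ?thesis by simp
qed

text \<open>The pairing of f with the series of n u^n, whose sum is u / (1 - u)^2, yields z f'(z) at
  z = R \<rho>.\<close>

lemma Hol_Cauchy_deriv:
  assumes f: "f \<in> Hol" "0 \<le> R" "R < 1" and \<rho>: "0 \<le> \<rho>" "\<rho> < 1"
  shows "(\<integral>t. f (of_real R * cis t) * (of_real \<rho> * cis (-t) / (1 - of_real \<rho> * cis (-t))\<^sup>2) \<partial>circ)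
    = of_real (R * \<rho>) * deriv f (of_real (R * \<rho>))"
proof -
  define b where "b n = of_nat n * complex_of_real \<rho> ^ n" for n
  have b: "summable (\<lambda>n. norm (b n))"
  proof -
    have "summable (\<lambda>n. of_nat n * complex_of_real \<rho> ^ n)"
      using \<rho> by (intro sums_summable[OF geometric_deriv_sum]) simp
    have "summable (\<lambda>n. complex_of_real (real n * \<rho> ^ n))" using \<open>summable (\<lambda>n. of_nat n * complex_of_real \<rho> ^ n)\<close> by simp
    then have "summable (\<lambda>n. real n * \<rho> ^ n)" by (simp only: summable_complex_of_real)
    then show ?thesis using \<rho> by (simp add: b_def norm_mult norm_power)
  qed
  have "(\<Sum>n. b n * cis (- (real n * t))) = of_real \<rho> * cis (-t) / (1 - of_real \<rho> * cis (-t))\<^sup>2" for t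
  proof -
    have "norm (of_real \<rho> * cis (-t)) < 1" using \<rho> by (simp add: norm_mult)
    from geometric_deriv_sum[OF this] show ?thesis
      by (simp add: b_def sums_iff powers_cis[symmetric] mult.assoc)
  qed
  then have 1: "(\<lambda>n. b n * (taylor_coeff f n * of_real R ^ n)) sums
    (\<integral>t. f (of_real R * cis t) * (of_real \<rho> * cis (-t) / (1 - of_real \<rho> * cis (-t))\<^sup>2) \<partial>circ)"
    using Hol_pairing[OF f b] by simp
  have "norm (of_real (R * \<rho>) :: complex) < 1"
    using f \<rho> by (simp add: mult_strict_mono'[of R 1 \<rho> 1, simplified] abs_mult del: of_real_mult)
  from Hol_deriv_sums[OF f(1) this]
  have "(\<lambda>n. b n * (taylor_coeff f n * of_real R ^ n)) sums (of_real (R * \<rho>) * deriv f (of_real (R * \<rho>)))"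
    by (simp add: b_def power_mult_distrib mult_ac)
  with 1 show ?thesis by (rule sums_unique2)
qed

lemma deriv_rotate:
  assumes "f \<in> Hol" "norm z < 1"
  shows "deriv (\<lambda>z. f (cis \<theta> * z)) z = cis \<theta> * deriv f (cis \<theta> * z)"
proof (rule DERIV_imp_deriv)
  have "(f has_field_derivative deriv f (cis \<theta> * z)) (at (cis \<theta> * z))"
    using assms by (intro holomorphic_derivI[of f "ball 0 1"]) (auto simp: Hol_def norm_mult)
  moreover have "((\<lambda>z. cis \<theta> * z) has_field_derivative cis \<theta>) (at z)"
    by (auto intro!: derivative_eq_intros)
  ultimately have "((\<lambda>z. f (cis \<theta> * z)) has_field_derivative deriv f (cis \<theta> * z) * cis \<theta>) (at z)"
    by (rule DERIV_chain2)
  then show "((\<lambda>z. f (cis \<theta> * z)) has_field_derivative cis \<theta> * deriv f (cis \<theta> * z)) (at z)"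
    by (simp only: mult.commute)
qed

text \<open>Compares the chord on the unit circle with the distance appearing in the kernel, so that
  modulus and kernel become powers of the same quantity.\<close>

lemma chord_le:
  assumes "0 \<le> \<rho>" "\<rho> < 1"
  shows "norm (1 - cis t) \<le> 2 * norm (1 - of_real \<rho> * cis (-t))"
proof -
  have "norm (1 - cis t) = norm (cnj (1 - cis t))" by (simp only: complex_mod_cnj)
  also have "cnj (1 - cis t) = (1 - of_real \<rho> * cis (-t)) - of_real (1 - \<rho>) * cis (-t)"
    by (simp add: cis_cnj algebra_simps)
  also have "norm \<dots> \<le> norm (1 - of_real \<rho> * cis (-t)) + (1 - \<rho>)"
    using norm_triangle_ineq4[of "1 - of_real \<rho> * cis (-t)" "of_real (1 - \<rho>) * cis (-t)"] assms
    by (simp add: norm_mult del: of_real_diff)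
  also have "1 - \<rho> \<le> norm (1 - of_real \<rho> * cis (-t))"
    using norm_triangle_ineq2[of 1 "of_real \<rho> * cis (-t)"] assms by (simp add: norm_mult)
  finally show ?thesis by simp
qed

text \<open>z f'(z) is an integral of increments of f against a kernel of modulus at most |1 -
  \<rho> e^(it)|^(-2). The term with exponent s > 1/p is there to absorb large t, where only a crude
  bound is available: it contributes (1 - \<rho>)^(s - 1), of smaller order than the main term,
  whose constant a is left intact. Chords replace |t| because increments are periodic in t.\<close>

lemma Hardy_Littlewood_kernel:
  assumes p: "1 < p" and s: "1/p < s" "s < 1"
  obtains C where "C > 0"
    "\<And>f a b R \<rho>. f \<in> Hol \<Longrightarrow> 0 < a \<Longrightarrow> 0 \<le> b \<Longrightarrow> 0 \<le> R \<Longrightarrow> R < 1 \<Longrightarrow> 0 \<le> \<rho> \<Longrightarrow> \<rho> < 1 \<Longrightarrow>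
      (\<forall>t. Mp p R (rot_diff f t) \<le> a * norm (1 - cis t) powr (1/p) + b * norm (1 - cis t) powr s) \<Longrightarrow>
      R * \<rho> * Mp p (R * \<rho>) (deriv f) \<le> C * (a * (1 - \<rho>) powr (1/p - 1) + b * (1 - \<rho>) powr (s - 1))"
proof -
  have s0: "0 < s" using s p by (smt (verit) divide_pos_pos)
  have p1: "1/p < 1" "0 < 1/p" using p by auto
  define c where "c e = 10 powr (2 - e) * 2 / (1 - e)" for e :: real
  define C where "C = 2 * max (c (1/p)) (c s)"
  have c0: "c e > 0" if "e < 1" for e unfolding c_def using that by (intro divide_pos_pos mult_pos_pos) auto
  note c = c0[OF p1(1)] c0[OF s(2)]
  show ?thesis
  proof (rule that[of C])
    show "C > 0" using c by (auto simp: C_def)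
    fix f :: "complex \<Rightarrow> complex" and a b R \<rho> :: real
    assume f: "f \<in> Hol" and ab: "0 < a" "0 \<le> b" and R: "0 \<le> R" "R < 1" and \<rho>: "0 \<le> \<rho>" "\<rho> < 1"
      and H: "\<forall>t. Mp p R (rot_diff f t) \<le> a * norm (1 - cis t) powr (1/p) + b * norm (1 - cis t) powr s"
    define X where "X t = norm (1 - of_real \<rho> * cis (-t))" for t
    have X0: "X t > 0" for t using one_minus_cis_pos[OF \<rho>] by (simp add: X_def)
    have Xeq: "X t = norm (1 - of_real \<rho> * cis t)" for t
      unfolding X_def by (metis cis_cnj complex_cnj_complex_of_real complex_cnj_diff complex_cnj_mult complex_cnj_one complex_mod_cnj)
    have cXp: "continuous_on UNIV (\<lambda>t. X t powr e)" for e
      unfolding Xeq by (rule cont_one_minus_cis_powr[OF \<rho>])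
    have cX: "continuous_on UNIV X" unfolding X_def by (intro continuous_intros)
    define \<omega> where "\<omega> t = a * (2 * X t) powr (1/p) + b * (2 * X t) powr s" for t
    have \<omega>0: "\<omega> t > 0" for t unfolding \<omega>_def using ab X0[of t] by (intro add_pos_nonneg) auto
    have c\<omega>: "continuous_on UNIV \<omega>"
      unfolding \<omega>_def using X0 by (intro continuous_intros cX) (auto simp: less_imp_neq[symmetric])
    have rr: "0 \<le> R * \<rho>" "R * \<rho> < 1" using R \<rho> by (auto simp: mult_strict_mono'[of R 1 \<rho> 1, simplified])
    define k where "k t = of_real \<rho> * cis (-t) / (1 - of_real \<rho> * cis (-t))\<^sup>2" for t
    have nk: "norm (k t) \<le> X t powr (-2)" for t
    proof -
      have "norm (k t) = \<rho> / (X t)\<^sup>2" using \<rho> by (simp add: k_def norm_divide norm_mult norm_power X_def)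
      also have "\<dots> \<le> 1 / (X t)\<^sup>2" using \<rho> by (intro divide_right_mono) auto
      also have "\<dots> = X t powr (-2)" using X0[of t] by (simp add: powr_minus_divide powr_numeral)
      finally show ?thesis .
    qed
    have ck: "continuous_on UNIV k"
      unfolding k_def using X0 by (intro continuous_intros) (auto simp: X_def)
    \<comment> \<open>The formula for the derivative, applied to a constant function; zero mean is
      what allows f to be replaced by its increment.\<close>
    have k0: "(\<integral>t. k t \<partial>circ) = 0"
      using Hol_Cauchy_deriv[of "\<lambda>_. 1" 0 \<rho>] \<rho> by (simp add: k_def)
    \<comment> \<open>The increments are divided by their bound \<open>\<omega> t\<close>, so their
      norms are at most 1 uniformly in t, and \<open>\<omega> t\<close> is moved into the
      kernel.\<close>
    have "Lc p (\<lambda>\<theta>. (of_real (R * \<rho>) * cis \<theta>) * deriv f (of_real (R * \<rho>) * cis \<theta>)) \<le> (\<integral>t. \<omega> t * X t powr (-2) \<partial>circ) * 1"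
    proof (rule Lc_minkowski)
      show "continuous_on UNIV (\<lambda>(\<theta>, t). norm (f (of_real R * cis (\<theta> + t)) - f (of_real R * cis \<theta>)) / \<omega> t)"
      proof -
        have "continuous_on UNIV (\<lambda>z::real\<times>real. \<omega> (snd z))"
          by (rule continuous_on_compose2[OF c\<omega>]) (auto intro!: continuous_intros)
        moreover have "continuous_on UNIV (\<lambda>z::real\<times>real. f (of_real R * cis (fst z + snd z)) - f (of_real R * cis (fst z)))"
          using R by (intro continuous_on_diff Hol_cont_compose[OF f]) (auto intro!: continuous_intros simp: norm_mult)
        ultimately show ?thesis unfolding case_prod_unfold using \<omega>0
          by (intro continuous_on_divide continuous_on_norm) (auto simp: less_imp_neq[symmetric])
      qed
      show "continuous_on UNIV (\<lambda>t. \<omega> t * X t powr (-2))" by (intro continuous_on_mult c\<omega> cXp)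
      show "continuous_on UNIV (\<lambda>\<theta>. (of_real (R * \<rho>) * cis \<theta>) * deriv f (of_real (R * \<rho>) * cis \<theta>))"
        by (intro continuous_on_mult continuous_on_const continuous_on_cis continuous_on_id Hol_cont_circle Hol_deriv f rr)
      show "norm (of_real (R * \<rho>) * cis \<theta> * deriv f (of_real (R * \<rho>) * cis \<theta>)) \<le>
          (\<integral>t. norm (f (of_real R * cis (\<theta> + t)) - f (of_real R * cis \<theta>)) / \<omega> t * (\<omega> t * X t powr (-2)) \<partial>circ)" for \<theta>
      proof -
        have cf: "continuous_on UNIV (\<lambda>t. f (of_real R * cis (\<theta> + t)))" using R by (intro cont_circle_sum f) auto
        have "of_real (R * \<rho>) * cis \<theta> * deriv f (of_real (R * \<rho>) * cis \<theta>) = of_real (R * \<rho>) * deriv (\<lambda>z. f (cis \<theta> * z)) (of_real (R * \<rho>))"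
        proof -
          have "norm (of_real (R * \<rho>) :: complex) < 1" using rr by (simp only: norm_of_real abs_of_nonneg)
          then show ?thesis by (subst deriv_rotate[OF f]) (simp_all only: mult_ac)
        qed
        also have "\<dots> = (\<integral>t. f (of_real R * cis (\<theta> + t)) * k t \<partial>circ)"
          using Hol_Cauchy_deriv[OF Hol_rotate[OF f, of \<theta>] R \<rho>] by (simp add: k_def cis_mult[symmetric] mult_ac)
        also have "\<dots> = (\<integral>t. f (of_real R * cis (\<theta> + t)) * k t \<partial>circ) - f (of_real R * cis \<theta>) * (\<integral>t. k t \<partial>circ)"
          by (simp add: k0)
        also have "\<dots> = (\<integral>t. (f (of_real R * cis (\<theta> + t)) - f (of_real R * cis \<theta>)) * k t \<partial>circ)"
          unfolding left_diff_distrib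
          by (subst Bochner_Integration.integral_diff) (auto intro!: integrable_circ_cont continuous_on_mult cf ck continuous_on_const)
        also have "norm \<dots> \<le> (\<integral>t. norm ((f (of_real R * cis (\<theta> + t)) - f (of_real R * cis \<theta>)) * k t) \<partial>circ)"
          by (rule integral_norm_bound)
        also have "\<dots> \<le> (\<integral>t. norm (f (of_real R * cis (\<theta> + t)) - f (of_real R * cis \<theta>)) * X t powr (-2) \<partial>circ)"
          unfolding norm_mult
          by (intro integral_mono mult_left_mono nk integrable_circ_cont continuous_on_mult continuous_on_norm continuous_on_diff cf ck cXp continuous_on_const) auto
        also have "\<dots> = (\<integral>t. norm (f (of_real R * cis (\<theta> + t)) - f (of_real R * cis \<theta>)) / \<omega> t * (\<omega> t * X t powr (-2)) \<partial>circ)"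
          using \<omega>0 by (intro Bochner_Integration.integral_cong) (auto simp: less_imp_neq[symmetric])
        finally show ?thesis .
      qed
      show "Lc p (\<lambda>\<theta>. norm (f (of_real R * cis (\<theta> + t)) - f (of_real R * cis \<theta>)) / \<omega> t) \<le> 1" for t
      proof -
        have "Lc p (\<lambda>\<theta>. norm (f (of_real R * cis (\<theta> + t)) - f (of_real R * cis \<theta>)) / \<omega> t) = Lc p (\<lambda>\<theta>. of_real (1 / \<omega> t) * rot_diff f t (of_real R * cis \<theta>))"
          using \<omega>0[of t] by (intro Lc_cong) (simp add: rot_diff_def norm_mult norm_divide cis_mult[symmetric] mult_ac)
        also have "\<dots> = (1 / \<omega> t) * Mp p R (rot_diff f t)"
          using p R \<omega>0[of t] by (subst Lc_cmult) (auto simp: Mp_eq_Lc rot_diff_Hol f norm_divide)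
        also have "\<dots> \<le> (1 / \<omega> t) * \<omega> t"
        proof (intro mult_left_mono order_trans[OF H[rule_format]])
          show "a * norm (1 - cis t) powr (1/p) + b * norm (1 - cis t) powr s \<le> \<omega> t"
            unfolding \<omega>_def X_def using ab p s0
            by (intro add_mono mult_left_mono powr_mono2 chord_le \<rho>) auto
        qed (use \<omega>0[of t] in auto)
        finally show ?thesis using \<omega>0[of t] by simp
      qed
    qed (use p \<omega>0 in \<open>auto simp: less_imp_le\<close>)
    also have "Lc p (\<lambda>\<theta>. (of_real (R * \<rho>) * cis \<theta>) * deriv f (of_real (R * \<rho>) * cis \<theta>)) = R * \<rho> * Mp p (R * \<rho>) (deriv f)"
      using p rr f Mp_eq_Lc[OF Hol_id_mult[OF Hol_deriv[OF f]] rr, of p] by (simp add: Mp_id_mult Hol_deriv)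
    finally have 1: "R * \<rho> * Mp p (R * \<rho>) (deriv f) \<le> (\<integral>t. \<omega> t * X t powr (-2) \<partial>circ)" by simp
    have "(\<integral>t. \<omega> t * X t powr (-2) \<partial>circ) = (\<integral>t. a * 2 powr (1/p) * X t powr (-(2 - 1/p)) + b * 2 powr s * X t powr (-(2 - s)) \<partial>circ)"
    proof (rule Bochner_Integration.integral_cong)
      fix t
      have e: "X t powr e * X t powr (-2) = X t powr (-(2 - e))" for e by (simp add: powr_add[symmetric])
      have "\<omega> t * X t powr (-2) = a * 2 powr (1/p) * (X t powr (1/p) * X t powr (-2)) + b * 2 powr s * (X t powr s * X t powr (-2))"
        using X0[of t] by (simp add: \<omega>_def powr_mult algebra_simps)
      then show "\<omega> t * X t powr (-2) = a * 2 powr (1/p) * X t powr (-(2 - 1/p)) + b * 2 powr s * X t powr (-(2 - s))"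
        unfolding e .
    qed simp
    also have "\<dots> = a * 2 powr (1/p) * (\<integral>t. X t powr (-(2 - 1/p)) \<partial>circ) + b * 2 powr s * (\<integral>t. X t powr (-(2 - s)) \<partial>circ)"
      by (subst Bochner_Integration.integral_add) (auto intro!: integrable_circ_cont continuous_on_mult continuous_on_const cXp)
    also have "\<dots> \<le> a * 2 * (c (1/p) * (1 - \<rho>) powr (1/p - 1)) + b * 2 * (c s * (1 - \<rho>) powr (s - 1))"
    proof -
      have h: "(\<integral>t. X t powr (-(2 - e)) \<partial>circ) \<le> c e * (1 - \<rho>) powr (e - 1)" if "e < 1" for e
        using integral_one_minus_cis[OF \<rho>, of "2 - e"] that by (simp add: Xeq c_def)
      have h2: "(2::real) powr e \<le> 2" if "e < 1" for e using powr_mono[of e 1 2] that by simp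
      show ?thesis using ab
        by (intro add_mono mult_mono h[OF p1(1)] h[OF s(2)] h2[OF p1(1)] h2[OF s(2)]) (auto intro!: integral_nonneg_AE)
    qed
    also have "\<dots> \<le> C * (a * (1 - \<rho>) powr (1/p - 1) + b * (1 - \<rho>) powr (s - 1))"
    proof -
      have "c (1/p) * (a * (1 - \<rho>) powr (1/p - 1)) \<le> max (c (1/p)) (c s) * (a * (1 - \<rho>) powr (1/p - 1))"
        "c s * (b * (1 - \<rho>) powr (s - 1)) \<le> max (c (1/p)) (c s) * (b * (1 - \<rho>) powr (s - 1))"
        using ab by (intro mult_right_mono; simp)+
      then show ?thesis unfolding C_def by (simp add: algebra_simps)
    qed
    finally show "R * \<rho> * Mp p (R * \<rho>) (deriv f) \<le> C * (a * (1 - \<rho>) powr (1/p - 1) + b * (1 - \<rho>) powr (s - 1))"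
      using 1 by simp
  qed
qed

lemma chord_lower:
  assumes "\<bar>t\<bar> \<le> pi"
  shows "\<bar>t\<bar> \<le> 2 * norm (1 - cis t)"
proof -
  have "(norm (1 - cis t))\<^sup>2 = (1 - cos t)\<^sup>2 + (sin t)\<^sup>2" by (simp add: cmod_power2)
  also have "\<dots> = 2 - 2 * cos t" by (simp add: sin_squared_eq power2_eq_square algebra_simps)
  also have "\<dots> = (2 * sin (\<bar>t\<bar> / 2))\<^sup>2"
    using cos_double_sin[of "\<bar>t\<bar> / 2"] by (simp add: power_mult_distrib)
  finally have e: "(norm (1 - cis t))\<^sup>2 = (2 * sin (\<bar>t\<bar> / 2))\<^sup>2" .
  have "\<bar>t\<bar> / pi \<le> sin (\<bar>t\<bar> / 2)" using sin_half_lower[of "\<bar>t\<bar>"] assms by (simp add: min_def split: if_splits)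
  moreover have "\<bar>t\<bar> / 4 \<le> \<bar>t\<bar> / pi" using pi_less_4 by (intro divide_left_mono) auto
  ultimately have "\<bar>t\<bar> / 4 \<le> sin (\<bar>t\<bar> / 2)" by (rule order_trans[rotated])
  then have "(\<bar>t\<bar> / 2)\<^sup>2 \<le> (2 * sin (\<bar>t\<bar> / 2))\<^sup>2" by (intro power_mono) auto
  then have "(\<bar>t\<bar> / 2)\<^sup>2 \<le> (norm (1 - cis t))\<^sup>2" unfolding e .
  then have "\<bar>t\<bar> / 2 \<le> norm (1 - cis t)" by (rule power2_le_imp_le) simp
  then show ?thesis by simp
qed

text \<open>Differentiation of f(e^w z) at w = 0, with w running through purely imaginary
  values.\<close>

lemma rot_diff_quotient:
  assumes f: "f \<in> Hol" and z: "norm z < 1" and t: "t \<longlonglongrightarrow> 0" "\<And>n. t n > 0"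
  shows "(\<lambda>n. norm (rot_diff f (t n) z) / t n) \<longlonglongrightarrow> norm (z * deriv f z)"
proof -
  have "(f has_field_derivative deriv f (exp 0 * z)) (at (exp 0 * z))"
    using f z by (intro holomorphic_derivI[of f "ball 0 1"]) (auto simp: Hol_def)
  moreover have "((\<lambda>w. exp w * z) has_field_derivative z) (at 0)" by (auto intro!: derivative_eq_intros)
  ultimately have "((\<lambda>w. f (exp w * z)) has_field_derivative deriv f (exp 0 * z) * z) (at 0)"
    by (rule DERIV_chain2)
  then have "((\<lambda>w. (f (exp w * z) - f z) / w) \<longlongrightarrow> deriv f z * z) (at 0)"
    by (simp add: has_field_derivative_iff)
  moreover have "filterlim (\<lambda>n. \<i> * of_real (t n)) (at 0) sequentially"
  proof -
    have "(\<lambda>n. complex_of_real (t n)) \<longlonglongrightarrow> 0" using tendsto_of_real[OF t(1), where 'a = complex] by simp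
    from tendsto_mult_right_zero[OF this, of \<i>] show ?thesis
      using t(2) by (auto simp: filterlim_at less_imp_neq[symmetric])
  qed
  ultimately have "(\<lambda>n. (f (exp (\<i> * of_real (t n)) * z) - f z) / (\<i> * of_real (t n))) \<longlonglongrightarrow> deriv f z * z"
    by (rule filterlim_compose)
  then have "(\<lambda>n. norm ((f (exp (\<i> * of_real (t n)) * z) - f z) / (\<i> * of_real (t n)))) \<longlonglongrightarrow> norm (deriv f z * z)"
    by (rule tendsto_norm)
  moreover have "norm ((f (exp (\<i> * of_real (t n)) * z) - f z) / (\<i> * of_real (t n))) = norm (rot_diff f (t n) z) / t n" for n
    using t(2)[of n] by (simp add: rot_diff_def cis_conv_exp norm_divide norm_mult)
  ultimately show ?thesis by (simp add: mult.commute)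
qed

text \<open>For p = 1 the Lipschitz exponent is 1 and the kernel method would integrate |1 - \<rho>
  e^(it)|^(-1), losing a logarithm. Instead z f' is the limit of difference quotients under
  rotation, and Fatou's lemma gives the bound without loss.\<close>

lemma Mp1_deriv_le:
  assumes f: "f \<in> Hol" and r: "0 \<le> r" "r < 1" and C: "0 \<le> C" "0 < \<delta>"
    and H: "\<And>t. 0 < t \<Longrightarrow> t < \<delta> \<Longrightarrow> Mp 1 r (rot_diff f t) \<le> C * t"
  shows "r * Mp 1 r (deriv f) \<le> C"
proof -
  define t where "t n = \<delta> / real (n + 2)" for n
  have t: "0 < t n" "t n < \<delta>" for n using C by (simp_all add: t_def field_simps add_pos_nonneg)
  have t0: "t \<longlonglongrightarrow> 0" unfolding t_def by (rule LIMSEQ_ignore_initial_segment) (rule lim_const_over_n)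
  have Hd: "(\<lambda>z. z * deriv f z) \<in> Hol" by (intro Hol_id_mult Hol_deriv f)
  have nn: "(\<integral>\<^sup>+\<theta>. ennreal (norm (g (of_real r * cis \<theta>)) / e) \<partial>circ) = ennreal (Mp 1 r g / e)" if g: "g \<in> Hol" and e: "e > 0" for g e
  proof -
    have "(\<integral>\<^sup>+\<theta>. ennreal (norm (g (of_real r * cis \<theta>)) / e) \<partial>circ) = ennreal (\<integral>\<theta>. norm (g (of_real r * cis \<theta>)) / e \<partial>circ)"
      using e r g by (intro nn_integral_eq_integral integrable_circ_cont continuous_intros Hol_cont_circle) auto
    then show ?thesis using g r by (simp add: Mp_eq_Lc Lc_def integral_nonneg)
  qed
  have [measurable]: "(\<lambda>\<theta>. rot_diff f s (of_real r * cis \<theta>)) \<in> borel_measurable borel" for s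
    by (intro borel_measurable_continuous_onI Hol_cont_circle rot_diff_Hol f r)
  have "ennreal (Mp 1 r (\<lambda>z. z * deriv f z)) = (\<integral>\<^sup>+\<theta>. ennreal (norm (of_real r * cis \<theta> * deriv f (of_real r * cis \<theta>))) \<partial>circ)"
    using nn[OF Hd, of 1] by simp
  also have "\<dots> = (\<integral>\<^sup>+\<theta>. liminf (\<lambda>n. ennreal (norm (rot_diff f (t n) (of_real r * cis \<theta>)) / t n)) \<partial>circ)"
  proof (rule nn_integral_cong)
    fix \<theta>
    have "norm (of_real r * cis \<theta>) < 1" using r by (simp add: norm_mult)
    from tendsto_ennrealI[OF rot_diff_quotient[OF f this t0 t(1)]]
    show "ennreal (norm (of_real r * cis \<theta> * deriv f (of_real r * cis \<theta>))) = liminf (\<lambda>n. ennreal (norm (rot_diff f (t n) (of_real r * cis \<theta>)) / t n))"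
      by (intro lim_imp_Liminf[symmetric]) auto
  qed
  also have "\<dots> \<le> liminf (\<lambda>n. \<integral>\<^sup>+\<theta>. ennreal (norm (rot_diff f (t n) (of_real r * cis \<theta>)) / t n) \<partial>circ)"
    by (rule nn_integral_liminf) measurable
  also have "\<dots> \<le> liminf (\<lambda>n. ennreal C)"
  proof (intro Liminf_mono always_eventually allI)
    fix n
    have "Mp 1 r (rot_diff f (t n)) / t n \<le> C" using H[OF t, of n] t(1)[of n] by (simp add: field_simps)
    then show "(\<integral>\<^sup>+\<theta>. ennreal (norm (rot_diff f (t n) (of_real r * cis \<theta>)) / t n) \<partial>circ) \<le> ennreal C"
      unfolding nn[OF rot_diff_Hol[OF f] t(1)] by (rule ennreal_leI)
  qed
  finally have "Mp 1 r (\<lambda>z. z * deriv f z) \<le> C" using C by (simp add: Liminf_const)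
  then show ?thesis using r f by (simp add: Mp_id_mult Hol_deriv)
qed

lemma dyad_Suc_square: "1/2 \<le> dyad (Suc n)" "dyad n \<le> dyad (Suc n) * dyad (Suc n)"
proof -
  show "1/2 \<le> dyad (Suc n)" using dyad_mono[of 1 "Suc n"] by (simp add: dyad_def[of "Suc 0"])
  have "dyad (Suc n) * dyad (Suc n) = 1 - 2 * (1/2) ^ Suc n + (1/2) ^ Suc n * (1/2) ^ Suc n"
    by (simp add: dyad_def algebra_simps)
  also have "\<dots> \<ge> dyad n" by (simp add: dyad_def)
  finally show "dyad n \<le> dyad (Suc n) * dyad (Suc n)" .
qed

lemma one_minus_dyad: "1 - dyad n = 2 powr (- real n)"
  by (simp add: dyad_def powr_minus_divide powr_realpow power_one_over)

text \<open>K depends on p alone; \<delta> and M decide only from which n on the estimate holds.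
  Hence one fixed C yields boundedness of \<open>lip_seq\<close>, and arbitrarily small C yields
  convergence to 0.\<close>

lemma lip_seq_eventually_le:
  assumes p: "1 \<le> p"
  obtains K where "K > 0"
    "\<And>f M C \<delta>. f \<in> Hol \<Longrightarrow> (\<forall>R. 0 \<le> R \<longrightarrow> R < 1 \<longrightarrow> Mp p R f \<le> M) \<Longrightarrow> 0 < C \<Longrightarrow> 0 < \<delta> \<Longrightarrow>
      (\<forall>t R. t \<noteq> 0 \<longrightarrow> \<bar>t\<bar> < \<delta> \<longrightarrow> 0 \<le> R \<longrightarrow> R < 1 \<longrightarrow> Mp p R (rot_diff f t) \<le> C * \<bar>t\<bar> powr (1/p)) \<Longrightarrow>
      eventually (\<lambda>n. lip_seq p f n \<le> K * C) sequentially"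
proof (cases "p = 1")
  case True
  show ?thesis
  proof (rule that[of 2])
    fix f M C \<delta> assume f: "f \<in> Hol" and C: "0 < C" "0 < (\<delta>::real)"
      and H0: "\<forall>t R. t \<noteq> 0 \<longrightarrow> \<bar>t\<bar> < \<delta> \<longrightarrow> 0 \<le> R \<longrightarrow> R < 1 \<longrightarrow> Mp p R (rot_diff f t) \<le> C * \<bar>t\<bar> powr (1/p)"
    have H: "Mp p R (rot_diff f t) \<le> C * \<bar>t\<bar> powr (1/p)" if "t \<noteq> 0" "\<bar>t\<bar> < \<delta>" "0 \<le> R" "R < 1" for t R
      using H0 that by blast
    have "lip_seq p f n \<le> 2 * C" for n
    proof -
      have "Mp 1 (dyad n) (deriv f) \<le> Mp 1 (dyad (Suc n)) (deriv f)"
        by (intro Mp_mono Hol_deriv f) (auto intro: dyad_mono)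
      moreover have "1/2 * Mp 1 (dyad (Suc n)) (deriv f) \<le> dyad (Suc n) * Mp 1 (dyad (Suc n)) (deriv f)"
        by (intro mult_right_mono dyad_Suc_square) auto
      moreover have "dyad (Suc n) * Mp 1 (dyad (Suc n)) (deriv f) \<le> C"
      proof (rule Mp1_deriv_le[OF f, where \<delta> = \<delta>])
        show "Mp 1 (dyad (Suc n)) (rot_diff f t) \<le> C * t" if "0 < t" "t < \<delta>" for t
          using H[of t "dyad (Suc n)"] that True by simp
      qed (use C in auto)
      ultimately show ?thesis by (simp add: lip_seq_def True)
    qed
    then show "eventually (\<lambda>n. lip_seq p f n \<le> 2 * C) sequentially" by simp
  qed simp
next
  case False
  then have p1: "1 < p" using p by simp
  \<comment> \<open>Any exponent strictly between 1/p and 1 would do; this is the midpoint.\<close>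
  define s where "s = (1 + 1/p) / 2"
  have s: "1/p < s" "s < 1" "0 < s" using p1 by (auto simp: s_def field_simps)
  obtain C1 where C1: "C1 > 0"
    "\<And>f a b R \<rho>. f \<in> Hol \<Longrightarrow> 0 < a \<Longrightarrow> 0 \<le> b \<Longrightarrow> 0 \<le> R \<Longrightarrow> R < 1 \<Longrightarrow> 0 \<le> \<rho> \<Longrightarrow> \<rho> < 1 \<Longrightarrow>
      (\<forall>t. Mp p R (rot_diff f t) \<le> a * norm (1 - cis t) powr (1/p) + b * norm (1 - cis t) powr s) \<Longrightarrow>
      R * \<rho> * Mp p (R * \<rho>) (deriv f) \<le> C1 * (a * (1 - \<rho>) powr (1/p - 1) + b * (1 - \<rho>) powr (s - 1))"
    by (rule Hardy_Littlewood_kernel[OF p1 s(1,2)]) (rule that)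
  show ?thesis
  \<comment> \<open>The factor 4 removes r^2 \<ge> 1/4; the bracket is 4 C from the main term,
    doubled by the index shift, and 2 C allowed for the vanishing term.\<close>
  proof (rule that[of "24 * C1"])
    fix f M C \<delta> assume f: "f \<in> Hol" and M0: "\<forall>R. 0 \<le> R \<longrightarrow> R < 1 \<longrightarrow> Mp p R f \<le> M" and C: "0 < C" "0 < (\<delta>::real)"
      and H0: "\<forall>t R. t \<noteq> 0 \<longrightarrow> \<bar>t\<bar> < \<delta> \<longrightarrow> 0 \<le> R \<longrightarrow> R < 1 \<longrightarrow> Mp p R (rot_diff f t) \<le> C * \<bar>t\<bar> powr (1/p)"
    have H: "Mp p R (rot_diff f t) \<le> C * \<bar>t\<bar> powr (1/p)" if "t \<noteq> 0" "\<bar>t\<bar> < \<delta>" "0 \<le> R" "R < 1" for t R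
      using H0 that by blast
    have M: "Mp p R f \<le> M" if "0 \<le> R" "R < 1" for R using M0 that by blast
    have M0: "0 \<le> M" using M[of 0] Mp_nonneg[of p 0 f] by linarith
    \<comment> \<open>Calibrated for angles beyond \<delta>: there twice the chord is at least
      \<delta>, so the trivial bound 2 M is at most b times the s-th power of the chord.\<close>
    define b where "b = 2 * M * (2 / \<delta>) powr s"
    have b: "0 \<le> b" using M0 by (simp add: b_def)
    have mod: "Mp p R (rot_diff f t) \<le> (2 * C) * norm (1 - cis t) powr (1/p) + b * norm (1 - cis t) powr s"
      if R: "0 \<le> R" "R < 1" for R t
    proof -
      \<comment> \<open>The representative of t in [-pi, pi], where the angle is at most twice the
        chord.\<close>
      define t' where "t' = Arg (cis t)"
      have ct: "cis t' = cis t" unfolding t'_def using cis_Arg[of "cis t"] by (simp add: sgn_eq)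
      have t': "\<bar>t'\<bar> \<le> pi" using Arg_bounded[of "cis t"] by (auto simp: t'_def)
      have rd: "rot_diff f t = rot_diff f t'" by (simp add: rot_diff_def[abs_def] ct)
      define e where "e = norm (1 - cis t)"
      have e: "\<bar>t'\<bar> \<le> 2 * e" "0 \<le> e" using chord_lower[OF t'] by (auto simp: e_def ct)
      have nn: "0 \<le> (2 * C) * e powr (1/p)" "0 \<le> b * e powr s" using C b by auto
      consider "t' = 0" | "t' \<noteq> 0" "\<bar>t'\<bar> < \<delta>" | "\<delta> \<le> \<bar>t'\<bar>" by linarith
      then have "Mp p R (rot_diff f t') \<le> (2 * C) * e powr (1/p) + b * e powr s"
      proof cases
        case 1
        then have "Mp p R (rot_diff f t') = 0" by (simp add: rot_diff_def Mp_def)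
        then show ?thesis using nn by simp
      next
        case 2
        have "Mp p R (rot_diff f t') \<le> C * \<bar>t'\<bar> powr (1/p)" by (rule H[OF 2 R])
        also have "\<dots> \<le> C * (2 * e) powr (1/p)" using C e p by (intro mult_left_mono powr_mono2) auto
        also have "\<dots> = C * (2 powr (1/p) * e powr (1/p))" using e by (simp add: powr_mult)
        also have "\<dots> \<le> C * (2 * e powr (1/p))"
          using C powr_mono[of "1/p" 1 2] p by (intro mult_left_mono mult_right_mono) auto
        finally show ?thesis using nn by simp
      next
        case 3
        have "Mp p R (rot_diff f t') \<le> 2 * M" using order_trans[OF Mp_rot_diff_le[OF f p R] mult_left_mono[OF M[OF R]]] by simp
        also have "\<dots> = 2 * M * 1" by simp
        also have "\<dots> \<le> 2 * M * (2 / \<delta> * e) powr s"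
          using M0 3 e C s by (intro mult_left_mono ge_one_powr_ge_zero) (auto simp: field_simps)
        also have "\<dots> = b * e powr s" using e C unfolding b_def by (subst powr_mult) auto
        finally show ?thesis using nn by simp
      qed
      then show ?thesis by (simp add: rd e_def)
    qed
    have le: "lip_seq p f n \<le> 4 * C1 * (4 * C + 2 * b * 2 powr (- (real n * (s - 1/p))))" for n
    proof -
      define r where "r = dyad (Suc n)"
      have r: "0 \<le> r" "r < 1" "1/2 \<le> r" "dyad n \<le> r * r" "1 - r = 2 powr (- real (Suc n))"
        using dyad_Suc_square[of n] by (auto simp: r_def one_minus_dyad)
      have rr: "r * r < 1" "1/4 \<le> r * r" using r mult_mono[of "1/2" r "1/2" r]
        by (auto simp: mult_strict_mono'[of r 1 r 1, simplified])
      have "1/4 * Mp p (dyad n) (deriv f) \<le> r * r * Mp p (r * r) (deriv f)"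
        using r rr p by (intro mult_mono Mp_mono Hol_deriv f) auto
      also have "\<dots> \<le> C1 * (2 * C * (1 - r) powr (1/p - 1) + b * (1 - r) powr (s - 1))"
        using mod C b r by (intro C1(2) f) auto
      also have "\<dots> = C1 * (2 * C * 2 powr (real (Suc n) * (1 - 1/p)) + b * 2 powr (real (Suc n) * (1 - s)))"
      proof -
        have e: "(1 - r) powr (x - 1) = 2 powr (real (Suc n) * (1 - x))" for x
          unfolding r powr_powr by (simp add: algebra_simps)
        show ?thesis by (simp only: e)
      qed
      finally have "Mp p (dyad n) (deriv f) \<le> 4 * C1 * (2 * C * 2 powr (real (Suc n) * (1 - 1/p)) + b * 2 powr (real (Suc n) * (1 - s)))"
        by simp
      then have "lip_seq p f n \<le> 2 powr (-(real n * (1 - 1/p))) * (4 * C1 * (2 * C * 2 powr (real (Suc n) * (1 - 1/p)) + b * 2 powr (real (Suc n) * (1 - s))))"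
        unfolding lip_seq_def by (intro mult_left_mono) auto
      also have "\<dots> = 4 * C1 * (2 * C * (2 powr (-(real n * (1 - 1/p)) + real (Suc n) * (1 - 1/p))) + b * (2 powr (-(real n * (1 - 1/p)) + real (Suc n) * (1 - s))))"
        unfolding powr_add by (simp add: algebra_simps)
      also have "-(real n * (1 - 1/p)) + real (Suc n) * (1 - 1/p) = 1 - 1/p" by (simp add: algebra_simps)
      also have "-(real n * (1 - 1/p)) + real (Suc n) * (1 - s) = (1 - s) + -(real n * (s - 1/p))" by (simp add: algebra_simps)
      also have "4 * C1 * (2 * C * 2 powr (1 - 1/p) + b * 2 powr ((1 - s) + -(real n * (s - 1/p)))) \<le> 4 * C1 * (2 * C * 2 + b * (2 * 2 powr (-(real n * (s - 1/p)))))"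
        unfolding powr_add using C1 C b p s powr_mono[of "1 - 1/p" 1 2] powr_mono[of "1 - s" 1 2]
        by (intro mult_left_mono add_mono mult_right_mono) auto
      finally show ?thesis by (simp add: mult_ac)
    qed
    have "(\<lambda>n. (2 powr (- (s - 1/p))) ^ n) \<longlonglongrightarrow> 0"
      using s powr_less_mono[of "-(s - 1/p)" 0 2] by (intro LIMSEQ_realpow_zero) auto
    then have "(\<lambda>n. 2 powr (- (real n * (s - 1/p)))) \<longlonglongrightarrow> 0"
    proof -
      have "(2 powr (- (s - 1/p))) ^ n = 2 powr (- (real n * (s - 1/p)))" for n
        by (subst powr_realpow[symmetric]) (simp_all add: powr_powr algebra_simps)
      then show ?thesis using \<open>(\<lambda>n. (2 powr (- (s - 1/p))) ^ n) \<longlonglongrightarrow> 0\<close> by simp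
    qed
    then have "(\<lambda>n. 2 * b * 2 powr (- (real n * (s - 1/p)))) \<longlonglongrightarrow> 0" by (rule tendsto_mult_right_zero)
    then have "eventually (\<lambda>n. 2 * b * 2 powr (- (real n * (s - 1/p))) < 2 * C) sequentially"
      by (rule order_tendstoD(2)) (use C in auto)
    then show "eventually (\<lambda>n. lip_seq p f n \<le> 24 * C1 * C) sequentially"
    proof eventually_elim
      case (elim n)
      have "4 * C1 * (4 * C + 2 * b * 2 powr (- (real n * (s - 1/p)))) \<le> 4 * C1 * (4 * C + 2 * C)"
        using elim C1 by (intro mult_left_mono) auto
      then show ?case using le[of n] by simp
    qed
  qed (use C1 in simp)
qed

lemma mean_modulus_eventually:
  assumes f: "f \<in> Hardy p" "has_boundary_values f" and p: "1 \<le> p"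
    and ev: "eventually (\<lambda>\<delta>. norm (mean_modulus p \<delta> f) \<le> C * norm (\<delta> powr (1/p))) (at_right 0)"
  obtains \<delta> where "0 < \<delta>"
    "\<And>t R. t \<noteq> 0 \<Longrightarrow> \<bar>t\<bar> < \<delta> \<Longrightarrow> 0 \<le> R \<Longrightarrow> R < 1 \<Longrightarrow> Mp p R (rot_diff f t) \<le> C * \<bar>t\<bar> powr (1/p)"
proof -
  from ev obtain \<delta> where d: "0 < \<delta>" "\<And>x. 0 < x \<Longrightarrow> x < \<delta> \<Longrightarrow> norm (mean_modulus p x f) \<le> C * norm (x powr (1/p))"
    by (auto simp: eventually_at_right[of 0 1])
  show ?thesis
  proof (rule that[OF d(1)])
    fix t R :: real assume t: "t \<noteq> 0" "\<bar>t\<bar> < \<delta>" and R: "0 \<le> R" "R < 1"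
    have "Mp p R (rot_diff f t) \<le> mean_modulus p \<bar>t\<bar> f"
      by (rule mean_modulus_controls[OF f p t(1) order_refl R])
    also have "\<dots> \<le> C * \<bar>t\<bar> powr (1/p)" using d(2)[of "\<bar>t\<bar>"] t by simp
    finally show "Mp p R (rot_diff f t) \<le> C * \<bar>t\<bar> powr (1/p)" .
  qed
qed

lemma mean_Lipschitz_lip_seq_bounded:
  assumes f: "f \<in> mean_Lipschitz p (1/p)" and p: "1 \<le> p"
  obtains A where "\<And>n. lip_seq p f n \<le> A"
proof -
  have H: "f \<in> Hardy p" "has_boundary_values f" using f by (auto simp: mean_Lipschitz_def)
  have fH: "f \<in> Hol" using H by (simp add: Hardy_def)
  obtain M where M: "\<And>r. 0 \<le> r \<Longrightarrow> r < 1 \<Longrightarrow> Mp p r f \<le> M" using Hardy_bound[OF H(1) p] by blast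
  obtain K where K: "K > 0"
    "\<And>f M C \<delta>. f \<in> Hol \<Longrightarrow> (\<forall>R. 0 \<le> R \<longrightarrow> R < 1 \<longrightarrow> Mp p R f \<le> M) \<Longrightarrow> 0 < C \<Longrightarrow> 0 < \<delta> \<Longrightarrow>
      (\<forall>t R. t \<noteq> 0 \<longrightarrow> \<bar>t\<bar> < \<delta> \<longrightarrow> 0 \<le> R \<longrightarrow> R < 1 \<longrightarrow> Mp p R (rot_diff f t) \<le> C * \<bar>t\<bar> powr (1/p)) \<Longrightarrow>
      eventually (\<lambda>n. lip_seq p f n \<le> K * C) sequentially"
    by (rule lip_seq_eventually_le[OF p]) (rule that)
  have "(\<lambda>\<delta>. mean_modulus p \<delta> f) \<in> O[at_right 0](\<lambda>\<delta>. \<delta> powr (1/p))" using f by (simp add: mean_Lipschitz_def)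
  then obtain C where C: "C > 0" "eventually (\<lambda>\<delta>. norm (mean_modulus p \<delta> f) \<le> C * norm (\<delta> powr (1/p))) (at_right 0)"
    by (rule landau_o.bigE)
  obtain \<delta> where d: "0 < \<delta>"
    "\<And>t R. t \<noteq> 0 \<Longrightarrow> \<bar>t\<bar> < \<delta> \<Longrightarrow> 0 \<le> R \<Longrightarrow> R < 1 \<Longrightarrow> Mp p R (rot_diff f t) \<le> C * \<bar>t\<bar> powr (1/p)"
    by (rule mean_modulus_eventually[OF H p C(2)]) (rule that)
  have "eventually (\<lambda>n. norm (lip_seq p f n) \<le> K * C) sequentially"
    using K(2)[of f M C \<delta>] fH M C(1) d by simp
  then have "Bseq (lip_seq p f)" by (rule BfunI)
  then obtain A where "\<And>n. norm (lip_seq p f n) \<le> A" by (rule BseqE) blast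
  then show ?thesis using that[of A] by simp
qed

lemma little_mean_Lipschitz_lip_seq:
  assumes f: "f \<in> little_mean_Lipschitz p (1/p)" and p: "1 \<le> p"
  shows "lip_seq p f \<longlonglongrightarrow> 0"
proof -
  have H: "f \<in> Hardy p" "has_boundary_values f" using f by (auto simp: little_mean_Lipschitz_def)
  have fH: "f \<in> Hol" using H by (simp add: Hardy_def)
  obtain M where M: "\<And>r. 0 \<le> r \<Longrightarrow> r < 1 \<Longrightarrow> Mp p r f \<le> M" using Hardy_bound[OF H(1) p] by blast
  obtain K where K: "K > 0"
    "\<And>f M C \<delta>. f \<in> Hol \<Longrightarrow> (\<forall>R. 0 \<le> R \<longrightarrow> R < 1 \<longrightarrow> Mp p R f \<le> M) \<Longrightarrow> 0 < C \<Longrightarrow> 0 < \<delta> \<Longrightarrow>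
      (\<forall>t R. t \<noteq> 0 \<longrightarrow> \<bar>t\<bar> < \<delta> \<longrightarrow> 0 \<le> R \<longrightarrow> R < 1 \<longrightarrow> Mp p R (rot_diff f t) \<le> C * \<bar>t\<bar> powr (1/p)) \<Longrightarrow>
      eventually (\<lambda>n. lip_seq p f n \<le> K * C) sequentially"
    by (rule lip_seq_eventually_le[OF p]) (rule that)
  have o: "(\<lambda>\<delta>. mean_modulus p \<delta> f) \<in> o[at_right 0](\<lambda>\<delta>. \<delta> powr (1/p))" using f by (simp add: little_mean_Lipschitz_def)
  show ?thesis
  proof (rule tendstoI)
    fix e :: real assume e: "e > 0"
    define C where "C = e / (2 * K)"
    have C: "C > 0" using e K by (simp add: C_def)
    have ev: "eventually (\<lambda>\<delta>. norm (mean_modulus p \<delta> f) \<le> C * norm (\<delta> powr (1/p))) (at_right 0)"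
      using landau_o.smallD[OF o C] .
    obtain \<delta> where d: "0 < \<delta>"
      "\<And>t R. t \<noteq> 0 \<Longrightarrow> \<bar>t\<bar> < \<delta> \<Longrightarrow> 0 \<le> R \<Longrightarrow> R < 1 \<Longrightarrow> Mp p R (rot_diff f t) \<le> C * \<bar>t\<bar> powr (1/p)"
      by (rule mean_modulus_eventually[OF H p ev]) (rule that)
    have "K * C < e" using K e by (simp add: C_def)
    then show "eventually (\<lambda>n. dist (lip_seq p f n) 0 < e) sequentially"
      using K(2)[of f M C \<delta>] fH M C d by (auto elim!: eventually_mono)
  qed
qed

section \<open>Test functions\<close>

lemma taylor_coeff_one: "taylor_coeff (\<lambda>_. 1) n = (if n = 0 then 1 else 0)"
proof (rule Hol_coeff_unique(2))
  fix z :: complex assume "norm z < 1"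
  have "(\<lambda>n. if n = 0 then z ^ n else 0) sums (z ^ 0)" by (rule sums_single)
  then show "(\<lambda>n. (if n = 0 then 1 else 0) * z ^ n) sums 1" by (simp add: if_distrib[of "\<lambda>x. x * _"] cong: if_cong)
qed

lemma Dirichlet_const: "(\<lambda>_. c) \<in> Dirichlet p \<alpha>"
  by (simp add: Dirichlet_def)

text \<open>The constant 1 belongs to the space, all its partial sums are 1, and its image is the
  series of \<eta> itself.\<close>

lemma Rhaly_well_defined_converges:
  assumes "Rhaly_well_defined_on \<eta> (Dirichlet p \<alpha>)"
  shows "converges_in_disc \<eta>"
proof -
  have "converges_in_disc (Rhaly_coeff \<eta> (\<lambda>_. 1))"
    using assms Dirichlet_const[of 1 p \<alpha>] by (simp add: Rhaly_well_defined_on_def)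
  moreover have "Rhaly_coeff \<eta> (\<lambda>_. 1) = \<eta>"
    by (rule ext) (simp add: Rhaly_coeff_def taylor_coeff_one)
  ultimately show ?thesis by simp
qed

lemma Rhaly_bounded_dnorm:
  assumes p: "1 \<le> p" and \<alpha>: "-1 < \<alpha>" and b: "Rhaly_bounded_Dirichlet \<eta> p \<alpha>"
  obtains K where "K > 0" "\<And>f. f \<in> Dirichlet p \<alpha> \<Longrightarrow> Rhaly \<eta> f \<in> Dirichlet p \<alpha>"
    "\<And>f. f \<in> Dirichlet p \<alpha> \<Longrightarrow> dnorm p \<alpha> (Rhaly \<eta> f) \<le> K * dnorm p \<alpha> f"
proof -
  obtain c C where cC: "c > 0" "C > 0"
    "\<And>f. f \<in> Dirichlet p \<alpha> \<Longrightarrow> c * dnorm p \<alpha> f \<le> Dirichlet_norm p \<alpha> f"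
    "\<And>f. f \<in> Dirichlet p \<alpha> \<Longrightarrow> Dirichlet_norm p \<alpha> f \<le> C * dnorm p \<alpha> f"
    by (rule Dirichlet_norm_equiv[OF p \<alpha>]) (rule that)
  have R: "\<And>f. f \<in> Dirichlet p \<alpha> \<Longrightarrow> Rhaly \<eta> f \<in> Dirichlet p \<alpha>"
    using b by (auto simp: Rhaly_bounded_Dirichlet_def bounded_operator_on_def linear_operator_on_def)
  from b obtain K where K: "\<And>f. f \<in> Dirichlet p \<alpha> \<Longrightarrow> Dirichlet_norm p \<alpha> (Rhaly \<eta> f) \<le> K * Dirichlet_norm p \<alpha> f"
    unfolding Rhaly_bounded_Dirichlet_def bounded_operator_on_def by blast
  have "dnorm p \<alpha> (Rhaly \<eta> f) \<le> (max K 0 + 1) * C / c * dnorm p \<alpha> f" if f: "f \<in> Dirichlet p \<alpha>" for f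
  proof -
    have "c * dnorm p \<alpha> (Rhaly \<eta> f) \<le> K * Dirichlet_norm p \<alpha> f" using cC(3)[OF R[OF f]] K[OF f] by simp
    also have "\<dots> \<le> (max K 0 + 1) * Dirichlet_norm p \<alpha> f" by (intro mult_right_mono) (auto simp: Dirichlet_norm_def)
    also have "\<dots> \<le> (max K 0 + 1) * (C * dnorm p \<alpha> f)" by (intro mult_left_mono cC f) auto
    finally show ?thesis using cC by (simp add: field_simps)
  qed
  moreover have "(max K 0 + 1) * C / c > 0" using cC by (intro divide_pos_pos mult_pos_pos) auto
  ultimately show ?thesis using that R by blast
qed

lemma Rhaly_compact_dnorm:
  assumes p: "1 \<le> p" and \<alpha>: "-1 < \<alpha>" and cp: "Rhaly_compact_Dirichlet \<eta> p \<alpha>"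
    and f: "\<And>n. f n \<in> Dirichlet p \<alpha>" and B: "\<And>n. dnorm p \<alpha> (f n) \<le> B"
  obtains g s where "g \<in> Dirichlet p \<alpha>" "strict_mono (s :: nat \<Rightarrow> nat)" "\<And>f. f \<in> Dirichlet p \<alpha> \<Longrightarrow> Rhaly \<eta> f \<in> Dirichlet p \<alpha>"
    "(\<lambda>n. dnorm p \<alpha> (\<lambda>z. Rhaly \<eta> (f (s n)) z - g z)) \<longlonglongrightarrow> 0"
proof -
  obtain c C where cC: "c > 0" "C > 0"
    "\<And>f. f \<in> Dirichlet p \<alpha> \<Longrightarrow> c * dnorm p \<alpha> f \<le> Dirichlet_norm p \<alpha> f"
    "\<And>f. f \<in> Dirichlet p \<alpha> \<Longrightarrow> Dirichlet_norm p \<alpha> f \<le> C * dnorm p \<alpha> f"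
    by (rule Dirichlet_norm_equiv[OF p \<alpha>]) (rule that)
  have R: "\<And>f. f \<in> Dirichlet p \<alpha> \<Longrightarrow> Rhaly \<eta> f \<in> Dirichlet p \<alpha>"
    using cp by (auto simp: Rhaly_compact_Dirichlet_def compact_operator_on_def linear_operator_on_def)
  have "Dirichlet_norm p \<alpha> (f n) \<le> C * B" for n
    using order_trans[OF cC(4)[OF f[of n]] mult_left_mono[OF B[of n]]] cC by simp
  then obtain g s where g: "g \<in> Dirichlet p \<alpha>" and s: "strict_mono (s :: nat \<Rightarrow> nat)"
    and lim: "(\<lambda>n. Dirichlet_norm p \<alpha> (\<lambda>z. Rhaly \<eta> (f (s n)) z - g z)) \<longlonglongrightarrow> 0"
    using cp f unfolding Rhaly_compact_Dirichlet_def compact_operator_on_def by blast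
  have "norm (dnorm p \<alpha> (\<lambda>z. Rhaly \<eta> (f (s n)) z - g z)) \<le> (1 / c) * Dirichlet_norm p \<alpha> (\<lambda>z. Rhaly \<eta> (f (s n)) z - g z)" for n
    using cC(3)[OF Dirichlet_diff[OF p \<alpha> R[OF f] g], of "s n"] cC(1) by (simp add: field_simps)
  then have "(\<lambda>n. dnorm p \<alpha> (\<lambda>z. Rhaly \<eta> (f (s n)) z - g z)) \<longlonglongrightarrow> 0"
    by (intro Lim_null_comparison[OF always_eventually tendsto_mult_right_zero[OF lim]] allI)
  then show ?thesis using that g s R by blast
qed

text \<open>Were the operator unbounded, there would be f n with image larger than n + 1 times f n.
  Rescaled so that the image has norm exactly n + 1, they stay in the unit ball, yet no subsequence
  of images can converge.\<close>

lemma Rhaly_compact_bounded_dnorm: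
  assumes p: "1 \<le> p" and \<alpha>: "-1 < \<alpha>" and cp: "Rhaly_compact_Dirichlet \<eta> p \<alpha>"
  obtains K where "K > 0" "\<And>f. f \<in> Dirichlet p \<alpha> \<Longrightarrow> Rhaly \<eta> f \<in> Dirichlet p \<alpha>"
    "\<And>f. f \<in> Dirichlet p \<alpha> \<Longrightarrow> dnorm p \<alpha> (Rhaly \<eta> f) \<le> K * dnorm p \<alpha> f"
proof (rule ccontr)
  assume no: "\<not> thesis"
  have R: "\<And>f. f \<in> Dirichlet p \<alpha> \<Longrightarrow> Rhaly \<eta> f \<in> Dirichlet p \<alpha>"
    using cp by (auto simp: Rhaly_compact_Dirichlet_def compact_operator_on_def linear_operator_on_def)
  have \<eta>: "converges_in_disc \<eta>" using cp Rhaly_well_defined_converges by (auto simp: Rhaly_compact_Dirichlet_def)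
  have "\<exists>f\<in>Dirichlet p \<alpha>. real (Suc n) * dnorm p \<alpha> f < dnorm p \<alpha> (Rhaly \<eta> f)" for n
  proof (rule ccontr)
    assume "\<not> (\<exists>f\<in>Dirichlet p \<alpha>. real (Suc n) * dnorm p \<alpha> f < dnorm p \<alpha> (Rhaly \<eta> f))"
    then have "\<And>f. f \<in> Dirichlet p \<alpha> \<Longrightarrow> dnorm p \<alpha> (Rhaly \<eta> f) \<le> real (Suc n) * dnorm p \<alpha> f" by force
    then show False using no that[of "real (Suc n)"] R by simp
  qed
  then obtain f where f: "\<And>n. f n \<in> Dirichlet p \<alpha>" "\<And>n. real (Suc n) * dnorm p \<alpha> (f n) < dnorm p \<alpha> (Rhaly \<eta> (f n))" by metis
  \<comment> \<open>Normalization is by the norm of the image, which is strictly positive, whereas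
    \<open>dnorm p \<alpha> (f n)\<close> could vanish.\<close>
  define a where "a n = dnorm p \<alpha> (Rhaly \<eta> (f n))" for n
  have a: "a n > 0" for n
  proof -
    have "0 \<le> real (Suc n) * dnorm p \<alpha> (f n)" by simp
    then show ?thesis using f(2)[of n] unfolding a_def by linarith
  qed
  define h where "h n z = of_real (real (Suc n) / a n) * f n z" for n and z :: complex
  have h: "h n \<in> Dirichlet p \<alpha>" for n unfolding h_def by (intro Dirichlet_cmult p \<alpha> f)
  have "dnorm p \<alpha> (h n) \<le> 1" for n
    unfolding h_def using f(2)[of n] a[of n] by (subst dnorm_cmult[OF p \<alpha> f(1)]) (simp add: a_def norm_divide field_simps del: of_nat_Suc)
  then obtain g s where g: "g \<in> Dirichlet p \<alpha>" and s: "strict_mono (s :: nat \<Rightarrow> nat)"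
    and lim: "(\<lambda>n. dnorm p \<alpha> (\<lambda>z. Rhaly \<eta> (h (s n)) z - g z)) \<longlonglongrightarrow> 0"
    by (rule Rhaly_compact_dnorm[OF p \<alpha> cp h]) (rule that)
  have Rh: "dnorm p \<alpha> (Rhaly \<eta> (h n)) = real (Suc n)" for n
  proof -
    have "dnorm p \<alpha> (Rhaly \<eta> (h n)) = dnorm p \<alpha> (\<lambda>z. of_real (real (Suc n) / a n) * Rhaly \<eta> (f n) z)"
      unfolding h_def by (rule dnorm_cong) (rule Rhaly_cmult[OF \<eta> Dirichlet_Hol[OF f(1)]])
    also have "\<dots> = real (Suc n)"
      using a[of n] by (subst dnorm_cmult[OF p \<alpha> R[OF f(1)]]) (simp add: a_def[symmetric] norm_divide del: of_nat_Suc)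
    finally show ?thesis .
  qed
  have "eventually (\<lambda>n. dnorm p \<alpha> (\<lambda>z. Rhaly \<eta> (h (s n)) z - g z) < 1) sequentially"
    using lim by (rule order_tendstoD(2)) simp
  moreover have "eventually (\<lambda>n. 4 * (1 + dnorm p \<alpha> g) < real n) sequentially"
    using filterlim_real_sequentially unfolding filterlim_at_top_dense by blast
  ultimately have "eventually (\<lambda>n::nat. False) sequentially"
  proof eventually_elim
    case (elim n)
    have "dnorm p \<alpha> (Rhaly \<eta> (h (s n))) = dnorm p \<alpha> (\<lambda>z. (Rhaly \<eta> (h (s n)) z - g z) + g z)" by simp
    also have "\<dots> \<le> 4 * (dnorm p \<alpha> (\<lambda>z. Rhaly \<eta> (h (s n)) z - g z) + dnorm p \<alpha> g)"
      by (intro dnorm_add p \<alpha> Dirichlet_diff R h g)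
    also have "\<dots> < 4 * (1 + dnorm p \<alpha> g)" using elim by simp
    finally have "real (Suc (s n)) < real n" using elim by (simp add: Rh del: of_nat_Suc)
    then show False using seq_suble[OF s, of n] by simp
  qed
  then show False by simp
qed

text \<open>For sequences with a peak at m and geometric decay on both sides the sum is comparable
  to the peak. Both families of test functions and the weights in the Lipschitz estimate have this
  shape.\<close>

lemma two_sided_geometric:
  fixes a :: "nat \<Rightarrow> real"
  assumes \<theta>: "0 < \<theta>" "\<theta> < 1" and a: "\<And>k. 0 \<le> a k" and B: "0 \<le> B"
    and le: "\<And>k. k \<le> m \<Longrightarrow> a k \<le> B * \<theta> ^ (m - k)" "\<And>k. m \<le> k \<Longrightarrow> a k \<le> B * \<theta> ^ (k - m)"
  shows "summable a" "(\<Sum>k. a k) \<le> 2 * B / (1 - \<theta>)"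
proof -
  have g: "summable (\<lambda>k. B * \<theta> ^ k)" using \<theta> by (intro summable_mult summable_geometric) simp
  have tl: "a (k + m) \<le> B * \<theta> ^ k" for k using le(2)[of "k + m"] by simp
  have st: "summable (\<lambda>k. a (k + m))" by (rule summable_comparison_test[OF _ g]) (use tl a in auto)
  then show s: "summable a" by (simp only: summable_iff_shift)
  have "(\<Sum>k. a (k + m)) \<le> (\<Sum>k. B * \<theta> ^ k)" by (rule suminf_le[OF tl st g])
  also have "\<dots> = B / (1 - \<theta>)" using \<theta> by (simp add: suminf_mult suminf_geometric summable_geometric)
  finally have 1: "(\<Sum>k. a (k + m)) \<le> B / (1 - \<theta>)" .
  have "(\<Sum>k<m. a k) \<le> (\<Sum>k<m. B * \<theta> ^ (m - k))" by (intro sum_mono le) auto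
  also have "\<dots> \<le> (\<Sum>k\<le>m. B * \<theta> ^ (m - k))" using \<theta> B by (intro sum_mono2) auto
  also have "\<dots> = (\<Sum>k\<le>m. B * \<theta> ^ k)"
    by (rule sum.reindex_bij_witness[of _ "\<lambda>k. m - k" "\<lambda>k. m - k"]) auto
  also have "\<dots> \<le> (\<Sum>k. B * \<theta> ^ k)" using \<theta> B by (intro sum_le_suminf g) auto
  also have "\<dots> = B / (1 - \<theta>)" using \<theta> by (simp add: suminf_mult suminf_geometric summable_geometric)
  finally have 2: "(\<Sum>k<m. a k) \<le> B / (1 - \<theta>)" .
  show "(\<Sum>k. a k) \<le> 2 * B / (1 - \<theta>)"
    unfolding suminf_split_initial_segment[OF s, of m] using add_mono[OF 1 2] by simp
qed

section \<open>Geometric test functions\<close>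

definition geom_fun :: "nat \<Rightarrow> complex \<Rightarrow> complex" where
  "geom_fun m z = 1 / (1 - of_real (dyad m) * z)"

lemma dyad_mult_norm: "norm (z::complex) < 1 \<Longrightarrow> norm (of_real (dyad m) * z) < 1"
  by (simp add: norm_mult mult_strict_mono'[of "dyad m" 1 "norm z" 1, simplified])

lemma one_minus_dyad_nonzero: "norm (z::complex) < 1 \<Longrightarrow> 1 - of_real (dyad m) * z \<noteq> 0"
  using dyad_mult_norm[of z m] by (metis eq_iff_diff_eq_0 norm_one order_less_irrefl)

lemma geom_fun_sums: "norm z < 1 \<Longrightarrow> (\<lambda>n. of_real (dyad m) ^ n * z ^ n) sums geom_fun m z"
  unfolding geom_fun_def power_mult_distrib[symmetric] by (intro geometric_sums dyad_mult_norm)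

lemma geom_fun_Hol: "geom_fun m \<in> Hol" "taylor_coeff (geom_fun m) n = of_real (dyad m) ^ n"
  using Hol_coeff_unique[OF geom_fun_sums] by auto

lemma deriv_geom_fun:
  assumes "norm z < 1"
  shows "deriv (geom_fun m) z = of_real (dyad m) / (1 - of_real (dyad m) * z)\<^sup>2"
  unfolding geom_fun_def[abs_def] using one_minus_dyad_nonzero[OF assms, of m]
  by (intro DERIV_imp_deriv) (auto intro!: derivative_eq_intros simp: power2_eq_square)

text \<open>The derivative at radius r_k has p-th mean of order at most 2^((2p - 1) min(m, k)). With
  the weight 2^(-k (\<alpha> + 1)) the bounds on the terms grow like 2^(k (2p - 2 - \<alpha>)) up to
  k = m and decay afterwards; the two conditions on \<alpha> are the positivity of these two
  rates.\<close>

lemma geom_fun_dnorm: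
  assumes p: "1 < p" and \<alpha>: "-1 < \<alpha>" "\<alpha> < 2 * p - 2"
  obtains C where "C > 0" "\<And>m. geom_fun m \<in> Dirichlet p \<alpha>"
    "\<And>m. dnorm p \<alpha> (geom_fun m) \<le> C * 2 powr (real m * (2 * p - 2 - \<alpha>) / p)"
proof -
  define e1 where "e1 = \<alpha> + 1"
  define e2 where "e2 = 2 * p - 2 - \<alpha>"
  have e: "e1 > 0" "e2 > 0" "e1 + e2 = 2 * p - 1" using \<alpha> by (auto simp: e1_def e2_def)
  define \<theta> where "\<theta> = 2 powr (- min e1 e2)"
  have \<theta>: "0 < \<theta>" "\<theta> < 1" using e powr_less_mono[of "- min e1 e2" 0 2] by (auto simp: \<theta>_def)
  define c where "c = 10 powr (2 * p) * 2 / (2 * p - 1)"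
  have c: "c > 0" using p by (simp add: c_def)
  have dle: "dseq p \<alpha> (geom_fun m) k \<le> 2 powr (-(real k * e1)) * (c * 2 powr (real (min m k) * (e1 + e2)))" for m k
  proof -
    define r where "r = dyad m * dyad k"
    have r: "0 \<le> r" "r < 1" using mult_strict_mono'[of "dyad m" 1 "dyad k" 1] by (auto simp: r_def)
    have r1: "1 - dyad (min m k) \<le> 1 - r"
      using mult_left_le[of "dyad k" "dyad m"] mult_left_le_one_le[of "dyad k" "dyad m"]
      by (auto simp: r_def min_def less_imp_le)
    have "Mp p (dyad k) (deriv (geom_fun m)) powr p = (\<integral>t. norm (deriv (geom_fun m) (of_real (dyad k) * cis t)) powr p \<partial>circ)"
      using p by (simp add: Mp_eq_Lc Hol_deriv geom_fun_Hol Lc_powr)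
    also have "\<dots> \<le> (\<integral>t. norm (1 - of_real r * cis t) powr (-(2 * p)) \<partial>circ)"
    proof (rule integral_mono)
      fix t
      have X: "norm (1 - of_real r * cis t) > 0" by (rule one_minus_cis_pos[OF r])
      have "norm (deriv (geom_fun m) (of_real (dyad k) * cis t)) = dyad m / (norm (1 - of_real r * cis t))\<^sup>2"
        by (subst deriv_geom_fun) (auto simp: norm_mult norm_divide norm_power r_def mult.assoc)
      also have "\<dots> \<le> 1 / (norm (1 - of_real r * cis t))\<^sup>2" by (intro divide_right_mono) (auto simp: less_imp_le)
      also have "\<dots> = norm (1 - of_real r * cis t) powr (-2)" using X by (simp add: powr_minus_divide powr_numeral)
      finally have "norm (deriv (geom_fun m) (of_real (dyad k) * cis t)) powr p \<le> (norm (1 - of_real r * cis t) powr (-2)) powr p"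
        using p by (intro powr_mono2) auto
      then show "norm (deriv (geom_fun m) (of_real (dyad k) * cis t)) powr p \<le> norm (1 - of_real r * cis t) powr (-(2 * p))"
        by (simp add: powr_powr)
    qed (use p in \<open>auto intro!: integrable_norm_powr[OF Hol_cont_circle[OF Hol_deriv[OF geom_fun_Hol(1)]]]
          integrable_circ_cont[OF cont_one_minus_cis_powr[OF r]]\<close>)
    also have "\<dots> \<le> c * (1 - r) powr (1 - 2 * p)"
      unfolding c_def using p by (intro integral_one_minus_cis r) auto
    also have "\<dots> \<le> c * (1 - dyad (min m k)) powr (1 - 2 * p)"
      using c p r1 by (intro mult_left_mono powr_mono2') auto
    also have "(1 - dyad (min m k)) powr (1 - 2 * p) = 2 powr (real (min m k) * (e1 + e2))"
      unfolding one_minus_dyad powr_powr e by (simp add: algebra_simps)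
    finally show ?thesis unfolding dseq_def e1_def by (intro mult_left_mono) auto
  qed
  have \<theta>p: "2 powr (-(real j * x)) \<le> \<theta> ^ j" if "min e1 e2 \<le> x" for j x
  proof -
    have "2 powr (-(real j * x)) \<le> 2 powr (-(min e1 e2) * real j)"
      using that mult_right_mono[OF that, of "real j"] by (intro powr_mono) (auto simp: mult.commute)
    also have "\<dots> = \<theta> ^ j" by (simp add: \<theta>_def powr_powr powr_realpow[symmetric])
    finally show ?thesis .
  qed
  have sum: "summable (dseq p \<alpha> (geom_fun m))" "(\<Sum>k. dseq p \<alpha> (geom_fun m) k) \<le> 2 * (c * 2 powr (real m * e2)) / (1 - \<theta>)" for m
  proof -
    have 1: "dseq p \<alpha> (geom_fun m) k \<le> c * 2 powr (real m * e2) * \<theta> ^ (m - k)" if "k \<le> m" for k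
    proof -
      have "dseq p \<alpha> (geom_fun m) k \<le> c * (2 powr (-(real k * e1)) * 2 powr (real k * (e1 + e2)))"
        using dle[of m k] that by (simp only: min_absorb2 mult.left_commute)
      also have "2 powr (-(real k * e1)) * 2 powr (real k * (e1 + e2)) = 2 powr (real m * e2) * 2 powr (-(real (m - k) * e2))"
        using that by (simp add: powr_add[symmetric] of_nat_diff algebra_simps)
      also have "c * (2 powr (real m * e2) * 2 powr (-(real (m - k) * e2))) \<le> c * (2 powr (real m * e2) * \<theta> ^ (m - k))"
        using c by (intro mult_left_mono \<theta>p) auto
      finally show ?thesis by (simp add: mult.assoc)
    qed
    have 2: "dseq p \<alpha> (geom_fun m) k \<le> c * 2 powr (real m * e2) * \<theta> ^ (k - m)" if "m \<le> k" for k
    proof -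
      have "dseq p \<alpha> (geom_fun m) k \<le> c * (2 powr (-(real k * e1)) * 2 powr (real m * (e1 + e2)))"
        using dle[of m k] that by (simp only: min_absorb1 mult.left_commute)
      also have "2 powr (-(real k * e1)) * 2 powr (real m * (e1 + e2)) = 2 powr (real m * e2) * 2 powr (-(real (k - m) * e1))"
        using that by (simp add: powr_add[symmetric] of_nat_diff algebra_simps)
      also have "c * (2 powr (real m * e2) * 2 powr (-(real (k - m) * e1))) \<le> c * (2 powr (real m * e2) * \<theta> ^ (k - m))"
        using c by (intro mult_left_mono \<theta>p) auto
      finally show ?thesis by (simp add: mult.assoc)
    qed
    show "summable (dseq p \<alpha> (geom_fun m))"
      by (rule two_sided_geometric(1)[OF \<theta> _ _ 1 2]) (use c in auto)
    show "(\<Sum>k. dseq p \<alpha> (geom_fun m) k) \<le> 2 * (c * 2 powr (real m * e2)) / (1 - \<theta>)"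
      by (rule two_sided_geometric(2)[OF \<theta> _ _ 1 2]) (use c in auto)
  qed
  define C where "C = 1 + 2 * c / (1 - \<theta>)"
  have C: "C > 0" using c \<theta> by (auto simp: C_def intro!: add_pos_nonneg)
  show ?thesis
  proof (rule that[of "C powr (1/p)"])
    show "C powr (1/p) > 0" using C by simp
    fix m
    show "geom_fun m \<in> Dirichlet p \<alpha>"
      using sum(1)[of m] p \<alpha> by (simp add: Dirichlet_iff' geom_fun_Hol)
    have "1 \<le> 2 powr (real m * e2)" using e powr_mono[of 0 "real m * e2" 2] by simp
    then have "dsum p \<alpha> (geom_fun m) \<le> 2 powr (real m * e2) + 2 * (c * 2 powr (real m * e2)) / (1 - \<theta>)"
      unfolding dsum_def using sum(2)[of m] by (intro add_mono) (auto simp: geom_fun_def)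
    also have "\<dots> = C * 2 powr (real m * e2)" by (simp add: C_def distrib_right)
    finally have "dsum p \<alpha> (geom_fun m) powr (1/p) \<le> (C * 2 powr (real m * e2)) powr (1/p)"
      using p dsum_nonneg[OF sum(1)] by (intro powr_mono2) auto
    then show "dnorm p \<alpha> (geom_fun m) \<le> C powr (1/p) * 2 powr (real m * (2 * p - 2 - \<alpha>) / p)"
      using C by (simp add: dnorm_def powr_mult powr_powr e2_def)
  qed
qed

text \<open>The partial sums are (1 - \<rho>^(n+1)) / (1 - \<rho>), and for \<rho> = r_m the
  denominator is exactly 2^(-m).\<close>

lemma Rhaly_geom_fun:
  assumes \<eta>: "converges_in_disc \<eta>" and z: "norm z < 1"
  shows "Rhaly \<eta> (geom_fun m) z = of_real (2 ^ m) * (power_series \<eta> z - of_real (dyad m) * power_series \<eta> (of_real (dyad m) * z))"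
proof -
  define \<rho> where "\<rho> = complex_of_real (dyad m)"
  have d: "1 - \<rho> = of_real (1 / 2 ^ m)" by (simp add: \<rho>_def dyad_def power_one_over)
  then have ne: "\<rho> \<noteq> 1" by auto
  have s: "(\<Sum>k\<le>n. taylor_coeff (geom_fun m) k) = of_real (2 ^ m) * (1 - \<rho> ^ Suc n)" for n
  proof -
    have "(\<Sum>k\<le>n. taylor_coeff (geom_fun m) k) = (1 - \<rho> ^ Suc n) / (1 - \<rho>)"
      using ne by (simp add: geom_fun_Hol \<rho>_def[symmetric] sum_gp0)
    then show ?thesis unfolding d by (simp add: mult.commute)
  qed
  have zz: "norm (\<rho> * z) < 1" unfolding \<rho>_def by (rule dyad_mult_norm[OF z])
  have "(\<lambda>n. of_real (2 ^ m) * (\<eta> n * z ^ n - \<rho> * (\<eta> n * (\<rho> * z) ^ n))) sums (of_real (2 ^ m) * (power_series \<eta> z - \<rho> * power_series \<eta> (\<rho> * z)))"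
    by (intro sums_mult sums_diff power_series_Hol(3) \<eta> z zz)
  moreover have "of_real (2 ^ m) * (\<eta> n * z ^ n - \<rho> * (\<eta> n * (\<rho> * z) ^ n)) = \<eta> n * (\<Sum>k\<le>n. taylor_coeff (geom_fun m) k) * z ^ n" for n
    unfolding s by (simp add: algebra_simps power_mult_distrib)
  ultimately show ?thesis
    using sums_unique2 Rhaly_Hol(3)[OF \<eta> geom_fun_Hol(1) z, of m] unfolding \<rho>_def by fastforce
qed

lemma Mp_dilate:
  assumes "f \<in> Hol" "0 \<le> \<rho>" "\<rho> < 1" "0 \<le> r" "r < 1" "p > 0"
  shows "Mp p r (\<lambda>z. f (of_real \<rho> * z)) = Mp p (\<rho> * r) f"
  by (simp add: Mp_def mult.assoc)

lemma Hol_dilate: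
  assumes "f \<in> Hol" "0 \<le> \<rho>" "\<rho> < 1"
  shows "(\<lambda>z. f (of_real \<rho> * z)) \<in> Hol"
  using assms unfolding Hol_def mem_Collect_eq
  by (intro holomorphic_on_compose_gen[of "\<lambda>z. of_real \<rho> * z" _ f "ball 0 1", unfolded o_def])
     (auto intro!: holomorphic_intros simp: norm_mult mult_strict_mono'[of \<rho> 1 _ 1, simplified])

lemma deriv_dilate:
  assumes "f \<in> Hol" "norm (of_real \<rho> * z) < 1"
  shows "((\<lambda>z. f (of_real \<rho> * z)) has_field_derivative of_real \<rho> * deriv f (of_real \<rho> * z)) (at z)"
proof -
  have "(f has_field_derivative deriv f (of_real \<rho> * z)) (at (of_real \<rho> * z))"
    using assms by (intro holomorphic_derivI[of f "ball 0 1"]) (auto simp: Hol_def)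
  moreover have "((\<lambda>z. of_real \<rho> * z) has_field_derivative of_real \<rho>) (at z)" by (auto intro!: derivative_eq_intros)
  ultimately have "((\<lambda>z. f (of_real \<rho> * z)) has_field_derivative deriv f (of_real \<rho> * z) * of_real \<rho>) (at z)"
    by (rule DERIV_chain2)
  then show ?thesis by (simp only: mult.commute)
qed

text \<open>The derivative of the image is 2^m times F'(z) - \<rho>^2 F'(\<rho> z) with \<rho> =
  r_m. Because \<rho> r_(m+1) \<le> r_m, a bound for it says how much the mean of F' can grow from
  r_m to r_(m+1). The increments grow geometrically, so their sum is of the size of the last one and
  no logarithm arises.\<close>

lemma lip_seq_bounded_if_Rhaly_dnorm_bounded:
  assumes p: "1 < p" and \<alpha>: "-1 < \<alpha>" "\<alpha> < 2 * p - 2" and \<eta>: "converges_in_disc \<eta>"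
    and K: "K > 0" "\<And>f. f \<in> Dirichlet p \<alpha> \<Longrightarrow> Rhaly \<eta> f \<in> Dirichlet p \<alpha>"
    "\<And>f. f \<in> Dirichlet p \<alpha> \<Longrightarrow> dnorm p \<alpha> (Rhaly \<eta> f) \<le> K * dnorm p \<alpha> f"
  obtains A where "A > 0" "\<And>n. lip_seq p (power_series \<eta>) n \<le> A"
proof -
  have p1: "1 \<le> p" using p by simp
  obtain C where C: "C > 0" "\<And>m. geom_fun m \<in> Dirichlet p \<alpha>"
    "\<And>m. dnorm p \<alpha> (geom_fun m) \<le> C * 2 powr (real m * (2 * p - 2 - \<alpha>) / p)"
    by (rule geom_fun_dnorm[OF p \<alpha>]) (rule that)
  define F where "F = power_series \<eta>"
  have F: "F \<in> Hol" unfolding F_def by (rule power_series_Hol[OF \<eta>])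
  define \<gamma> where "\<gamma> = 1 - 1/p"
  have \<gamma>: "\<gamma> > 0" using p by (simp add: \<gamma>_def)
  define x where "x n = Mp p (dyad n) (deriv F)" for n
  define D where "D = K * C * 2 powr ((\<alpha> + 1) / p)"
  have D: "D > 0" using K C by (simp add: D_def)
  have step: "x (Suc m) \<le> x m + D * 2 powr (real m * \<gamma>)" for m
  proof -
    define \<rho> where "\<rho> = dyad m"
    have \<rho>: "0 \<le> \<rho>" "\<rho> < 1" by (auto simp: \<rho>_def)
    define H where "H z = deriv F z - of_real \<rho> * (of_real \<rho> * deriv F (of_real \<rho> * z))" for z
    have dR: "deriv (Rhaly \<eta> (geom_fun m)) z = of_real (2 ^ m) * H z" if z: "norm z < 1" for z
    proof -
      have "deriv (Rhaly \<eta> (geom_fun m)) z = deriv (\<lambda>z. of_real (2 ^ m) * (F z - of_real \<rho> * F (of_real \<rho> * z))) z"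
        unfolding F_def \<rho>_def by (rule deriv_cong_disc[OF _ z]) (rule Rhaly_geom_fun[OF \<eta>])
      also have "\<dots> = of_real (2 ^ m) * H z"
      proof (rule DERIV_imp_deriv)
        have 1: "(F has_field_derivative deriv F z) (at z)"
          using F z by (intro holomorphic_derivI[of F "ball 0 1"]) (auto simp: Hol_def)
        have 2: "((\<lambda>z. F (of_real \<rho> * z)) has_field_derivative of_real \<rho> * deriv F (of_real \<rho> * z)) (at z)"
          using dyad_mult_norm[OF z, of m] by (intro deriv_dilate F) (simp add: \<rho>_def)
        show "((\<lambda>z. of_real (2 ^ m) * (F z - of_real \<rho> * F (of_real \<rho> * z))) has_field_derivative of_real (2 ^ m) * H z) (at z)"
          unfolding H_def by (intro DERIV_cmult DERIV_diff 1 2)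
      qed
      finally show ?thesis .
    qed
    have Fd: "(\<lambda>z. deriv F (of_real \<rho> * z)) \<in> Hol" by (intro Hol_dilate Hol_deriv F \<rho>)
    have HH: "H \<in> Hol" unfolding H_def[abs_def] by (intro Hol_diff Hol_cmult Hol_deriv F Fd)
    have "2 ^ m * Mp p (dyad (Suc m)) H = Mp p (dyad (Suc m)) (\<lambda>z. of_real (2 ^ m) * H z)"
      using p HH by (subst Mp_cmult) (auto simp: norm_power)
    also have "\<dots> = Mp p (dyad (Suc m)) (deriv (Rhaly \<eta> (geom_fun m)))"
      by (rule Mp_cong) (auto simp: dR)
    also have "\<dots> \<le> 2 powr (real (Suc m) * (\<alpha> + 1) / p) * dnorm p \<alpha> (Rhaly \<eta> (geom_fun m))"
      by (rule Mp_dyad_le_dnorm[OF p1 \<alpha>(1) K(2)[OF C(2)]])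
    also have "\<dots> \<le> 2 powr (real (Suc m) * (\<alpha> + 1) / p) * (K * (C * 2 powr (real m * (2 * p - 2 - \<alpha>) / p)))"
      using K C by (intro mult_left_mono order_trans[OF K(3)[OF C(2)]]) auto
    also have "\<dots> = K * C * 2 powr (real (Suc m) * (\<alpha> + 1) / p + real m * (2 * p - 2 - \<alpha>) / p)"
      by (simp only: powr_add mult_ac)
    \<comment> \<open>Here \<alpha> cancels from the growth in m: the rates of the point estimate
      and of the test function add up to (2p - 1)/p = 1 + \<gamma>, and the 1 is absorbed by the
      factor 2^m.\<close>
    also have "real (Suc m) * (\<alpha> + 1) / p + real m * (2 * p - 2 - \<alpha>) / p = (\<alpha> + 1) / p + (real m + real m * \<gamma>)"
      using p by (simp add: \<gamma>_def field_simps)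
    also have "K * C * 2 powr ((\<alpha> + 1) / p + (real m + real m * \<gamma>)) = 2 ^ m * (D * 2 powr (real m * \<gamma>))"
      unfolding powr_add D_def by (simp add: powr_realpow)
    finally have MH: "Mp p (dyad (Suc m)) H \<le> D * 2 powr (real m * \<gamma>)" by simp
    have "x (Suc m) = Mp p (dyad (Suc m)) (\<lambda>z. H z + of_real \<rho> * (of_real \<rho> * deriv F (of_real \<rho> * z)))"
      by (simp add: x_def H_def)
    also have "\<dots> \<le> Mp p (dyad (Suc m)) H + Mp p (dyad (Suc m)) (\<lambda>z. of_real \<rho> * (of_real \<rho> * deriv F (of_real \<rho> * z)))"
      by (intro Mp_triangle HH Hol_cmult Fd p1) auto
    also have "Mp p (dyad (Suc m)) (\<lambda>z. of_real \<rho> * (of_real \<rho> * deriv F (of_real \<rho> * z))) = \<rho> * (\<rho> * Mp p (\<rho> * dyad (Suc m)) (deriv F))"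
      using p \<rho> by (simp add: Mp_cmult Hol_cmult Fd Mp_dilate Hol_deriv F)
    also have "\<dots> \<le> 1 * (1 * x m)"
    proof (intro mult_mono)
      show "Mp p (\<rho> * dyad (Suc m)) (deriv F) \<le> x m" unfolding x_def \<rho>_def
        using mult_left_le[OF less_imp_le[OF dyad_bounds(2)] dyad_bounds(1), of m "Suc m"]
        by (intro Mp_mono Hol_deriv F p1) auto
    qed (use \<rho> in \<open>auto simp: x_def\<close>)
    finally show ?thesis using MH by simp
  qed
  \<comment> \<open>The quotient is the smallest constant for which the recursion closes: A + D
    \<le> A 2^\<gamma>.\<close>
  define A where "A = max (x 0) (D / (2 powr \<gamma> - 1)) + 1"
  have g1: "2 powr \<gamma> > 1" using \<gamma> powr_less_mono[of 0 \<gamma> 2] by simp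
  have x0: "0 \<le> x 0" by (simp add: x_def)
  have A: "A > 0" using x0 by (simp add: A_def)
  have xb: "x n \<le> A * 2 powr (real n * \<gamma>)" for n
  proof (induction n)
    case 0
    then show ?case by (simp add: A_def)
  next
    case (Suc n)
    have "D / (2 powr \<gamma> - 1) \<le> A" by (simp add: A_def)
    then have "D \<le> A * (2 powr \<gamma> - 1)" using g1 by (simp add: field_simps)
    then have "D * 2 powr (real n * \<gamma>) \<le> A * (2 powr \<gamma> - 1) * 2 powr (real n * \<gamma>)" by (rule mult_right_mono) simp
    moreover have "2 powr (real (Suc n) * \<gamma>) = 2 powr \<gamma> * 2 powr (real n * \<gamma>)" by (simp add: distrib_right powr_add)
    ultimately show ?case using step[of n] Suc by (simp add: algebra_simps)
  qed
  have "lip_seq p F n \<le> A" for n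
  proof -
    have "lip_seq p F n \<le> 2 powr (-(real n * \<gamma>)) * (A * 2 powr (real n * \<gamma>))"
      unfolding lip_seq_def \<gamma>_def[symmetric] x_def[symmetric] by (intro mult_left_mono xb) auto
    also have "\<dots> = A" by (simp add: powr_minus field_simps)
    finally show ?thesis .
  qed
  then show ?thesis using that A by (simp add: F_def)
qed

lemma Mp_deriv_le_of_lip_seq:
  assumes F: "F \<in> Hol" and p: "1 \<le> p" and A: "\<And>n. lip_seq p F n \<le> A" and r: "0 \<le> r" "r < 1"
  shows "Mp p r (deriv F) \<le> 2 * A * (1 - r) powr (-(1 - 1/p))"
proof -
  have A0: "0 \<le> A" using A[of 0] lip_seq_nonneg[of p F 0] by linarith
  obtain k where k: "dyad k \<le> r" "r < dyad (Suc k)" using dyad_interval[OF r] by blast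
  have g: "0 \<le> 1 - 1/p" "1 - 1/p \<le> 1" using p by auto
  have "Mp p r (deriv F) \<le> Mp p (dyad (Suc k)) (deriv F)" using k r by (intro Mp_mono Hol_deriv F p) auto
  also have "\<dots> = lip_seq p F (Suc k) * 2 powr (real (Suc k) * (1 - 1/p))"
    unfolding lip_seq_def by (simp add: powr_minus)
  also have "\<dots> \<le> A * 2 powr (real (Suc k) * (1 - 1/p))" by (intro mult_right_mono A) auto
  also have "2 powr (real (Suc k) * (1 - 1/p)) = 2 powr (1 - 1/p) * (1 - dyad k) powr (-(1 - 1/p))"
    unfolding one_minus_dyad powr_powr by (simp add: powr_add[symmetric] algebra_simps)
  also have "A * (2 powr (1 - 1/p) * (1 - dyad k) powr (-(1 - 1/p))) \<le> A * (2 * (1 - r) powr (-(1 - 1/p)))"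
    using A0 g k r powr_mono[of "1 - 1/p" 1 2] by (intro mult_left_mono mult_mono powr_mono2') auto
  finally show ?thesis by simp
qed

text \<open>The logarithm tends to infinity, so a bound without it beats any multiple c of the
  comparison function near the boundary.\<close>

lemma lip_seq_bounded_smallo:
  assumes F: "F \<in> Hol" and p: "1 \<le> p" and A: "\<And>n. lip_seq p F n \<le> A"
  shows "(\<lambda>r. Mp p r (deriv F)) \<in> o[at_left 1](\<lambda>r. ln (1 / (1 - r)) / (1 - r) powr (1 - 1/p))"
proof (rule landau_o.smallI)
  fix c :: real assume c: "c > 0"
  have A0: "0 \<le> A" using A[of 0] lip_seq_nonneg[of p F 0] by linarith
  \<comment> \<open>Beyond this radius c log(1 / (1 - r)) is at least 2 A.\<close>
  define b where "b = 1 - exp (-(2 * A / c))"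
  have b: "b < 1" by (simp add: b_def)
  show "eventually (\<lambda>r. norm (Mp p r (deriv F)) \<le> c * norm (ln (1 / (1 - r)) / (1 - r) powr (1 - 1/p))) (at_left 1)"
    unfolding eventually_at_left[OF zero_less_one]
  proof (intro exI[of _ "max b 0"] conjI allI impI)
    fix r :: real assume r: "max b 0 < r" "r < 1"
    have "1 - r \<le> exp (-(2 * A / c))" using r by (simp add: b_def)
    then have "ln (1 - r) \<le> -(2 * A / c)" using r by (metis exp_le_cancel_iff exp_ln diff_gt_0_iff_gt)
    then have "2 * A / c \<le> ln (1 / (1 - r))" using r by (simp add: ln_div)
    then have l: "2 * A \<le> c * ln (1 / (1 - r))" "0 \<le> ln (1 / (1 - r))" using c A0 r by (simp_all add: field_simps)
    have "norm (Mp p r (deriv F)) \<le> 2 * A * (1 - r) powr (-(1 - 1/p))"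
      using Mp_deriv_le_of_lip_seq[OF F p A] r by simp
    also have "\<dots> \<le> c * ln (1 / (1 - r)) * (1 - r) powr (-(1 - 1/p))" using l by (intro mult_right_mono) auto
    also have "\<dots> = c * norm (ln (1 / (1 - r)) / (1 - r) powr (1 - 1/p))"
      using l(2) by (simp only: powr_minus divide_inverse norm_mult real_norm_def) (simp add: powr_minus[symmetric])
    finally show "norm (Mp p r (deriv F)) \<le> c * norm (ln (1 / (1 - r)) / (1 - r) powr (1 - 1/p))" .
  qed (use b in auto)
qed

section \<open>Dyadic blocks of coefficients\<close>

lemma Mp2_Parseval:
  assumes "f \<in> Hol" "0 \<le> r" "r < 1"
  shows "(\<lambda>n. (norm (taylor_coeff f n) * r ^ n)\<^sup>2) sums (Mp 2 r f powr 2)"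
proof -
  have "Mp 2 r f powr 2 = (\<integral>t. norm (f (of_real r * cis t)) powr 2 \<partial>circ)"
    using Lc_powr[of 2 "\<lambda>t. f (of_real r * cis t)"] Mp_eq_Lc[OF assms, of 2] by (simp del: powr_numeral)
  then show ?thesis using Parseval[OF assms] by simp
qed

lemma Mp2_deriv_Parseval:
  assumes "f \<in> Hol" "0 \<le> r" "r < 1"
  shows "(\<lambda>n. (real (Suc n) * norm (taylor_coeff f (Suc n)) * r ^ n)\<^sup>2) sums (Mp 2 r (deriv f) powr 2)"
  using Mp2_Parseval[OF Hol_deriv[OF assms(1)] assms(2,3)]
  by (simp add: taylor_coeff_deriv norm_mult del: of_nat_Suc)

definition block :: "nat \<Rightarrow> nat set" where
  "block j = {2 ^ j..<2 ^ Suc j}"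

lemma block_finite [simp]: "finite (block j)" and card_block: "card (block j) = 2 ^ j"
  by (auto simp: block_def)

definition block_fun :: "nat \<Rightarrow> complex \<Rightarrow> complex" where
  "block_fun j z = (\<Sum>n\<in>block j. z ^ n)"

lemma block_fun_Hol: "block_fun j \<in> Hol" "taylor_coeff (block_fun j) n = (if n \<in> block j then 1 else 0)"
proof -
  have s: "(\<lambda>n. (if n \<in> block j then 1 else 0) * z ^ n) sums block_fun j z" for z
    using sums_If_finite_set[of "block j" "\<lambda>n. z ^ n"]
    by (simp add: block_fun_def if_distrib[of "\<lambda>x. x * _"] cong: if_cong)
  show "block_fun j \<in> Hol" "taylor_coeff (block_fun j) n = (if n \<in> block j then 1 else 0)"
    using Hol_coeff_unique[OF s] by auto
qed

lemma power_le_fact_exp: "0 \<le> (x::real) \<Longrightarrow> x ^ m \<le> fact m * exp x"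
proof -
  assume x: "0 \<le> x"
  have s: "(\<lambda>n. x ^ n / fact n) sums exp x" using exp_converges[of x] by (simp add: divide_inverse mult.commute)
  have "x ^ m / fact m \<le> exp x"
    using sum_le_suminf[OF sums_summable[OF s], of "{m}"] x sums_unique[OF s] by simp
  then show ?thesis by (simp add: field_simps)
qed

text \<open>By Parseval the square mean is a sum of N = 2^j terms, each at most (2N)^2 r^(2(N - 1)).
  The exponent N - 1 is the lowest degree in the derivative.\<close>

lemma Mp2_block_fun_le:
  "Mp 2 (dyad k) (deriv (block_fun j)) powr 2 \<le> 4 * (2 ^ j) ^ 3 * dyad k ^ (2 * (2 ^ j - 1))"
proof -
  define N :: nat where "N = 2 ^ j"
  have N: "N \<ge> 1" by (simp add: N_def)
  define a where "a n = (real (Suc n) * norm (taylor_coeff (block_fun j) (Suc n)) * dyad k ^ n)\<^sup>2" for n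
  have s: "a sums (Mp 2 (dyad k) (deriv (block_fun j)) powr 2)"
    unfolding a_def using Mp2_deriv_Parseval[OF block_fun_Hol(1) dyad_bounds] .
  have z: "a n = 0" if "n \<notin> {N - 1..<2 * N - 1}" for n
    using that N by (auto simp: a_def block_fun_Hol block_def N_def)
  have "Mp 2 (dyad k) (deriv (block_fun j)) powr 2 = (\<Sum>n\<in>{N - 1..<2 * N - 1}. a n)"
    using sums_unique2[OF s sums_finite[of "{N - 1..<2 * N - 1}" a]] z by auto
  also have "\<dots> \<le> (\<Sum>n\<in>{N - 1..<2 * N - 1}. (2 * real N)\<^sup>2 * dyad k ^ (2 * (N - 1)))"
  proof (rule sum_mono)
    fix n assume n: "n \<in> {N - 1..<2 * N - 1}"
    have "a n \<le> (real (Suc n) * 1 * dyad k ^ n)\<^sup>2"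
      unfolding a_def by (intro power_mono mult_right_mono mult_left_mono) (auto simp: block_fun_Hol)
    also have "\<dots> \<le> (2 * real N * dyad k ^ (N - 1))\<^sup>2"
    proof -
      have "Suc n \<le> 2 * N" using n by auto
      then have "real (Suc n) * 1 \<le> 2 * real N" by (simp del: of_nat_Suc)
      then show ?thesis using n by (intro power_mono mult_mono[OF _ power_decreasing]) (auto simp: less_imp_le)
    qed
    also have "\<dots> = (2 * real N)\<^sup>2 * dyad k ^ (2 * (N - 1))"
      by (simp add: power_mult_distrib power_mult[symmetric] mult.commute)
    finally show "a n \<le> (2 * real N)\<^sup>2 * dyad k ^ (2 * (N - 1))" .
  qed
  also have "\<dots> = real N * ((2 * real N)\<^sup>2 * dyad k ^ (2 * (N - 1)))"
    using N by (simp add: of_nat_diff)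
  also have "\<dots> = 4 * real N ^ 3 * dyad k ^ (2 * (N - 1))"
    by (simp add: power_mult_distrib power2_eq_square power3_eq_cube)
  finally show ?thesis by (simp add: N_def)
qed

text \<open>The dyadic terms peak at k = j. For k > j the powers are at most 1 and the weight
  decays; for k < j the factor r_k^(2^j) \<le> exp(-2^(j-k)) beats every power of 2^(j-k). This
  works for all \<alpha> > -1.\<close>

lemma block_fun_dnorm:
  assumes \<alpha>: "-1 < \<alpha>"
  obtains C where "C > 0" "\<And>j. block_fun j \<in> Dirichlet 2 \<alpha>"
    "\<And>j. dnorm 2 \<alpha> (block_fun j) \<le> C * 2 powr (real j * (2 - \<alpha>) / 2)"
proof -
  define e1 where "e1 = \<alpha> + 1"
  have e1: "e1 > 0" using \<alpha> by (simp add: e1_def)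
  \<comment> \<open>Large enough that x^(e1 + 1) \<le> x^m \<le> m! e^x for x \<ge> 1, which leaves
    one spare factor 1 / x = 2^(-(j - k)) for geometric decay.\<close>
  obtain m :: nat where m: "\<alpha> + 2 < real m" using reals_Archimedean2 by blast
  define \<theta> where "\<theta> = max (1/2) (2 powr (-e1))"
  have \<theta>: "0 < \<theta>" "\<theta> < 1" using e1 powr_less_mono[of "-e1" 0 2] by (auto simp: \<theta>_def)
  define B where "B j = 4 * fact m * 2 powr (real j * (2 - \<alpha>))" for j :: nat
  have B: "0 \<le> B j" for j by (simp add: B_def)
  have scale: "(2 ^ j) ^ 3 * 2 powr (-(real j * e1)) = 2 powr (real j * (2 - \<alpha>))" for j
  proof -
    have "((2::real) ^ j) ^ 3 = 2 powr (real j * 3)"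
      by (simp add: powr_realpow[symmetric] powr_powr power_mult[symmetric] del: powr_realpow)
    then show ?thesis by (simp add: powr_add[symmetric] e1_def algebra_simps)
  qed
  have d: "dseq 2 \<alpha> (block_fun j) k \<le> 2 powr (-(real k * e1)) * (4 * (2 ^ j) ^ 3 * dyad k ^ (2 * (2 ^ j - 1)))" for j k
    unfolding dseq_def e1_def by (intro mult_left_mono Mp2_block_fun_le) auto
  have f1: "(1::real) \<le> fact m" by (rule fact_ge_1)
  have up: "dseq 2 \<alpha> (block_fun j) k \<le> B j * \<theta> ^ (k - j)" if "j \<le> k" for j k
  proof -
    have "dseq 2 \<alpha> (block_fun j) k \<le> 2 powr (-(real k * e1)) * (4 * (2 ^ j) ^ 3 * 1)"
      by (intro order_trans[OF d] mult_left_mono power_le_one) (auto simp: less_imp_le)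
    also have "2 powr (-(real k * e1)) = 2 powr (-(real j * e1)) * (2 powr (-e1)) ^ (k - j)"
      using that by (simp add: powr_realpow[symmetric] powr_powr powr_add[symmetric] of_nat_diff algebra_simps)
    also have "2 powr (-(real j * e1)) * (2 powr (-e1)) ^ (k - j) * (4 * (2 ^ j) ^ 3 * 1) = 4 * ((2 ^ j) ^ 3 * 2 powr (-(real j * e1))) * (2 powr (-e1)) ^ (k - j)"
      by simp
    also have "\<dots> \<le> B j * \<theta> ^ (k - j)"
      unfolding scale B_def using f1 by (intro mult_mono power_mono) (auto simp: \<theta>_def)
    finally show ?thesis .
  qed
  have down: "dseq 2 \<alpha> (block_fun j) k \<le> B j * \<theta> ^ (j - k)" if kj: "k \<le> j" for j k
  proof (cases "k = j")
    case True
    then show ?thesis using up[of j j] by simp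
  next
    case False
    then have lt: "k < j" using kj by simp
    define x where "x = (2::real) ^ (j - k)"
    have x: "x \<ge> 1" by (simp add: x_def)
    have j1: "(2::nat) ^ j \<le> 2 * (2 ^ j - 1)"
    proof -
      have "(2::nat) ^ 1 \<le> 2 ^ j" using lt by (intro power_increasing) auto
      then show ?thesis by simp
    qed
    have xe: "(1/2::real) ^ k * 2 ^ j = x"
      unfolding x_def using kj by (simp add: power_diff power_one_over field_simps)
    have "dyad k ^ (2 * (2 ^ j - 1)) \<le> dyad k ^ (2 ^ j)"
      using j1 by (intro power_decreasing) (auto simp: less_imp_le)
    \<comment> \<open>From 1 - y \<le> e^(-y) with y = 2^(-k).\<close>
    also have "\<dots> \<le> exp (-((1/2) ^ k)) ^ (2 ^ j)"
      using exp_ge_add_one_self[of "-((1/2) ^ k)"] by (intro power_mono) (auto simp: dyad_def power_le_one)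
    also have "\<dots> = exp (-x)" by (simp add: exp_of_nat_mult[symmetric] xe[symmetric] mult.commute)
    finally have de: "dyad k ^ (2 * (2 ^ j - 1)) \<le> exp (-x)" .
    have "2 powr (-(real k * e1)) = 2 powr (-(real j * e1)) * x powr e1"
      using kj by (simp add: x_def powr_realpow[symmetric] powr_powr powr_add[symmetric] of_nat_diff algebra_simps)
    then have "dseq 2 \<alpha> (block_fun j) k \<le> 2 powr (-(real j * e1)) * x powr e1 * (4 * (2 ^ j) ^ 3 * exp (-x))"
      using order_trans[OF d mult_left_mono[OF mult_left_mono[OF de]]] by simp
    also have "\<dots> = 4 * 2 powr (real j * (2 - \<alpha>)) * (x powr e1 * exp (-x))"
      unfolding scale[symmetric] by simp
    also have "x powr e1 * exp (-x) \<le> fact m * (1/2) ^ (j - k)"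
    proof -
      have "x powr e1 * x = x powr (e1 + 1)" using x by (simp add: powr_add)
      also have "\<dots> \<le> x powr real m" using m x by (intro powr_mono) (auto simp: e1_def)
      also have "\<dots> = x ^ m" using x by (simp add: powr_realpow)
      also have "\<dots> \<le> fact m * exp x" using x by (intro power_le_fact_exp) simp
      finally have "x powr e1 * x * exp (-x) \<le> fact m * exp x * exp (-x)" by (rule mult_right_mono) simp
      then have "x powr e1 * x * exp (-x) \<le> fact m" by (simp add: mult.assoc exp_add[symmetric])
      then have "x powr e1 * exp (-x) \<le> fact m / x" using x by (simp add: field_simps)
      then show ?thesis by (simp add: x_def power_one_over)
    qed
    also have "fact m * (1/2) ^ (j - k) \<le> fact m * \<theta> ^ (j - k)"
      by (intro mult_left_mono power_mono) (auto simp: \<theta>_def)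
    finally have "dseq 2 \<alpha> (block_fun j) k \<le> 4 * 2 powr (real j * (2 - \<alpha>)) * (fact m * \<theta> ^ (j - k))"
      by (simp add: mult_left_mono)
    then show ?thesis by (simp only: B_def mult_ac)
  qed
  define C where "C = 8 * fact m / (1 - \<theta>)"
  have C: "C > 0" using \<theta> by (simp add: C_def)
  show ?thesis
  proof (rule that[of "C powr (1/2)"])
    show "C powr (1/2) > 0" using C by simp
    fix j
    have s: "summable (dseq 2 \<alpha> (block_fun j))"
      by (rule two_sided_geometric(1)[OF \<theta> _ B down up]) auto
    show "block_fun j \<in> Dirichlet 2 \<alpha>" using s \<alpha> by (simp add: Dirichlet_iff' block_fun_Hol)
    have "(\<Sum>k. dseq 2 \<alpha> (block_fun j) k) \<le> 2 * B j / (1 - \<theta>)"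
      by (rule two_sided_geometric(2)[OF \<theta> _ B down up]) auto
    moreover have "block_fun j 0 = 0"
      unfolding block_fun_def by (intro sum.neutral) (auto simp: block_def power_0_left)
    ultimately have "dsum 2 \<alpha> (block_fun j) \<le> C * 2 powr (real j * (2 - \<alpha>))"
      by (simp add: dsum_def C_def B_def)
    then have "dsum 2 \<alpha> (block_fun j) powr (1/2) \<le> (C * 2 powr (real j * (2 - \<alpha>))) powr (1/2)"
      using dsum_nonneg[OF s] by (intro powr_mono2) auto
    then show "dnorm 2 \<alpha> (block_fun j) \<le> C powr (1/2) * 2 powr (real j * (2 - \<alpha>) / 2)"
      using C by (simp add: dnorm_def powr_mult powr_powr)
  qed
qed

text \<open>Boundedness of these dyadic averages is the mean Lipschitz condition of order 1/2 in
  terms of coefficients, and convergence to 0 its little-o version.\<close>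

definition block_energy :: "(nat \<Rightarrow> complex) \<Rightarrow> nat \<Rightarrow> real" where
  "block_energy \<eta> j = (1/2) ^ j * (\<Sum>n\<in>block j. (real n * norm (\<eta> n))\<^sup>2)"

lemma block_energy_nonneg [simp]: "0 \<le> block_energy \<eta> j"
  by (simp add: block_energy_def sum_nonneg)

text \<open>For n in the following block every partial sum of \<open>block_fun j\<close> is N = 2^j,
  so the image has coefficients N times \<eta> n there, and Parseval at one radius recovers their
  energy. The index moves to j + 1 because partial sums are constant only after the block is
  complete.\<close>

lemma block_energy_le_dnorm:
  assumes \<alpha>: "-1 < \<alpha>" and \<eta>: "converges_in_disc \<eta>" and R: "Rhaly \<eta> (block_fun j) \<in> Dirichlet 2 \<alpha>"
  shows "block_energy \<eta> (Suc j) \<le> 128 * 2 powr (\<alpha> + 1) * (2 powr (-(real j * (2 - \<alpha>) / 2)) * dnorm 2 \<alpha> (Rhaly \<eta> (block_fun j))) powr 2"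
proof -
  define N :: nat where "N = 2 ^ j"
  have N: "N \<ge> 1" by (simp add: N_def)
  define r where "r = dyad (Suc j)"
  have r: "0 \<le> r" "r < 1" by (simp_all add: r_def)
  have r': "r = 1 - 1 / (2 * real N)" by (simp add: r_def dyad_def N_def power_one_over)
  have rN: "1/2 \<le> r ^ N"
  proof -
    have "1 + real N * (-(1 / (2 * real N))) \<le> (1 + -(1 / (2 * real N))) ^ N"
      using N by (intro Bernoulli_inequality) (simp add: divide_le_eq)
    then show ?thesis using N by (simp add: r')
  qed
  define S where "S = (\<Sum>n\<in>block (Suc j). (real n * norm (\<eta> n))\<^sup>2)"
  note RH = Dirichlet_Hol[OF R]
  define a where "a n = (real (Suc n) * norm (taylor_coeff (Rhaly \<eta> (block_fun j)) (Suc n)) * r ^ n)\<^sup>2" for n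
  have s: "a sums (Mp 2 r (deriv (Rhaly \<eta> (block_fun j))) powr 2)"
    unfolding a_def by (rule Mp2_deriv_Parseval[OF RH r(1,2)])
  have ps: "(\<Sum>k\<le>n. taylor_coeff (block_fun j) k) = of_nat N" if n: "n \<in> block (Suc j)" for n
  proof -
    have "block j \<subseteq> {..n}" using n by (auto simp: block_def)
    then have "(\<Sum>k\<le>n. if k \<in> block j then 1 else 0 :: complex) = (\<Sum>k\<in>block j. 1)"
      by (subst sum.inter_restrict[symmetric]) (auto simp: Int_absorb1)
    then show ?thesis by (simp add: block_fun_Hol card_block N_def)
  qed
  \<comment> \<open>The degrees are at most 4 N and r^N \<ge> 1/2 by Bernoulli, so r^(n - 1) \<ge>
    1/16; squaring gives 1/256.\<close>
  have trm: "(1/256) * (real N)\<^sup>2 * (real n * norm (\<eta> n))\<^sup>2 \<le> a (n - 1)" if n: "n \<in> block (Suc j)" for n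
  proof -
    have n1: "1 \<le> n" "n \<le> 4 * N" using n by (auto simp: block_def N_def intro: le_trans[OF one_le_numeral])
    have "(1/2) ^ 4 \<le> (r ^ N) ^ 4" using rN by (intro power_mono) auto
    also have "\<dots> = r ^ (4 * N)" by (simp add: power_mult[symmetric] mult.commute)
    also have "\<dots> \<le> r ^ (n - 1)" using n1 r by (intro power_decreasing) auto
    finally have "1/16 \<le> r ^ (n - 1)" by (simp add: power_divide)
    then have "real n * (norm (\<eta> n) * real N) * (1/16) \<le> real n * (norm (\<eta> n) * real N) * r ^ (n - 1)"
      by (rule mult_left_mono) simp
    then have "(real n * (norm (\<eta> n) * real N) * (1/16))\<^sup>2 \<le> (real n * (norm (\<eta> n) * real N) * r ^ (n - 1))\<^sup>2"
      by (rule power_mono) simp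
    also have "\<dots> = a (n - 1)"
      using n1 ps[OF n] by (simp add: a_def Rhaly_Hol(2)[OF \<eta> block_fun_Hol(1)] norm_mult)
    finally show ?thesis by (simp add: power_mult_distrib power_divide mult_ac)
  qed
  have "(1/256) * (real N)\<^sup>2 * S = (\<Sum>n\<in>block (Suc j). (1/256) * (real N)\<^sup>2 * (real n * norm (\<eta> n))\<^sup>2)"
    by (simp add: S_def sum_distrib_left)
  also have "\<dots> \<le> (\<Sum>n\<in>block (Suc j). a (n - 1))" by (intro sum_mono trm)
  also have "\<dots> = (\<Sum>n\<in>(\<lambda>n. n - 1) ` block (Suc j). a n)"
    by (subst sum.reindex) (auto simp: inj_on_def block_def intro: one_le_power)
  also have "\<dots> \<le> Mp 2 r (deriv (Rhaly \<eta> (block_fun j))) powr 2"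
    unfolding sums_unique[OF s] by (intro sum_le_suminf sums_summable[OF s]) (auto simp: a_def)
  also have "\<dots> \<le> (2 powr (real (Suc j) * (\<alpha> + 1) / 2) * dnorm 2 \<alpha> (Rhaly \<eta> (block_fun j))) powr 2"
    unfolding r_def by (intro powr_mono2 Mp_dyad_le_dnorm \<alpha> R) auto
  also have "\<dots> = 2 powr (real (Suc j) * (\<alpha> + 1)) * dnorm 2 \<alpha> (Rhaly \<eta> (block_fun j)) powr 2"
    by (simp add: powr_mult powr_powr del: of_nat_Suc)
  finally have 1: "(real N)\<^sup>2 * S \<le> 256 * (2 powr (real (Suc j) * (\<alpha> + 1)) * dnorm 2 \<alpha> (Rhaly \<eta> (block_fun j)) powr 2)"
    by simp
  have N2: "(1/2) ^ Suc j = (1/2) * 2 powr (-(real j * 3)) * (real N)\<^sup>2"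
  proof -
    have "(real N)\<^sup>2 = 2 powr (real j * 2)" by (simp add: N_def powr_realpow[symmetric] powr_powr)
    moreover have "(1/2::real) ^ j = 2 powr (- real j)" by (simp add: powr_minus_divide powr_realpow power_one_over)
    ultimately show ?thesis by (simp add: powr_add[symmetric])
  qed
  have "block_energy \<eta> (Suc j) = (1/2) * 2 powr (-(real j * 3)) * ((real N)\<^sup>2 * S)"
    unfolding block_energy_def S_def[symmetric] N2 by simp
  also have "\<dots> \<le> (1/2) * 2 powr (-(real j * 3)) * (256 * (2 powr (real (Suc j) * (\<alpha> + 1)) * dnorm 2 \<alpha> (Rhaly \<eta> (block_fun j)) powr 2))"
    by (intro mult_left_mono 1) auto
  also have "\<dots> = 128 * (2 powr (-(real j * 3) + real (Suc j) * (\<alpha> + 1))) * dnorm 2 \<alpha> (Rhaly \<eta> (block_fun j)) powr 2"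
    unfolding powr_add by simp
  also have "-(real j * 3) + real (Suc j) * (\<alpha> + 1) = (\<alpha> + 1) + -(real j * (2 - \<alpha>))" by (simp add: algebra_simps)
  also have "128 * 2 powr ((\<alpha> + 1) + -(real j * (2 - \<alpha>))) * dnorm 2 \<alpha> (Rhaly \<eta> (block_fun j)) powr 2
      = 128 * 2 powr (\<alpha> + 1) * (2 powr (-(real j * (2 - \<alpha>) / 2)) * dnorm 2 \<alpha> (Rhaly \<eta> (block_fun j))) powr 2"
    unfolding powr_add by (simp add: powr_mult powr_powr)
  finally show ?thesis .
qed

lemma block_energy_bounded:
  assumes \<alpha>: "-1 < \<alpha>" and \<eta>: "converges_in_disc \<eta>"
    and K: "K > 0" "\<And>f. f \<in> Dirichlet 2 \<alpha> \<Longrightarrow> Rhaly \<eta> f \<in> Dirichlet 2 \<alpha>"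
    "\<And>f. f \<in> Dirichlet 2 \<alpha> \<Longrightarrow> dnorm 2 \<alpha> (Rhaly \<eta> f) \<le> K * dnorm 2 \<alpha> f"
  obtains A where "\<And>j. block_energy \<eta> j \<le> A"
proof -
  obtain C where C: "C > 0" "\<And>j. block_fun j \<in> Dirichlet 2 \<alpha>"
    "\<And>j. dnorm 2 \<alpha> (block_fun j) \<le> C * 2 powr (real j * (2 - \<alpha>) / 2)"
    by (rule block_fun_dnorm[OF \<alpha>]) (rule that)
  have "block_energy \<eta> (Suc j) \<le> 128 * 2 powr (\<alpha> + 1) * (K * C) powr 2" for j
  proof -
    have "2 powr (-(real j * (2 - \<alpha>) / 2)) * dnorm 2 \<alpha> (Rhaly \<eta> (block_fun j)) \<le> 2 powr (-(real j * (2 - \<alpha>) / 2)) * (K * (C * 2 powr (real j * (2 - \<alpha>) / 2)))"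
      using K(1) by (intro mult_left_mono order_trans[OF K(3)[OF C(2)]] C(3)) auto
    also have "\<dots> = K * C" by (simp add: powr_minus)
    finally have "(2 powr (-(real j * (2 - \<alpha>) / 2)) * dnorm 2 \<alpha> (Rhaly \<eta> (block_fun j))) powr 2 \<le> (K * C) powr 2"
      by (intro powr_mono2) auto
    then show ?thesis by (intro order_trans[OF block_energy_le_dnorm[OF \<alpha> \<eta> K(2)[OF C(2)]]] mult_left_mono) auto
  qed
  then have "block_energy \<eta> j \<le> max (block_energy \<eta> 0) (128 * 2 powr (\<alpha> + 1) * (K * C) powr 2)" for j
    by (cases j) (auto simp: le_max_iff_disj)
  then show ?thesis using that by blast
qed

text \<open>The images of the normalized blocks have no coefficients below 2^j, so any subsequential
  limit has all Taylor coefficients 0. Compactness then makes the norms of the whole sequence of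
  images tend to 0, and these dominate the block energies.\<close>

lemma block_energy_tendsto_0:
  assumes \<alpha>: "-1 < \<alpha>" and cp: "Rhaly_compact_Dirichlet \<eta> 2 \<alpha>"
  shows "block_energy \<eta> \<longlonglongrightarrow> 0"
proof -
  have \<eta>: "converges_in_disc \<eta>" using cp Rhaly_well_defined_converges by (auto simp: Rhaly_compact_Dirichlet_def)
  obtain C where C: "C > 0" "\<And>j. block_fun j \<in> Dirichlet 2 \<alpha>"
    "\<And>j. dnorm 2 \<alpha> (block_fun j) \<le> C * 2 powr (real j * (2 - \<alpha>) / 2)"
    by (rule block_fun_dnorm[OF \<alpha>]) (rule that)
  have R: "\<And>f. f \<in> Dirichlet 2 \<alpha> \<Longrightarrow> Rhaly \<eta> f \<in> Dirichlet 2 \<alpha>"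
    using cp by (auto simp: Rhaly_compact_Dirichlet_def compact_operator_on_def linear_operator_on_def)
  define c where "c j = complex_of_real (2 powr (-(real j * (2 - \<alpha>) / 2)))" for j :: nat
  define h where "h j z = c j * block_fun j z" for j z
  have h: "h j \<in> Dirichlet 2 \<alpha>" for j unfolding h_def by (intro Dirichlet_cmult \<alpha> C) auto
  have hB: "dnorm 2 \<alpha> (h j) \<le> C" for j
  proof -
    have "dnorm 2 \<alpha> (h j) = 2 powr (-(real j * (2 - \<alpha>) / 2)) * dnorm 2 \<alpha> (block_fun j)"
      unfolding h_def by (subst dnorm_cmult[OF _ \<alpha> C(2)]) (auto simp: c_def)
    also have "\<dots> \<le> 2 powr (-(real j * (2 - \<alpha>) / 2)) * (C * 2 powr (real j * (2 - \<alpha>) / 2))" by (intro mult_left_mono C) auto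
    also have "\<dots> = C" by (simp add: powr_minus)
    finally show ?thesis .
  qed
  have Rh: "2 powr (-(real j * (2 - \<alpha>) / 2)) * dnorm 2 \<alpha> (Rhaly \<eta> (block_fun j)) = dnorm 2 \<alpha> (Rhaly \<eta> (h j))" for j
  proof -
    have "dnorm 2 \<alpha> (Rhaly \<eta> (h j)) = dnorm 2 \<alpha> (\<lambda>z. c j * Rhaly \<eta> (block_fun j) z)"
      unfolding h_def by (rule dnorm_cong) (rule Rhaly_cmult[OF \<eta> block_fun_Hol(1)])
    then show ?thesis by (subst (asm) dnorm_cmult[OF _ \<alpha> R[OF C(2)]]) (auto simp: c_def)
  qed
  have coeff: "taylor_coeff (Rhaly \<eta> (h j)) n = 0" if "n < 2 ^ j" for n j
  proof -
    have "taylor_coeff (h j) k = 0" if "k \<le> n" for k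
      using that \<open>n < 2 ^ j\<close> unfolding h_def by (subst taylor_coeff_cmult[OF block_fun_Hol(1)]) (auto simp: block_fun_Hol block_def)
    then show ?thesis by (simp add: Rhaly_Hol(2)[OF \<eta> Dirichlet_Hol[OF h]])
  qed
  have sub: "\<exists>s'. strict_mono (s' :: nat \<Rightarrow> nat) \<and> (\<lambda>n. dnorm 2 \<alpha> (Rhaly \<eta> (h (s (s' n))))) \<longlonglongrightarrow> 0" if s: "strict_mono (s :: nat \<Rightarrow> nat)" for s
  proof -
    obtain g s' where g: "g \<in> Dirichlet 2 \<alpha>" and s': "strict_mono (s' :: nat \<Rightarrow> nat)"
      and lim: "(\<lambda>n. dnorm 2 \<alpha> (\<lambda>z. Rhaly \<eta> (h (s (s' n))) z - g z)) \<longlonglongrightarrow> 0"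
      by (rule Rhaly_compact_dnorm[OF _ \<alpha> cp, of "\<lambda>n. h (s n)"]) (use h hB that in \<open>auto\<close>)
    have D: "(\<lambda>z. Rhaly \<eta> (h (s (s' n))) z - g z) \<in> Dirichlet 2 \<alpha>" for n
      by (intro Dirichlet_diff \<alpha> R h g) auto
    have "taylor_coeff g k = 0" for k
    proof (rule ccontr)
      assume nz: "taylor_coeff g k \<noteq> 0"
      obtain C1 where C1: "C1 > 0" "\<And>f (z::complex). f \<in> Dirichlet 2 \<alpha> \<Longrightarrow> norm z \<le> dyad 1 \<Longrightarrow> norm (f z) \<le> C1 * dnorm 2 \<alpha> f"
        using Dirichlet_pointwise[of 2 \<alpha> 1] \<alpha> by auto
      \<comment> \<open>For such n the k-th coefficient of the difference is that of -g; a Fourier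
        integral over the circle of radius 1/2 bounds it by the norm of the difference, which tends
        to 0.\<close>
      have bound: "norm (taylor_coeff g k) * dyad 1 ^ k \<le> C1 * dnorm 2 \<alpha> (\<lambda>z. Rhaly \<eta> (h (s (s' n))) z - g z)" if "k \<le> n" for n
      proof -
        let ?f = "\<lambda>z. Rhaly \<eta> (h (s (s' n))) z - g z"
        have "n \<le> s (s' n)" using seq_suble[OF s', of n] seq_suble[OF s, of "s' n"] by simp
        then have kk: "k < 2 ^ s (s' n)" using that less_exp[of "s (s' n)"] by linarith
        have "taylor_coeff ?f k = taylor_coeff (\<lambda>z. Rhaly \<eta> (h (s (s' n))) z + (-1) * g z) k" by simp
        also have "\<dots> = taylor_coeff (Rhaly \<eta> (h (s (s' n)))) k + taylor_coeff (\<lambda>z. (-1) * g z) k"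
          by (intro taylor_coeff_add Dirichlet_Hol[OF R[OF h]] Hol_cmult Dirichlet_Hol[OF g])
        also have "\<dots> = - taylor_coeff g k"
          unfolding coeff[OF kk] taylor_coeff_cmult[OF Dirichlet_Hol[OF g]] by simp
        finally have t: "taylor_coeff ?f k = - taylor_coeff g k" .
        have "norm (taylor_coeff g k) * dyad 1 ^ k = norm (\<integral>t. ?f (of_real (dyad 1) * cis t) * cis (- (real k * t)) \<partial>circ)"
          using Hol_coeff_integral[OF Dirichlet_Hol[OF D[of n]] dyad_bounds, of 1 k] by (simp add: t norm_mult norm_power)
        also have "\<dots> \<le> (\<integral>t. norm (?f (of_real (dyad 1) * cis t) * cis (- (real k * t))) \<partial>circ)" by (rule integral_norm_bound)
        also have "\<dots> \<le> (\<integral>t. C1 * dnorm 2 \<alpha> ?f \<partial>circ)"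
          by (intro integral_mono integrable_circ_cont[OF continuous_on_norm[OF continuous_on_mult[OF Hol_cont_circle[OF Dirichlet_Hol[OF D]]]]])
             (auto simp: norm_mult intro!: C1(2)[OF D] continuous_intros)
        finally show ?thesis by simp
      qed
      have "(\<lambda>n. C1 * dnorm 2 \<alpha> (\<lambda>z. Rhaly \<eta> (h (s (s' n))) z - g z)) \<longlonglongrightarrow> 0" by (rule tendsto_mult_right_zero[OF lim])
      then have "norm (taylor_coeff g k) * dyad 1 ^ k \<le> 0"
        by (rule LIMSEQ_le_const) (use bound in blast)
      moreover have "norm (taylor_coeff g k) * dyad 1 ^ k > 0" using nz by (simp add: dyad_def)
      ultimately show False by simp
    qed
    then have g0: "g z = 0" if "norm z < 1" for z
      using Hol_sums[OF Dirichlet_Hol[OF g] that] by (simp add: sums_iff)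
    have "dnorm 2 \<alpha> (\<lambda>z. Rhaly \<eta> (h (s (s' n))) z - g z) = dnorm 2 \<alpha> (Rhaly \<eta> (h (s (s' n))))" for n
      by (rule dnorm_cong) (simp add: g0)
    then show ?thesis using lim s' by auto
  qed
  have lim: "(\<lambda>j. dnorm 2 \<alpha> (Rhaly \<eta> (h j))) \<longlonglongrightarrow> 0"
  proof (rule ccontr)
    assume "\<not> (\<lambda>j. dnorm 2 \<alpha> (Rhaly \<eta> (h j))) \<longlonglongrightarrow> 0"
    then obtain e where e: "e > 0" "\<And>N. \<exists>j\<ge>N. e \<le> dnorm 2 \<alpha> (Rhaly \<eta> (h j))"
      unfolding LIMSEQ_iff by (auto simp: not_less)
    have inf: "infinite {j. e \<le> dnorm 2 \<alpha> (Rhaly \<eta> (h j))}"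
      unfolding infinite_nat_iff_unbounded_le using e(2) by blast
    obtain s :: "nat \<Rightarrow> nat" where s: "strict_mono s" "\<And>n. s n \<in> {j. e \<le> dnorm 2 \<alpha> (Rhaly \<eta> (h j))}"
      using infinite_enumerate[OF inf] by blast
    obtain s' where s': "(\<lambda>n. dnorm 2 \<alpha> (Rhaly \<eta> (h (s (s' n))))) \<longlonglongrightarrow> 0" using sub[OF s(1)] by blast
    have "e \<le> 0" by (rule LIMSEQ_le_const[OF s']) (use s(2) in auto)
    then show False using e by simp
  qed
  have "(\<lambda>j. 128 * 2 powr (\<alpha> + 1) * (dnorm 2 \<alpha> (Rhaly \<eta> (h j)) * 1) powr 2) \<longlonglongrightarrow> 0"
    by (rule tendsto_powr_zero_mult[OF lim]) auto
  then have l: "(\<lambda>j. 128 * 2 powr (\<alpha> + 1) * dnorm 2 \<alpha> (Rhaly \<eta> (h j)) powr 2) \<longlonglongrightarrow> 0" by simp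
  have le: "norm (block_energy \<eta> (Suc j)) \<le> 128 * 2 powr (\<alpha> + 1) * dnorm 2 \<alpha> (Rhaly \<eta> (h j)) powr 2" for j
    using block_energy_le_dnorm[OF \<alpha> \<eta> R[OF C(2)], of j] unfolding Rh by simp
  have "(\<lambda>j. block_energy \<eta> (Suc j)) \<longlonglongrightarrow> 0"
    by (rule Lim_null_comparison[OF always_eventually l]) (use le in blast)
  then show ?thesis by (simp only: filterlim_sequentially_Suc)
qed

section \<open>From block energies to the mean Lipschitz condition\<close>

lemma sum_blocks:
  fixes a :: "nat \<Rightarrow> real"
  assumes "a 0 = 0"
  shows "(\<Sum>n<2 ^ J. a n) = (\<Sum>j<J. \<Sum>n\<in>block j. a n)"
proof (induction J)
  case (Suc J)
  have "{..<2 ^ Suc J} = {..<2 ^ J} \<union> block J" by (auto simp: block_def)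
  moreover have "{..<2 ^ J} \<inter> block J = {}" by (auto simp: block_def)
  ultimately show ?case using Suc by (simp add: sum.union_disjoint)
qed (simp add: assms)

lemma suminf_le_blocks:
  fixes a :: "nat \<Rightarrow> real"
  assumes a: "a sums S" "\<And>n. 0 \<le> a n" "a 0 = 0" and le: "\<And>J. (\<Sum>j<J. \<Sum>n\<in>block j. a n) \<le> C"
  shows "S \<le> C"
proof -
  have "(\<Sum>n<N. a n) \<le> C" for N
  proof -
    have "(\<Sum>n<N. a n) \<le> (\<Sum>n<2 ^ N. a n)"
      by (rule sum_mono2) (use a(2) less_exp[of N] in auto)
    then show ?thesis unfolding sum_blocks[of a N, OF a(3)] using le[of N] by simp
  qed
  then show ?thesis using suminf_le_const[OF sums_summable[OF a(1)]] sums_unique[OF a(1)] by simp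
qed

lemma sum_block_weight:
  assumes "\<And>n. n \<in> block j \<Longrightarrow> a n \<le> (real n * norm (\<eta> n))\<^sup>2 * c"
  shows "(\<Sum>n\<in>block j. a n) \<le> block_energy \<eta> j * (2 ^ j * c)"
proof -
  have "(\<Sum>n\<in>block j. a n) \<le> (\<Sum>n\<in>block j. (real n * norm (\<eta> n))\<^sup>2 * c)" by (intro sum_mono assms)
  also have "\<dots> = block_energy \<eta> j * (2 ^ j * c)"
    by (simp add: block_energy_def sum_distrib_right[symmetric] power_one_over)
  finally show ?thesis .
qed

lemma norm_cis_minus_1_le: "norm (cis x - 1) \<le> min \<bar>x\<bar> 2"
proof -
  have "norm (cis x - 1) = 2 * \<bar>sin (x / 2)\<bar>" using dist_exp_i_1[of x] by (simp add: cis_conv_exp)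
  then show ?thesis using abs_sin_le_one[of "x/2"] abs_sin_x_le_abs_x[of "x/2"] by (simp add: min_def)
qed

lemma taylor_coeff_rot_diff:
  assumes "converges_in_disc \<eta>"
  shows "taylor_coeff (rot_diff (power_series \<eta>) t) n = \<eta> n * (cis (real n * t) - 1)"
proof (rule Hol_coeff_unique(2))
  fix z :: complex assume z: "norm z < 1"
  have "(\<lambda>n. \<eta> n * (cis t * z) ^ n - \<eta> n * z ^ n) sums rot_diff (power_series \<eta>) t z"
    unfolding rot_diff_def by (intro sums_diff power_series_Hol assms) (use z in \<open>auto simp: norm_mult\<close>)
  then show "(\<lambda>n. \<eta> n * (cis (real n * t) - 1) * z ^ n) sums rot_diff (power_series \<eta>) t z"
    by (simp add: power_mult_distrib Complex.DeMoivre algebra_simps)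
qed

lemma geometric_weights:
  fixes t :: real
  assumes t: "t \<noteq> 0" "\<bar>t\<bar> \<le> 1"
  shows "(\<Sum>j<J. 2 ^ j * (min \<bar>t\<bar> (2 / 2 ^ j))\<^sup>2) \<le> 32 * \<bar>t\<bar>"
proof -
  \<comment> \<open>The scale with 2^(-i) comparable to |t|, where the two entries of the minimum
    balance and the weights have their peak.\<close>
  obtain i where i: "dyad i \<le> 1 - \<bar>t\<bar>" "1 - \<bar>t\<bar> < dyad (Suc i)"
    using dyad_interval[of "1 - \<bar>t\<bar>"] t by auto
  have ti: "\<bar>t\<bar> \<le> (1/2) ^ i" "(1/2) ^ i < 2 * \<bar>t\<bar>" using i by (auto simp: dyad_def)
  define w where "w j = 2 ^ j * (min \<bar>t\<bar> (2 / 2 ^ j))\<^sup>2" for j :: nat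
  define B :: real where "B = 4 * (1/2) ^ i"
  have 1: "w j \<le> B * (1/2) ^ (i - j)" if "j \<le> i" for j
  proof -
    have "w j \<le> 2 ^ j * ((1/2) ^ i)\<^sup>2"
      unfolding w_def using ti by (intro mult_left_mono power_mono) auto
    also have "\<dots> = (1/2) ^ i * (1/2) ^ (i - j)"
      using that by (simp add: power2_eq_square power_diff power_one_over field_simps)
    also have "\<dots> \<le> B * (1/2) ^ (i - j)" by (intro mult_right_mono) (auto simp: B_def)
    finally show ?thesis .
  qed
  have 2: "w j \<le> B * (1/2) ^ (j - i)" if "i \<le> j" for j
  proof -
    have "w j \<le> 2 ^ j * (2 / 2 ^ j)\<^sup>2"
      unfolding w_def by (intro mult_left_mono power_mono) auto
    also have "\<dots> = B * (1/2) ^ (j - i)"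
      using that by (simp add: B_def power2_eq_square power_diff power_one_over field_simps)
    finally show ?thesis .
  qed
  have w: "0 \<le> w j" for j by (simp add: w_def)
  have B: "0 \<le> B" by (simp add: B_def)
  have "(\<Sum>j<J. w j) \<le> (\<Sum>j. w j)"
    by (rule sum_le_suminf[OF two_sided_geometric(1)[OF _ _ w B 1 2]]) (auto simp: w)
  also have "\<dots> \<le> 2 * B / (1 - 1/2)" by (rule two_sided_geometric(2)[OF _ _ w B 1 2]) auto
  also have "\<dots> \<le> 32 * \<bar>t\<bar>" using ti by (simp add: B_def)
  finally show ?thesis by (simp add: w_def)
qed

text \<open>By Parseval the n-th term carries |e^(int) - 1|^2 \<le> min(n |t|, 2)^2. The first m
  blocks are estimated by A and contribute a multiple of t^2, negligible against |t|; only the later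
  blocks, of energy at most \<epsilon>, contribute at the critical order.\<close>

lemma Mp_rot_diff_block_energy:
  assumes \<eta>: "converges_in_disc \<eta>" and A: "\<And>j. block_energy \<eta> j \<le> A" and e: "\<And>j. m \<le> j \<Longrightarrow> block_energy \<eta> j \<le> \<epsilon>"
    and t: "t \<noteq> 0" "\<bar>t\<bar> \<le> 1" and R: "0 \<le> R" "R < 1"
  shows "Mp 2 R (rot_diff (power_series \<eta>) t) powr 2 \<le> A * 2 ^ m * t\<^sup>2 + 32 * \<epsilon> * \<bar>t\<bar>"
proof (rule suminf_le_blocks[OF Mp2_Parseval[OF rot_diff_Hol[OF power_series_Hol(1)[OF \<eta>]] R]])
  have A0: "0 \<le> A" using order_trans[OF block_energy_nonneg A] .
  have e0: "0 \<le> \<epsilon>" using order_trans[OF block_energy_nonneg e[OF order_refl]] .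
  let ?w = "\<lambda>j::nat. 2 ^ j * (min \<bar>t\<bar> (2 / 2 ^ j))\<^sup>2"
  let ?a = "\<lambda>n. (norm (taylor_coeff (rot_diff (power_series \<eta>) t) n) * R ^ n)\<^sup>2"
  show "0 \<le> ?a n" for n by simp
  show "?a 0 = 0" by (simp add: taylor_coeff_rot_diff[OF \<eta>])
  fix J
  have blk: "(\<Sum>n\<in>block j. ?a n) \<le> block_energy \<eta> j * ?w j" for j
  proof (rule sum_block_weight)
    fix n assume n: "n \<in> block j"
    then have n2: "2 ^ j \<le> real n" by (auto simp: block_def)
    have np: "real n > 0" using n2 zero_less_power[of "2::real" j] by linarith
    have "norm (taylor_coeff (rot_diff (power_series \<eta>) t) n) * R ^ n \<le> norm (\<eta> n) * min \<bar>real n * t\<bar> 2 * 1"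
      unfolding taylor_coeff_rot_diff[OF \<eta>] norm_mult
      using R by (intro mult_mono mult_left_mono norm_cis_minus_1_le) (auto simp: power_le_one)
    also have "min \<bar>real n * t\<bar> 2 = real n * min \<bar>t\<bar> (2 / real n)"
      using np by (simp add: min_def abs_mult field_simps)
    also have "norm (\<eta> n) * (real n * min \<bar>t\<bar> (2 / real n)) * 1 \<le> real n * norm (\<eta> n) * min \<bar>t\<bar> (2 / 2 ^ j)"
    proof -
      have "2 / real n \<le> 2 / 2 ^ j" using n2 np by (intro divide_left_mono) auto
      then have "min \<bar>t\<bar> (2 / real n) \<le> min \<bar>t\<bar> (2 / 2 ^ j)" by simp
      then have "real n * norm (\<eta> n) * min \<bar>t\<bar> (2 / real n) \<le> real n * norm (\<eta> n) * min \<bar>t\<bar> (2 / 2 ^ j)"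
        by (rule mult_left_mono) simp
      then show ?thesis by (simp only: mult_ac mult_1_right)
    qed
    finally have "?a n \<le> (real n * norm (\<eta> n) * min \<bar>t\<bar> (2 / 2 ^ j))\<^sup>2" using R by (intro power_mono) auto
    then show "?a n \<le> (real n * norm (\<eta> n))\<^sup>2 * (min \<bar>t\<bar> (2 / 2 ^ j))\<^sup>2" by (simp only: power_mult_distrib)
  qed
  have "(\<Sum>j<J. \<Sum>n\<in>block j. ?a n) \<le> (\<Sum>j<J. (if j < m then A * t\<^sup>2 * 2 ^ j else 0) + \<epsilon> * ?w j)"
  proof (rule sum_mono)
    fix j
    have "block_energy \<eta> j * ?w j \<le> (if j < m then A * t\<^sup>2 * 2 ^ j else 0) + \<epsilon> * ?w j"
    proof (cases "j < m")
      case True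
      have "(min \<bar>t\<bar> (2 / 2 ^ j))\<^sup>2 \<le> \<bar>t\<bar>\<^sup>2" by (intro power_mono) auto
      then have "block_energy \<eta> j * ?w j \<le> A * (2 ^ j * t\<^sup>2)" by (intro mult_mono A A0 mult_left_mono) auto
      moreover have "0 \<le> \<epsilon> * ?w j" using e0 by simp
      ultimately show ?thesis using True by (simp only: if_True mult_ac)
    next
      case False
      then show ?thesis using mult_right_mono[OF e[of j], of "?w j"] by simp
    qed
    then show "(\<Sum>n\<in>block j. ?a n) \<le> (if j < m then A * t\<^sup>2 * 2 ^ j else 0) + \<epsilon> * ?w j"
      using blk[of j] by simp
  qed
  also have "\<dots> = (\<Sum>j<J. if j < m then A * t\<^sup>2 * 2 ^ j else 0) + \<epsilon> * (\<Sum>j<J. ?w j)"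
    by (simp only: sum.distrib sum_distrib_left)
  also have "\<dots> \<le> A * t\<^sup>2 * 2 ^ m + \<epsilon> * (32 * \<bar>t\<bar>)"
  proof (intro add_mono mult_left_mono geometric_weights t e0)
    have "(\<Sum>j<J. if j < m then A * t\<^sup>2 * 2 ^ j else 0) = (\<Sum>j\<in>{..<J} \<inter> {..<m}. A * t\<^sup>2 * 2 ^ j)"
      by (subst sum.inter_restrict) auto
    also have "\<dots> \<le> (\<Sum>j<m. A * t\<^sup>2 * 2 ^ j)" using A0 by (intro sum_mono2) auto
    also have "\<dots> = A * t\<^sup>2 * (\<Sum>j<m. 2 ^ j)" by (simp only: sum_distrib_left)
    also have "(\<Sum>j<m. (2::real) ^ j) \<le> 2 ^ m" by (simp add: sum_gp_strict)
    finally show "(\<Sum>j<J. if j < m then A * t\<^sup>2 * 2 ^ j else 0) \<le> A * t\<^sup>2 * 2 ^ m"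
      using A0 by (simp add: mult_left_mono)
  qed
  finally show "(\<Sum>j<J. \<Sum>n\<in>block j. ?a n) \<le> A * 2 ^ m * t\<^sup>2 + 32 * \<epsilon> * \<bar>t\<bar>" by (simp add: mult_ac)
qed

lemma Hardy_block_energy:
  assumes \<eta>: "converges_in_disc \<eta>" and A: "\<And>j. block_energy \<eta> j \<le> A"
  shows "power_series \<eta> \<in> Hardy 2"
proof -
  note H = power_series_Hol[OF \<eta>]
  have A0: "0 \<le> A" using order_trans[OF block_energy_nonneg A] .
  have le: "Mp 2 R (\<lambda>z. power_series \<eta> z - \<eta> 0) powr 2 \<le> 2 * A" if R: "0 < R" "R < 1" for R
  proof -
    \<comment> \<open>The blocks start at n = 1, so the constant term is split off and restored at
      the end.\<close>
    have s: "(\<lambda>n. (if n = 0 then 0 else \<eta> n) * z ^ n) sums (power_series \<eta> z - \<eta> 0)" if "norm z < 1" for z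
      using sums_diff[OF H(3)[OF that] sums_single[of 0 "\<lambda>n. \<eta> n * z ^ n"]]
      by (simp add: if_distrib[of "\<lambda>x. x * _"] if_distrib[of "\<lambda>x. _ - x"] cong: if_cong)
    note c = Hol_coeff_unique[OF s]
    show ?thesis
    proof (rule suminf_le_blocks[OF Mp2_Parseval[OF c(1) less_imp_le[OF R(1)] R(2)]])
      fix J
      have "(\<Sum>n\<in>block j. (norm (taylor_coeff (\<lambda>z. power_series \<eta> z - \<eta> 0) n) * R ^ n)\<^sup>2) \<le> A * (1/2) ^ j" for j
      proof -
        have "(\<Sum>n\<in>block j. (norm (taylor_coeff (\<lambda>z. power_series \<eta> z - \<eta> 0) n) * R ^ n)\<^sup>2) \<le> block_energy \<eta> j * (2 ^ j * (1 / 2 ^ j)\<^sup>2)"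
        proof (rule sum_block_weight)
          fix n assume n: "n \<in> block j"
          then have n2: "2 ^ j \<le> real n" by (auto simp: block_def)
          have "norm (taylor_coeff (\<lambda>z. power_series \<eta> z - \<eta> 0) n) * R ^ n \<le> norm (\<eta> n) * 1"
            using R by (intro mult_mono) (auto simp: c(2) power_le_one)
          also have "\<dots> \<le> norm (\<eta> n) * (real n * (1 / 2 ^ j))" using n2 by (intro mult_left_mono) auto
          finally have "(norm (taylor_coeff (\<lambda>z. power_series \<eta> z - \<eta> 0) n) * R ^ n)\<^sup>2 \<le> (norm (\<eta> n) * (real n * (1 / 2 ^ j)))\<^sup>2"
            using R by (intro power_mono) auto
          then show "(norm (taylor_coeff (\<lambda>z. power_series \<eta> z - \<eta> 0) n) * R ^ n)\<^sup>2 \<le> (real n * norm (\<eta> n))\<^sup>2 * (1 / 2 ^ j)\<^sup>2"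
            by (simp only: power_mult_distrib mult_ac)
        qed
        also have "\<dots> = block_energy \<eta> j * (1/2) ^ j" by (simp add: power2_eq_square power_one_over)
        also have "\<dots> \<le> A * (1/2) ^ j" by (intro mult_right_mono A) simp
        finally show ?thesis .
      qed
      then have "(\<Sum>j<J. \<Sum>n\<in>block j. (norm (taylor_coeff (\<lambda>z. power_series \<eta> z - \<eta> 0) n) * R ^ n)\<^sup>2) \<le> (\<Sum>j<J. A * (1/2) ^ j)"
        by (intro sum_mono)
      also have "\<dots> = A * (\<Sum>j<J. (1/2) ^ j)" by (simp only: sum_distrib_left)
      also have "\<dots> \<le> A * 2" using A0 by (intro mult_left_mono) (auto simp: sum_gp_strict)
      finally show "(\<Sum>j<J. \<Sum>n\<in>block j. (norm (taylor_coeff (\<lambda>z. power_series \<eta> z - \<eta> 0) n) * R ^ n)\<^sup>2) \<le> 2 * A" by simp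
    qed (auto simp: c(2))
  qed
  have "Mp 2 R (power_series \<eta>) \<le> (2 * A) powr (1/2) + norm (\<eta> 0)" if R: "0 < R" "R < 1" for R
  proof -
    have "(Mp 2 R (\<lambda>z. power_series \<eta> z - \<eta> 0) powr 2) powr (1/2) \<le> (2 * A) powr (1/2)"
      by (intro powr_mono2 le R) auto
    then have 1: "Mp 2 R (\<lambda>z. power_series \<eta> z - \<eta> 0) \<le> (2 * A) powr (1/2)" by (simp add: powr_powr)
    have cH: "(\<lambda>z. c) \<in> Hol" for c by (simp add: Hol_def)
    have "Mp 2 R (power_series \<eta>) = Mp 2 R (\<lambda>z. (power_series \<eta> z - \<eta> 0) + \<eta> 0)" by simp
    also have "\<dots> \<le> Mp 2 R (\<lambda>z. power_series \<eta> z - \<eta> 0) + Mp 2 R (\<lambda>z. \<eta> 0)"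
      using R by (intro Mp_triangle Hol_diff H cH) auto
    also have "Mp 2 R (\<lambda>z. \<eta> 0) = norm (\<eta> 0)"
      using R by (simp add: Mp_eq_Lc[OF cH] Lc_def powr_powr del: powr_numeral)
    finally show ?thesis using 1 by simp
  qed
  then show ?thesis using H(1) by (auto simp: Hardy_def intro!: bdd_aboveI)
qed

lemma Suc_mult_power_le:
  assumes "0 \<le> (r::real)" "r < 1"
  shows "real (Suc n) * r ^ n \<le> 1 / (1 - r)"
proof -
  have "real (Suc n) * r ^ n = (\<Sum>k<Suc n. r ^ n)" by simp
  also have "\<dots> \<le> (\<Sum>k<Suc n. r ^ k)"
    using assms by (intro sum_mono power_decreasing) auto
  also have "\<dots> \<le> (\<Sum>k. r ^ k)" using assms by (intro sum_le_suminf summable_geometric) auto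
  also have "\<dots> = 1 / (1 - r)" using assms by (intro suminf_geometric) auto
  finally show ?thesis .
qed

text \<open>The exponent 3/2 is a compromise. Replacing (r^(n-1))^2 by ((1 - r) n)^(-e) makes the
  sum over blocks geometric for e > 1, and the resulting bound (1 - r)^(-e/2) for the mean is
  integrable for e < 2.\<close>

lemma Mp2_deriv_block_energy:
  assumes \<eta>: "converges_in_disc \<eta>" and A: "\<And>j. block_energy \<eta> j \<le> A"
  obtains C where "C > 0"
    "\<And>r. 0 \<le> r \<Longrightarrow> r < 1 \<Longrightarrow> Mp 2 r (deriv (power_series \<eta>)) powr 2 \<le> C * (1 - r) powr (-(3/2))"
proof -
  have A0: "0 \<le> A" using order_trans[OF block_energy_nonneg A] .
  note H = power_series_Hol[OF \<eta>]
  define q :: real where "q = 2 powr (-(1/2))"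
  have q: "0 < q" "q < 1" using powr_less_mono[of "-(1/2)" 0 2] by (auto simp: q_def)
  show ?thesis
  proof (rule that[of "A / (1 - q) + 1"])
    show "A / (1 - q) + 1 > 0" using A0 q by (intro add_nonneg_pos divide_nonneg_pos) auto
    fix r :: real assume r: "0 \<le> r" "r < 1"
    define a where "a n = (real n * norm (\<eta> n) * r ^ (n - 1))\<^sup>2" for n
    have "(\<lambda>n. a (Suc n)) sums (Mp 2 r (deriv (power_series \<eta>)) powr 2)"
      unfolding a_def using Mp2_deriv_Parseval[OF H(1) r] by (simp add: H(2))
    from sums_Suc[OF this] have s: "a sums (Mp 2 r (deriv (power_series \<eta>)) powr 2)" by (simp add: a_def[abs_def])
    have "Mp 2 r (deriv (power_series \<eta>)) powr 2 \<le> A / (1 - q) * (1 - r) powr (-(3/2))"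
    proof (rule suminf_le_blocks[OF s])
      fix J
      have b: "(\<Sum>n\<in>block j. a n) \<le> A * (1 - r) powr (-(3/2)) * q ^ j" for j
      proof -
        have "(\<Sum>n\<in>block j. a n) \<le> block_energy \<eta> j * (2 ^ j * ((1 - r) powr (-(3/2)) * (2 ^ j) powr (-(3/2))))"
        proof (rule sum_block_weight)
          fix n assume n: "n \<in> block j"
          then have n2: "2 ^ j \<le> real n" by (auto simp: block_def)
          have np: "real n > 0" using n2 zero_less_power[of "2::real" j] by linarith
          have u: "real n * r ^ (n - 1) \<le> 1 / (1 - r)" using Suc_mult_power_le[OF r, of "n - 1"] np by simp
          have "(r ^ (n - 1))\<^sup>2 = (r ^ (n - 1)) powr 2" using r by simp
          also have "\<dots> \<le> (r ^ (n - 1)) powr (3/2)" using r by (intro powr_mono') (auto simp: power_le_one)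
          also have "\<dots> = (real n * r ^ (n - 1)) powr (3/2) * real n powr (-(3/2))"
            using np r by (simp add: powr_mult powr_minus field_simps)
          also have "\<dots> \<le> (1 / (1 - r)) powr (3/2) * (2 ^ j) powr (-(3/2))"
            using u r n2 by (intro mult_mono powr_mono2 powr_mono2') auto
          also have "(1 / (1 - r)) powr (3/2) = (1 - r) powr (-(3/2))" using r by (simp add: powr_divide powr_minus_divide)
          finally have "(real n * norm (\<eta> n))\<^sup>2 * (r ^ (n - 1))\<^sup>2 \<le> (real n * norm (\<eta> n))\<^sup>2 * ((1 - r) powr (-(3/2)) * (2 ^ j) powr (-(3/2)))"
            by (intro mult_left_mono) auto
          then show "a n \<le> (real n * norm (\<eta> n))\<^sup>2 * ((1 - r) powr (-(3/2)) * (2 ^ j) powr (-(3/2)))"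
            unfolding a_def power_mult_distrib .
        qed
        also have "2 ^ j * ((1 - r) powr (-(3/2)) * (2 ^ j) powr (-(3/2))) = (1 - r) powr (-(3/2)) * q ^ j"
          by (simp add: q_def powr_realpow[symmetric] powr_powr powr_add[symmetric] mult_ac)
        also have "block_energy \<eta> j * ((1 - r) powr (-(3/2)) * q ^ j) \<le> A * ((1 - r) powr (-(3/2)) * q ^ j)"
          using q by (intro mult_right_mono A) auto
        finally show ?thesis by (simp only: mult_ac)
      qed
      have "(\<Sum>j<J. \<Sum>n\<in>block j. a n) \<le> (\<Sum>j<J. A * (1 - r) powr (-(3/2)) * q ^ j)" by (intro sum_mono b)
      also have "\<dots> = A * (1 - r) powr (-(3/2)) * (\<Sum>j<J. q ^ j)" by (simp only: sum_distrib_left)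
      also have "\<dots> \<le> A * (1 - r) powr (-(3/2)) * (1 / (1 - q))"
      proof (rule mult_left_mono)
        have "(\<Sum>j<J. q ^ j) \<le> (\<Sum>j. q ^ j)" using q by (intro sum_le_suminf summable_geometric) auto
        then show "(\<Sum>j<J. q ^ j) \<le> 1 / (1 - q)" using q by (simp add: suminf_geometric)
      qed (use A0 in auto)
      finally show "(\<Sum>j<J. \<Sum>n\<in>block j. a n) \<le> A / (1 - q) * (1 - r) powr (-(3/2))" by simp
    qed (auto simp: a_def)
    also have "\<dots> \<le> (A / (1 - q) + 1) * (1 - r) powr (-(3/2))" by (intro mult_right_mono) auto
    finally show "Mp 2 r (deriv (power_series \<eta>)) powr 2 \<le> (A / (1 - q) + 1) * (1 - r) powr (-(3/2))" .
  qed
qed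

section \<open>Existence of boundary values\<close>

lemma AE_lborel_periodic:
  assumes P: "AE t in circ. P t" and per: "\<And>t. P (t + 2*pi) \<longleftrightarrow> P t"
  shows "AE t in lborel. P t"
proof -
  have 0: "AE t in lborel. t \<in> {0..2*pi} \<longrightarrow> P t"
    using P unfolding circ_def by (subst (asm) AE_uniform_measure) auto
  have "AE t in lborel. \<forall>m::int. t + 2 * pi * of_int m \<in> {0..2*pi} \<longrightarrow> P (t + 2 * pi * of_int m)"
    unfolding AE_all_countable by (intro allI AE_lborel_shift[OF 0])
  then show ?thesis
  proof eventually_elim
    case (elim t)
    have pern: "P (t + 2 * pi * real n) \<longleftrightarrow> P t" for n t
    proof (induction n)
      case (Suc n)
      then show ?case using per[of "t + 2 * pi * real n"] by (simp add: algebra_simps)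
    qed simp
    have per_int: "P (t + 2 * pi * of_int m) \<longleftrightarrow> P t" for m
    proof (cases "m \<ge> 0")
      case True
      then show ?thesis using pern[of t "nat m"] by simp
    next
      case False
      then show ?thesis using pern[of "t + 2 * pi * of_int m" "nat (-m)"] by simp
    qed
    define m where "m = - \<lfloor>t / (2*pi)\<rfloor>"
    have "of_int \<lfloor>t / (2*pi)\<rfloor> * (2*pi) \<le> t" "t \<le> (of_int \<lfloor>t / (2*pi)\<rfloor> + 1) * (2*pi)"
      using floor_divide_lower[of "2*pi" t] floor_divide_upper[of "2*pi" t] by simp_all
    then have "t + 2 * pi * of_int m \<in> {0..2*pi}" by (simp add: m_def algebra_simps)
    then show ?case using elim per_int by blast
  qed
qed

text \<open>The mean of |F'| is integrable in the distance s = 1 - r from the circle, so by Fubini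
  F' is integrable along almost every radius, and F converges along each of these.\<close>

lemma has_boundary_values_if_deriv:
  assumes F: "F \<in> Hol" and C: "C > 0"
    "\<And>r. 0 \<le> r \<Longrightarrow> r < 1 \<Longrightarrow> Mp 2 r (deriv F) powr 2 \<le> C * (1 - r) powr (-(3/2))"
  shows "has_boundary_values F"
proof -
  note F' = Hol_deriv[OF F]
  define G where "G s t = deriv F (of_real (1 - s) * cis t)" for s t
  define K where "K = (C + 1) / 2"
  have inner: "(\<integral>\<^sup>+t. ennreal (norm (G s t)) \<partial>circ) \<le> ennreal (K * s powr (-(3/4)))" if s: "0 < s" "s \<le> 1" for s
  proof -
    \<comment> \<open>The size expected of the quadratic mean. With it, 2 c |G| \<le> c^2 + |G|^2
      passes from quadratic to linear means.\<close>
    define c where "c = s powr (-(3/4))"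
    have c: "c > 0" using s by (simp add: c_def)
    have cc: "c * c = s powr (-(3/2))" by (simp add: c_def powr_add[symmetric])
    have cont: "continuous_on UNIV (G s)" unfolding G_def by (rule Hol_cont_circle[OF F']) (use s in auto)
    have "Mp 2 (1 - s) (deriv F) powr 2 = (\<integral>t. norm (G s t) powr 2 \<partial>circ)"
      using Lc_powr[of 2 "G s"] Mp_eq_Lc[OF F', of "1 - s" 2] s by (simp add: G_def[abs_def] del: powr_numeral)
    then have m: "(\<integral>t. norm (G s t) powr 2 \<partial>circ) \<le> C * (c * c)" using C(2)[of "1 - s"] s by (simp add: cc)
    have am: "norm (G s t) \<le> c / 2 + norm (G s t) powr 2 / (2 * c)" for t
    proof -
      have "0 \<le> (norm (G s t) - c)\<^sup>2" by simp
      then have "2 * c * norm (G s t) \<le> c * c + (norm (G s t))\<^sup>2" by (simp add: power2_eq_square algebra_simps)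
      then show ?thesis using c by (simp add: field_simps power2_eq_square)
    qed
    have i: "integrable circ (\<lambda>t. norm (G s t) powr 2)" by (rule integrable_norm_powr[OF cont]) simp
    have i1: "integrable circ (\<lambda>t. norm (G s t))" by (intro integrable_circ_cont continuous_on_norm cont)
    have "(\<integral>t. norm (G s t) \<partial>circ) \<le> (\<integral>t. c / 2 + norm (G s t) powr 2 / (2 * c) \<partial>circ)"
      by (rule integral_mono[OF i1 _ am]) (intro Bochner_Integration.integrable_add integrable_divide i; simp)
    also have "\<dots> = c / 2 + (\<integral>t. norm (G s t) powr 2 \<partial>circ) / (2 * c)"
      by (subst Bochner_Integration.integral_add) (auto simp del: powr_numeral intro!: i integrable_divide)
    also have "\<dots> \<le> c / 2 + C * (c * c) / (2 * c)" using m c by (intro add_left_mono divide_right_mono) auto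
    also have "\<dots> = K * c" using c by (simp add: K_def field_simps)
    finally show ?thesis using i1 by (subst nn_integral_eq_integral) (auto simp: c_def intro: ennreal_leI)
  qed
  define u where "u x = indicator ({0<..1} \<times> UNIV) x *\<^sub>R G (fst x) (snd x)" for x :: "real \<times> real"
  have "u \<in> borel_measurable borel"
    unfolding u_def G_def
  proof (rule borel_measurable_continuous_on_indicator)
    show "{0<..1} \<times> UNIV \<in> sets (borel :: (real \<times> real) measure)"
      unfolding borel_prod[symmetric] by auto
    show "continuous_on ({0<..1} \<times> UNIV) (\<lambda>x::real \<times> real. deriv F (of_real (1 - fst x) * cis (snd x)))"
      by (rule Hol_cont_compose[OF F']) (auto intro!: continuous_intros simp: norm_mult simp del: of_real_diff)
  qed
  then have [measurable]: "u \<in> borel_measurable (borel \<Otimes>\<^sub>M borel)" by (simp add: borel_prod)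
  have ue: "u (s, t) = indicator {0<..1} s *\<^sub>R G s t" for s t by (auto simp: u_def indicator_def)
  have I: "(\<integral>\<^sup>+s. ennreal (indicator {0<..1} s * s powr (-(3/4))) \<partial>lborel) = ennreal 4"
  proof (rule nn_integral_has_integral_lborel)
    have "((\<lambda>x. x powr (-(3/4))) has_integral (1 powr (-(3/4)+1) / (-(3/4)+1))) {0..1::real}"
      by (rule has_integral_powr_from_0) auto
    then have "((\<lambda>x. x powr (-(3/4))) has_integral 4) {0..1::real}" by simp
    then have "((\<lambda>x. if x \<in> {0..1} then x powr (-(3/4)) else 0) has_integral 4) (UNIV :: real set)"
      by (simp only: has_integral_restrict_UNIV)
    then show "((\<lambda>s. indicator {0<..1} s * s powr (-(3/4))) has_integral 4) (UNIV :: real set)"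
      by (rule has_integral_eq[rotated]) (auto simp: indicator_def)
  qed auto
  have "(\<integral>\<^sup>+t. (\<integral>\<^sup>+s. ennreal (norm (u (s, t))) \<partial>lborel) \<partial>circ) = (\<integral>\<^sup>+s. (\<integral>\<^sup>+t. ennreal (norm (u (s, t))) \<partial>circ) \<partial>lborel)"
  proof -
    interpret L: pair_sigma_finite circ "lborel :: real measure" ..
    have [measurable]: "(\<lambda>(t, s). u (s, t)) \<in> borel_measurable (circ \<Otimes>\<^sub>M lborel)" by measurable
    show ?thesis by (rule L.Fubini'[symmetric]) measurable
  qed
  also have "\<dots> \<le> (\<integral>\<^sup>+s. ennreal K * ennreal (indicator {0<..1} s * s powr (-(3/4))) \<partial>lborel)"
  proof (rule nn_integral_mono)
    fix s :: real
    show "(\<integral>\<^sup>+t. ennreal (norm (u (s, t))) \<partial>circ) \<le> ennreal K * ennreal (indicator {0<..1} s * s powr (-(3/4)))"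
      using inner[of s] C(1) by (cases "s \<in> {0<..1}") (auto simp: ue ennreal_mult[symmetric] K_def)
  qed
  also have "\<dots> = ennreal K * 4" by (subst nn_integral_cmult) (auto simp: I)
  also have "\<dots> < \<infinity>" by (simp add: ennreal_mult_less_top)
  finally have fin: "(\<integral>\<^sup>+t. (\<integral>\<^sup>+s. ennreal (norm (u (s, t))) \<partial>lborel) \<partial>circ) \<noteq> \<infinity>" by simp
  have "AE t in circ. (\<integral>\<^sup>+s. ennreal (norm (u (s, t))) \<partial>lborel) \<noteq> \<infinity>"
    by (rule nn_integral_PInf_AE[OF _ fin]) measurable
  then have ae: "AE t in circ. \<exists>l. ((\<lambda>r::real. F (of_real r * cis t)) \<longlongrightarrow> l) (at_left 1)"
  proof eventually_elim
    case (elim t)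
    have [measurable]: "(\<lambda>s. u (s, t)) \<in> borel_measurable borel" by measurable
    have "integrable lborel (\<lambda>s. u (s, t))"
      using elim by (intro integrableI_bounded) (auto simp: less_top)
    then have int: "set_integrable lborel {0<..1} (\<lambda>s. - cis t * G s t)"
      unfolding set_integrable_def
      using integrable_mult_right[of "- cis t" lborel "\<lambda>s. u (s, t)"] by (simp add: ue)
    define \<phi> where "\<phi> s = F (of_real (1 - s) * cis t)" for s
    have ftc: "(LBINT s:{a..1}. - cis t * G s t) = \<phi> 1 - \<phi> a" if a: "0 < a" "a \<le> 1" for a
      unfolding set_lebesgue_integral_def
    proof (rule integral_FTC_atLeastAtMost[OF a(2)])
      show "continuous_on {a..1} (\<lambda>s. - cis t * G s t)" unfolding G_def
        by (intro continuous_intros Hol_cont_compose[OF F']) (use a in \<open>auto simp: norm_mult simp del: of_real_diff\<close>)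
      fix s assume s: "a \<le> s" "s \<le> 1"
      have n: "norm (of_real (1 - s) * cis t) < 1" using a s by (simp add: norm_mult del: of_real_diff)
      have d: "(F has_field_derivative G s t) (at (of_real (1 - s) * cis t))"
        unfolding G_def by (rule holomorphic_derivI[of F "ball 0 1"]) (use F n in \<open>auto simp: Hol_def\<close>)
      have "((\<lambda>s. of_real (1 - s) * cis t) has_vector_derivative - cis t) (at s within {a..1})"
        unfolding has_vector_derivative_def by (auto intro!: derivative_eq_intros simp: scaleR_conv_of_real)
      from field_vector_diff_chain_within[OF this has_field_derivative_at_within[OF d]]
      show "(\<phi> has_vector_derivative - cis t * G s t) (at s within {a..1})" by (simp add: \<phi>_def[abs_def] o_def)
    qed
    have "((\<lambda>a. (LBINT s:{a..1}. - cis t * G s t)) \<longlongrightarrow> (LBINT s:{0<..1}. - cis t * G s t)) (at_right 0)"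
      by (rule tendsto_set_lebesgue_integral_at_right[OF _ _ int]) auto
    moreover have "\<forall>\<^sub>F a in at_right 0. (LBINT s:{a..1}. - cis t * G s t) = \<phi> 1 - \<phi> a"
    proof (rule eventually_mono)
      show "\<forall>\<^sub>F a in at_right 0. a \<in> {0<..<1::real}" by (rule eventually_at_right_real) simp
    qed (intro ftc; simp)
    ultimately have "((\<lambda>a. \<phi> 1 - \<phi> a) \<longlongrightarrow> (LBINT s:{0<..1}. - cis t * G s t)) (at_right 0)"
      by (rule Lim_transform_eventually)
    from tendsto_diff[OF tendsto_const[of "\<phi> 1"] this]
    have "(\<phi> \<longlongrightarrow> \<phi> 1 - (LBINT s:{0<..1}. - cis t * G s t)) (at_right 0)" by simp
    moreover have "filterlim (\<lambda>r::real. 1 - r) (at_right 0) (at_left 1)"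
      by (rule filterlim_at_withinI) (auto intro!: tendsto_eq_intros simp: eventually_at_filter)
    ultimately have "((\<lambda>r. \<phi> (1 - r)) \<longlongrightarrow> \<phi> 1 - (LBINT s:{0<..1}. - cis t * G s t)) (at_left 1)"
      by (rule filterlim_compose)
    then show ?case by (auto simp: \<phi>_def)
  qed
  show ?thesis unfolding has_boundary_values_def
  proof (rule AE_lborel_periodic[OF ae])
    have "cis (t + 2*pi) = cis t" for t by (simp add: cis_mult[symmetric])
    then show "(\<exists>l. ((\<lambda>r::real. F (of_real r * cis (t + 2*pi))) \<longlongrightarrow> l) (at_left 1)) \<longleftrightarrow>
      (\<exists>l. ((\<lambda>r::real. F (of_real r * cis t)) \<longlongrightarrow> l) (at_left 1))" for t by simp
  qed
qed

text \<open>A real supremum is bounded below only through a member of a bounded family: the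
  increment for t = \<delta> shows that it is nonnegative, so the absolute value is controlled as
  well.\<close>

lemma mean_modulus_le:
  assumes f: "f \<in> Hol" and bv: "has_boundary_values f" and p: "1 \<le> p" and \<delta>: "0 < \<delta>"
    and M: "\<And>t n. t \<noteq> 0 \<Longrightarrow> \<bar>t\<bar> \<le> \<delta> \<Longrightarrow> Mp p (dyad n) (rot_diff f t) \<le> M"
  shows "\<bar>mean_modulus p \<delta> f\<bar> \<le> M"
proof -
  let ?E = "\<lambda>s. Lc p (\<lambda>x. boundary_value f (x + s) - boundary_value f x)"
  have le: "?E s \<le> M" if "0 < \<bar>s\<bar>" "\<bar>s\<bar> \<le> \<delta>" for s
    by (rule radial_limit.Lc_g_le[OF radial_limit_rot_diff[OF f bv p M]]) (use that in auto)
  have "mean_modulus p \<delta> f \<le> M"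
    unfolding mean_modulus_eq_Lc[OF f] using \<delta> by (intro cSUP_least le) (auto intro!: exI[of _ \<delta>])
  moreover have "?E \<delta> \<le> mean_modulus p \<delta> f"
    unfolding mean_modulus_eq_Lc[OF f] using \<delta> le by (intro cSUP_upper) (auto intro!: bdd_aboveI)
  ultimately show ?thesis using Lc_nonneg[of p "\<lambda>x. boundary_value f (x + \<delta>) - boundary_value f x"] by linarith
qed

lemma mean_modulus_block_energy:
  assumes \<eta>: "converges_in_disc \<eta>" and A: "\<And>j. block_energy \<eta> j \<le> A" and e: "\<And>j. m \<le> j \<Longrightarrow> block_energy \<eta> j \<le> \<epsilon>"
    and bv: "has_boundary_values (power_series \<eta>)" and \<delta>: "0 < \<delta>" "\<delta> \<le> 1" and c: "A * 2 ^ m * \<delta> + 32 * \<epsilon> \<le> c\<^sup>2" "0 \<le> c"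
  shows "norm (mean_modulus 2 \<delta> (power_series \<eta>)) \<le> c * norm (\<delta> powr (1/2))"
proof -
  have A0: "0 \<le> A" using order_trans[OF block_energy_nonneg A] .
  have e0: "0 \<le> \<epsilon>" using order_trans[OF block_energy_nonneg e[OF order_refl]] .
  have "Mp 2 (dyad n) (rot_diff (power_series \<eta>) t) \<le> c * \<delta> powr (1/2)" if t: "t \<noteq> 0" "\<bar>t\<bar> \<le> \<delta>" for t n
  proof -
    have "t\<^sup>2 \<le> \<delta>\<^sup>2" using power_mono[OF t(2), of 2] by simp
    then have "A * 2 ^ m * t\<^sup>2 + 32 * \<epsilon> * \<bar>t\<bar> \<le> A * 2 ^ m * \<delta>\<^sup>2 + 32 * \<epsilon> * \<delta>"
      using A0 e0 t by (intro add_mono mult_left_mono) auto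
    also have "\<dots> = (A * 2 ^ m * \<delta> + 32 * \<epsilon>) * \<delta>" by (simp add: power2_eq_square algebra_simps)
    also have "\<dots> \<le> c\<^sup>2 * \<delta>" using c \<delta> by (intro mult_right_mono) auto
    finally have le: "A * 2 ^ m * t\<^sup>2 + 32 * \<epsilon> * \<bar>t\<bar> \<le> c\<^sup>2 * \<delta>" .
    have "Mp 2 (dyad n) (rot_diff (power_series \<eta>) t) powr 2 \<le> c\<^sup>2 * \<delta>"
      by (rule order_trans[OF Mp_rot_diff_block_energy[where m = m, OF \<eta> A e] le]) (use t \<delta> in auto)
    then have "(Mp 2 (dyad n) (rot_diff (power_series \<eta>) t) powr 2) powr (1/2) \<le> (c\<^sup>2 * \<delta>) powr (1/2)"
      by (intro powr_mono2) auto
    also have "\<dots> = c * \<delta> powr (1/2)" using c \<delta> by (simp add: powr_mult powr_half_sqrt)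
    finally show ?thesis by (simp add: powr_powr)
  qed
  then have "\<bar>mean_modulus 2 \<delta> (power_series \<eta>)\<bar> \<le> c * \<delta> powr (1/2)"
    by (intro mean_modulus_le power_series_Hol \<eta> bv \<delta>) auto
  then show ?thesis by simp
qed

lemma mean_Lipschitz_block_energy:
  assumes \<eta>: "converges_in_disc \<eta>" and A: "\<And>j. block_energy \<eta> j \<le> A"
  shows "power_series \<eta> \<in> mean_Lipschitz 2 (1 / 2)"
    and "block_energy \<eta> \<longlonglongrightarrow> 0 \<Longrightarrow> power_series \<eta> \<in> little_mean_Lipschitz 2 (1 / 2)"
proof -
  have A0: "0 \<le> A" using order_trans[OF block_energy_nonneg A] .
  obtain C where C: "C > 0"
    "\<And>r. 0 \<le> r \<Longrightarrow> r < 1 \<Longrightarrow> Mp 2 r (deriv (power_series \<eta>)) powr 2 \<le> C * (1 - r) powr (-(3/2))"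
    by (rule Mp2_deriv_block_energy[OF \<eta> A]) (rule that)
  have bv: "has_boundary_values (power_series \<eta>)"
    by (rule has_boundary_values_if_deriv[OF power_series_Hol(1)[OF \<eta>] C])
  have ev1: "\<forall>\<^sub>F \<delta> in at_right 0. 0 < \<delta> \<and> \<delta> < (b::real)" if "0 < b" for b
    using eventually_at_right_real[OF that] by simp
  have "(\<lambda>\<delta>. mean_modulus 2 \<delta> (power_series \<eta>)) \<in> O[at_right 0](\<lambda>\<delta>. \<delta> powr (1 / 2))"
  proof (rule bigoI[of _ "sqrt (33 * A)"])
    show "\<forall>\<^sub>F \<delta> in at_right 0. norm (mean_modulus 2 \<delta> (power_series \<eta>)) \<le> sqrt (33 * A) * norm (\<delta> powr (1 / 2))"
      using ev1[of 1]
    proof (rule eventually_mono)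
      fix \<delta> :: real assume \<delta>: "0 < \<delta> \<and> \<delta> < 1"
      show "norm (mean_modulus 2 \<delta> (power_series \<eta>)) \<le> sqrt (33 * A) * norm (\<delta> powr (1 / 2))"
        \<comment> \<open>With m = 0 the bound A serves also as \<epsilon>, and \<delta> < 1 gives A
          \<delta> + 32 A \<le> 33 A.\<close>
        by (rule mean_modulus_block_energy[where m = 0, OF \<eta> A A bv]) (use \<delta> A0 mult_left_le[of \<delta> A] in auto)
    qed simp
  qed
  then show "power_series \<eta> \<in> mean_Lipschitz 2 (1 / 2)"
    using bv Hardy_block_energy[OF \<eta> A] by (simp add: mean_Lipschitz_def)
  assume z: "block_energy \<eta> \<longlonglongrightarrow> 0"
  have "(\<lambda>\<delta>. mean_modulus 2 \<delta> (power_series \<eta>)) \<in> o[at_right 0](\<lambda>\<delta>. \<delta> powr (1 / 2))"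
  proof (rule landau_o.smallI)
    fix c :: real assume c: "c > 0"
    have "\<forall>\<^sub>F j in sequentially. block_energy \<eta> j < c\<^sup>2 / 64" using c by (intro order_tendstoD(2)[OF z]) auto
    then obtain m where m: "\<And>j. m \<le> j \<Longrightarrow> block_energy \<eta> j \<le> c\<^sup>2 / 64"
      by (auto simp: eventually_sequentially intro: less_imp_le)
    \<comment> \<open>The budget c^2 is halved: the late blocks use 32 c^2 / 64, and \<delta> below
      b keeps the early blocks within the other half.\<close>
    define b where "b = min 1 (c\<^sup>2 / (2 * (A * 2 ^ m + 1)))"
    have d: "A * 2 ^ m + 1 > 0" using A0 by (intro add_nonneg_pos mult_nonneg_nonneg) auto
    have b: "b > 0" using c d by (simp add: b_def)
    show "\<forall>\<^sub>F \<delta> in at_right 0. norm (mean_modulus 2 \<delta> (power_series \<eta>)) \<le> c * norm (\<delta> powr (1 / 2))"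
      using ev1[OF b]
    proof (rule eventually_mono)
      fix \<delta> :: real assume \<delta>: "0 < \<delta> \<and> \<delta> < b"
      have "A * 2 ^ m * \<delta> \<le> (A * 2 ^ m + 1) * (c\<^sup>2 / (2 * (A * 2 ^ m + 1)))"
        using \<delta> A0 by (intro mult_mono) (auto simp: b_def)
      also have "\<dots> = c\<^sup>2 / 2" using d by (simp add: field_simps)
      finally show "norm (mean_modulus 2 \<delta> (power_series \<eta>)) \<le> c * norm (\<delta> powr (1 / 2))"
        by (intro mean_modulus_block_energy[OF \<eta> A m bv]) (use \<delta> c in \<open>auto simp: b_def\<close>)
    qed
  qed
  then show "power_series \<eta> \<in> little_mean_Lipschitz 2 (1 / 2)"
    using bv Hardy_block_energy[OF \<eta> A] by (simp add: little_mean_Lipschitz_def)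
qed

lemma lip_seq_smallo_if_Rhaly_dnorm_bounded:
  assumes p: "1 < p" and \<alpha>: "-1 < \<alpha>" "\<alpha> < 2 * p - 2" and \<eta>: "converges_in_disc \<eta>"
    and K: "K > 0" "\<And>f. f \<in> Dirichlet p \<alpha> \<Longrightarrow> Rhaly \<eta> f \<in> Dirichlet p \<alpha>"
    "\<And>f. f \<in> Dirichlet p \<alpha> \<Longrightarrow> dnorm p \<alpha> (Rhaly \<eta> f) \<le> K * dnorm p \<alpha> f"
  shows "(\<lambda>r. Mp p r (deriv (power_series \<eta>))) \<in> o[at_left 1](\<lambda>r. ln (1 / (1 - r)) / (1 - r) powr (1 - 1/p))"
proof -
  obtain A where "A > 0" and A: "\<And>n. lip_seq p (power_series \<eta>) n \<le> A"
    by (rule lip_seq_bounded_if_Rhaly_dnorm_bounded[OF p \<alpha> \<eta> K]) (assumption | rule that)+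
  show ?thesis by (rule lip_seq_bounded_smallo[OF power_series_Hol(1)[OF \<eta>] _ A]) (use p in simp)
qed

theorem theorem4:
  fixes \<eta> :: "nat \<Rightarrow> complex"
  shows "(\<forall>p \<alpha> :: real. 1 \<le> p \<and> p - 2 < \<alpha> \<and>
            converges_in_disc \<eta> \<and> power_series \<eta> \<in> mean_Lipschitz p (1 / p) \<longrightarrow>
            Rhaly_bounded_Dirichlet \<eta> p \<alpha>) \<and>
         (\<forall>p \<alpha> :: real. 1 \<le> p \<and> p - 2 < \<alpha> \<and>
            converges_in_disc \<eta> \<and> power_series \<eta> \<in> little_mean_Lipschitz p (1 / p) \<longrightarrow>
            Rhaly_compact_Dirichlet \<eta> p \<alpha>) \<and>
         (\<forall>p \<alpha> :: real. 1 < p \<and> -1 < \<alpha> \<and> \<alpha> < 2 * p - 2 \<and>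
            Rhaly_bounded_Dirichlet \<eta> p \<alpha> \<longrightarrow>
            converges_in_disc \<eta> \<and>
            (\<lambda>r. Mp p r (deriv (power_series \<eta>)))
              \<in> O[at_left 1](\<lambda>r. ln (1 / (1 - r)) / (1 - r) powr (1 - 1 / p))) \<and>
         (\<forall>p \<alpha> :: real. 1 < p \<and> -1 < \<alpha> \<and> \<alpha> < 2 * p - 2 \<and>
            Rhaly_compact_Dirichlet \<eta> p \<alpha> \<longrightarrow>
            converges_in_disc \<eta> \<and>
            (\<lambda>r. Mp p r (deriv (power_series \<eta>)))
              \<in> o[at_left 1](\<lambda>r. ln (1 / (1 - r)) / (1 - r) powr (1 - 1 / p))) \<and>
         (\<forall>\<alpha> :: real. 0 < \<alpha> \<longrightarrow>
            (Rhaly_bounded_Dirichlet \<eta> 2 \<alpha> \<longleftrightarrow>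
             converges_in_disc \<eta> \<and> power_series \<eta> \<in> mean_Lipschitz 2 (1 / 2))) \<and>
         (\<forall>\<alpha> :: real. 0 < \<alpha> \<longrightarrow>
            (Rhaly_compact_Dirichlet \<eta> 2 \<alpha> \<longleftrightarrow>
             converges_in_disc \<eta> \<and> power_series \<eta> \<in> little_mean_Lipschitz 2 (1 / 2)))"
proof (intro conjI allI impI)
  fix p \<alpha> :: real
  assume h: "1 \<le> p \<and> p - 2 < \<alpha> \<and> converges_in_disc \<eta> \<and> power_series \<eta> \<in> mean_Lipschitz p (1 / p)"
  then show "Rhaly_bounded_Dirichlet \<eta> p \<alpha>"
    using mean_Lipschitz_lip_seq_bounded Rhaly_bounded_if_lip_seq_bounded by metis
next
  fix p \<alpha> :: real
  assume h: "1 \<le> p \<and> p - 2 < \<alpha> \<and> converges_in_disc \<eta> \<and> power_series \<eta> \<in> little_mean_Lipschitz p (1 / p)"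
  then show "Rhaly_compact_Dirichlet \<eta> p \<alpha>"
    using little_mean_Lipschitz_lip_seq Rhaly_compact_if_lip_seq_tendsto_0 by metis
next
  fix p \<alpha> :: real
  assume h: "1 < p \<and> -1 < \<alpha> \<and> \<alpha> < 2 * p - 2 \<and> Rhaly_bounded_Dirichlet \<eta> p \<alpha>"
  then show \<eta>: "converges_in_disc \<eta>"
    using Rhaly_well_defined_converges by (auto simp: Rhaly_bounded_Dirichlet_def)
  obtain K where K: "K > 0" "\<And>f. f \<in> Dirichlet p \<alpha> \<Longrightarrow> Rhaly \<eta> f \<in> Dirichlet p \<alpha>"
    "\<And>f. f \<in> Dirichlet p \<alpha> \<Longrightarrow> dnorm p \<alpha> (Rhaly \<eta> f) \<le> K * dnorm p \<alpha> f"
    by (rule Rhaly_bounded_dnorm[of p \<alpha> \<eta>]) (use h that in auto)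
  show "(\<lambda>r. Mp p r (deriv (power_series \<eta>))) \<in> O[at_left 1](\<lambda>r. ln (1 / (1 - r)) / (1 - r) powr (1 - 1 / p))"
    by (rule landau_o.small_imp_big[OF lip_seq_smallo_if_Rhaly_dnorm_bounded[OF _ _ _ \<eta> K]]) (use h in auto)
next
  fix p \<alpha> :: real
  assume h: "1 < p \<and> -1 < \<alpha> \<and> \<alpha> < 2 * p - 2 \<and> Rhaly_compact_Dirichlet \<eta> p \<alpha>"
  then show \<eta>: "converges_in_disc \<eta>"
    using Rhaly_well_defined_converges by (auto simp: Rhaly_compact_Dirichlet_def)
  obtain K where K: "K > 0" "\<And>f. f \<in> Dirichlet p \<alpha> \<Longrightarrow> Rhaly \<eta> f \<in> Dirichlet p \<alpha>"
    "\<And>f. f \<in> Dirichlet p \<alpha> \<Longrightarrow> dnorm p \<alpha> (Rhaly \<eta> f) \<le> K * dnorm p \<alpha> f"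
    by (rule Rhaly_compact_bounded_dnorm[of p \<alpha> \<eta>]) (use h that in auto)
  show "(\<lambda>r. Mp p r (deriv (power_series \<eta>))) \<in> o[at_left 1](\<lambda>r. ln (1 / (1 - r)) / (1 - r) powr (1 - 1 / p))"
    by (rule lip_seq_smallo_if_Rhaly_dnorm_bounded[OF _ _ _ \<eta> K]) (use h in auto)
next
  fix \<alpha> :: real
  assume \<alpha>: "0 < \<alpha>"
  then have \<alpha>': "-1 < \<alpha>" by simp
  show "Rhaly_bounded_Dirichlet \<eta> 2 \<alpha> \<longleftrightarrow> converges_in_disc \<eta> \<and> power_series \<eta> \<in> mean_Lipschitz 2 (1 / 2)"
  proof (intro iffI conjI)
    assume b: "Rhaly_bounded_Dirichlet \<eta> 2 \<alpha>"
    then show \<eta>: "converges_in_disc \<eta>"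
      using Rhaly_well_defined_converges by (auto simp: Rhaly_bounded_Dirichlet_def)
    obtain K where K: "K > 0" "\<And>f. f \<in> Dirichlet 2 \<alpha> \<Longrightarrow> Rhaly \<eta> f \<in> Dirichlet 2 \<alpha>"
      "\<And>f. f \<in> Dirichlet 2 \<alpha> \<Longrightarrow> dnorm 2 \<alpha> (Rhaly \<eta> f) \<le> K * dnorm 2 \<alpha> f"
      by (rule Rhaly_bounded_dnorm[of 2 \<alpha> \<eta>]) (use \<alpha>' b that in auto)
    obtain A where "\<And>j. block_energy \<eta> j \<le> A" by (rule block_energy_bounded[OF \<alpha>' \<eta> K]) (assumption | rule that)+
    then show "power_series \<eta> \<in> mean_Lipschitz 2 (1 / 2)" by (rule mean_Lipschitz_block_energy(1)[OF \<eta>])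
  next
    assume "converges_in_disc \<eta> \<and> power_series \<eta> \<in> mean_Lipschitz 2 (1 / 2)"
    then show "Rhaly_bounded_Dirichlet \<eta> 2 \<alpha>"
      using \<alpha> mean_Lipschitz_lip_seq_bounded[of "power_series \<eta>" 2] Rhaly_bounded_if_lip_seq_bounded[of 2 \<alpha> \<eta>] by auto
  qed
next
  fix \<alpha> :: real
  assume \<alpha>: "0 < \<alpha>"
  then have \<alpha>': "-1 < \<alpha>" by simp
  show "Rhaly_compact_Dirichlet \<eta> 2 \<alpha> \<longleftrightarrow> converges_in_disc \<eta> \<and> power_series \<eta> \<in> little_mean_Lipschitz 2 (1 / 2)"
  proof (intro iffI conjI)
    assume cp: "Rhaly_compact_Dirichlet \<eta> 2 \<alpha>"
    then show \<eta>: "converges_in_disc \<eta>"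
      using Rhaly_well_defined_converges by (auto simp: Rhaly_compact_Dirichlet_def)
    have lim: "block_energy \<eta> \<longlonglongrightarrow> 0" by (rule block_energy_tendsto_0[OF \<alpha>' cp])
    then have "Bseq (block_energy \<eta>)" using convergentI convergent_imp_Bseq by blast
    then obtain A where "\<And>j. norm (block_energy \<eta> j) \<le> A" by (auto simp: Bseq_def)
    then have "\<And>j. block_energy \<eta> j \<le> A" by simp
    then show "power_series \<eta> \<in> little_mean_Lipschitz 2 (1 / 2)" by (rule mean_Lipschitz_block_energy(2)[OF \<eta> _ lim])
  next
    assume "converges_in_disc \<eta> \<and> power_series \<eta> \<in> little_mean_Lipschitz 2 (1 / 2)"
    then show "Rhaly_compact_Dirichlet \<eta> 2 \<alpha>"
      using \<alpha> little_mean_Lipschitz_lip_seq[of "power_series \<eta>" 2] Rhaly_compact_if_lip_seq_tendsto_0[of 2 \<alpha> \<eta>] by auto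
  qed
qed

end
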